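(* Let $R$ be a noetherian ring, and let $M$ be a finitely generated $R^\circ$-module that has a complete projective resolution. There are isomorphisms of functors (on $R$-modules) $$\widetilde{\mathrm{Tor}}{}^R_i(M,-)\;\cong\;\widehat{\mathrm{Tor}}{}^R_i(M,-)\quad\text{for all } i\in\mathbb{Z}.$$
   Context: Rings are associative with unit and are algebras over a commutative ring $\Bbbk$; noetherian means left and right noetherian. An $R$-module is a left $R$-module; $R^\circ$ is the opposite ring, so $R^\circ$-modules are right $R$-modules. Complexes are indexed homologically; acyclic means having zero homology. Stable homology. For an $R^\circ$-complex $X$ and an $R$-complex $Y$, the unbounded tensor product $X\,\overline{\otimes}_R\,Y$ is the $\Bbbk$-complex with degree $n$ term $\prod_{i\in\mathbb{Z}} X_i\otimes_R Y_{n-i}$ and differential given on elementary tensors by $\partial(x\otimes y)=\partial^X(x)\otimes y+(-1)^{i}x\otimes\partial^Y(y)$ for $x\in X_i$. It contains the usual tensor product $X\otimes_R Y$ (with degree $n$ term $\coprod_{i} X_i\otimes_R Y_{n-i}$) as a subcomplex, and the stable tensor product is $X\,\widetilde{\otimes}_R\,Y=(X\,\overline{\otimes}_R\,Y)/(X\otimes_R Y)$. For an $R^\circ$-module $M$ with projective resolution $P\to M$ and an $R$-module $N$ with injective resolution $N\to I$, $\widetilde{\mathrm{Tor}}{}^R_i(M,N)=\mathrm{H}_{i+1}(P\,\widetilde{\otimes}_R\,I)$, $i\in\mathbb{Z}$; these are independent of the choice of resolutions and functorial in both arguments. Tate homology. An acyclic complex $T$ of projective $R^\circ$-modules is totally acyclic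 if $\mathrm{Hom}_{R^\circ}(T,Q)$ is acyclic for every projective $R^\circ$-module $Q$. A complete projective resolution of an $R^\circ$-module $M$ is a diagram $T\xrightarrow{\varpi}P\xrightarrow{\simeq}M$ where $T$ is a totally acyclic complex of projective $R^\circ$-modules, $P\xrightarrow{\simeq}M$ is a projective resolution, and $\varpi$ is a morphism of complexes with $\varpi_i$ an isomorphism for all $i\gg0$. If $M$ has such a resolution, its Tate homology with coefficients in an $R$-module $N$ is $\widehat{\mathrm{Tor}}{}^R_i(M,N)=\mathrm{H}_i(T\otimes_R N)$, $i\in\mathbb{Z}$ (independent of the choice of complete projective resolution). *)

theory Defs
  imports "HOL-Algebra.Module" "HOL-Algebra.AbelCoset" "HOL-Algebra.Free_Abelian_Groups"
begin

section \<open>Modules over associative rings\<close>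

text \<open>The library locale \<open>module\<close> requires a commutative ring of scalars; the record type
  \<open>('r, 'm) module\<close> is reused here (its multiplicative fields play no role).
  Right modules over \<open>R\<close> are left modules over \<open>opp R\<close>.\<close>

definition opp :: "'r ring \<Rightarrow> 'r ring" where
  "opp R = R\<lparr>monoid.mult := (\<lambda>x y. y \<otimes>\<^bsub>R\<^esub> x)\<rparr>"

locale left_module = R?: ring R + M?: abelian_group M
  for R :: "'r ring" (structure) and M :: "('r, 'm) module" (structure) +
  assumes smult_closed:
      "\<lbrakk>a \<in> carrier R; x \<in> carrier M\<rbrakk> \<Longrightarrow> a \<odot>\<^bsub>M\<^esub> x \<in> carrier M"
    and smult_l_distr:
      "\<lbrakk>a \<in> carrier R; b \<in> carrier R; x \<in> carrier M\<rbrakk> \<Longrightarrow>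
        (a \<oplus>\<^bsub>R\<^esub> b) \<odot>\<^bsub>M\<^esub> x = a \<odot>\<^bsub>M\<^esub> x \<oplus>\<^bsub>M\<^esub> b \<odot>\<^bsub>M\<^esub> x"
    and smult_r_distr:
      "\<lbrakk>a \<in> carrier R; x \<in> carrier M; y \<in> carrier M\<rbrakk> \<Longrightarrow>
        a \<odot>\<^bsub>M\<^esub> (x \<oplus>\<^bsub>M\<^esub> y) = a \<odot>\<^bsub>M\<^esub> x \<oplus>\<^bsub>M\<^esub> a \<odot>\<^bsub>M\<^esub> y"
    and smult_assoc:
      "\<lbrakk>a \<in> carrier R; b \<in> carrier R; x \<in> carrier M\<rbrakk> \<Longrightarrow>
        (a \<otimes>\<^bsub>R\<^esub> b) \<odot>\<^bsub>M\<^esub> x = a \<odot>\<^bsub>M\<^esub> (b \<odot>\<^bsub>M\<^esub> x)"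
    and smult_one:
      "x \<in> carrier M \<Longrightarrow> \<one>\<^bsub>R\<^esub> \<odot>\<^bsub>M\<^esub> x = x"

definition mod_hom :: "'r ring \<Rightarrow> ('r, 'a) module \<Rightarrow> ('r, 'b) module \<Rightarrow> ('a \<Rightarrow> 'b) set" where
  "mod_hom R M N = {f \<in> carrier M \<rightarrow> carrier N.
     (\<forall>x\<in>carrier M. \<forall>y\<in>carrier M. f (x \<oplus>\<^bsub>M\<^esub> y) = f x \<oplus>\<^bsub>N\<^esub> f y) \<and>
     (\<forall>a\<in>carrier R. \<forall>x\<in>carrier M. f (a \<odot>\<^bsub>M\<^esub> x) = a \<odot>\<^bsub>N\<^esub> f x)}"

definition mod_iso :: "'r ring \<Rightarrow> ('r, 'a) module \<Rightarrow> ('r, 'b) module \<Rightarrow> ('a \<Rightarrow> 'b) set" where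
  "mod_iso R M N = {f \<in> mod_hom R M N. bij_betw f (carrier M) (carrier N)}"

definition fin_gen :: "'r ring \<Rightarrow> ('r, 'm) module \<Rightarrow> 'm set \<Rightarrow> bool" where
  "fin_gen R M H \<longleftrightarrow> (\<exists>A. finite A \<and> A \<subseteq> H \<and> (\<forall>K. submodule K R M \<and> A \<subseteq> K \<longrightarrow> H \<subseteq> K))"

definition regular_module :: "'r ring \<Rightarrow> ('r, 'r) module" where
  "regular_module R = \<lparr>carrier = carrier R, monoid.mult = (\<otimes>\<^bsub>R\<^esub>), monoid.one = \<one>\<^bsub>R\<^esub>,
     ring.zero = \<zero>\<^bsub>R\<^esub>, ring.add = (\<oplus>\<^bsub>R\<^esub>), smult = (\<otimes>\<^bsub>R\<^esub>)\<rparr>"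

definition left_noetherian :: "'r ring \<Rightarrow> bool" where
  "left_noetherian R \<longleftrightarrow>
     (\<forall>H. submodule H R (regular_module R) \<longrightarrow> fin_gen R (regular_module R) H)"

text \<open>Not the library locale \<open>noetherian_ring\<close>, which is about two-sided ideals.\<close>

definition noetherian :: "'r ring \<Rightarrow> bool" where
  "noetherian R \<longleftrightarrow> ring R \<and> left_noetherian R \<and> left_noetherian (opp R)"

definition ring_algebra :: "'k ring \<Rightarrow> 'r ring \<Rightarrow> ('k \<Rightarrow> 'r) \<Rightarrow> bool" where
  "ring_algebra k R \<eta> \<longleftrightarrow> cring k \<and> ring R \<and> \<eta> \<in> ring_hom k R \<and>
     (\<forall>a\<in>carrier k. \<forall>r\<in>carrier R. \<eta> a \<otimes>\<^bsub>R\<^esub> r = r \<otimes>\<^bsub>R\<^esub> \<eta> a)"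


section \<open>Projective and injective modules\<close>

text \<open>Since HOL cannot quantify over types inside a definition, the test modules below have
  carriers in the type \<open>'m \<Rightarrow> 'r\<close>, where \<open>'r\<close> is the type of the ring and \<open>'m\<close> that of the
  module \<open>M\<close> under consideration. This is no restriction. That type contains a copy of \<open>R\<close>
  (constant functions), one of \<open>M\<close> (indicator functions, if \<open>R\<close> is not zero) and the free module
  on the set \<open>M\<close> (finitely supported functions). So a module that is projective in
  the sense below is a direct summand of a free module, and a module that is injective in the sense
  below extends homomorphisms from left ideals and satisfies Baer's criterion. In both cases
  the lifting property follows for test modules of every type.\<close>

definition projective_module :: "'r ring \<Rightarrow> ('r, 'm) module \<Rightarrow> bool" where
  "projective_module R M \<longleftrightarrow> left_module R M \<and>
     (\<forall>(A :: ('r, 'm \<Rightarrow> 'r) module) (B :: ('r, 'm \<Rightarrow> 'r) module) p f.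
        left_module R A \<and> left_module R B \<and>
        p \<in> mod_hom R A B \<and> p ` carrier A = carrier B \<and> f \<in> mod_hom R M B \<longrightarrow>
        (\<exists>h \<in> mod_hom R M A. \<forall>x\<in>carrier M. p (h x) = f x))"

definition injective_module :: "'r ring \<Rightarrow> ('r, 'm) module \<Rightarrow> bool" where
  "injective_module R M \<longleftrightarrow> left_module R M \<and>
     (\<forall>(A :: ('r, 'm \<Rightarrow> 'r) module) (B :: ('r, 'm \<Rightarrow> 'r) module) j f.
        left_module R A \<and> left_module R B \<and>
        j \<in> mod_hom R A B \<and> inj_on j (carrier A) \<and> f \<in> mod_hom R A M \<longrightarrow>
        (\<exists>h \<in> mod_hom R B M. \<forall>x\<in>carrier A. h (j x) = f x))"


section \<open>Complexes and homology\<close>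

text \<open>Homological indexing: \<open>diff X n\<close> maps \<open>obj X n\<close> to \<open>obj X (n - 1)\<close>. All terms of a complex
  share a carrier type, as can be arranged by passing to a sum of types.\<close>

record ('r, 'x) cplx =
  obj :: "int \<Rightarrow> ('r, 'x) module"
  diff :: "int \<Rightarrow> 'x \<Rightarrow> 'x"

definition is_cplx :: "'r ring \<Rightarrow> ('r, 'x) cplx \<Rightarrow> bool" where
  "is_cplx R X \<longleftrightarrow> (\<forall>n. left_module R (obj X n) \<and>
     diff X n \<in> mod_hom R (obj X n) (obj X (n - 1)) \<and>
     (\<forall>x\<in>carrier (obj X n). diff X (n - 1) (diff X n x) = \<zero>\<^bsub>obj X (n - 2)\<^esub>))"

definition chain_map ::
  "'r ring \<Rightarrow> ('r, 'x) cplx \<Rightarrow> ('r, 'y) cplx \<Rightarrow> (int \<Rightarrow> 'x \<Rightarrow> 'y) \<Rightarrow> bool" where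
  "chain_map R X Y f \<longleftrightarrow> (\<forall>n. f n \<in> mod_hom R (obj X n) (obj Y n) \<and>
     (\<forall>x\<in>carrier (obj X n). diff Y n (f n x) = f (n - 1) (diff X n x)))"

definition cycles :: "('r, 'x) cplx \<Rightarrow> int \<Rightarrow> 'x set" where
  "cycles X n = {x \<in> carrier (obj X n). diff X n x = \<zero>\<^bsub>obj X (n - 1)\<^esub>}"

definition boundaries :: "('r, 'x) cplx \<Rightarrow> int \<Rightarrow> 'x set" where
  "boundaries X n = diff X (n + 1) ` carrier (obj X (n + 1))"

definition acyclic_at :: "('r, 'x) cplx \<Rightarrow> int \<Rightarrow> bool" where
  "acyclic_at X n \<longleftrightarrow> cycles X n = boundaries X n"

text \<open>\<open>quot_map N K f\<close> is the map induced by \<open>f\<close> from cosets (in the source) to cosets of \<open>K\<close>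
  in \<open>N\<close>: the union below is over the representatives of the coset \<open>C\<close>, and it is the
  single coset \<open>K + f x\<close> whenever \<open>f\<close> carries \<open>C\<close> into one coset of \<open>K\<close>.\<close>

definition quot_map :: "('r, 'b) module \<Rightarrow> 'b set \<Rightarrow> ('a \<Rightarrow> 'b) \<Rightarrow> 'a set \<Rightarrow> 'b set" where
  "quot_map N K f C = (\<Union>x\<in>C. K +>\<^bsub>N\<^esub> f x)"

definition quot_module :: "('r, 'a) module \<Rightarrow> 'a set \<Rightarrow> ('r, 'a set) module" where
  "quot_module M H = \<lparr>carrier = a_rcosets\<^bsub>M\<^esub> H, monoid.mult = undefined, monoid.one = undefined,
     ring.zero = H, ring.add = set_add M, smult = (\<lambda>a. quot_map M H (\<lambda>x. a \<odot>\<^bsub>M\<^esub> x))\<rparr>"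

definition homology :: "('r, 'x) cplx \<Rightarrow> int \<Rightarrow> ('r, 'x set) module" where
  "homology X n = quot_module ((obj X n)\<lparr>carrier := cycles X n\<rparr>) (boundaries X n)"

definition homology_map ::
  "('r, 'y) cplx \<Rightarrow> (int \<Rightarrow> 'x \<Rightarrow> 'y) \<Rightarrow> int \<Rightarrow> 'x set \<Rightarrow> 'y set" where
  "homology_map Y f n = quot_map (obj Y n) (boundaries Y n) (f n)"


section \<open>Resolutions\<close>

definition projective_resolution ::
  "'r ring \<Rightarrow> ('r, 'p) cplx \<Rightarrow> ('p \<Rightarrow> 'm) \<Rightarrow> ('r, 'm) module \<Rightarrow> bool" where
  "projective_resolution R P \<epsilon> M \<longleftrightarrow> left_module R M \<and> is_cplx R P \<and>
     (\<forall>n. projective_module R (obj P n)) \<and>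
     (\<forall>n<0. carrier (obj P n) = {\<zero>\<^bsub>obj P n\<^esub>}) \<and>
     (\<forall>n>0. acyclic_at P n) \<and>
     \<epsilon> \<in> mod_hom R (obj P 0) M \<and> \<epsilon> ` carrier (obj P 0) = carrier M \<and>
     {x \<in> carrier (obj P 0). \<epsilon> x = \<zero>\<^bsub>M\<^esub>} = boundaries P 0"

definition injective_resolution ::
  "'r ring \<Rightarrow> ('r, 'n) module \<Rightarrow> ('n \<Rightarrow> 'i) \<Rightarrow> ('r, 'i) cplx \<Rightarrow> bool" where
  "injective_resolution R N \<iota> I \<longleftrightarrow> left_module R N \<and> is_cplx R I \<and>
     (\<forall>n. injective_module R (obj I n)) \<and>
     (\<forall>n>0. carrier (obj I n) = {\<zero>\<^bsub>obj I n\<^esub>}) \<and>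
     (\<forall>n<0. acyclic_at I n) \<and>
     \<iota> \<in> mod_hom R N (obj I 0) \<and> inj_on \<iota> (carrier N) \<and>
     \<iota> ` carrier N = cycles I 0"

text \<open>Acyclicity of \<open>Hom(X, Q)\<close>: each \<open>f : X\<^sub>n \<rightarrow> Q\<close> vanishing on boundaries factors
  through \<open>X\<^sub>n \<rightarrow> X\<^sub>n\<^sub>-\<^sub>1\<close> (signs in the differential of the Hom complex do not matter).\<close>

definition Hom_acyclic :: "'r ring \<Rightarrow> ('r, 'x) cplx \<Rightarrow> ('r, 'q) module \<Rightarrow> bool" where
  "Hom_acyclic R X Q \<longleftrightarrow> (\<forall>n. \<forall>f \<in> mod_hom R (obj X n) Q.
     (\<forall>x\<in>carrier (obj X (n + 1)). f (diff X (n + 1) x) = \<zero>\<^bsub>Q\<^esub>) \<longrightarrow>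
     (\<exists>g \<in> mod_hom R (obj X (n - 1)) Q. \<forall>x\<in>carrier (obj X n). f x = g (diff X n x)))"

text \<open>It suffices to let \<open>Q\<close> range over the projective modules with carrier in \<open>'t \<Rightarrow> 'r\<close>. One may
  take \<open>Q\<close> to be free; the image of a homomorphism from the term \<open>T\<^sub>n\<close> then lies in the span of a
  basis subset that is finite or of cardinality at most that of \<open>T\<^sub>n\<close>. In the second case this span
  is a direct summand isomorphic to a module in that type; in the first one it is a finite direct
  sum of copies of \<open>R\<close>.\<close>

definition totally_acyclic :: "'r ring \<Rightarrow> ('r, 't) cplx \<Rightarrow> bool" where
  "totally_acyclic R T \<longleftrightarrow> is_cplx R T \<and> (\<forall>n. projective_module R (obj T n)) \<and>
     (\<forall>n. acyclic_at T n) \<and>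
     (\<forall>Q :: ('r, 't \<Rightarrow> 'r) module. projective_module R Q \<longrightarrow> Hom_acyclic R T Q)"

definition complete_projective_resolution ::
  "'r ring \<Rightarrow> ('r, 't) cplx \<Rightarrow> (int \<Rightarrow> 't \<Rightarrow> 'p) \<Rightarrow> ('r, 'p) cplx \<Rightarrow> ('p \<Rightarrow> 'm) \<Rightarrow>
     ('r, 'm) module \<Rightarrow> bool" where
  "complete_projective_resolution R T \<tau> P \<epsilon> M \<longleftrightarrow> totally_acyclic R T \<and>
     projective_resolution R P \<epsilon> M \<and> chain_map R T P \<tau> \<and>
     (\<exists>m. \<forall>n\<ge>m. \<tau> n \<in> mod_iso R (obj T n) (obj P n))"


section \<open>Tensor products\<close>

type_synonym ('x, 'y) tensor = "('x \<times> 'y \<Rightarrow>\<^sub>0 int) set"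

definition tensor_relations ::
  "'r ring \<Rightarrow> ('r, 'x) module \<Rightarrow> ('r, 'y) module \<Rightarrow> ('x \<times> 'y \<Rightarrow>\<^sub>0 int) set" where
  "tensor_relations R X Y = generate (free_Abelian_group (carrier X \<times> carrier Y))
     ({frag_of (x \<oplus>\<^bsub>X\<^esub> x', y) - frag_of (x, y) - frag_of (x', y) | x x' y.
         x \<in> carrier X \<and> x' \<in> carrier X \<and> y \<in> carrier Y} \<union>
      {frag_of (x, y \<oplus>\<^bsub>Y\<^esub> y') - frag_of (x, y) - frag_of (x, y') | x y y'.
         x \<in> carrier X \<and> y \<in> carrier Y \<and> y' \<in> carrier Y} \<union>
      {frag_of (r \<odot>\<^bsub>X\<^esub> x, y) - frag_of (x, r \<odot>\<^bsub>Y\<^esub> y) | r x y.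
         r \<in> carrier R \<and> x \<in> carrier X \<and> y \<in> carrier Y})"

text \<open>The free abelian group on \<open>X \<times> Y\<close> with the operation \<open>a \<cdot> (x, y) = (a x, y)\<close> of
  \<open>k\<close>; it becomes a \<open>k\<close>-module only after passing to the quotient.\<close>

definition free_product_module ::
  "('k \<Rightarrow> 'r) \<Rightarrow> ('r, 'x) module \<Rightarrow> ('r, 'y) module \<Rightarrow> ('k, 'x \<times> 'y \<Rightarrow>\<^sub>0 int) module" where
  "free_product_module \<eta> X Y =
     \<lparr>carrier = carrier (free_Abelian_group (carrier X \<times> carrier Y)),
      monoid.mult = undefined, monoid.one = undefined, ring.zero = 0, ring.add = (+),
      smult = (\<lambda>a. frag_extend (\<lambda>(x, y). frag_of (\<eta> a \<odot>\<^bsub>X\<^esub> x, y)))\<rparr>"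

text \<open>Here \<open>X\<close> is a module over \<open>opp R\<close> and \<open>Y\<close> is a module over \<open>R\<close>.\<close>

definition tensor_module ::
  "('k \<Rightarrow> 'r) \<Rightarrow> 'r ring \<Rightarrow> ('r, 'x) module \<Rightarrow> ('r, 'y) module \<Rightarrow> ('k, ('x, 'y) tensor) module" where
  "tensor_module \<eta> R X Y = quot_module (free_product_module \<eta> X Y) (tensor_relations R X Y)"

definition tensor_map ::
  "('k \<Rightarrow> 'r) \<Rightarrow> 'r ring \<Rightarrow> ('r, 'x2) module \<Rightarrow> ('r, 'y2) module \<Rightarrow>
     ('x \<Rightarrow> 'x2) \<Rightarrow> ('y \<Rightarrow> 'y2) \<Rightarrow> ('x, 'y) tensor \<Rightarrow> ('x2, 'y2) tensor" where
  "tensor_map \<eta> R X2 Y2 f g =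
     quot_map (free_product_module \<eta> X2 Y2) (tensor_relations R X2 Y2)
       (frag_extend (\<lambda>(x, y). frag_of (f x, g y)))"

definition prod_module :: "(int \<Rightarrow> ('k, 'a) module) \<Rightarrow> ('k, int \<Rightarrow> 'a) module" where
  "prod_module A =
     \<lparr>carrier = {z. \<forall>i. z i \<in> carrier (A i)}, monoid.mult = undefined, monoid.one = undefined,
      ring.zero = (\<lambda>i. \<zero>\<^bsub>A i\<^esub>), ring.add = (\<lambda>z w i. z i \<oplus>\<^bsub>A i\<^esub> w i), smult = (\<lambda>a z i. a \<odot>\<^bsub>A i\<^esub> z i)\<rparr>"

definition coprod_carrier :: "(int \<Rightarrow> ('k, 'a) module) \<Rightarrow> (int \<Rightarrow> 'a) set" where
  "coprod_carrier A = {z \<in> carrier (prod_module A). finite {i. z i \<noteq> \<zero>\<^bsub>A i\<^esub>}}"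

definition tensor_term ::
  "('k \<Rightarrow> 'r) \<Rightarrow> 'r ring \<Rightarrow> ('r, 'x) cplx \<Rightarrow> ('r, 'y) cplx \<Rightarrow> int \<Rightarrow> int \<Rightarrow>
     ('k, ('x, 'y) tensor) module" where
  "tensor_term \<eta> R X Y n i = tensor_module \<eta> R (obj X i) (obj Y (n - i))"

text \<open>The component of \<open>\<partial> z\<close> at \<open>j\<close> collects \<open>\<partial>\<^sup>X \<otimes> Y\<close> of \<open>z (j + 1)\<close> and
  \<open>(- 1)\<^sup>j X \<otimes> \<partial>\<^sup>Y\<close> of \<open>z j\<close>.\<close>

definition unbounded_tensor ::
  "('k \<Rightarrow> 'r) \<Rightarrow> 'r ring \<Rightarrow> ('r, 'x) cplx \<Rightarrow> ('r, 'y) cplx \<Rightarrow> ('k, int \<Rightarrow> ('x, 'y) tensor) cplx" where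
  "unbounded_tensor \<eta> R X Y =
     \<lparr>obj = (\<lambda>n. prod_module (tensor_term \<eta> R X Y n)),
      diff = (\<lambda>n z j.
        let A = tensor_term \<eta> R X Y (n - 1) j;
            u = tensor_map \<eta> R (obj X j) (obj Y (n - 1 - j)) (diff X (j + 1)) id (z (j + 1));
            v = tensor_map \<eta> R (obj X j) (obj Y (n - 1 - j)) id (diff Y (n - j)) (z j)
        in u \<oplus>\<^bsub>A\<^esub> (if even j then v else \<ominus>\<^bsub>A\<^esub> v))\<rparr>"

definition stable_tensor ::
  "('k \<Rightarrow> 'r) \<Rightarrow> 'r ring \<Rightarrow> ('r, 'x) cplx \<Rightarrow> ('r, 'y) cplx \<Rightarrow>
     ('k, (int \<Rightarrow> ('x, 'y) tensor) set) cplx" where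
  "stable_tensor \<eta> R X Y =
     \<lparr>obj = (\<lambda>n. quot_module (obj (unbounded_tensor \<eta> R X Y) n)
               (coprod_carrier (tensor_term \<eta> R X Y n))),
      diff = (\<lambda>n. quot_map (obj (unbounded_tensor \<eta> R X Y) (n - 1))
               (coprod_carrier (tensor_term \<eta> R X Y (n - 1)))
               (diff (unbounded_tensor \<eta> R X Y) n))\<rparr>"

text \<open>The map \<open>X \<otimes> Y \<rightarrow> X \<otimes> Y2\<close> of stable tensor products induced by \<open>g : Y \<rightarrow> Y2\<close>.\<close>

definition stable_tensor_map ::
  "('k \<Rightarrow> 'r) \<Rightarrow> 'r ring \<Rightarrow> ('r, 'x) cplx \<Rightarrow> ('r, 'y2) cplx \<Rightarrow> (int \<Rightarrow> 'y \<Rightarrow> 'y2) \<Rightarrow>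
     int \<Rightarrow> (int \<Rightarrow> ('x, 'y) tensor) set \<Rightarrow> (int \<Rightarrow> ('x, 'y2) tensor) set" where
  "stable_tensor_map \<eta> R X Y2 g n =
     quot_map (obj (unbounded_tensor \<eta> R X Y2) n) (coprod_carrier (tensor_term \<eta> R X Y2 n))
       (\<lambda>z i. tensor_map \<eta> R (obj X i) (obj Y2 (n - i)) id (g (n - i)) (z i))"

definition tensor_with_module ::
  "('k \<Rightarrow> 'r) \<Rightarrow> 'r ring \<Rightarrow> ('r, 'x) cplx \<Rightarrow> ('r, 'n) module \<Rightarrow> ('k, ('x, 'n) tensor) cplx" where
  "tensor_with_module \<eta> R X N =
     \<lparr>obj = (\<lambda>n. tensor_module \<eta> R (obj X n) N),
      diff = (\<lambda>n. tensor_map \<eta> R (obj X (n - 1)) N (diff X n) id)\<rparr>"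


section \<open>Stable homology and Tate homology\<close>

text \<open>Both are given by resolutions: \<open>P\<close> is a projective resolution of the \<open>opp R\<close>-module
  in the first argument, \<open>I\<close> is an injective resolution of the \<open>R\<close>-module in the second one, and
  \<open>T\<close> is the totally acyclic complex in a complete projective resolution. The action of a
  homomorphism \<open>f : N \<rightarrow> N2\<close> on stable homology is \<open>stable_Tor_map\<close> of any lift \<open>g : I \<rightarrow> I2\<close>
  of \<open>f\<close> to injective resolutions.\<close>

definition stable_Tor ::
  "('k \<Rightarrow> 'r) \<Rightarrow> 'r ring \<Rightarrow> ('r, 'p) cplx \<Rightarrow> ('r, 'i) cplx \<Rightarrow> int \<Rightarrow>
     ('k, (int \<Rightarrow> ('p, 'i) tensor) set set) module" where
  "stable_Tor \<eta> R P I i = homology (stable_tensor \<eta> R P I) (i + 1)"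

definition stable_Tor_map ::
  "('k \<Rightarrow> 'r) \<Rightarrow> 'r ring \<Rightarrow> ('r, 'p) cplx \<Rightarrow> ('r, 'i2) cplx \<Rightarrow> (int \<Rightarrow> 'i \<Rightarrow> 'i2) \<Rightarrow> int \<Rightarrow>
     (int \<Rightarrow> ('p, 'i) tensor) set set \<Rightarrow> (int \<Rightarrow> ('p, 'i2) tensor) set set" where
  "stable_Tor_map \<eta> R P I2 g i =
     homology_map (stable_tensor \<eta> R P I2) (stable_tensor_map \<eta> R P I2 g) (i + 1)"

definition Tate_Tor ::
  "('k \<Rightarrow> 'r) \<Rightarrow> 'r ring \<Rightarrow> ('r, 't) cplx \<Rightarrow> ('r, 'n) module \<Rightarrow> int \<Rightarrow>
     ('k, ('t, 'n) tensor set) module" where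
  "Tate_Tor \<eta> R T N i = homology (tensor_with_module \<eta> R T N) i"

definition Tate_Tor_map ::
  "('k \<Rightarrow> 'r) \<Rightarrow> 'r ring \<Rightarrow> ('r, 't) cplx \<Rightarrow> ('r, 'n2) module \<Rightarrow> ('n \<Rightarrow> 'n2) \<Rightarrow> int \<Rightarrow>
     ('t, 'n) tensor set \<Rightarrow> ('t, 'n2) tensor set" where
  "Tate_Tor_map \<eta> R T N2 f i =
     homology_map (tensor_with_module \<eta> R T N2)
       (\<lambda>n. tensor_map \<eta> R (obj T n) N2 id f) i"

definition lifts_to ::
  "'r ring \<Rightarrow> ('r, 'n) module \<Rightarrow> ('n \<Rightarrow> 'i) \<Rightarrow> ('r, 'i) cplx \<Rightarrow>
     ('r, 'n2) module \<Rightarrow> ('n2 \<Rightarrow> 'i2) \<Rightarrow> ('r, 'i2) cplx \<Rightarrow>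
     ('n \<Rightarrow> 'n2) \<Rightarrow> (int \<Rightarrow> 'i \<Rightarrow> 'i2) \<Rightarrow> bool" where
  "lifts_to R N \<iota> I N2 \<iota>2 I2 f g \<longleftrightarrow> f \<in> mod_hom R N N2 \<and> chain_map R I I2 g \<and>
     (\<forall>x\<in>carrier N. g 0 (\<iota> x) = \<iota>2 (f x))"

text \<open>An isomorphism between the functors \<open>N \<mapsto> stable_Tor \<eta> R P I i\<close> and
  \<open>N \<mapsto> Tate_Tor \<eta> R T N i\<close> from \<open>R\<close>-modules to \<open>k\<close>-modules. The family \<open>\<phi>\<close> is indexed by
  modules together with an injective resolution \<open>N \<rightarrow> I\<close>. Given any choice of a resolution
  for each module, \<open>\<phi>\<close> restricts to a natural isomorphism of functors for that choice;
  taking \<open>f\<close> to be the identity, naturality says that \<open>\<phi>\<close> is compatible with the change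
  of resolution.\<close>

definition natural_iso_stable_Tate ::
  "'k ring \<Rightarrow> ('k \<Rightarrow> 'r) \<Rightarrow> 'r ring \<Rightarrow> ('r, 'p) cplx \<Rightarrow> ('r, 't) cplx \<Rightarrow> int \<Rightarrow>
     (('r, 'n) module \<Rightarrow> ('n \<Rightarrow> 'i) \<Rightarrow> ('r, 'i) cplx \<Rightarrow>
        (int \<Rightarrow> ('p, 'i) tensor) set set \<Rightarrow> ('t, 'n) tensor set) \<Rightarrow> bool" where
  "natural_iso_stable_Tate k \<eta> R P T i \<phi> \<longleftrightarrow>
     (\<forall>N \<iota> I. injective_resolution R N \<iota> I \<longrightarrow>
        \<phi> N \<iota> I \<in> mod_iso k (stable_Tor \<eta> R P I i) (Tate_Tor \<eta> R T N i)) \<and>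
     (\<forall>N \<iota> I N2 \<iota>2 I2 f g.
        injective_resolution R N \<iota> I \<and> injective_resolution R N2 \<iota>2 I2 \<and>
        lifts_to R N \<iota> I N2 \<iota>2 I2 f g \<longrightarrow>
        (\<forall>c\<in>carrier (stable_Tor \<eta> R P I i).
           \<phi> N2 \<iota>2 I2 (stable_Tor_map \<eta> R P I2 g i c) = Tate_Tor_map \<eta> R T N2 f i (\<phi> N \<iota> I c)))"

end

theory Submission
  imports Defs
begin

text \<open>Let \<open>N \<rightarrow> I\<close> be an injective resolution and consider the double complex \<open>T \<otimes> I\<close>, augmented by
  \<open>T \<otimes> N\<close>.  Its rows \<open>T\<^sub>p \<otimes> I\<close> are exact because projective modules are flat.  Its columns \<open>T \<otimes> I\<^sub>q\<close> are exact
  too: as \<open>R\<close> is noetherian and \<open>M\<close> finitely generated, the identity of \<open>T\<close> is locally homotopic to a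
  map through finite free modules, so that exactness of \<open>T \<otimes> J\<close> for \<open>J\<close> injective becomes the
  solvability of a finite linear system over \<open>J\<close>, whose compatibility is total acyclicity of \<open>T\<close>.
  Exact columns make the product total complex acyclic, whereas by exact rows the coproduct total
  complex computes the homology of \<open>T \<otimes> N\<close>.  Hence the connecting map identifies the homology of the
  stable tensor product of \<open>T\<close> and \<open>I\<close> in degree \<open>i + 1\<close> with that of \<open>T \<otimes> N\<close> in degree \<open>i\<close>.  The
  stable tensor product only sees the high degrees of its first factor, and there \<open>T\<close> and \<open>P\<close> are
  homotopy equivalent.\<close>

text \<open>The terms of \<open>T\<close> and \<open>P\<close> are arbitrary projective modules, so
  the finiteness of \<open>M\<close> is available only up to homotopy. \<open>fin_approx\<close>
  records it degree by degree: a finite presentation of \<open>M\<close> supplies degree 0 of a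
  resolution, syzygies of right modules carry it upwards, and dual syzygies, which rest on finitely
  generated left modules of row vectors and on total acyclicity, carry it down through the negative
  degrees of \<open>T\<close>. Since \<open>I\<close> lives in degrees at most 0, the term of
  bidegree \<open>(i, n - i)\<close> vanishes for \<open>i < n\<close>. Products are thus infinite
  in one direction only, and a stable class is a germ of a family for \<open>i\<close> tending to
  infinity. For this reason maps between \<open>T\<close> and \<open>P\<close> in high degrees are
  enough; they are extended by zero below a bound. The connecting map is kept as a correspondence
  between representatives, not as a function: no preimages are chosen, and naturality holds because
  a map of resolutions carries witnesses to witnesses. The shift from \<open>i + 1\<close> to
  \<open>i\<close> is the degree of this map.\<close>

section \<open>Groups with operators: submodules, cosets and homomorphisms\<close>

text \<open>Abelian groups with operators serve both for the \<open>R\<close>-modules and for the modules over the ground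
  ring, for which no axiom beyond additivity of the action is needed.\<close>

locale op_group = abelian_group M for K :: "'k ring" and M :: "('k, 'm) module" (structure) +
  assumes op_closed [simp, intro]: "\<lbrakk>a \<in> carrier K; x \<in> carrier M\<rbrakk> \<Longrightarrow> a \<odot> x \<in> carrier M"
    and op_add: "\<lbrakk>a \<in> carrier K; x \<in> carrier M; y \<in> carrier M\<rbrakk> \<Longrightarrow> a \<odot> (x \<oplus> y) = a \<odot> x \<oplus> a \<odot> y"
begin

text \<open>Ordered rewriting of sums may leave an element and its inverse separated by other
  summands. These rules cancel across one, two or three of them, and the collection
  \<open>ag\<close> then settles most identities between sums that occur below.\<close>

lemma cancel2: "\<lbrakk>x \<in> carrier M; y \<in> carrier M\<rbrakk> \<Longrightarrow> x \<oplus> (y \<oplus> \<ominus> x) = y"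
  "\<lbrakk>x \<in> carrier M; y \<in> carrier M\<rbrakk> \<Longrightarrow> \<ominus> x \<oplus> (y \<oplus> x) = y"
  by (simp_all add: a_lcomm[of x y] a_lcomm[of "\<ominus> x" y] l_neg r_neg)

lemma cancel3:
  assumes "x \<in> carrier M" "y \<in> carrier M" "z \<in> carrier M"
  shows "x \<oplus> (y \<oplus> (\<ominus> x \<oplus> z)) = y \<oplus> z" "\<ominus> x \<oplus> (y \<oplus> (x \<oplus> z)) = y \<oplus> z"
    "x \<oplus> (y \<oplus> (z \<oplus> \<ominus> x)) = y \<oplus> z" "\<ominus> x \<oplus> (y \<oplus> (z \<oplus> x)) = y \<oplus> z"
  using assms
  by (simp_all add: a_lcomm[of x y] a_lcomm[of "\<ominus> x" y] cancel2 r_neg1 r_neg2)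

lemma cancel4:
  assumes "x \<in> carrier M" "y \<in> carrier M" "z \<in> carrier M" "w \<in> carrier M"
  shows "x \<oplus> (y \<oplus> (z \<oplus> (\<ominus> x \<oplus> w))) = y \<oplus> (z \<oplus> w)" "\<ominus> x \<oplus> (y \<oplus> (z \<oplus> (x \<oplus> w))) = y \<oplus> (z \<oplus> w)"
    "x \<oplus> (y \<oplus> (z \<oplus> (w \<oplus> \<ominus> x))) = y \<oplus> (z \<oplus> w)" "\<ominus> x \<oplus> (y \<oplus> (z \<oplus> (w \<oplus> x))) = y \<oplus> (z \<oplus> w)"
  using assms
  by (simp_all add: a_lcomm[of x y] a_lcomm[of "\<ominus> x" y] cancel3)

lemmas ag = minus_eq minus_add a_ac r_neg1 r_neg2 l_neg r_neg cancel2 cancel3 cancel4 minus_minus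

lemma eq_iff_diff: "\<lbrakk>x \<in> carrier M; y \<in> carrier M\<rbrakk> \<Longrightarrow> x = y \<longleftrightarrow> x \<ominus> y = \<zero>"
  by (metis minus_eq minus_equality minus_minus r_neg a_inv_closed)

lemma neg_zero [simp]: "\<ominus> \<zero> = \<zero>"
  by (metis l_neg r_zero zero_closed a_inv_closed)

lemma op_zero [simp]: "a \<in> carrier K \<Longrightarrow> a \<odot> \<zero> = \<zero>"
  by (metis add.l_cancel_one' op_add op_closed r_zero zero_closed)

lemma op_minus: "\<lbrakk>a \<in> carrier K; x \<in> carrier M\<rbrakk> \<Longrightarrow> a \<odot> (\<ominus> x) = \<ominus> (a \<odot> x)"
  by (metis a_inv_closed minus_equality op_add op_closed op_zero l_neg)

lemma submoduleI:
  assumes "H \<subseteq> carrier M" "\<zero> \<in> H" "\<And>x y. \<lbrakk>x \<in> H; y \<in> H\<rbrakk> \<Longrightarrow> x \<oplus> y \<in> H"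
    and "\<And>x. x \<in> H \<Longrightarrow> \<ominus> x \<in> H" "\<And>a x. \<lbrakk>a \<in> carrier K; x \<in> H\<rbrakk> \<Longrightarrow> a \<odot> x \<in> H"
  shows "submodule H K M"
  using assms by (auto intro!: submodule.intro subgroup.intro submodule_axioms.intro simp: a_inv_def)

lemma submoduleE:
  assumes "submodule H K M"
  shows "H \<subseteq> carrier M" "\<zero> \<in> H" "\<And>x y. \<lbrakk>x \<in> H; y \<in> H\<rbrakk> \<Longrightarrow> x \<oplus> y \<in> H"
    "\<And>x. x \<in> H \<Longrightarrow> \<ominus> x \<in> H" "\<And>x y. \<lbrakk>x \<in> H; y \<in> H\<rbrakk> \<Longrightarrow> x \<ominus> y \<in> H"
    "\<And>a x. \<lbrakk>a \<in> carrier K; x \<in> H\<rbrakk> \<Longrightarrow> a \<odot> x \<in> H"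
proof -
  interpret H: submodule H K M by fact
  have sub: "additive_subgroup H M" using H.subgroup_axioms by (rule additive_subgroupI)
  show "H \<subseteq> carrier M" "\<zero> \<in> H" "\<And>x y. \<lbrakk>x \<in> H; y \<in> H\<rbrakk> \<Longrightarrow> x \<oplus> y \<in> H"
    "\<And>x. x \<in> H \<Longrightarrow> \<ominus> x \<in> H"  "\<And>x y. \<lbrakk>x \<in> H; y \<in> H\<rbrakk> \<Longrightarrow> x \<ominus> y \<in> H"
    using additive_subgroup.a_subset[OF sub] additive_subgroup.zero_closed[OF sub]
      additive_subgroup.a_closed[OF sub] additive_subgroup.a_inv_closed[OF sub]
    by (auto simp: minus_eq)
  show "\<And>a x. \<lbrakk>a \<in> carrier K; x \<in> H\<rbrakk> \<Longrightarrow> a \<odot> x \<in> H" by simp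
qed

lemma coset_mem_iff:
  assumes "submodule H K M" "x \<in> carrier M"
  shows "y \<in> H +> x \<longleftrightarrow> y \<in> carrier M \<and> y \<ominus> x \<in> H"
proof -
  note H = submoduleE[OF assms(1)]
  have "y \<in> H +> x \<longleftrightarrow> (\<exists>h\<in>H. y = h \<oplus> x)" by (auto simp: a_r_coset_def')
  moreover have "(\<exists>h\<in>H. y = h \<oplus> x) \<longleftrightarrow> y \<in> carrier M \<and> y \<ominus> x \<in> H"
  proof safe
    fix h assume h: "h \<in> H" "y = h \<oplus> x"
    with H(1) assms(2) show "h \<oplus> x \<in> carrier M" by auto
    have "h \<in> carrier M" using H(1) h by auto
    with h assms(2) show "(h \<oplus> x) \<ominus> x \<in> H" by (simp add: ag)
  next
    assume "y \<in> carrier M" "y \<ominus> x \<in> H"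
    then show "\<exists>h\<in>H. y = h \<oplus> x" using assms(2) by (intro bexI[of _ "y \<ominus> x"]) (auto simp: ag)
  qed
  ultimately show ?thesis by simp
qed

lemma coset_self: "\<lbrakk>submodule H K M; x \<in> carrier M\<rbrakk> \<Longrightarrow> x \<in> H +> x"
  using coset_mem_iff submoduleE(2) by (simp add: ag)

lemma coset_eq_iff:
  assumes "submodule H K M" "x \<in> carrier M" "y \<in> carrier M"
  shows "H +> x = H +> y \<longleftrightarrow> x \<ominus> y \<in> H"
proof
  assume "H +> x = H +> y"
  then show "x \<ominus> y \<in> H" using coset_self[OF assms(1,2)] coset_mem_iff[OF assms(1,3)] by auto
next
  note H = submoduleE[OF assms(1)]
  assume d: "x \<ominus> y \<in> H"
  have *: "z \<ominus> x \<in> H \<longleftrightarrow> z \<ominus> y \<in> H" if z: "z \<in> carrier M" for z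
  proof -
    have "z \<ominus> y = (z \<ominus> x) \<oplus> (x \<ominus> y)" "z \<ominus> x = (z \<ominus> y) \<ominus> (x \<ominus> y)"
      using z assms by (simp_all add: ag)
    then show ?thesis using d H(3,5) by metis
  qed
  show "H +> x = H +> y"
    unfolding set_eq_iff coset_mem_iff[OF assms(1,2)] coset_mem_iff[OF assms(1,3)] using * by blast
qed

lemma coset_zero: "submodule H K M \<Longrightarrow> H +> \<zero> = H"
  using submoduleE by simp

lemma coset_eq_sub_iff:
  "\<lbrakk>submodule H K M; x \<in> carrier M\<rbrakk> \<Longrightarrow> H +> x = H \<longleftrightarrow> x \<in> H"
  using coset_eq_iff[of H x \<zero>] coset_zero by (simp add: ag)

lemma restrict_op_group:
  assumes "submodule H K M"
  shows "op_group K (M\<lparr>carrier := H\<rparr>)"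
proof -
  note H = submoduleE[OF assms]
  have "\<exists>y\<in>H. y \<oplus> x = \<zero>" if "x \<in> H" for x
    using that H(1,4) l_neg by blast
  then show ?thesis
    using H by (intro op_group.intro abelian_groupI op_group_axioms.intro)
      (auto simp: a_ac op_add subset_iff)
qed

end

lemma restrict_submodule:
  assumes "op_group K M" "submodule H K M" "submodule B K M" "B \<subseteq> H"
  shows "submodule B K (M\<lparr>carrier := H\<rparr>)"
proof -
  interpret op_group K M by fact
  interpret H: op_group K "M\<lparr>carrier := H\<rparr>" by (rule restrict_op_group) fact
  note B = submoduleE[OF assms(3)] and SH = submoduleE[OF assms(2)]
  have inv: "\<ominus>\<^bsub>M\<lparr>carrier := H\<rparr>\<^esub> x = \<ominus>\<^bsub>M\<^esub> x" if "x \<in> H" for x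
    using that SH by (intro H.minus_equality) (auto simp: l_neg subset_iff)
  show ?thesis
    using B assms(4) by (intro H.submoduleI) (auto simp: inv subset_iff)
qed

lemma left_module_op_group: "left_module R M \<Longrightarrow> op_group R M"
  unfolding left_module_def op_group_def op_group_axioms_def left_module_axioms_def by auto

lemma mod_homI:
  assumes "\<And>x. x \<in> carrier M \<Longrightarrow> f x \<in> carrier N"
    and "\<And>x y. \<lbrakk>x \<in> carrier M; y \<in> carrier M\<rbrakk> \<Longrightarrow> f (x \<oplus>\<^bsub>M\<^esub> y) = f x \<oplus>\<^bsub>N\<^esub> f y"
    and "\<And>a x. \<lbrakk>a \<in> carrier R; x \<in> carrier M\<rbrakk> \<Longrightarrow> f (a \<odot>\<^bsub>M\<^esub> x) = a \<odot>\<^bsub>N\<^esub> f x"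
  shows "f \<in> mod_hom R M N"
  using assms by (auto simp: mod_hom_def)

lemma mod_hom_closed: "\<lbrakk>f \<in> mod_hom R M N; x \<in> carrier M\<rbrakk> \<Longrightarrow> f x \<in> carrier N"
  and mod_hom_add: "\<lbrakk>f \<in> mod_hom R M N; x \<in> carrier M; y \<in> carrier M\<rbrakk> \<Longrightarrow> f (x \<oplus>\<^bsub>M\<^esub> y) = f x \<oplus>\<^bsub>N\<^esub> f y"
  and mod_hom_smult: "\<lbrakk>f \<in> mod_hom R M N; a \<in> carrier R; x \<in> carrier M\<rbrakk> \<Longrightarrow> f (a \<odot>\<^bsub>M\<^esub> x) = a \<odot>\<^bsub>N\<^esub> f x"
  by (auto simp: mod_hom_def)

locale op_hom = M: op_group K M + N: op_group K N
  for K :: "'k ring" and M :: "('k, 'm) module" and N :: "('k, 'n) module" +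
  fixes f :: "'m \<Rightarrow> 'n"
  assumes hom: "f \<in> mod_hom K M N"
begin

lemma closed [simp, intro]: "x \<in> carrier M \<Longrightarrow> f x \<in> carrier N"
  using hom by (rule mod_hom_closed)

lemma add [simp]: "\<lbrakk>x \<in> carrier M; y \<in> carrier M\<rbrakk> \<Longrightarrow> f (x \<oplus>\<^bsub>M\<^esub> y) = f x \<oplus>\<^bsub>N\<^esub> f y"
  using hom by (rule mod_hom_add)

lemma smult [simp]: "\<lbrakk>a \<in> carrier K; x \<in> carrier M\<rbrakk> \<Longrightarrow> f (a \<odot>\<^bsub>M\<^esub> x) = a \<odot>\<^bsub>N\<^esub> f x"
  using hom by (rule mod_hom_smult)

lemma zero [simp]: "f \<zero>\<^bsub>M\<^esub> = \<zero>\<^bsub>N\<^esub>"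
  by (metis M.r_zero M.zero_closed N.add.l_cancel_one' add closed)

lemma minus [simp]: "x \<in> carrier M \<Longrightarrow> f (\<ominus>\<^bsub>M\<^esub> x) = \<ominus>\<^bsub>N\<^esub> f x"
  by (metis M.a_inv_closed M.l_neg N.minus_equality add closed zero)

lemma diff [simp]: "\<lbrakk>x \<in> carrier M; y \<in> carrier M\<rbrakk> \<Longrightarrow> f (x \<ominus>\<^bsub>M\<^esub> y) = f x \<ominus>\<^bsub>N\<^esub> f y"
  by (simp add: M.minus_eq N.minus_eq)

lemma finsum: "\<lbrakk>finite I; \<And>i. i \<in> I \<Longrightarrow> g i \<in> carrier M\<rbrakk> \<Longrightarrow>
    f (finsum M g I) = finsum N (\<lambda>i. f (g i)) I"
  by (induct rule: finite_induct) (auto simp: M.finsum_insert N.finsum_insert Pi_def M.finsum_closed)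

end

lemma op_homI: "\<lbrakk>op_group K M; op_group K N; f \<in> mod_hom K M N\<rbrakk> \<Longrightarrow> op_hom K M N f"
  by (simp add: op_hom_def op_hom_axioms_def)

lemma mod_hom_comp: "\<lbrakk>f \<in> mod_hom R M N; g \<in> mod_hom R N L\<rbrakk> \<Longrightarrow> (\<lambda>x. g (f x)) \<in> mod_hom R M L"
  by (rule mod_homI) (simp_all add: mod_hom_closed mod_hom_add mod_hom_smult)

lemma mod_hom_ident: "(\<lambda>x. x) \<in> mod_hom R M M" and mod_hom_id: "id \<in> mod_hom R M M"
  by (auto simp: mod_hom_def)

lemma mod_hom_sum:
  assumes "op_group R M" "op_group R N" "f \<in> mod_hom R M N" "g \<in> mod_hom R M N"
  shows "(\<lambda>x. f x \<oplus>\<^bsub>N\<^esub> g x) \<in> mod_hom R M N"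
proof -
  interpret f: op_hom R M N f using assms by (intro op_homI)
  interpret g: op_hom R M N g using assms by (intro op_homI)
  show ?thesis by (rule mod_homI) (auto simp: f.N.ag f.N.op_add)
qed

lemma mod_hom_diff:
  assumes "op_group R M" "op_group R N" "f \<in> mod_hom R M N" "g \<in> mod_hom R M N"
  shows "(\<lambda>x. f x \<ominus>\<^bsub>N\<^esub> g x) \<in> mod_hom R M N"
proof -
  interpret f: op_hom R M N f using assms by (intro op_homI)
  interpret g: op_hom R M N g using assms by (intro op_homI)
  show ?thesis by (rule mod_homI) (auto simp: f.N.ag f.N.op_add f.N.op_minus)
qed

lemma mod_hom_zero_fun: "op_group R N \<Longrightarrow> (\<lambda>x. \<zero>\<^bsub>N\<^esub>) \<in> mod_hom R M N"
proof -
  assume "op_group R N"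
  then interpret op_group R N .
  show ?thesis by (rule mod_homI) auto
qed

section \<open>Quotients\<close>

text \<open>Cosets, their sums and induced maps only use the addition. As \<open>homology\<close>
  restricts the carrier to the cycles, these rules let everything be computed in the whole
  term.\<close>

lemma a_r_coset_restrict [simp]: "a_r_coset (M\<lparr>carrier := Z\<rparr>) = a_r_coset M"
  and set_add_restrict [simp]: "set_add (M\<lparr>carrier := Z\<rparr>) = set_add M"
  and quot_map_restrict [simp]: "quot_map (M\<lparr>carrier := Z\<rparr>) = quot_map M"
  by (auto simp: fun_eq_iff a_r_coset_def' set_add_def' quot_map_def)

lemma quot_carrier: "carrier (quot_module M H) = (\<lambda>x. H +>\<^bsub>M\<^esub> x) ` carrier M"
  by (auto simp: quot_module_def A_RCOSETS_def')

lemma quot_zero [simp]: "\<zero>\<^bsub>quot_module M H\<^esub> = H"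
  by (simp add: quot_module_def)

text \<open>Elements of one coset differ by an element of \<open>H\<close>, whose image is absorbed
  by \<open>L\<close>; hence the union defining \<open>quot_map\<close> is a single coset. Stated
  for additive maps, so as to cover scalar multiplication on a quotient as well as module
  maps.\<close>

lemma quot_map_coset:
  assumes "op_group K M" "submodule H K M" "op_group K N" "submodule L K N"
    and "\<And>x. x \<in> carrier M \<Longrightarrow> f x \<in> carrier N"
    and "\<And>x y. \<lbrakk>x \<in> carrier M; y \<in> carrier M\<rbrakk> \<Longrightarrow> f (x \<oplus>\<^bsub>M\<^esub> y) = f x \<oplus>\<^bsub>N\<^esub> f y"
    and "\<And>x. x \<in> H \<Longrightarrow> f x \<in> L" and x: "x \<in> carrier M"
  shows "quot_map N L f (H +>\<^bsub>M\<^esub> x) = L +>\<^bsub>N\<^esub> f x"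
proof -
  interpret M: op_group K M by fact
  interpret N: op_group K N by fact
  note H = M.submoduleE[OF assms(2)] and L = N.submoduleE[OF assms(4)]
  have "L +>\<^bsub>N\<^esub> f y = L +>\<^bsub>N\<^esub> f x" if "y \<in> H +>\<^bsub>M\<^esub> x" for y
  proof -
    from that obtain h where h: "h \<in> H" "y = h \<oplus>\<^bsub>M\<^esub> x" by (auto simp: a_r_coset_def')
    have hM: "h \<in> carrier M" using h H by auto
    have "f y \<ominus>\<^bsub>N\<^esub> f x = f h"
      using h hM x assms(5,6) by (simp add: N.ag)
    then show ?thesis using N.coset_eq_iff[OF assms(4)] h hM x assms(5,7) by simp
  qed
  moreover have "x \<in> H +>\<^bsub>M\<^esub> x" using M.coset_self assms(2) x by blast
  ultimately show ?thesis unfolding quot_map_def by blast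
qed

locale quot = op_group K M for K :: "'k ring" and M :: "('k, 'm) module" (structure) +
  fixes H assumes sub: "submodule H K M"
begin

lemma quot_add:
  assumes "x \<in> carrier M" "y \<in> carrier M"
  shows "(H +> x) \<oplus>\<^bsub>quot_module M H\<^esub> (H +> y) = H +> (x \<oplus> y)"
proof -
  interpret S: abelian_subgroup H M
    by (intro abelian_subgroupI3 additive_subgroupI abelian_group_axioms submodule.axioms(1)[OF sub])
  show ?thesis using S.a_rcos_sum assms by (simp add: quot_module_def)
qed

lemma quot_smult:
  "\<lbrakk>a \<in> carrier K; x \<in> carrier M\<rbrakk> \<Longrightarrow> a \<odot>\<^bsub>quot_module M H\<^esub> (H +> x) = H +> (a \<odot> x)"
  using submoduleE[OF sub]
  by (simp add: quot_module_def)
    (rule quot_map_coset[OF op_group_axioms sub op_group_axioms sub], auto simp: op_add)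

lemma quot_closed [simp]: "x \<in> carrier M \<Longrightarrow> H +> x \<in> carrier (quot_module M H)"
  by (auto simp: quot_carrier)

lemma quot_op_group: "op_group K (quot_module M H)"
proof -
  have z: "H = H +> \<zero>" using coset_zero[OF sub] by simp
  have inv: "\<exists>Y\<in>carrier (quot_module M H). Y \<oplus>\<^bsub>quot_module M H\<^esub> (H +> x) = H"
    if "x \<in> carrier M" for x
    using that coset_zero[OF sub] by (intro bexI[of _ "H +> (\<ominus> x)"]) (auto simp: quot_add l_neg)
  have l0: "H \<oplus>\<^bsub>quot_module M H\<^esub> (H +> x) = H +> x" if "x \<in> carrier M" for x
    using quot_add[of \<zero> x] z that by simp
  have zc: "H \<in> carrier (quot_module M H)" using quot_closed[of \<zero>] z by simp
  show ?thesis
    by (intro op_group.intro abelian_groupI op_group_axioms.intro)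
      (auto simp: quot_carrier quot_add quot_smult op_add a_ac l0 zc[unfolded quot_carrier]
         intro: inv[unfolded quot_carrier bex_simps])
qed

end

lemma mod_hom_quot_map:
  assumes "quot K M H" "quot K N L" "f \<in> mod_hom K M N" "\<And>x. x \<in> H \<Longrightarrow> f x \<in> L"
  shows "quot_map N L f \<in> mod_hom K (quot_module M H) (quot_module N L)"
    and "x \<in> carrier M \<Longrightarrow> quot_map N L f (H +>\<^bsub>M\<^esub> x) = L +>\<^bsub>N\<^esub> f x"
proof -
  interpret M: quot K M H by fact
  interpret N: quot K N L by fact
  interpret f: op_hom K M N f by (intro op_homI M.op_group_axioms N.op_group_axioms assms)
  have *: "quot_map N L f (H +>\<^bsub>M\<^esub> x) = L +>\<^bsub>N\<^esub> f x" if "x \<in> carrier M" for x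
    using that assms(4)
    by (intro quot_map_coset[OF M.op_group_axioms M.sub N.op_group_axioms N.sub]) auto
  then show "x \<in> carrier M \<Longrightarrow> quot_map N L f (H +>\<^bsub>M\<^esub> x) = L +>\<^bsub>N\<^esub> f x" .
  show "quot_map N L f \<in> mod_hom K (quot_module M H) (quot_module N L)"
    by (rule mod_homI) (auto simp: quot_carrier * M.quot_add N.quot_add M.quot_smult N.quot_smult)
qed

section \<open>Isomorphisms of subquotients induced by an additive correspondence\<close>

text \<open>The map of quotients induced by a correspondence \<rho> in place of a function. As for
  \<open>quot_map\<close>, the union collapses to one coset as soon as \<rho> is additive and
  matches \<open>B\<close> with \<open>B'\<close>.\<close>

definition rel_map where
  "rel_map N B' Z' \<rho> C = \<Union>{B' +>\<^bsub>N\<^esub> z' | z z'. z \<in> C \<and> z' \<in> Z' \<and> \<rho> z z'}"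

text \<open>The setting of a zigzag such as a connecting homomorphism, without choice of preimages.
  Of the equivalence \<open>\<rho>_iff\<close>, one direction makes the induced map well defined and
  the other makes it injective; \<open>\<rho>_total\<close> provides values everywhere and
  \<open>\<rho>_onto\<close> surjectivity.\<close>

locale quot_rel = M: op_group K M + N: op_group K N
  for K :: "'k ring" and M :: "('k, 'm) module" and N :: "('k, 'n) module" +
  fixes Z B Z' B' \<rho>
  assumes Z: "submodule Z K M" and B: "submodule B K M" and BZ: "B \<subseteq> Z"
    and Z': "submodule Z' K N" and B': "submodule B' K N" and BZ': "B' \<subseteq> Z'"
    and \<rho>_add: "\<And>x x' y y'. \<lbrakk>x \<in> Z; y \<in> Z; x' \<in> Z'; y' \<in> Z'; \<rho> x x'; \<rho> y y'\<rbrakk> \<Longrightarrow> \<rho> (x \<oplus>\<^bsub>M\<^esub> y) (x' \<oplus>\<^bsub>N\<^esub> y')"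
    and \<rho>_neg: "\<And>x x'. \<lbrakk>x \<in> Z; x' \<in> Z'; \<rho> x x'\<rbrakk> \<Longrightarrow> \<rho> (\<ominus>\<^bsub>M\<^esub> x) (\<ominus>\<^bsub>N\<^esub> x')"
    and \<rho>_smult: "\<And>a x x'. \<lbrakk>a \<in> carrier K; x \<in> Z; x' \<in> Z'; \<rho> x x'\<rbrakk> \<Longrightarrow> \<rho> (a \<odot>\<^bsub>M\<^esub> x) (a \<odot>\<^bsub>N\<^esub> x')"
    and \<rho>_total: "\<And>x. x \<in> Z \<Longrightarrow> \<exists>x'\<in>Z'. \<rho> x x'"
    and \<rho>_onto: "\<And>x'. x' \<in> Z' \<Longrightarrow> \<exists>x\<in>Z. \<rho> x x'"
    and \<rho>_iff: "\<And>x x'. \<lbrakk>x \<in> Z; x' \<in> Z'; \<rho> x x'\<rbrakk> \<Longrightarrow> x \<in> B \<longleftrightarrow> x' \<in> B'"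
begin

lemma \<rho>_diff: "\<lbrakk>x \<in> Z; y \<in> Z; x' \<in> Z'; y' \<in> Z'; \<rho> x x'; \<rho> y y'\<rbrakk> \<Longrightarrow> \<rho> (x \<ominus>\<^bsub>M\<^esub> y) (x' \<ominus>\<^bsub>N\<^esub> y')"
  unfolding M.minus_eq N.minus_eq
  using \<rho>_add[of x "\<ominus>\<^bsub>M\<^esub> y" x' "\<ominus>\<^bsub>N\<^esub> y'"] \<rho>_neg[of y y'] M.submoduleE(4)[OF Z] N.submoduleE(4)[OF Z']
  by simp

lemma rel_map_coset:
  assumes "x \<in> Z" "x' \<in> Z'" "\<rho> x x'"
  shows "rel_map N B' Z' \<rho> (B +>\<^bsub>M\<^esub> x) = B' +>\<^bsub>N\<^esub> x'"
proof -
  note sZ = M.submoduleE[OF Z] and sZ' = N.submoduleE[OF Z'] and sB = M.submoduleE[OF B]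
  have "B' +>\<^bsub>N\<^esub> y' = B' +>\<^bsub>N\<^esub> x'" if "y \<in> B +>\<^bsub>M\<^esub> x" "y' \<in> Z'" "\<rho> y y'" for y y'
  proof -
    have yx: "y \<ominus>\<^bsub>M\<^esub> x \<in> B" "y \<in> carrier M"
      using that M.coset_mem_iff[OF B] assms(1) sZ(1) by auto
    have "y = (y \<ominus>\<^bsub>M\<^esub> x) \<oplus>\<^bsub>M\<^esub> x" using yx assms(1) sZ(1) by (auto simp: M.ag subset_iff)
    then have "y \<in> Z" using yx BZ sZ(3) assms(1) by (metis subsetD)
    then have "y' \<ominus>\<^bsub>N\<^esub> x' \<in> B'"
      using \<rho>_iff[of "y \<ominus>\<^bsub>M\<^esub> x" "y' \<ominus>\<^bsub>N\<^esub> x'"] \<rho>_diff[of y x y' x'] that assms yx sZ(5) sZ'(5) by auto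
    then show ?thesis using N.coset_eq_iff[OF B'] that assms sZ' by auto
  qed
  moreover have "x \<in> B +>\<^bsub>M\<^esub> x" using M.coset_self[OF B] assms(1) sZ(1) by auto
  ultimately show ?thesis unfolding rel_map_def using assms by fast
qed

lemma rel_map_iso:
  "rel_map N B' Z' \<rho> \<in> mod_iso K (quot_module (M\<lparr>carrier := Z\<rparr>) B) (quot_module (N\<lparr>carrier := Z'\<rparr>) B')"
  (is "?f \<in> mod_iso K ?Q ?Q'")
proof -
  interpret Q: quot K "M\<lparr>carrier := Z\<rparr>" B
    by (intro quot.intro quot_axioms.intro M.restrict_op_group Z restrict_submodule[OF M.op_group_axioms] B BZ)
  interpret Q': quot K "N\<lparr>carrier := Z'\<rparr>" B'
    by (intro quot.intro quot_axioms.intro N.restrict_op_group Z' restrict_submodule[OF N.op_group_axioms] B' BZ')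
  note sZ = M.submoduleE[OF Z] and sZ' = N.submoduleE[OF Z']
  have Qc: "carrier ?Q = (\<lambda>x. B +>\<^bsub>M\<^esub> x) ` Z" and Qc': "carrier ?Q' = (\<lambda>x. B' +>\<^bsub>N\<^esub> x) ` Z'"
    by (simp_all add: quot_carrier)
  have ex: "\<exists>z\<in>Z. \<exists>z'\<in>Z'. \<rho> z z' \<and> C = B +>\<^bsub>M\<^esub> z \<and> ?f C = B' +>\<^bsub>N\<^esub> z'" if C: "C \<in> carrier ?Q" for C
  proof -
    obtain z where z: "z \<in> Z" "C = B +>\<^bsub>M\<^esub> z" using C Qc by auto
    obtain z' where z': "z' \<in> Z'" "\<rho> z z'" using \<rho>_total z by blast
    show ?thesis using z z' rel_map_coset[OF z(1) z'] by blast
  qed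
  have hom: "?f \<in> mod_hom K ?Q ?Q'"
  proof (rule mod_homI)
    fix C assume "C \<in> carrier ?Q"
    with ex show "?f C \<in> carrier ?Q'" unfolding Qc' by blast
  next
    fix C D assume "C \<in> carrier ?Q" "D \<in> carrier ?Q"
    from ex[OF this(1)] ex[OF this(2)] obtain z z' w w' where
      zw: "z \<in> Z" "z' \<in> Z'" "\<rho> z z'" "C = B +>\<^bsub>M\<^esub> z" "?f C = B' +>\<^bsub>N\<^esub> z'"
      "w \<in> Z" "w' \<in> Z'" "\<rho> w w'" "D = B +>\<^bsub>M\<^esub> w" "?f D = B' +>\<^bsub>N\<^esub> w'" by blast
    show "?f (C \<oplus>\<^bsub>?Q\<^esub> D) = ?f C \<oplus>\<^bsub>?Q'\<^esub> ?f D"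
      using Q.quot_add[of z w] Q'.quot_add[of z' w'] zw
        rel_map_coset[of "z \<oplus>\<^bsub>M\<^esub> w" "z' \<oplus>\<^bsub>N\<^esub> w'"] \<rho>_add sZ(3) sZ'(3) by simp
  next
    fix a C assume a: "a \<in> carrier K" "C \<in> carrier ?Q"
    from ex[OF this(2)] obtain z z' where
      zw: "z \<in> Z" "z' \<in> Z'" "\<rho> z z'" "C = B +>\<^bsub>M\<^esub> z" "?f C = B' +>\<^bsub>N\<^esub> z'" by blast
    show "?f (a \<odot>\<^bsub>?Q\<^esub> C) = a \<odot>\<^bsub>?Q'\<^esub> ?f C"
      using Q.quot_smult[of a z] Q'.quot_smult[of a z'] zw a
        rel_map_coset[of "a \<odot>\<^bsub>M\<^esub> z" "a \<odot>\<^bsub>N\<^esub> z'"] \<rho>_smult sZ(6) sZ'(6) by simp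
  qed
  have "inj_on ?f (carrier ?Q)"
  proof (rule inj_onI)
    fix C D assume CD: "C \<in> carrier ?Q" "D \<in> carrier ?Q" "?f C = ?f D"
    from ex[OF this(1)] ex[OF this(2)] obtain z z' w w' where
      zw: "z \<in> Z" "z' \<in> Z'" "\<rho> z z'" "C = B +>\<^bsub>M\<^esub> z" "?f C = B' +>\<^bsub>N\<^esub> z'"
      "w \<in> Z" "w' \<in> Z'" "\<rho> w w'" "D = B +>\<^bsub>M\<^esub> w" "?f D = B' +>\<^bsub>N\<^esub> w'" by blast
    have "z' \<ominus>\<^bsub>N\<^esub> w' \<in> B'" using CD(3) zw N.coset_eq_iff[OF B', of z' w'] sZ'(1) by auto
    then have "z \<ominus>\<^bsub>M\<^esub> w \<in> B"
      using \<rho>_iff[of "z \<ominus>\<^bsub>M\<^esub> w" "z' \<ominus>\<^bsub>N\<^esub> w'"] \<rho>_diff[of z w z' w'] zw sZ(5) sZ'(5) by simp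
    then show "C = D" using zw M.coset_eq_iff[OF B, of z w] sZ(1) by auto
  qed
  moreover have "carrier ?Q' \<subseteq> ?f ` carrier ?Q"
  proof
    fix D assume "D \<in> carrier ?Q'"
    then obtain z' where z': "z' \<in> Z'" "D = B' +>\<^bsub>N\<^esub> z'" using Qc' by auto
    then obtain z where z: "z \<in> Z" "\<rho> z z'" using \<rho>_onto by blast
    then show "D \<in> ?f ` carrier ?Q" using rel_map_coset[OF z(1) z'(1) z(2)] z' Qc by auto
  qed
  moreover have "?f ` carrier ?Q \<subseteq> carrier ?Q'" using mod_hom_closed[OF hom] by auto
  ultimately show ?thesis using hom by (auto simp: mod_iso_def bij_betw_def)
qed

end

section \<open>Free and projective modules\<close>

sublocale left_module \<subseteq> M?: op_group R M
  using left_module_axioms by (rule left_module_op_group)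

lemma projective_moduleD:
  fixes A B :: "('r, 'm \<Rightarrow> 'r) module" and M :: "('r, 'm) module"
  assumes "projective_module S M" "left_module S A" "left_module S B" "p \<in> mod_hom S A B"
    "p ` carrier A = carrier B" "f \<in> mod_hom S M B"
  shows "\<exists>h\<in>mod_hom S M A. \<forall>x\<in>carrier M. p (h x) = f x"
  using assms unfolding projective_module_def by blast

lemma injective_moduleD:
  fixes A B :: "('r, 'm \<Rightarrow> 'r) module" and M :: "('r, 'm) module"
  assumes "injective_module S M" "left_module S A" "left_module S B" "j \<in> mod_hom S A B"
    "inj_on j (carrier A)" "f \<in> mod_hom S A M"
  shows "\<exists>h\<in>mod_hom S B M. \<forall>x\<in>carrier A. h (j x) = f x"
  using assms unfolding injective_module_def by blast

context left_module begin

lemma smult_zero_left [simp]: "x \<in> carrier M \<Longrightarrow> \<zero> \<odot>\<^bsub>M\<^esub> x = \<zero>\<^bsub>M\<^esub>"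
  by (metis M.add.l_cancel_one' R.l_zero R.zero_closed smult_closed smult_l_distr)

lemma smult_minus_left: "\<lbrakk>a \<in> carrier R; x \<in> carrier M\<rbrakk> \<Longrightarrow> (\<ominus> a) \<odot>\<^bsub>M\<^esub> x = \<ominus>\<^bsub>M\<^esub> (a \<odot>\<^bsub>M\<^esub> x)"
  by (metis M.minus_equality R.a_inv_closed R.l_neg smult_closed smult_l_distr smult_zero_left)

end

lemma left_module_regular:
  fixes S (structure)
  assumes "ring S" shows "left_module S (regular_module S)"
proof -
  interpret ring S by fact
  show ?thesis
    by (intro left_module.intro left_module_axioms.intro abelian_groupI ring_axioms)
      (auto simp: regular_module_def a_ac l_distr r_distr m_assoc intro: bexI[of _ "\<ominus> x" for x] r_neg)
qed

text \<open>Functions on the whole type \<open>'x\<close> that vanish off \<open>X\<close>. For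
  \<open>X\<close> inside the type of a module this is the type prescribed for the test modules in
  \<open>projective_module\<close>, so these free modules can be tested against directly.\<close>

definition free_mod :: "'r ring \<Rightarrow> 'x set \<Rightarrow> ('r, 'x \<Rightarrow> 'r) module" where
  "free_mod S X = \<lparr>carrier = {f. (\<forall>x. f x \<in> carrier S) \<and> (\<forall>x. x \<notin> X \<longrightarrow> f x = \<zero>\<^bsub>S\<^esub>) \<and> finite {x. f x \<noteq> \<zero>\<^bsub>S\<^esub>}},
     monoid.mult = undefined, monoid.one = undefined, ring.zero = (\<lambda>_. \<zero>\<^bsub>S\<^esub>),
     ring.add = (\<lambda>f g x. f x \<oplus>\<^bsub>S\<^esub> g x), smult = (\<lambda>a f x. a \<otimes>\<^bsub>S\<^esub> f x)\<rparr>"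

definition basis_vec :: "'r ring \<Rightarrow> 'x \<Rightarrow> 'x \<Rightarrow> 'r" where
  "basis_vec S x = (\<lambda>y. if y = x then \<one>\<^bsub>S\<^esub> else \<zero>\<^bsub>S\<^esub>)"

definition lin_comb :: "'r ring \<Rightarrow> ('r, 'm) module \<Rightarrow> ('x \<Rightarrow> 'm) \<Rightarrow> ('x \<Rightarrow> 'r) \<Rightarrow> 'm" where
  "lin_comb S N \<phi> f = finsum N (\<lambda>x. f x \<odot>\<^bsub>N\<^esub> \<phi> x) {x. f x \<noteq> \<zero>\<^bsub>S\<^esub>}"

lemma free_mod_simps [simp]:
  "f \<oplus>\<^bsub>free_mod S X\<^esub> g = (\<lambda>x. f x \<oplus>\<^bsub>S\<^esub> g x)" "\<zero>\<^bsub>free_mod S X\<^esub> = (\<lambda>_. \<zero>\<^bsub>S\<^esub>)"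
  "a \<odot>\<^bsub>free_mod S X\<^esub> f = (\<lambda>x. a \<otimes>\<^bsub>S\<^esub> f x)"
  by (simp_all add: free_mod_def)

lemma free_mod_carrier: "f \<in> carrier (free_mod S X) \<longleftrightarrow>
    (\<forall>x. f x \<in> carrier S) \<and> (\<forall>x. x \<notin> X \<longrightarrow> f x = \<zero>\<^bsub>S\<^esub>) \<and> finite {x. f x \<noteq> \<zero>\<^bsub>S\<^esub>}"
  by (simp add: free_mod_def)

lemma free_mod_finite_carrier: "finite X \<Longrightarrow> f \<in> carrier (free_mod S X) \<longleftrightarrow>
    (\<forall>x. f x \<in> carrier S) \<and> (\<forall>x. x \<notin> X \<longrightarrow> f x = \<zero>\<^bsub>S\<^esub>)"
  by (auto simp: free_mod_carrier intro: finite_subset[of _ X])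

lemma left_module_free:
  fixes S (structure)
  assumes "ring S" shows "left_module S (free_mod S X)"
proof -
  interpret ring S by fact
  have fin: "finite {x. h (f x) (g x) \<noteq> \<zero>}" 
    if "finite {x. f x \<noteq> \<zero>}" "finite {x. g x \<noteq> \<zero>}" "h \<zero> \<zero> = \<zero>" for h and f g :: "'b \<Rightarrow> 'a"
    by (rule finite_subset[OF _ finite_UnI[OF that(1,2)]]) (use that(3) in auto)
  have add: "(\<lambda>x. f x \<oplus> g x) \<in> carrier (free_mod S X)"
    if "f \<in> carrier (free_mod S X)" "g \<in> carrier (free_mod S X)" for f g
    using that fin[of f g "(\<oplus>)"] by (auto simp: free_mod_carrier)
  have neg: "(\<lambda>x. \<ominus> f x) \<in> carrier (free_mod S X)" if "f \<in> carrier (free_mod S X)" for f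
    using that fin[of f f "\<lambda>x y. \<ominus> x"] by (auto simp: free_mod_carrier)
  have mul: "(\<lambda>x. a \<otimes> f x) \<in> carrier (free_mod S X)" 
    if "f \<in> carrier (free_mod S X)" "a \<in> carrier S" for f a
    using that fin[of f f "\<lambda>x y. a \<otimes> x"] by (auto simp: free_mod_carrier)
  have ab: "abelian_group (free_mod S X)"
  proof (rule abelian_groupI)
    fix f assume f: "f \<in> carrier (free_mod S X)"
    then have "(\<lambda>x. \<ominus> f x \<oplus> f x) = (\<lambda>_. \<zero>)" by (auto simp: free_mod_carrier l_neg)
    with neg[OF f] show "\<exists>g\<in>carrier (free_mod S X). g \<oplus>\<^bsub>free_mod S X\<^esub> f = \<zero>\<^bsub>free_mod S X\<^esub>"
      by (intro bexI[of _ "\<lambda>x. \<ominus> f x"]) auto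
  next
    fix f g assume "f \<in> carrier (free_mod S X)" "g \<in> carrier (free_mod S X)"
    then show "f \<oplus>\<^bsub>free_mod S X\<^esub> g \<in> carrier (free_mod S X)" by (simp add: add)
  qed (auto simp: a_ac free_mod_carrier fun_eq_iff)
  show ?thesis
  proof (intro left_module.intro left_module_axioms.intro ring_axioms ab)
    fix a f assume "a \<in> carrier S" "f \<in> carrier (free_mod S X)"
    then show "a \<odot>\<^bsub>free_mod S X\<^esub> f \<in> carrier (free_mod S X)" by (simp add: mul)
  qed (auto simp: l_distr r_distr m_assoc free_mod_carrier fun_eq_iff)
qed

lemma basis_vec_carrier: "\<lbrakk>ring S; x \<in> X\<rbrakk> \<Longrightarrow> basis_vec S x \<in> carrier (free_mod S X)"
proof -
  assume "ring S" "x \<in> X"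
  then interpret ring S by simp
  show ?thesis using \<open>x \<in> X\<close>
    by (auto simp: free_mod_carrier basis_vec_def intro: finite_subset[of _ "{x}"])
qed

text \<open>Induction on the size of the support: resetting one value to zero splits off one
  multiple of a basis vector.\<close>

lemma free_mod_induct [consumes 2, case_names zero add]:
  fixes S (structure)
  assumes "ring S" and f: "f \<in> carrier (free_mod S X)" and zero: "P (\<lambda>_. \<zero>\<^bsub>S\<^esub>)"
    and step: "\<And>g x a. \<lbrakk>g \<in> carrier (free_mod S X); P g; x \<in> X; a \<in> carrier S\<rbrakk> \<Longrightarrow>
      P (g \<oplus>\<^bsub>free_mod S X\<^esub> a \<odot>\<^bsub>free_mod S X\<^esub> basis_vec S x)"
  shows "P f"
proof -
  interpret ring S by fact
  have "finite F \<Longrightarrow> f \<in> carrier (free_mod S X) \<Longrightarrow> {x. f x \<noteq> \<zero>} = F \<Longrightarrow> P f" for F f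
  proof (induction F arbitrary: f rule: finite_induct)
    case empty
    then have "f = (\<lambda>_. \<zero>)" by auto
    then show ?case using zero by simp
  next
    case (insert y F)
    define g where "g = f(y := \<zero>)"
    have g: "{x. g x \<noteq> \<zero>} = F" using insert by (auto simp: g_def)
    then have gc: "g \<in> carrier (free_mod S X)" using insert by (auto simp: free_mod_carrier g_def)
    have y: "y \<in> X" "f y \<in> carrier S" using insert.prems by (auto simp: free_mod_carrier)
    have "f = g \<oplus>\<^bsub>free_mod S X\<^esub> f y \<odot>\<^bsub>free_mod S X\<^esub> basis_vec S y"
      using insert.prems(1) by (auto simp: fun_eq_iff g_def basis_vec_def free_mod_carrier)
    then show ?case using step[OF gc insert.IH[OF gc g] y] by simp
  qed
  then show ?thesis using f by (auto simp: free_mod_carrier)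
qed

lemma free_hom_eq:
  assumes "left_module S N" "f \<in> mod_hom S (free_mod S X) N" "g \<in> mod_hom S (free_mod S X) N"
    and "\<And>x. x \<in> X \<Longrightarrow> f (basis_vec S x) = g (basis_vec S x)" and "v \<in> carrier (free_mod S X)"
  shows "f v = g v"
proof -
  interpret N: left_module S N by fact
  interpret F: left_module S "free_mod S X" by (rule left_module_free) unfold_locales
  note ops = left_module_op_group[OF F.left_module_axioms] left_module_op_group[OF N.left_module_axioms]
  interpret f: op_hom S "free_mod S X" N f by (intro op_homI ops assms)
  interpret g: op_hom S "free_mod S X" N g by (intro op_homI ops assms)
  have bv: "basis_vec S x \<in> carrier (free_mod S X)" if "x \<in> X" for x
    using basis_vec_carrier[OF N.ring_axioms that] .
  show ?thesis
    using N.ring_axioms assms(5)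
  proof (induction rule: free_mod_induct)
    case zero
    show ?case using f.zero g.zero by simp
  next
    case (add h x a)
    then show ?case using bv[of x] assms(4)[of x] 
      by (simp del: free_mod_simps add: F.smult_closed)
  qed
qed

context left_module begin

lemma lin_comb_eq:
  assumes "finite F" "\<And>x. f x \<in> carrier R" "{x. f x \<noteq> \<zero>} \<subseteq> F" "\<And>x. x \<in> F \<Longrightarrow> \<phi> x \<in> carrier M"
  shows "lin_comb R M \<phi> f = finsum M (\<lambda>x. f x \<odot>\<^bsub>M\<^esub> \<phi> x) F"
  unfolding lin_comb_def
  using assms by (intro M.add.finprod_mono_neutral_cong_left) (auto intro!: smult_closed)

lemma lin_comb_hom:
  assumes "\<And>x. x \<in> X \<Longrightarrow> \<phi> x \<in> carrier M"
  shows "lin_comb R M \<phi> \<in> mod_hom R (free_mod R X) M"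
proof (rule mod_homI)
  fix f assume f: "f \<in> carrier (free_mod R X)"
  then have sub: "{x. f x \<noteq> \<zero>} \<subseteq> X" and fin: "finite {x. f x \<noteq> \<zero>}" and cl: "\<And>x. f x \<in> carrier R"
    by (auto simp: free_mod_carrier)
  show "lin_comb R M \<phi> f \<in> carrier M"
    unfolding lin_comb_def using sub cl assms by (intro M.finsum_closed) (auto intro!: smult_closed)
  {
    fix g assume g: "g \<in> carrier (free_mod R X)"
    then have sub': "{x. g x \<noteq> \<zero>} \<subseteq> X" and fin': "finite {x. g x \<noteq> \<zero>}" and cl': "\<And>x. g x \<in> carrier R"
      by (auto simp: free_mod_carrier)
    \<comment> \<open>Two functions and their sum may have different supports;
      \<open>lin_comb_eq\<close> lets all three sums run over one finite set.\<close>
    let ?F = "{x. f x \<noteq> \<zero>} \<union> {x. g x \<noteq> \<zero>}"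
    have \<phi>: "\<phi> x \<in> carrier M" if "x \<in> ?F" for x using assms sub sub' that by auto
    have "lin_comb R M \<phi> (\<lambda>x. f x \<oplus> g x) = finsum M (\<lambda>x. (f x \<oplus> g x) \<odot>\<^bsub>M\<^esub> \<phi> x) ?F"
      using fin fin' cl cl' \<phi> by (intro lin_comb_eq) auto
    also have "\<dots> = finsum M (\<lambda>x. f x \<odot>\<^bsub>M\<^esub> \<phi> x \<oplus>\<^bsub>M\<^esub> g x \<odot>\<^bsub>M\<^esub> \<phi> x) ?F"
      using cl cl' \<phi> by (intro M.finsum_cong') (simp_all add: smult_closed smult_l_distr Pi_def)
    also have "\<dots> = finsum M (\<lambda>x. f x \<odot>\<^bsub>M\<^esub> \<phi> x) ?F \<oplus>\<^bsub>M\<^esub> finsum M (\<lambda>x. g x \<odot>\<^bsub>M\<^esub> \<phi> x) ?F"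
      using cl cl' \<phi> by (intro M.finsum_addf) (simp_all add: smult_closed Pi_def)
    also have "\<dots> = lin_comb R M \<phi> f \<oplus>\<^bsub>M\<^esub> lin_comb R M \<phi> g"
      using lin_comb_eq[of ?F f \<phi>] lin_comb_eq[of ?F g \<phi>] fin fin' cl cl' \<phi> by auto
    finally show "lin_comb R M \<phi> (f \<oplus>\<^bsub>free_mod R X\<^esub> g) = lin_comb R M \<phi> f \<oplus>\<^bsub>M\<^esub> lin_comb R M \<phi> g" by simp
  }
  fix a assume a: "a \<in> carrier R"
  let ?F = "{x. f x \<noteq> \<zero>}"
  have \<phi>: "\<phi> x \<in> carrier M" if "x \<in> ?F" for x using assms sub that by auto
  have "lin_comb R M \<phi> (\<lambda>x. a \<otimes> f x) = finsum M (\<lambda>x. (a \<otimes> f x) \<odot>\<^bsub>M\<^esub> \<phi> x) ?F"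
    using fin cl \<phi> a by (intro lin_comb_eq) auto
  also have "\<dots> = finsum M (\<lambda>x. a \<odot>\<^bsub>M\<^esub> (f x \<odot>\<^bsub>M\<^esub> \<phi> x)) ?F"
  proof (rule M.finsum_cong')
    show "(\<lambda>x. a \<odot>\<^bsub>M\<^esub> (f x \<odot>\<^bsub>M\<^esub> \<phi> x)) \<in> ?F \<rightarrow> carrier M"
      using cl \<phi> a by (auto intro: smult_closed)
    show "(a \<otimes> f x) \<odot>\<^bsub>M\<^esub> \<phi> x = a \<odot>\<^bsub>M\<^esub> (f x \<odot>\<^bsub>M\<^esub> \<phi> x)" if "x \<in> ?F" for x
      using smult_assoc[OF a cl \<phi>[OF that]] .
  qed simp
  also have "\<dots> = a \<odot>\<^bsub>M\<^esub> finsum M (\<lambda>x. f x \<odot>\<^bsub>M\<^esub> \<phi> x) ?F"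
    using fin \<phi>
  proof (induction rule: finite_induct)
    case empty
    show ?case using a by simp
  next
    case (insert x F)
    then show ?case using cl a
      by (simp add: M.finsum_insert Pi_def smult_closed M.finsum_closed smult_r_distr)
  qed
  finally show "lin_comb R M \<phi> (a \<odot>\<^bsub>free_mod R X\<^esub> f) = a \<odot>\<^bsub>M\<^esub> lin_comb R M \<phi> f"
    by (simp add: lin_comb_def)
qed

lemma lin_comb_basis:
  assumes "\<phi> x \<in> carrier M"
  shows "lin_comb R M \<phi> (basis_vec R x) = \<phi> x"
proof -
  have "lin_comb R M \<phi> (basis_vec R x) = finsum M (\<lambda>y. basis_vec R x y \<odot>\<^bsub>M\<^esub> \<phi> y) {x}"
    using assms by (intro lin_comb_eq) (auto simp: basis_vec_def)
  then show ?thesis using assms by (simp add: M.finsum_insert basis_vec_def smult_one)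
qed

end

lemma free_lift:
  assumes A: "left_module S A" and B: "left_module S B" and p: "p \<in> mod_hom S A B"
    and f: "f \<in> mod_hom S (free_mod S X) B" and sub: "\<And>x. x \<in> X \<Longrightarrow> f (basis_vec S x) \<in> p ` carrier A"
  shows "\<exists>h\<in>mod_hom S (free_mod S X) A. \<forall>v\<in>carrier (free_mod S X). p (h v) = f v"
proof -
  interpret A: left_module S A by fact
  from sub have "\<exists>a. \<forall>x\<in>X. a x \<in> carrier A \<and> p (a x) = f (basis_vec S x)"
    by (intro bchoice) (fastforce simp: image_iff)
  then obtain a where a: "\<And>x. x \<in> X \<Longrightarrow> a x \<in> carrier A" "\<And>x. x \<in> X \<Longrightarrow> p (a x) = f (basis_vec S x)" by blast
  have hom: "lin_comb S A a \<in> mod_hom S (free_mod S X) A" using a by (intro A.lin_comb_hom)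
  moreover have "p (lin_comb S A a v) = f v" if "v \<in> carrier (free_mod S X)" for v
    by (rule free_hom_eq[OF B mod_hom_comp[OF hom p] f _ that]) (simp add: A.lin_comb_basis a)
  ultimately show ?thesis by blast
qed

lemma projective_free:
  assumes "ring S"
  shows "projective_module S (free_mod S X)"
  unfolding projective_module_def
proof (intro conjI allI impI)
  show "left_module S (free_mod S X)" by (rule left_module_free) fact
  fix A B :: "('a, ('b \<Rightarrow> 'a) \<Rightarrow> 'a) module" and p f
  assume *: "left_module S A \<and> left_module S B \<and> p \<in> mod_hom S A B \<and>
    p ` carrier A = carrier B \<and> f \<in> mod_hom S (free_mod S X) B"
  then have "f (basis_vec S x) \<in> p ` carrier A" if "x \<in> X" for x
    using mod_hom_closed basis_vec_carrier[OF assms that] by metis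
  then show "\<exists>h\<in>mod_hom S (free_mod S X) A. \<forall>x\<in>carrier (free_mod S X). p (h x) = f x"
    using * by (intro free_lift[of S A B]) auto
qed

section \<open>Projective modules as retracts of free modules\<close>

text \<open>Test modules for projectivity and injectivity must have carriers in a prescribed type.
  Copying the structure along an injection brings a given module into that type.\<close>

definition transport :: "('a \<Rightarrow> 'b) \<Rightarrow> ('r, 'a) module \<Rightarrow> ('r, 'b) module" where
  "transport j M = \<lparr>carrier = j ` carrier M, monoid.mult = undefined, monoid.one = undefined,
     ring.zero = j \<zero>\<^bsub>M\<^esub>, ring.add = (\<lambda>u v. j (inv_into (carrier M) j u \<oplus>\<^bsub>M\<^esub> inv_into (carrier M) j v)),
     smult = (\<lambda>a u. j (a \<odot>\<^bsub>M\<^esub> inv_into (carrier M) j u))\<rparr>"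

lemma transport:
  assumes "left_module R M" "inj_on j (carrier M)"
  shows "left_module R (transport j M)" "j \<in> mod_hom R M (transport j M)"
    "inv_into (carrier M) j \<in> mod_hom R (transport j M) M"
proof -
  interpret left_module R M by fact
  have neg: "\<exists>y\<in>carrier M. j (x \<oplus>\<^bsub>M\<^esub> y) = j \<zero>\<^bsub>M\<^esub>" if "x \<in> carrier M" for x
    using that M.r_neg[of x] by (intro bexI[of _ "\<ominus>\<^bsub>M\<^esub> x"]) auto
  note [simp] = inv_into_f_f[OF assms(2)]
  have "abelian_group (transport j M)"
    by (rule abelian_groupI) (auto simp: transport_def M.a_ac neg)
  then show "left_module R (transport j M)"
    by (intro left_module.intro left_module_axioms.intro R.ring_axioms)
      (auto simp: transport_def smult_closed smult_l_distr smult_r_distr smult_assoc smult_one)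
  show "j \<in> mod_hom R M (transport j M)" "inv_into (carrier M) j \<in> mod_hom R (transport j M) M"
    by (auto intro!: mod_homI simp: transport_def smult_closed)
qed

text \<open>The free module on the elements of \<open>M\<close> maps onto \<open>M\<close>, and
  projectivity splits this map. The target has to lie in the type
  \<open>'m \<Rightarrow> 'r\<close>, so \<open>M\<close> is replaced by its copy under
  \<open>basis_vec\<close>.\<close>

lemma projective_dual_basis:
  fixes M :: "('r, 'm) module"
  assumes "projective_module S M"
  shows "\<exists>s\<in>mod_hom S M (free_mod S (carrier M)). \<forall>x\<in>carrier M. lin_comb S M (\<lambda>m. m) (s x) = x"
proof -
  interpret M: left_module S M using assms by (simp add: projective_module_def)
  let ?F = "free_mod S (carrier M)" and ?e = "basis_vec S :: 'm \<Rightarrow> _"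
  have F: "left_module S ?F" by (rule left_module_free) unfold_locales
  have l: "lin_comb S M (\<lambda>m. m) \<in> mod_hom S ?F M" by (rule M.lin_comb_hom)
  show ?thesis
  proof (cases "\<one>\<^bsub>S\<^esub> = \<zero>\<^bsub>S\<^esub>")
    \<comment> \<open>Over the zero ring basis vectors do not separate points; but then every module
      is trivial and the zero map is a section.\<close>
    case True
    have triv: "x = \<zero>\<^bsub>M\<^esub>" if "x \<in> carrier M" for x
      using M.smult_one[OF that] M.smult_zero_left[OF that] True by simp
    have "(\<lambda>x. \<zero>\<^bsub>?F\<^esub>) \<in> mod_hom S M ?F" by (rule mod_hom_zero_fun[OF left_module_op_group[OF F]])
    moreover have "lin_comb S M (\<lambda>m. m) \<zero>\<^bsub>?F\<^esub> = x" if "x \<in> carrier M" for x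
      using triv[OF that] by (simp add: lin_comb_def)
    ultimately show ?thesis by (intro bexI[of _ "\<lambda>x. \<zero>\<^bsub>?F\<^esub>"]) auto
  next
    case False
    then have inj: "inj_on ?e (carrier M)"
      by (auto simp: inj_on_def basis_vec_def fun_eq_iff split: if_splits)
    note tr = transport[OF M.left_module_axioms inj]
    have p: "(\<lambda>x. ?e (lin_comb S M (\<lambda>m. m) x)) \<in> mod_hom S ?F (transport ?e M)"
      by (rule mod_hom_comp[OF l tr(2)])
    have "(\<lambda>x. ?e (lin_comb S M (\<lambda>m. m) x)) ` carrier ?F = carrier (transport ?e M)"
    proof
      show "carrier (transport ?e M) \<subseteq> (\<lambda>x. ?e (lin_comb S M (\<lambda>m. m) x)) ` carrier ?F"
        using M.lin_comb_basis[of "\<lambda>m. m"] basis_vec_carrier[OF M.ring_axioms, of _ "carrier M"]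
        by (force simp: transport_def image_iff)
    qed (use mod_hom_closed[OF p] in auto)
    then have "\<exists>h\<in>mod_hom S M ?F. \<forall>x\<in>carrier M. ?e (lin_comb S M (\<lambda>m. m) (h x)) = ?e x"
      by (rule projective_moduleD[OF assms F tr(1) p _ tr(2)])
    then obtain h where h: "h \<in> mod_hom S M ?F" 
      "\<forall>x\<in>carrier M. ?e (lin_comb S M (\<lambda>m. m) (h x)) = ?e x" by blast
    have "lin_comb S M (\<lambda>m. m) (h x) = x" if "x \<in> carrier M" for x
      using h(2) inj mod_hom_closed[OF l mod_hom_closed[OF h(1)]] that by (auto simp: inj_on_def)
    then show ?thesis using h(1) by blast
  qed
qed

text \<open>A lift over the free module on \<open>M\<close> is composed with the section of
  \<open>projective_dual_basis\<close>. This frees the lifting property from the type of the test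
  modules and gives it in the form used below, where the image of \<open>p\<close> contains that of
  \<open>f\<close>.\<close>

lemma projective_lift:
  assumes M: "projective_module S M" and A: "left_module S A" and B: "left_module S B"
    and p: "p \<in> mod_hom S A B" and f: "f \<in> mod_hom S M B" and sub: "f ` carrier M \<subseteq> p ` carrier A"
  shows "\<exists>h\<in>mod_hom S M A. \<forall>x\<in>carrier M. p (h x) = f x"
proof -
  interpret M: left_module S M using M by (simp add: projective_module_def)
  let ?F = "free_mod S (carrier M)"
  obtain s where s: "s \<in> mod_hom S M ?F" "\<And>x. x \<in> carrier M \<Longrightarrow> lin_comb S M (\<lambda>m. m) (s x) = x"
    using projective_dual_basis[OF M] by blast
  have g: "(\<lambda>x. f (lin_comb S M (\<lambda>m. m) x)) \<in> mod_hom S ?F B"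
    by (rule mod_hom_comp[OF M.lin_comb_hom f])
  have "f (lin_comb S M (\<lambda>m. m) (basis_vec S x)) \<in> p ` carrier A" if "x \<in> carrier M" for x
    using M.lin_comb_basis[of "\<lambda>m. m" x] sub that by auto
  then obtain h where h: "h \<in> mod_hom S ?F A" "\<forall>v\<in>carrier ?F. p (h v) = f (lin_comb S M (\<lambda>m. m) v)"
    using free_lift[OF A B p g] by blast
  show ?thesis
    using h(2) mod_hom_closed[OF s(1)] s(2) by (intro bexI[OF _ mod_hom_comp[OF s(1) h(1)]]) auto
qed

section \<open>Noetherian rings\<close>

lemma (in op_hom) image_submodule:
  assumes "submodule H K M"
  shows "submodule (f ` H) K N"
proof -
  note H = M.submoduleE[OF assms]
  show ?thesis
  proof (rule N.submoduleI)
    show "f ` H \<subseteq> carrier N" using H(1) by auto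
    show "\<zero>\<^bsub>N\<^esub> \<in> f ` H" using H(2) zero by force
    fix x assume "x \<in> f ` H"
    then obtain u where u: "u \<in> H" "x = f u" "u \<in> carrier M" using H(1) by auto
    have "x = f u" "\<ominus>\<^bsub>N\<^esub> x = f (\<ominus>\<^bsub>M\<^esub> u)" using u by auto
    then show "\<ominus>\<^bsub>N\<^esub> x \<in> f ` H" using H(4) u by blast
    show "a \<odot>\<^bsub>N\<^esub> x \<in> f ` H" if "a \<in> carrier K" for a
    proof -
      have "a \<odot>\<^bsub>N\<^esub> x = f (a \<odot>\<^bsub>M\<^esub> u)" using u that by auto
      then show ?thesis using H(6)[OF that] u by blast
    qed
    fix y assume "y \<in> f ` H"
    then obtain v where v: "v \<in> H" "y = f v" "v \<in> carrier M" using H(1) by auto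
    have "x \<oplus>\<^bsub>N\<^esub> y = f (u \<oplus>\<^bsub>M\<^esub> v)" using u v by auto
    then show "x \<oplus>\<^bsub>N\<^esub> y \<in> f ` H" using H(3) u v by blast
  qed
qed

lemma (in op_group) carrier_submodule: "submodule (carrier M) K M"
  by (intro submoduleI) auto

lemma (in op_hom) preimage_submodule:
  assumes "submodule L K N"
  shows "submodule {x \<in> carrier M. f x \<in> L} K M"
  using N.submoduleE[OF assms] by (intro M.submoduleI) auto

lemma (in op_group) zero_submodule: "submodule {\<zero>} K M"
  by (intro submoduleI) auto

lemma (in op_hom) kernel_submodule: "submodule {x \<in> carrier M. f x = \<zero>\<^bsub>N\<^esub>} K M"
  using preimage_submodule[OF N.zero_submodule] by simp

text \<open>Closure under negatives comes for free from multiplication by the negative of 1.\<close>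

lemma (in left_module) submoduleI_smult:
  assumes "H \<subseteq> carrier M" "\<zero>\<^bsub>M\<^esub> \<in> H" "\<And>x y. \<lbrakk>x \<in> H; y \<in> H\<rbrakk> \<Longrightarrow> x \<oplus>\<^bsub>M\<^esub> y \<in> H"
    and "\<And>a x. \<lbrakk>a \<in> carrier R; x \<in> H\<rbrakk> \<Longrightarrow> a \<odot>\<^bsub>M\<^esub> x \<in> H"
  shows "submodule H R M"
proof (rule M.submoduleI[OF assms(1-3)])
  fix x assume "x \<in> H"
  then show "\<ominus>\<^bsub>M\<^esub> x \<in> H" using assms(1) assms(4)[of "\<ominus> \<one>" x] smult_minus_left[of \<one> x] smult_one[of x] by auto
qed (use assms in auto)

lemma (in left_module) restrict_left_module:
  assumes "submodule H R M"
  shows "left_module R (M\<lparr>carrier := H\<rparr>)"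
proof -
  interpret H: op_group R "M\<lparr>carrier := H\<rparr>" by (rule M.restrict_op_group[OF assms])
  note sH = M.submoduleE[OF assms]
  show ?thesis
    using sH by (intro left_module.intro left_module_axioms.intro R.ring_axioms H.abelian_group_axioms)
      (auto simp: smult_l_distr smult_r_distr smult_assoc smult_one subset_iff)
qed

abbreviation FM :: "'r ring \<Rightarrow> nat \<Rightarrow> ('r, nat \<Rightarrow> 'r) module" where
  "FM S b \<equiv> free_mod S {..<b}"

lemma FM_carrier: "f \<in> carrier (FM S b) \<longleftrightarrow> (\<forall>i. f i \<in> carrier S) \<and> (\<forall>i. \<not> i < b \<longrightarrow> f i = \<zero>\<^bsub>S\<^esub>)"
  by (simp add: free_mod_finite_carrier)

lemma regular_simps [simp]: "carrier (regular_module S) = carrier S" "\<zero>\<^bsub>regular_module S\<^esub> = \<zero>\<^bsub>S\<^esub>"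
  "\<one>\<^bsub>regular_module S\<^esub> = \<one>\<^bsub>S\<^esub>"
  "x \<oplus>\<^bsub>regular_module S\<^esub> y = x \<oplus>\<^bsub>S\<^esub> y" "x \<odot>\<^bsub>regular_module S\<^esub> y = x \<otimes>\<^bsub>S\<^esub> y"
  "add (regular_module S) = add S" "smult (regular_module S) = mult S"
  by (simp_all add: regular_module_def)

lemma coordinate_hom: "(\<lambda>f. f x) \<in> mod_hom S (free_mod S X) (regular_module S)"
  by (rule mod_homI) (auto simp: free_mod_carrier)

lemma fin_genE:
  assumes "fin_gen S N H"
  obtains A where "finite A" "A \<subseteq> H" "\<forall>K. submodule K S N \<longrightarrow> A \<subseteq> K \<longrightarrow> H \<subseteq> K"
proof -
  from assms obtain A where "finite A \<and> A \<subseteq> H \<and> (\<forall>K. submodule K S N \<and> A \<subseteq> K \<longrightarrow> H \<subseteq> K)"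
    unfolding fin_gen_def by (elim exE)
  then show ?thesis by (intro that[of A]) simp_all
qed

text \<open>\<open>fin_gen\<close> describes generation through the submodules that contain
  \<open>A\<close>. The image of the free module is one of them, hence contains \<open>H\<close>;
  the converse inclusion is an induction over linear combinations.\<close>

lemma fin_gen_image:
  assumes N: "left_module S N" and H: "submodule H S N" and fg: "fin_gen S N H"
  shows "\<exists>a. \<exists>f\<in>mod_hom S (FM S a) N. f ` carrier (FM S a) = H"
proof -
  interpret N: left_module S N by fact
  note sH = N.M.submoduleE[OF H]
  obtain A where A: "finite A" "A \<subseteq> H" "\<forall>K. submodule K S N \<longrightarrow> A \<subseteq> K \<longrightarrow> H \<subseteq> K"
    by (rule fin_genE[OF fg])
  obtain \<phi> where \<phi>: "bij_betw \<phi> {0..<card A} A" using ex_bij_betw_nat_finite[OF A(1)] by blast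
  let ?F = "FM S (card A)"
  have \<phi>A: "\<phi> i \<in> A" if "i \<in> {..<card A}" for i
    using \<phi> that by (auto simp: bij_betw_def)
  have \<phi>H: "\<phi> i \<in> H" "\<phi> i \<in> carrier N" if "i \<in> {..<card A}" for i
    using \<phi>A[OF that] A(2) sH(1) by auto
  interpret F: left_module S ?F by (rule left_module_free) unfold_locales
  interpret f: op_hom S ?F N "lin_comb S N \<phi>"
    using \<phi>H by (intro op_homI N.lin_comb_hom F.M.op_group_axioms N.M.op_group_axioms) auto
  have sub: "submodule (lin_comb S N \<phi> ` carrier ?F) S N"
    by (intro f.image_submodule F.M.carrier_submodule)
  have "A \<subseteq> lin_comb S N \<phi> ` carrier ?F"
  proof
    fix x assume "x \<in> A"
    then obtain i where i: "i \<in> {..<card A}" "x = \<phi> i" using \<phi> unfolding bij_betw_def by fastforce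
    then show "x \<in> lin_comb S N \<phi> ` carrier ?F"
      using N.lin_comb_basis[of \<phi> i] \<phi>H basis_vec_carrier[OF N.ring_axioms i(1)] by (metis imageI)
  qed
  then have "H \<subseteq> lin_comb S N \<phi> ` carrier ?F" using A(3) sub by blast
  moreover have "lin_comb S N \<phi> v \<in> H" if "v \<in> carrier ?F" for v
    using N.ring_axioms that
  proof (induction rule: free_mod_induct)
    case zero
    show ?case using sH(2) f.zero by simp
  next
    case (add g x a)
    then show ?case
      using sH(3,6) \<phi>H[of x] N.lin_comb_basis[of \<phi> x] basis_vec_carrier[OF N.ring_axioms add.hyps(2)]
      by (simp del: free_mod_simps add: F.smult_closed)
  qed
  ultimately show ?thesis using f.hom by blast
qed

text \<open>Induction on the rank. The last coordinates of elements of \<open>H\<close> form a left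
  ideal, and the elements with last coordinate zero form a submodule of the free module of rank
  \<open>b\<close>. Lifts of generators of the ideal, together with generators of that submodule,
  generate \<open>H\<close>.\<close>

lemma fin_gen_FM:
  assumes S: "ring S" "left_noetherian S"
  shows "submodule H S (FM S b) \<Longrightarrow> fin_gen S (FM S b) H"
proof (induction b arbitrary: H)
  case 0
  interpret F: left_module S "FM S 0" by (rule left_module_free) fact
  have "f = (\<lambda>_. \<zero>\<^bsub>S\<^esub>)" if "f \<in> H" for f
    using F.M.submoduleE(1)[OF 0] that by (intro ext) (auto simp: free_mod_carrier)
  then have "H \<subseteq> {\<zero>\<^bsub>FM S 0\<^esub>}" by auto
  then show ?case using F.M.submoduleE(2) unfolding fin_gen_def by (intro exI[of _ "{}"]) auto
next
  case (Suc b)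
  interpret F: left_module S "FM S (Suc b)" by (rule left_module_free) fact
  interpret F0: left_module S "FM S b" by (rule left_module_free) fact
  interpret R: left_module S "regular_module S" by (rule left_module_regular) fact
  note sH = F.M.submoduleE[OF Suc.prems]
  interpret p: op_hom S "FM S (Suc b)" "regular_module S" "\<lambda>h. h b"
    by (intro op_homI coordinate_hom F.M.op_group_axioms R.M.op_group_axioms)
  have low: "submodule {h \<in> K. h b = \<zero>\<^bsub>S\<^esub>} S (FM S b)" if K: "submodule K S (FM S (Suc b))" for K
  proof -
    note sK = F.M.submoduleE[OF K]
    have cK: "\<And>h i. h \<in> K \<Longrightarrow> h i \<in> carrier S" and zK: "\<And>h i. h \<in> K \<Longrightarrow> i > b \<Longrightarrow> h i = \<zero>\<^bsub>S\<^esub>"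
      using sK(1) by (auto simp: FM_carrier subset_iff)
    show ?thesis
    proof (rule F0.submoduleI_smult)
      show "{h \<in> K. h b = \<zero>\<^bsub>S\<^esub>} \<subseteq> carrier (FM S b)"
        using cK zK by (auto simp: FM_carrier) (metis linorder_neqE_nat)
    qed (use sK(2,3,6) in auto)
  qed
  have reg: "submodule ((\<lambda>h. h b) ` K) S (regular_module S)" if K: "submodule K S (FM S (Suc b))" for K
    by (rule p.image_submodule[OF K])
  obtain A1 where A1: "finite A1" "A1 \<subseteq> (\<lambda>h. h b) ` H"
     "\<forall>K. submodule K S (regular_module S) \<longrightarrow> A1 \<subseteq> K \<longrightarrow> (\<lambda>h. h b) ` H \<subseteq> K"
    by (rule fin_genE[OF S(2)[unfolded left_noetherian_def, rule_format, OF reg[OF Suc.prems]]])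
  obtain A0 where A0: "finite A0" "A0 \<subseteq> {h \<in> H. h b = \<zero>\<^bsub>S\<^esub>}"
     "\<forall>K. submodule K S (FM S b) \<longrightarrow> A0 \<subseteq> K \<longrightarrow> {h \<in> H. h b = \<zero>\<^bsub>S\<^esub>} \<subseteq> K"
    by (rule fin_genE[OF Suc.IH[OF low[OF Suc.prems]]])
  have "\<forall>x\<in>A1. \<exists>h. h \<in> H \<and> h b = x" using A1(2) by auto
  then obtain r where r: "\<forall>x\<in>A1. r x \<in> H \<and> r x b = x" by (rule bchoice[THEN exE])
  show ?case unfolding fin_gen_def
  proof (intro exI[of _ "r ` A1 \<union> A0"] conjI allI impI)
    show "finite (r ` A1 \<union> A0)" "r ` A1 \<union> A0 \<subseteq> H" using A1(1) A0(1,2) r by auto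
    fix K assume K: "submodule K S (FM S (Suc b)) \<and> r ` A1 \<union> A0 \<subseteq> K"
    note sK = F.M.submoduleE[OF conjunct1[OF K]]
    \<comment> \<open>With \<open>K \<inter> H\<close> in place of \<open>K\<close>, the element
      that matches the last coordinate of \<open>h\<close> lies in \<open>H\<close>. So does its
      difference to \<open>h\<close>, which is then caught by the generators
      \<open>A0\<close>.\<close>
    have KH: "submodule (K \<inter> H) S (FM S (Suc b))"
    proof (rule F.submoduleI_smult)
      show "K \<inter> H \<subseteq> carrier (FM S (Suc b))" using sH(1) by auto
    qed (use sK(2,3,6) sH(2,3,6) in auto)
    have "A1 \<subseteq> (\<lambda>h. h b) ` (K \<inter> H)"
    proof
      fix x assume "x \<in> A1"
      then have "r x \<in> K \<inter> H" "x = r x b" using K r by auto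
      then show "x \<in> (\<lambda>h. h b) ` (K \<inter> H)" by blast
    qed
    then have 1: "(\<lambda>h. h b) ` H \<subseteq> (\<lambda>h. h b) ` (K \<inter> H)" using A1(3) reg[OF KH] by simp
    have "A0 \<subseteq> {h \<in> K. h b = \<zero>\<^bsub>S\<^esub>}" using K A0(2) by auto
    then have 2: "{h \<in> H. h b = \<zero>\<^bsub>S\<^esub>} \<subseteq> K" using A0(3) low[OF conjunct1[OF K]] by auto
    show "H \<subseteq> K"
    proof
      fix h assume h: "h \<in> H"
      then obtain k where k: "k \<in> K" "k \<in> H" "h b = k b" using 1 by auto
      have hk: "h \<in> carrier (FM S (Suc b))" "k \<in> carrier (FM S (Suc b))" using h k sH(1) by auto
      have "(h \<ominus>\<^bsub>FM S (Suc b)\<^esub> k) b = \<zero>\<^bsub>S\<^esub>"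
        using p.diff[OF hk] k(3) R.M.r_neg[OF p.closed[OF hk(2)]] by (simp add: R.M.minus_eq)
      then have "h \<ominus>\<^bsub>FM S (Suc b)\<^esub> k \<in> K" using 2 sH(5)[OF h k(2)] by blast
      then have "(h \<ominus>\<^bsub>FM S (Suc b)\<^esub> k) \<oplus>\<^bsub>FM S (Suc b)\<^esub> k \<in> K" using sK(3) k by blast
      moreover have "(h \<ominus>\<^bsub>FM S (Suc b)\<^esub> k) \<oplus>\<^bsub>FM S (Suc b)\<^esub> k = h"
        using hk by (simp del: free_mod_simps add: F.M.ag)
      ultimately show "h \<in> K" by simp
    qed
  qed
qed

text \<open>The form in which the noetherian hypothesis is used: kernels of maps out of finite free
  modules, and modules of rows that annihilate a matrix, are images of finite free modules.\<close>

lemma noetherian_image: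
  assumes "ring S" "left_noetherian S" "submodule H S (FM S b)"
  shows "\<exists>a. \<exists>f\<in>mod_hom S (FM S a) (FM S b). f ` carrier (FM S a) = H"
  using fin_gen_image[OF left_module_free[OF assms(1)] assms(3) fin_gen_FM[OF assms]] .

section \<open>Row and column vectors\<close>

lemma opp_simps [simp]: "carrier (opp R) = carrier R" "\<zero>\<^bsub>opp R\<^esub> = \<zero>\<^bsub>R\<^esub>" "\<one>\<^bsub>opp R\<^esub> = \<one>\<^bsub>R\<^esub>"
  "x \<otimes>\<^bsub>opp R\<^esub> y = y \<otimes>\<^bsub>R\<^esub> x" "add (opp R) = add R" "opp (opp R) = R"
  "finsum (opp R) = finsum R"
  by (simp_all add: opp_def finsum_def)

lemma free_mod_opp_carrier [simp]: "carrier (free_mod (opp R) X) = carrier (free_mod R X)"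
  by (simp add: free_mod_def)

lemma basis_vec_opp [simp]: "basis_vec (opp R) = basis_vec R"
  by (simp add: basis_vec_def fun_eq_iff)

lemma ring_opp: "ring R \<Longrightarrow> ring (opp R)"
proof -
  assume "ring R"
  then interpret ring R .
  show ?thesis
    by (intro ringI abelian_groupI monoidI)
      (auto simp: a_ac m_assoc l_distr r_distr intro: bexI[of _ "\<ominus>\<^bsub>R\<^esub> x" for x] r_neg)
qed

text \<open>The pairing of rows with columns. It is \<open>R\<close>-linear in the row and
  \<open>opp R\<close>-linear in the column, so that rows are the functionals on the free right
  module of columns.\<close>

definition dotp :: "'r ring \<Rightarrow> nat \<Rightarrow> (nat \<Rightarrow> 'r) \<Rightarrow> (nat \<Rightarrow> 'r) \<Rightarrow> 'r" where
  "dotp R b \<phi> x = finsum R (\<lambda>i. \<phi> i \<otimes>\<^bsub>R\<^esub> x i) {..<b}"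

text \<open>Over the opposite ring rows and columns change places; statements about columns are
  those about rows for \<open>opp R\<close>.\<close>

lemma dotp_opp: "dotp (opp R) b \<phi> x = dotp R b x \<phi>"
  by (simp add: dotp_def)

lemma dotp_lin_comb:
  fixes R (structure)
  assumes "ring R" "\<phi> \<in> carrier (FM R b)" "\<And>i. i < b \<Longrightarrow> x i \<in> carrier R"
  shows "dotp R b \<phi> x = lin_comb R (regular_module R) x \<phi>"
proof -
  interpret L: left_module R "regular_module R" by (rule left_module_regular) fact
  have "finsum (regular_module R) g I = finsum R g I" for g :: "nat \<Rightarrow> 'a" and I
    by (simp add: finsum_def finprod_def)
  moreover have "{i. \<phi> i \<noteq> \<zero>} \<subseteq> {..<b}" using assms(2) by (auto simp: free_mod_carrier)
  ultimately show ?thesis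
    using assms(2,3) L.lin_comb_eq[of "{..<b}" \<phi> x] by (auto simp: dotp_def free_mod_carrier)
qed

lemma dotp_left_hom:
  assumes "ring R" "\<And>i. i < b \<Longrightarrow> x i \<in> carrier R"
  shows "(\<lambda>\<phi>. dotp R b \<phi> x) \<in> mod_hom R (FM R b) (regular_module R)"
proof -
  interpret L: left_module R "regular_module R" by (rule left_module_regular) fact
  interpret F: left_module R "FM R b" by (rule left_module_free) fact
  have l: "lin_comb R (regular_module R) x \<in> mod_hom R (FM R b) (regular_module R)"
    using assms(2) by (intro L.lin_comb_hom) auto
  note eq = dotp_lin_comb[where x = x, OF assms(1) _ assms(2)]
  show ?thesis
  proof (rule mod_homI)
    fix \<phi> assume \<phi>: "\<phi> \<in> carrier (FM R b)"
    show "dotp R b \<phi> x \<in> carrier (regular_module R)" using mod_hom_closed[OF l] eq \<phi> by simp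
    show "dotp R b (\<phi> \<oplus>\<^bsub>FM R b\<^esub> \<psi>) x = dotp R b \<phi> x \<oplus>\<^bsub>regular_module R\<^esub> dotp R b \<psi> x"
      if "\<psi> \<in> carrier (FM R b)" for \<psi>
      using mod_hom_add[OF l \<phi> that] eq[OF \<phi>] eq[OF that] eq[OF F.M.a_closed[OF \<phi> that]] by simp
    show "dotp R b (a \<odot>\<^bsub>FM R b\<^esub> \<phi>) x = a \<odot>\<^bsub>regular_module R\<^esub> dotp R b \<phi> x"
      if "a \<in> carrier R" for a
      using mod_hom_smult[OF l that \<phi>] eq[OF \<phi>] eq[OF F.smult_closed[OF that \<phi>]] by simp
  qed
qed

lemma dotp_right_hom:
  assumes "ring R" "\<And>i. i < b \<Longrightarrow> x i \<in> carrier R"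
  shows "dotp R b x \<in> mod_hom (opp R) (FM (opp R) b) (regular_module (opp R))"
  using dotp_left_hom[OF ring_opp, of R b x] assms by (simp add: dotp_opp)

lemma dotp_basis_left:
  assumes "ring R" "i < b" "\<And>i. i < b \<Longrightarrow> x i \<in> carrier R"
  shows "dotp R b (basis_vec R i) x = x i"
proof -
  interpret L: left_module R "regular_module R" by (rule left_module_regular) fact
  show ?thesis
    using L.lin_comb_basis[of x i] dotp_lin_comb[OF assms(1) basis_vec_carrier[OF assms(1)], of i b x] assms
    by simp
qed

lemma dotp_basis_right:
  assumes "ring R" "i < b" "\<And>i. i < b \<Longrightarrow> x i \<in> carrier R"
  shows "dotp R b x (basis_vec R i) = x i"
  using dotp_basis_left[OF ring_opp, of R i b x] assms by (simp add: dotp_opp)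

lemma tuple_hom:
  assumes "left_module S X" "finite F" "F \<subseteq> Y" "\<And>i. i \<in> F \<Longrightarrow> g i \<in> mod_hom S X (regular_module S)"
  shows "(\<lambda>x i. if i \<in> F then g i x else \<zero>\<^bsub>S\<^esub>) \<in> mod_hom S X (free_mod S Y)"
proof -
  interpret X: left_module S X by fact
  note g = mod_hom_closed[OF assms(4)] mod_hom_add[OF assms(4)] mod_hom_smult[OF assms(4)]
  show ?thesis
  proof (rule mod_homI)
    fix x assume "x \<in> carrier X"
    then show "(\<lambda>i. if i \<in> F then g i x else \<zero>\<^bsub>S\<^esub>) \<in> carrier (free_mod S Y)"
      using assms(2,3) g(1) by (auto simp: free_mod_carrier intro: finite_subset[of _ F])
  qed (auto simp: g)
qed

text \<open>The components of \<open>B\<close> are generators of the left module of row vectors that kill the image of \<open>A\<close>.\<close>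

lemma weak_cokernel:
  assumes R: "ring R" "left_noetherian R"
    and A: "A \<in> mod_hom (opp R) (FM (opp R) a) (FM (opp R) b)"
  shows "\<exists>c. \<exists>B\<in>mod_hom (opp R) (FM (opp R) b) (FM (opp R) c).
    (\<forall>x\<in>carrier (FM (opp R) a). B (A x) = \<zero>\<^bsub>FM (opp R) c\<^esub>) \<and>
    (\<forall>f\<in>mod_hom (opp R) (FM (opp R) b) (regular_module (opp R)).
      (\<forall>x\<in>carrier (FM (opp R) a). f (A x) = \<zero>\<^bsub>R\<^esub>) \<longrightarrow>
      (\<exists>g\<in>mod_hom (opp R) (FM (opp R) c) (regular_module (opp R)).
        \<forall>y\<in>carrier (FM (opp R) b). f y = g (B y)))"
proof -
  let ?S = "opp R"
  interpret ring R by fact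
  interpret Lb: left_module R "FM R b" by (rule left_module_free) fact
  interpret Lr: left_module R "regular_module R" by (rule left_module_regular) fact
  interpret Sb: left_module ?S "FM ?S b" by (rule left_module_free) (rule ring_opp, fact)
  interpret Sr: left_module ?S "regular_module ?S" by (rule left_module_regular) (rule ring_opp, fact)
  note Ac = mod_hom_closed[OF A]
  define K where "K = {\<phi> \<in> carrier (FM R b). \<forall>x\<in>carrier (FM ?S a). dotp R b \<phi> (A x) = \<zero>\<^bsub>R\<^esub>}"
  have dl: "op_hom R (FM R b) (regular_module R) (\<lambda>\<phi>. dotp R b \<phi> y)" if "y \<in> carrier (FM R b)" for y
    using that by (intro op_homI dotp_left_hom R Lb.M.op_group_axioms Lr.M.op_group_axioms)
      (auto simp: FM_carrier)
  have K: "submodule K R (FM R b)"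
  proof (rule Lb.submoduleI_smult)
    show "K \<subseteq> carrier (FM R b)" by (auto simp: K_def)
    show "\<zero>\<^bsub>FM R b\<^esub> \<in> K" using op_hom.zero[OF dl] Ac Lb.M.zero_closed by (simp add: K_def)
  next
    fix x y assume "x \<in> K" "y \<in> K"
    then show "x \<oplus>\<^bsub>FM R b\<^esub> y \<in> K"
      using op_hom.add[OF dl] Ac Lb.M.a_closed by (auto simp: K_def)
  next
    fix s x assume "s \<in> carrier R" "x \<in> K"
    then show "s \<odot>\<^bsub>FM R b\<^esub> x \<in> K"
      using op_hom.smult[OF dl] Ac Lb.smult_closed by (auto simp: K_def)
  qed
  obtain c \<psi> where \<psi>: "\<psi> \<in> mod_hom R (FM R c) (FM R b)" "\<psi> ` carrier (FM R c) = K"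
    using noetherian_image[OF R K] by blast
  interpret Lc: left_module R "FM R c" by (rule left_module_free) fact
  define B where "B = (\<lambda>y l. if l \<in> {..<c} then dotp R b (\<psi> (basis_vec R l)) y else \<zero>\<^bsub>?S\<^esub>)"
  have \<psi>e: "\<psi> (basis_vec R l) \<in> K" "\<psi> (basis_vec R l) \<in> carrier (FM R b)" if "l < c" for l
    using \<psi> basis_vec_carrier[OF R(1), of l "{..<c}"] mod_hom_closed[OF \<psi>(1)] that by auto
  have B: "B \<in> mod_hom ?S (FM ?S b) (FM ?S c)"
    unfolding B_def
    using \<psi>e(2) by (intro tuple_hom Sb.left_module_axioms dotp_right_hom R) (auto simp: FM_carrier)
  have BA: "B (A x) = \<zero>\<^bsub>FM ?S c\<^esub>" if "x \<in> carrier (FM ?S a)" for x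
    using \<psi>e(1) that by (auto simp: B_def K_def)
  have fac: "\<exists>g\<in>mod_hom ?S (FM ?S c) (regular_module ?S). \<forall>y\<in>carrier (FM ?S b). f y = g (B y)"
    if f: "f \<in> mod_hom ?S (FM ?S b) (regular_module ?S)"
      and fA: "\<forall>x\<in>carrier (FM ?S a). f (A x) = \<zero>\<^bsub>R\<^esub>" for f
  proof -
    \<comment> \<open>A functional is the pairing with the row of its values on the basis. That row
      lies in \<open>K\<close>, hence is a combination of the generators, and the row \<rho> of
      coefficients is the functional \<open>g\<close>.\<close>
    define \<phi> where "\<phi> = (\<lambda>i. if i < b then f (basis_vec R i) else \<zero>\<^bsub>R\<^esub>)"
    have \<phi>: "\<phi> \<in> carrier (FM R b)"
      using mod_hom_closed[OF f] basis_vec_carrier[OF R(1), of _ "{..<b}"] by (auto simp: FM_carrier \<phi>_def)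
    then have \<phi>c: "\<And>i. \<phi> i \<in> carrier R" by (auto simp: FM_carrier)
    have f\<phi>: "f y = dotp R b \<phi> y" if "y \<in> carrier (FM R b)" for y
    proof (rule free_hom_eq[OF Sr.left_module_axioms f dotp_right_hom[OF R(1)]])
      show "f (basis_vec ?S x) = dotp R b \<phi> (basis_vec ?S x)" if "x \<in> {..<b}" for x
      proof -
        have "\<phi> x = f (basis_vec R x)" using that by (simp add: \<phi>_def)
        then show ?thesis using dotp_basis_right[OF R(1), of x b \<phi>] that \<phi>c by simp
      qed
    qed (use that \<phi>c in auto)
    have "\<phi> \<in> K" using \<phi> fA f\<phi> Ac by (auto simp: K_def)
    then obtain \<rho> where \<rho>: "\<rho> \<in> carrier (FM R c)" "\<phi> = \<psi> \<rho>" using \<psi>(2) by auto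
    have "dotp R b (\<psi> \<rho>) y = dotp R c \<rho> (B y)" if y: "y \<in> carrier (FM R b)" for y
    proof (rule free_hom_eq[OF Lr.left_module_axioms _ _ _ \<rho>(1)])
      have By: "\<And>i. B y i \<in> carrier R" using mod_hom_closed[OF B] y by (auto simp: FM_carrier)
      show "(\<lambda>\<rho>. dotp R b (\<psi> \<rho>) y) \<in> mod_hom R (FM R c) (regular_module R)"
        using mod_hom_comp[OF \<psi>(1) op_hom.hom[OF dl[OF y]]] .
      show "(\<lambda>\<rho>. dotp R c \<rho> (B y)) \<in> mod_hom R (FM R c) (regular_module R)"
        using By by (intro dotp_left_hom R)
      show "dotp R b (\<psi> (basis_vec R x)) y = dotp R c (basis_vec R x) (B y)" if "x \<in> {..<c}" for x
      proof -
        have "B y x = dotp R b (\<psi> (basis_vec R x)) y" using that by (simp add: B_def)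
        then show ?thesis using dotp_basis_left[OF R(1), of x c "B y"] that By by simp
      qed
    qed
    then have "f y = dotp R c \<rho> (B y)" if "y \<in> carrier (FM ?S b)" for y using f\<phi> \<rho> that by simp
    moreover have "dotp R c \<rho> \<in> mod_hom ?S (FM ?S c) (regular_module ?S)"
      using \<rho>(1) by (intro dotp_right_hom R) (auto simp: FM_carrier)
    ultimately show ?thesis by blast
  qed
  show ?thesis using B BA fac by blast
qed

text \<open>Factoring through the weak cokernel for maps into an arbitrary projective module, by
  coordinates with respect to a dual basis.\<close>

lemma factor_projective:
  assumes S: "ring S" and X: "projective_module S X"
    and B: "B \<in> mod_hom S (FM S b) (FM S c)"
    and fac: "\<And>f. \<lbrakk>f \<in> mod_hom S (FM S b) (regular_module S); \<And>y. y \<in> Y \<Longrightarrow> f y = \<zero>\<^bsub>S\<^esub>\<rbrakk> \<Longrightarrow>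
      \<exists>g\<in>mod_hom S (FM S c) (regular_module S). \<forall>y\<in>carrier (FM S b). f y = g (B y)"
    and f: "f \<in> mod_hom S (FM S b) X" and fY: "\<And>y. y \<in> Y \<Longrightarrow> f y = \<zero>\<^bsub>X\<^esub>"
  shows "\<exists>g\<in>mod_hom S (FM S c) X. \<forall>y\<in>carrier (FM S b). f y = g (B y)"
proof -
  interpret X: left_module S X using X by (simp add: projective_module_def)
  interpret Fb: left_module S "FM S b" by (rule left_module_free) fact
  interpret Fc: left_module S "FM S c" by (rule left_module_free) fact
  interpret Fr: left_module S "regular_module S" by (rule left_module_regular) fact
  interpret FX: left_module S "free_mod S (carrier X)" by (rule left_module_free) fact
  obtain s where s: "s \<in> mod_hom S X (free_mod S (carrier X))"
    "\<And>x. x \<in> carrier X \<Longrightarrow> lin_comb S X (\<lambda>m. m) (s x) = x"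
    using projective_dual_basis[OF X] by blast
  interpret s: op_hom S X "free_mod S (carrier X)" s
    by (intro op_homI X.M.op_group_axioms FX.M.op_group_axioms s)
  have sm: "(\<lambda>x. s x m) \<in> mod_hom S X (regular_module S)" for m
    by (rule mod_hom_comp[OF s(1) coordinate_hom])
  have sfm: "(\<lambda>y. s (f y) m) \<in> mod_hom S (FM S b) (regular_module S)" for m
    by (rule mod_hom_comp[OF f sm])
  have "\<exists>g\<in>mod_hom S (FM S c) (regular_module S). \<forall>y\<in>carrier (FM S b). s (f y) m = g (B y)" for m
    using fac[OF sfm] fY s.zero by simp
  then obtain g where g: "\<And>m. g m \<in> mod_hom S (FM S c) (regular_module S)"
    "\<And>m y. y \<in> carrier (FM S b) \<Longrightarrow> s (f y) m = g m (B y)" by metis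
  \<comment> \<open>Only the coordinates that are nonzero on some \<open>f (basis_vec S i)\<close>
    matter. There are finitely many, so the separate factors can be assembled to a map into the free
    module.\<close>
  define F where "F = (\<Union>i<b. {m. s (f (basis_vec S i)) m \<noteq> \<zero>\<^bsub>S\<^esub>})"
  have sf: "s (f y) \<in> carrier (free_mod S (carrier X))" if "y \<in> carrier (FM S b)" for y
    using mod_hom_closed[OF f that] by simp
  have e: "basis_vec S i \<in> carrier (FM S b)" if "i < b" for i using basis_vec_carrier[OF S, of i "{..<b}"] that by simp
  have F: "finite F" "F \<subseteq> carrier X" using sf[OF e] by (auto simp: F_def free_mod_carrier)
  have out: "s (f y) m = \<zero>\<^bsub>S\<^esub>" if "m \<notin> F" "y \<in> carrier (FM S b)" for m y
  proof -
    have "s (f y) m = (\<lambda>_. \<zero>\<^bsub>regular_module S\<^esub>) y"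
      by (rule free_hom_eq[OF Fr.left_module_axioms sfm mod_hom_zero_fun[OF Fr.M.op_group_axioms] _ that(2)])
        (use that(1) in \<open>auto simp: F_def\<close>)
    then show ?thesis by simp
  qed
  \<comment> \<open>Off \<open>F\<close> the factor \<open>g m\<close> is replaced by zero: there
    \<open>s (f y) m\<close> vanishes for all \<open>y\<close>, while \<open>g m\<close> may be
    nonzero away from the image of \<open>B\<close>.\<close>
  let ?G = "\<lambda>z m. if m \<in> F then g m z else \<zero>\<^bsub>S\<^esub>"
  have G: "?G \<in> mod_hom S (FM S c) (free_mod S (carrier X))"
    by (rule tuple_hom[OF Fc.left_module_axioms F g(1)])
  have "f y = lin_comb S X (\<lambda>m. m) (?G (B y))" if y: "y \<in> carrier (FM S b)" for y
  proof -
    have "?G (B y) = s (f y)" using out[OF _ y] g(2)[OF y] by auto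
    then show ?thesis using s(2)[OF mod_hom_closed[OF f y]] by simp
  qed
  then show ?thesis by (intro bexI[OF _ mod_hom_comp[OF G X.lin_comb_hom]]) auto
qed

section \<open>Finite approximations of complexes\<close>

lemma cplx_module: "is_cplx S X \<Longrightarrow> left_module S (obj X n)"
  and cplx_diff: "is_cplx S X \<Longrightarrow> diff X n \<in> mod_hom S (obj X n) (obj X (n - 1))"
  by (auto simp: is_cplx_def)

lemma cplx_diff_Suc: "is_cplx S X \<Longrightarrow> diff X (n + 1) \<in> mod_hom S (obj X (n + 1)) (obj X n)"
  using cplx_diff[of S X "n + 1"] by simp

lemma cplx_dd: "\<lbrakk>is_cplx S X; x \<in> carrier (obj X (n + 1))\<rbrakk> \<Longrightarrow>
    diff X n (diff X (n + 1) x) = \<zero>\<^bsub>obj X (n - 1)\<^esub>"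
proof -
  assume "is_cplx S X" "x \<in> carrier (obj X (n + 1))"
  then have "diff X (n + 1 - 1) (diff X (n + 1) x) = \<zero>\<^bsub>obj X (n + 1 - 2)\<^esub>"
    unfolding is_cplx_def by blast
  then show ?thesis by (simp add: algebra_simps)
qed

lemma cplx_diff2: "is_cplx S X \<Longrightarrow> diff X (n + 2) \<in> mod_hom S (obj X (n + 2)) (obj X (n + 1))"
  using cplx_diff_Suc[of S X "n + 1"] by (simp add: add.assoc)

lemma cplx_dd2:
  assumes "is_cplx S X" "x \<in> carrier (obj X (n + 2))"
  shows "diff X (n + 1) (diff X (n + 2) x) = \<zero>\<^bsub>obj X n\<^esub>"
proof -
  have eq: "n + 1 + 1 = n + 2" "n + 1 - 1 = n" by simp_all
  show ?thesis using cplx_dd[of S X x "n + 1", unfolded eq] assms by blast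
qed

section \<open>Total acyclicity tested on free modules, the ring and the terms of the
  complex\<close>

lemma Hom_acyclicD:
  assumes "Hom_acyclic S X Q" "f \<in> mod_hom S (obj X n) Q"
    "\<And>x. x \<in> carrier (obj X (n + 1)) \<Longrightarrow> f (diff X (n + 1) x) = \<zero>\<^bsub>Q\<^esub>"
  shows "\<exists>g\<in>mod_hom S (obj X (n - 1)) Q. \<forall>x\<in>carrier (obj X n). f x = g (diff X n x)"
  using assms unfolding Hom_acyclic_def by blast

lemma Hom_acyclic_retract:
  assumes Q: "Hom_acyclic S X Q" and mods: "left_module S N" "left_module S Q"
    and i: "i \<in> mod_hom S N Q" and p: "p \<in> mod_hom S Q N" and pi: "\<And>y. y \<in> carrier N \<Longrightarrow> p (i y) = y"
  shows "Hom_acyclic S X N"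
  unfolding Hom_acyclic_def
proof (intro allI ballI impI)
  fix n f assume f: "f \<in> mod_hom S (obj X n) N"
    and fd: "\<forall>x\<in>carrier (obj X (n + 1)). f (diff X (n + 1) x) = \<zero>\<^bsub>N\<^esub>"
  interpret i: op_hom S N Q i by (intro op_homI left_module_op_group mods i)
  have "\<exists>g\<in>mod_hom S (obj X (n - 1)) Q. \<forall>x\<in>carrier (obj X n). i (f x) = g (diff X n x)"
    by (rule Hom_acyclicD[OF Q mod_hom_comp[OF f i]]) (simp add: fd)
  then obtain g where g: "g \<in> mod_hom S (obj X (n - 1)) Q" "\<forall>x\<in>carrier (obj X n). i (f x) = g (diff X n x)"
    by blast
  have "f x = p (g (diff X n x))" if "x \<in> carrier (obj X n)" for x
    using g(2) that pi[OF mod_hom_closed[OF f that]] by metis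
  then show "\<exists>g\<in>mod_hom S (obj X (n - 1)) N. \<forall>x\<in>carrier (obj X n). f x = g (diff X n x)"
    by (intro bexI[OF _ mod_hom_comp[OF g(1) p]]) simp
qed

lemma totally_acyclic_free:
  fixes T :: "('r, 't) cplx" and Y :: "'t set"
  assumes "totally_acyclic S T"
  shows "Hom_acyclic S T (free_mod S Y)"
proof -
  have "left_module S (obj T 0)" using assms by (simp add: totally_acyclic_def is_cplx_def)
  then interpret left_module S "obj T 0" .
  show ?thesis using assms projective_free[OF R.ring_axioms, of Y] by (simp add: totally_acyclic_def)
qed

text \<open>The ring itself does not lie in the type of the test modules of
  \<open>totally_acyclic\<close>. It is a retract of the free module on one point of type
  \<open>'t\<close>, by extension by zero and a coordinate.\<close>

lemma totally_acyclic_regular: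
  fixes T :: "('r, 't) cplx"
  assumes T: "totally_acyclic S T"
  shows "Hom_acyclic S T (regular_module S)"
proof -
  have "left_module S (obj T 0)" using assms by (simp add: totally_acyclic_def is_cplx_def)
  then interpret left_module S "obj T 0" .
  let ?F = "free_mod S {undefined :: 't}"
  have lm: "left_module S (regular_module S)" "left_module S ?F"
    by (intro left_module_regular left_module_free R.ring_axioms)+
  have "(\<lambda>a y. if y \<in> {undefined} then a else \<zero>\<^bsub>S\<^esub>) \<in> mod_hom S (regular_module S) ?F"
    by (rule tuple_hom[OF lm(1)]) (auto intro: mod_hom_ident)
  from Hom_acyclic_retract[OF totally_acyclic_free[OF T] lm this coordinate_hom, of undefined]
  show ?thesis by simp
qed

text \<open>Each term is a retract of the free module on its own elements, to which total acyclicity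
  applies. This instance supplies the homotopies when \<open>fin_approx\<close> descends.\<close>

lemma totally_acyclic_term:
  assumes T: "totally_acyclic S T"
  shows "Hom_acyclic S T (obj T m)"
proof -
  have pr: "projective_module S (obj T m)" using assms by (simp add: totally_acyclic_def)
  then have lm: "left_module S (obj T m)" by (simp add: projective_module_def)
  interpret left_module S "obj T m" by fact
  obtain s where s: "s \<in> mod_hom S (obj T m) (free_mod S (carrier (obj T m)))"
    "\<And>x. x \<in> carrier (obj T m) \<Longrightarrow> lin_comb S (obj T m) (\<lambda>m. m) (s x) = x"
    using projective_dual_basis[OF pr] by blast
  have l: "lin_comb S (obj T m) (\<lambda>m. m) \<in> mod_hom S (free_mod S (carrier (obj T m))) (obj T m)"
    by (rule lin_comb_hom)
  show ?thesis
    by (rule Hom_acyclic_retract[OF totally_acyclic_free[OF T] lm left_module_free[OF R.ring_axioms] s(1) l])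
      (rule s(2))
qed

lemma Hom_acyclic_FM:
  assumes X: "is_cplx S X" and ac: "Hom_acyclic S X (regular_module S)"
  shows "Hom_acyclic S X (FM S c)"
  unfolding Hom_acyclic_def
proof (intro allI ballI impI)
  fix n f assume f: "f \<in> mod_hom S (obj X n) (FM S c)"
    and fd: "\<forall>x\<in>carrier (obj X (n + 1)). f (diff X (n + 1) x) = \<zero>\<^bsub>FM S c\<^esub>"
  have "\<exists>g\<in>mod_hom S (obj X (n - 1)) (regular_module S). \<forall>x\<in>carrier (obj X n). f x i = g (diff X n x)" for i
    by (rule Hom_acyclicD[OF ac mod_hom_comp[OF f coordinate_hom]]) (use fd in simp)
  then obtain g where g: "\<And>i. g i \<in> mod_hom S (obj X (n - 1)) (regular_module S)"
    "\<And>i x. x \<in> carrier (obj X n) \<Longrightarrow> f x i = g i (diff X n x)" by metis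
  let ?G = "\<lambda>x i. if i \<in> {..<c} then g i x else \<zero>\<^bsub>S\<^esub>"
  have "?G \<in> mod_hom S (obj X (n - 1)) (FM S c)"
    by (rule tuple_hom[OF cplx_module[OF X]]) (auto intro: g)
  moreover have "f x = ?G (diff X n x)" if "x \<in> carrier (obj X n)" for x
    using mod_hom_closed[OF f that] g(2)[OF that] by (auto simp: FM_carrier)
  ultimately show "\<exists>g\<in>mod_hom S (obj X (n - 1)) (FM S c). \<forall>x\<in>carrier (obj X n). f x = g (diff X n x)"
    by (intro bexI) simp_all
qed

text \<open>In degrees \<open>n + 1\<close> and \<open>n\<close>, the identity of \<open>X\<close> is homotopic to a map that factors through
  finite free modules; equivalently, the identity of the cokernel of \<open>X\<^sub>n\<^sub>+\<^sub>1 \<rightarrow> X\<^sub>n\<close> factors through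
  the sum of a finitely presented and a projective module.\<close>

definition fin_approx :: "'r ring \<Rightarrow> ('r, 'x) cplx \<Rightarrow> int \<Rightarrow> bool" where
  "fin_approx S X n \<longleftrightarrow> (\<exists>a b A g g' h h' k l.
     A \<in> mod_hom S (FM S a) (FM S b) \<and> g \<in> mod_hom S (obj X n) (FM S b) \<and>
     g' \<in> mod_hom S (obj X (n + 1)) (FM S a) \<and> h \<in> mod_hom S (FM S b) (obj X n) \<and>
     h' \<in> mod_hom S (FM S a) (obj X (n + 1)) \<and> k \<in> mod_hom S (obj X (n - 1)) (obj X n) \<and>
     l \<in> mod_hom S (obj X n) (obj X (n + 1)) \<and>
     (\<forall>t\<in>carrier (obj X (n + 1)). g (diff X (n + 1) t) = A (g' t)) \<and>
     (\<forall>y\<in>carrier (FM S a). h (A y) = diff X (n + 1) (h' y)) \<and>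
     (\<forall>t\<in>carrier (obj X n).
        t = h (g t) \<oplus>\<^bsub>obj X n\<^esub> k (diff X n t) \<oplus>\<^bsub>obj X n\<^esub> diff X (n + 1) (l t)))"

lemma fin_approxI:
  assumes "A \<in> mod_hom S (FM S a) (FM S b)" "g \<in> mod_hom S (obj X n) (FM S b)"
     "g' \<in> mod_hom S (obj X (n + 1)) (FM S a)" "h \<in> mod_hom S (FM S b) (obj X n)"
     "h' \<in> mod_hom S (FM S a) (obj X (n + 1))" "k \<in> mod_hom S (obj X (n - 1)) (obj X n)"
     "l \<in> mod_hom S (obj X n) (obj X (n + 1))"
     "\<And>t. t\<in>carrier (obj X (n + 1)) \<Longrightarrow> g (diff X (n + 1) t) = A (g' t)"
     "\<And>y. y\<in>carrier (FM S a) \<Longrightarrow> h (A y) = diff X (n + 1) (h' y)"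
     "\<And>t. t\<in>carrier (obj X n) \<Longrightarrow>
        t = h (g t) \<oplus>\<^bsub>obj X n\<^esub> k (diff X n t) \<oplus>\<^bsub>obj X n\<^esub> diff X (n + 1) (l t)"
  shows "fin_approx S X n"
  unfolding fin_approx_def using assms
  by (intro exI[of _ a] exI[of _ b] exI[of _ A] exI[of _ g] exI[of _ g'] exI[of _ h] exI[of _ h']
     exI[of _ k] exI[of _ l] conjI ballI)

text \<open>The neighbouring degrees enter as \<open>p\<close> and \<open>q\<close>, so that a
  shifted instance arrives with indices such as \<open>n + 2\<close> already simplified.\<close>

lemma fin_approxE:
  assumes "fin_approx S X n" "p = n + 1" "q = n - 1"
  obtains a b A g g' h h' k l where
    "A \<in> mod_hom S (FM S a) (FM S b)" "g \<in> mod_hom S (obj X n) (FM S b)"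
     "g' \<in> mod_hom S (obj X p) (FM S a)" "h \<in> mod_hom S (FM S b) (obj X n)"
     "h' \<in> mod_hom S (FM S a) (obj X p)" "k \<in> mod_hom S (obj X q) (obj X n)"
     "l \<in> mod_hom S (obj X n) (obj X p)"
     "\<And>t. t\<in>carrier (obj X p) \<Longrightarrow> g (diff X p t) = A (g' t)"
     "\<And>y. y\<in>carrier (FM S a) \<Longrightarrow> h (A y) = diff X p (h' y)"
     "\<And>t. t\<in>carrier (obj X n) \<Longrightarrow>
        t = h (g t) \<oplus>\<^bsub>obj X n\<^esub> k (diff X n t) \<oplus>\<^bsub>obj X n\<^esub> diff X p (l t)"
  using assms(1) unfolding fin_approx_def assms(2,3)[symmetric]
  by (elim exE conjE) (rule that; (assumption | erule (1) bspec))

section \<open>Finite approximations: start, ascent, transfer and descent\<close>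

text \<open>A finite presentation of \<open>M\<close> and the beginning of the resolution both
  present \<open>M\<close> by projectives; comparing them in the two directions gives
  \<open>g\<close>, \<open>g'\<close> and \<open>h\<close>, \<open>h'\<close>. As \<open>h\<close>
  after \<open>g\<close> covers the identity of \<open>M\<close>, the difference to the identity
  takes values in boundaries and factors through some \<open>l\<close>, with \<open>k\<close>
  zero.\<close>

lemma fin_approx_resolution_zero:
  assumes S: "ring S" "left_noetherian S" and Q: "projective_resolution S Q \<pi> M"
    and fg: "fin_gen S M (carrier M)"
  shows "fin_approx S Q 0"
proof -
  have M: "left_module S M" and cQ: "is_cplx S Q" and pQ: "\<And>n. projective_module S (obj Q n)"
    and \<pi>: "\<pi> \<in> mod_hom S (obj Q 0) M" "\<pi> ` carrier (obj Q 0) = carrier M"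
    and ker: "{x \<in> carrier (obj Q 0). \<pi> x = \<zero>\<^bsub>M\<^esub>} = diff Q 1 ` carrier (obj Q 1)"
    using Q by (auto simp: projective_resolution_def boundaries_def)
  note lQ = cplx_module[OF cQ] and lF = left_module_free[OF S(1)]
  interpret M: left_module S M by fact
  obtain b p where p: "p \<in> mod_hom S (FM S b) M" "p ` carrier (FM S b) = carrier M"
    using fin_gen_image[OF M M.M.carrier_submodule fg] by blast
  interpret \<pi>: op_hom S "obj Q 0" M \<pi> by (intro op_homI left_module_op_group lQ M \<pi>)
  interpret p: op_hom S "FM S b" M p by (intro op_homI left_module_op_group lF M p)
  obtain a A where A: "A \<in> mod_hom S (FM S a) (FM S b)"
    "A ` carrier (FM S a) = {x \<in> carrier (FM S b). p x = \<zero>\<^bsub>M\<^esub>}"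
    using noetherian_image[OF S p.kernel_submodule] by blast
  have pA: "p (A y) = \<zero>\<^bsub>M\<^esub>" if "y \<in> carrier (FM S a)" for y using A(2) that by blast
  have d: "diff Q 1 \<in> mod_hom S (obj Q 1) (obj Q 0)" using cplx_diff[OF cQ, of 1] by simp
  have \<pi>d: "\<pi> (diff Q 1 t) = \<zero>\<^bsub>M\<^esub>" if "t \<in> carrier (obj Q 1)" for t using ker that by blast
  obtain h where h: "h \<in> mod_hom S (FM S b) (obj Q 0)" "\<And>y. y \<in> carrier (FM S b) \<Longrightarrow> \<pi> (h y) = p y"
    using projective_lift[OF projective_free[OF S(1)] lQ M \<pi>(1) p(1)] \<pi>(2) p(2) by auto
  obtain g where g: "g \<in> mod_hom S (obj Q 0) (FM S b)" "\<And>y. y \<in> carrier (obj Q 0) \<Longrightarrow> p (g y) = \<pi> y"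
    using projective_lift[OF pQ lF M p(1) \<pi>(1)] \<pi>(2) p(2) by auto
  have im: "x \<in> diff Q 1 ` carrier (obj Q 1)" if "x \<in> carrier (obj Q 0)" "\<pi> x = \<zero>\<^bsub>M\<^esub>" for x
    using ker that by blast
  have "(\<lambda>y. h (A y)) ` carrier (FM S a) \<subseteq> diff Q 1 ` carrier (obj Q 1)"
    using im h(2) pA mod_hom_closed[OF A(1)] mod_hom_closed[OF h(1)] by (intro image_subsetI) simp
  then obtain h' where h': "h' \<in> mod_hom S (FM S a) (obj Q 1)"
    "\<And>y. y \<in> carrier (FM S a) \<Longrightarrow> diff Q 1 (h' y) = h (A y)"
    using projective_lift[OF projective_free[OF S(1)] lQ lQ d mod_hom_comp[OF A(1) h(1)]] by auto
  have "(\<lambda>t. g (diff Q 1 t)) ` carrier (obj Q 1) \<subseteq> A ` carrier (FM S a)"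
    unfolding A(2) using g(2) \<pi>d mod_hom_closed[OF d] mod_hom_closed[OF g(1)] by (intro image_subsetI) simp
  then obtain g' where g': "g' \<in> mod_hom S (obj Q 1) (FM S a)"
    "\<And>t. t \<in> carrier (obj Q 1) \<Longrightarrow> A (g' t) = g (diff Q 1 t)"
    using projective_lift[OF pQ lF lF A(1) mod_hom_comp[OF d g(1)]] by auto
  have hg: "(\<lambda>t. h (g t)) \<in> mod_hom S (obj Q 0) (obj Q 0)" by (rule mod_hom_comp[OF g(1) h(1)])
  have dh: "(\<lambda>t. t \<ominus>\<^bsub>obj Q 0\<^esub> h (g t)) \<in> mod_hom S (obj Q 0) (obj Q 0)"
    by (intro mod_hom_diff left_module_op_group lQ mod_hom_ident hg)
  have "(\<lambda>t. t \<ominus>\<^bsub>obj Q 0\<^esub> h (g t)) ` carrier (obj Q 0) \<subseteq> diff Q 1 ` carrier (obj Q 1)"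
  proof (rule image_subsetI)
    fix t assume t: "t \<in> carrier (obj Q 0)"
    have "\<pi> (t \<ominus>\<^bsub>obj Q 0\<^esub> h (g t)) = \<zero>\<^bsub>M\<^esub>"
      using t mod_hom_closed[OF g(1) t] mod_hom_closed[OF hg t] h(2) g(2) by (simp add: M.M.ag)
    then show "t \<ominus>\<^bsub>obj Q 0\<^esub> h (g t) \<in> diff Q 1 ` carrier (obj Q 1)"
      using im t mod_hom_closed[OF dh t] by blast
  qed
  then obtain l where l: "l \<in> mod_hom S (obj Q 0) (obj Q 1)"
    "\<And>t. t \<in> carrier (obj Q 0) \<Longrightarrow> diff Q 1 (l t) = t \<ominus>\<^bsub>obj Q 0\<^esub> h (g t)"
    using projective_lift[OF pQ lQ lQ d dh] by auto
  show ?thesis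
  proof (rule fin_approxI[OF A(1) g(1) _ h(1) _ mod_hom_zero_fun[OF left_module_op_group[OF lQ]]])
    fix t assume t: "t \<in> carrier (obj Q 0)"
    show "t = h (g t) \<oplus>\<^bsub>obj Q 0\<^esub> \<zero>\<^bsub>obj Q 0\<^esub> \<oplus>\<^bsub>obj Q 0\<^esub> diff Q (0 + 1) (l t)"
      using t mod_hom_closed[OF hg t] by (simp add: l(2) \<pi>.M.ag)
  qed (use g' h' l in auto)
qed

text \<open>Passage to syzygies. The new matrix has the kernel of \<open>A\<close> as its image,
  which is possible over a noetherian ring; \<open>g'\<close> and \<open>h'\<close> take the roles
  of \<open>g\<close> and \<open>h\<close>, and \<open>l\<close> becomes the new \<open>k\<close>.
  The new defect \<open>?e\<close> takes values in cycles, hence in boundaries, and lifts to the new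
  \<open>l\<close>.\<close>

lemma fin_approx_up:
  assumes S: "ring S" "left_noetherian S" and X: "is_cplx S X" and pX: "\<And>n. projective_module S (obj X n)"
    and ac: "acyclic_at X (n + 1)" and ap: "fin_approx S X n"
  shows "fin_approx S X (n + 1)"
  using ap
proof (rule fin_approxE[OF _ refl refl])
  fix a b A g g' h h' k l
  assume A: "A \<in> mod_hom S (FM S a) (FM S b)" and g: "g \<in> mod_hom S (obj X n) (FM S b)"
     and g': "g' \<in> mod_hom S (obj X (n + 1)) (FM S a)" and h: "h \<in> mod_hom S (FM S b) (obj X n)"
     and h': "h' \<in> mod_hom S (FM S a) (obj X (n + 1))" and k: "k \<in> mod_hom S (obj X (n - 1)) (obj X n)"
     and l: "l \<in> mod_hom S (obj X n) (obj X (n + 1))"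
     and gA: "\<And>t. t\<in>carrier (obj X (n + 1)) \<Longrightarrow> g (diff X (n + 1) t) = A (g' t)"
     and hA: "\<And>y. y\<in>carrier (FM S a) \<Longrightarrow> h (A y) = diff X (n + 1) (h' y)"
     and hom: "\<And>t. t\<in>carrier (obj X n) \<Longrightarrow>
        t = h (g t) \<oplus>\<^bsub>obj X n\<^esub> k (diff X n t) \<oplus>\<^bsub>obj X n\<^esub> diff X (n + 1) (l t)"
  note lX = cplx_module[OF X] and lF = left_module_free[OF S(1)]
  have d2: "diff X (n + 2) \<in> mod_hom S (obj X (n + 2)) (obj X (n + 1))" by (rule cplx_diff2[OF X])
  have d1: "diff X (n + 1) \<in> mod_hom S (obj X (n + 1)) (obj X n)" using cplx_diff[OF X, of "n + 1"] by simp
  have d0: "diff X n \<in> mod_hom S (obj X n) (obj X (n - 1))" by (rule cplx_diff[OF X])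
  have dd: "diff X (n + 1) (diff X (n + 2) x) = \<zero>\<^bsub>obj X n\<^esub>" if "x \<in> carrier (obj X (n + 2))" for x
    by (rule cplx_dd2[OF X that])
  have im: "x \<in> diff X (n + 2) ` carrier (obj X (n + 2))"
    if "x \<in> carrier (obj X (n + 1))" "diff X (n + 1) x = \<zero>\<^bsub>obj X n\<^esub>" for x
  proof -
    have eq: "n + 1 + 1 = n + 2" "n + 1 - 1 = n" by simp_all
    show ?thesis using ac[unfolded acyclic_at_def cycles_def boundaries_def eq] that by blast
  qed
  interpret A: op_hom S "FM S a" "FM S b" A by (intro op_homI left_module_op_group lF A)
  interpret g: op_hom S "obj X n" "FM S b" g by (intro op_homI left_module_op_group lF lX g)
  interpret h: op_hom S "FM S b" "obj X n" h by (intro op_homI left_module_op_group lF lX h)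
  interpret k: op_hom S "obj X (n - 1)" "obj X n" k by (intro op_homI left_module_op_group lX k)
  interpret l: op_hom S "obj X n" "obj X (n + 1)" l by (intro op_homI left_module_op_group lX l)
  interpret d1: op_hom S "obj X (n + 1)" "obj X n" "diff X (n + 1)" by (intro op_homI left_module_op_group lX d1)
  obtain a' A' where A': "A' \<in> mod_hom S (FM S a') (FM S a)"
    "A' ` carrier (FM S a') = {x \<in> carrier (FM S a). A x = \<zero>\<^bsub>FM S b\<^esub>}"
    using noetherian_image[OF S A.kernel_submodule] by blast
  have AA': "A (A' y) = \<zero>\<^bsub>FM S b\<^esub>" if "y \<in> carrier (FM S a')" for y using A'(2) that by blast
  have "(\<lambda>t. g' (diff X (n + 2) t)) ` carrier (obj X (n + 2)) \<subseteq> A' ` carrier (FM S a')"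
    unfolding A'(2) using gA[symmetric] dd mod_hom_closed[OF d2] mod_hom_closed[OF g'] g.zero
    by (intro image_subsetI) (simp del: free_mod_simps)
  then obtain g'' where g'': "g'' \<in> mod_hom S (obj X (n + 2)) (FM S a')"
    "\<And>t. t \<in> carrier (obj X (n + 2)) \<Longrightarrow> A' (g'' t) = g' (diff X (n + 2) t)"
    using projective_lift[OF pX lF lF A'(1) mod_hom_comp[OF d2 g']] by auto
  have "(\<lambda>y. h' (A' y)) ` carrier (FM S a') \<subseteq> diff X (n + 2) ` carrier (obj X (n + 2))"
    using im hA[symmetric] AA' mod_hom_closed[OF A'(1)] mod_hom_closed[OF h'] h.zero
    by (intro image_subsetI) (simp del: free_mod_simps)
  then obtain h'' where h'': "h'' \<in> mod_hom S (FM S a') (obj X (n + 2))"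
    "\<And>y. y \<in> carrier (FM S a') \<Longrightarrow> diff X (n + 2) (h'' y) = h' (A' y)"
    using projective_lift[OF projective_free[OF S(1)] lX lX d2 mod_hom_comp[OF A'(1) h']] by auto
  have hg: "(\<lambda>t. h' (g' t)) \<in> mod_hom S (obj X (n + 1)) (obj X (n + 1))"
    and ld: "(\<lambda>t. l (diff X (n + 1) t)) \<in> mod_hom S (obj X (n + 1)) (obj X (n + 1))"
    by (rule mod_hom_comp[OF g' h'] mod_hom_comp[OF d1 l])+
  let ?e = "\<lambda>t. t \<ominus>\<^bsub>obj X (n + 1)\<^esub> h' (g' t) \<ominus>\<^bsub>obj X (n + 1)\<^esub> l (diff X (n + 1) t)"
  have e: "?e \<in> mod_hom S (obj X (n + 1)) (obj X (n + 1))"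
    by (intro mod_hom_diff left_module_op_group lX mod_hom_ident hg ld)
  have "?e ` carrier (obj X (n + 1)) \<subseteq> diff X (n + 2) ` carrier (obj X (n + 2))"
  proof (rule image_subsetI)
    fix t assume t: "t \<in> carrier (obj X (n + 1))"
    let ?u = "diff X (n + 1) t"
    have cl: "h' (g' t) \<in> carrier (obj X (n + 1))" "l ?u \<in> carrier (obj X (n + 1))" "g' t \<in> carrier (FM S a)"
      using mod_hom_closed[OF hg t] mod_hom_closed[OF ld t] mod_hom_closed[OF g' t] by auto
    have u: "?u \<in> carrier (obj X n)" using t by simp
    \<comment> \<open>The old homotopy is applied to the boundary \<open>?u\<close>, where its
      \<open>k\<close>-term vanishes; what remains is the differential of the two terms that
      \<open>?e\<close> subtracts.\<close>
    have "diff X n ?u = \<zero>\<^bsub>obj X (n - 1)\<^esub>" by (rule cplx_dd[OF X t])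
    then have "?u = h (g ?u) \<oplus>\<^bsub>obj X n\<^esub> diff X (n + 1) (l ?u)" using hom[OF u] u cl by simp
    moreover have "diff X (n + 1) (h' (g' t)) = h (g ?u)" using hA[OF cl(3)] gA[OF t] by simp
    ultimately have "diff X (n + 1) (?e t) = (h (g ?u) \<oplus>\<^bsub>obj X n\<^esub> diff X (n + 1) (l ?u))
        \<ominus>\<^bsub>obj X n\<^esub> h (g ?u) \<ominus>\<^bsub>obj X n\<^esub> diff X (n + 1) (l ?u)"
      using t cl by simp
    also have "\<dots> = \<zero>\<^bsub>obj X n\<^esub>" using u cl by (simp add: g.M.ag)
    finally show "?e t \<in> diff X (n + 2) ` carrier (obj X (n + 2))"
      using im mod_hom_closed[OF e t] by blast
  qed
  then obtain l' where l': "l' \<in> mod_hom S (obj X (n + 1)) (obj X (n + 2))"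
    "\<And>t. t \<in> carrier (obj X (n + 1)) \<Longrightarrow> diff X (n + 2) (l' t) = ?e t"
    using projective_lift[OF pX lX lX d2 e] by auto
  have [simp]: "n + 1 + 1 = n + 2" "n + 1 - 1 = n" by simp_all
  show ?thesis
  proof (rule fin_approxI[OF A'(1) g' _ h'])
    fix t assume t: "t \<in> carrier (obj X (n + 1))"
    show "t = h' (g' t) \<oplus>\<^bsub>obj X (n + 1)\<^esub> l (diff X (n + 1) t) \<oplus>\<^bsub>obj X (n + 1)\<^esub> diff X (n + 1 + 1) (l' t)"
      using t mod_hom_closed[OF hg t] mod_hom_closed[OF ld t] by (simp add: l'(2) l.N.ag)
  qed (use g'' h'' l' l in auto)
qed

lemma mod_iso_inverse:
  assumes M: "op_group S M" and f: "f \<in> mod_iso S M N"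
  obtains g where "g \<in> mod_hom S N M" "\<And>x. x \<in> carrier M \<Longrightarrow> g (f x) = x" "\<And>y. y \<in> carrier N \<Longrightarrow> f (g y) = y"
proof -
  interpret M: op_group S M by fact
  let ?g = "inv_into (carrier M) f"
  have hf: "f \<in> mod_hom S M N" and b: "inj_on f (carrier M)" "f ` carrier M = carrier N"
    using f by (auto simp: mod_iso_def bij_betw_def)
  note f_simps = mod_hom_add[OF hf, symmetric] mod_hom_smult[OF hf, symmetric]
  have gf: "?g (f x) = x" if "x \<in> carrier M" for x using that b by simp
  have "?g \<in> mod_hom S N M"
    unfolding mod_hom_def b(2)[symmetric] by (auto simp: gf f_simps)
  moreover have "f (?g y) = y" if "y \<in> carrier N" for y using that b(2) by (simp add: f_inv_into_f)
  ultimately show ?thesis using that gf by blast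
qed

text \<open>The data involve the degrees \<open>n - 1\<close>, \<open>n\<close> and
  \<open>n + 1\<close> only, in which \<tau> is invertible, and are carried over by
  conjugation.\<close>

lemma fin_approx_transfer:
  assumes X: "is_cplx S X" and Y: "is_cplx S Y" and \<tau>: "chain_map S X Y \<tau>"
    and iso: "\<And>j. j \<ge> n - 1 \<Longrightarrow> \<tau> j \<in> mod_iso S (obj X j) (obj Y j)" and ap: "fin_approx S Y n"
  shows "fin_approx S X n"
  using ap
proof (rule fin_approxE[OF _ refl refl])
  fix a b A g g' h h' k l
  assume A: "A \<in> mod_hom S (FM S a) (FM S b)" and g: "g \<in> mod_hom S (obj Y n) (FM S b)"
     and g': "g' \<in> mod_hom S (obj Y (n + 1)) (FM S a)" and h: "h \<in> mod_hom S (FM S b) (obj Y n)"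
     and h': "h' \<in> mod_hom S (FM S a) (obj Y (n + 1))" and k: "k \<in> mod_hom S (obj Y (n - 1)) (obj Y n)"
     and l: "l \<in> mod_hom S (obj Y n) (obj Y (n + 1))"
     and gA: "\<And>t. t\<in>carrier (obj Y (n + 1)) \<Longrightarrow> g (diff Y (n + 1) t) = A (g' t)"
     and hA: "\<And>y. y\<in>carrier (FM S a) \<Longrightarrow> h (A y) = diff Y (n + 1) (h' y)"
     and hom: "\<And>t. t\<in>carrier (obj Y n) \<Longrightarrow>
        t = h (g t) \<oplus>\<^bsub>obj Y n\<^esub> k (diff Y n t) \<oplus>\<^bsub>obj Y n\<^esub> diff Y (n + 1) (l t)"
  note lX = left_module_op_group[OF cplx_module[OF X]] and lY = left_module_op_group[OF cplx_module[OF Y]]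
  have t: "\<tau> j \<in> mod_hom S (obj X j) (obj Y j)" for j using \<tau> by (simp add: chain_map_def)
  have td: "diff Y (n + 1) (\<tau> (n + 1) x) = \<tau> n (diff X (n + 1) x)" if "x \<in> carrier (obj X (n + 1))" for x
    using \<tau> that unfolding chain_map_def by (metis add_diff_cancel_right')
  have td0: "diff Y n (\<tau> n x) = \<tau> (n - 1) (diff X n x)" if "x \<in> carrier (obj X n)" for x
    using \<tau> that unfolding chain_map_def by metis
  note dX1 = cplx_diff_Suc[OF X, of n] and dY1 = cplx_diff_Suc[OF Y, of n]
  note dX0 = cplx_diff[OF X, of n] and dY0 = cplx_diff[OF Y, of n]
  obtain s0 where s0: "s0 \<in> mod_hom S (obj Y n) (obj X n)" "\<And>x. x \<in> carrier (obj X n) \<Longrightarrow> s0 (\<tau> n x) = x"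
    "\<And>y. y \<in> carrier (obj Y n) \<Longrightarrow> \<tau> n (s0 y) = y"
    using mod_iso_inverse[OF lX iso[of n]] by auto
  obtain s1 where s1: "s1 \<in> mod_hom S (obj Y (n + 1)) (obj X (n + 1))"
    "\<And>y. y \<in> carrier (obj Y (n + 1)) \<Longrightarrow> \<tau> (n + 1) (s1 y) = y"
    by (rule mod_iso_inverse[OF lX iso[of "n + 1"]]) auto
  interpret s0: op_hom S "obj Y n" "obj X n" s0 by (intro op_homI lX lY s0)
  have ds: "diff X (n + 1) (s1 y) = s0 (diff Y (n + 1) y)" if y: "y \<in> carrier (obj Y (n + 1))" for y
    using s0(2)[OF mod_hom_closed[OF dX1 mod_hom_closed[OF s1(1) y]]] td[OF mod_hom_closed[OF s1(1) y]] s1(2)[OF y]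
    by simp
  show ?thesis
  proof (rule fin_approxI[OF A mod_hom_comp[OF t g] mod_hom_comp[OF t g'] mod_hom_comp[OF h s0(1)]
      mod_hom_comp[OF h' s1(1)] mod_hom_comp[OF mod_hom_comp[OF t k] s0(1)]
      mod_hom_comp[OF mod_hom_comp[OF t l] s1(1)]])
    fix x assume x: "x \<in> carrier (obj X (n + 1))"
    show "g (\<tau> n (diff X (n + 1) x)) = A (g' (\<tau> (n + 1) x))"
      using gA[OF mod_hom_closed[OF t x]] td[OF x] by simp
  next
    fix y assume y: "y \<in> carrier (FM S a)"
    show "s0 (h (A y)) = diff X (n + 1) (s1 (h' y))"
      using hA[OF y] ds[OF mod_hom_closed[OF h' y]] by simp
  next
    fix x assume x: "x \<in> carrier (obj X n)"
    have tx: "\<tau> n x \<in> carrier (obj Y n)" by (rule mod_hom_closed[OF t x])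
    have cl: "h (g (\<tau> n x)) \<in> carrier (obj Y n)" "k (diff Y n (\<tau> n x)) \<in> carrier (obj Y n)"
      "l (\<tau> n x) \<in> carrier (obj Y (n + 1))" "diff Y (n + 1) (l (\<tau> n x)) \<in> carrier (obj Y n)"
      by (intro mod_hom_closed[OF h] mod_hom_closed[OF g] mod_hom_closed[OF k] mod_hom_closed[OF l]
          mod_hom_closed[OF dY0] mod_hom_closed[OF dY1] tx)+
    have "x = s0 (h (g (\<tau> n x)) \<oplus>\<^bsub>obj Y n\<^esub> k (diff Y n (\<tau> n x)) \<oplus>\<^bsub>obj Y n\<^esub> diff Y (n + 1) (l (\<tau> n x)))"
      using hom[OF tx] s0(2)[OF x] by simp
    then show "x = s0 (h (g (\<tau> n x))) \<oplus>\<^bsub>obj X n\<^esub> s0 (k (\<tau> (n - 1) (diff X n x))) \<oplus>\<^bsub>obj X n\<^esub>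
        diff X (n + 1) (s1 (l (\<tau> n x)))"
      using cl ds[OF cl(3)] td0[OF x] by simp
  qed
qed

text \<open>Dual to \<open>fin_approx_up\<close>, with weak cokernels for kernels. \<open>B\<close>
  after \<open>g\<close> kills boundaries, so total acyclicity extends it over the differential to
  \<open>g0\<close>; the differential after \<open>h\<close> kills the image of \<open>A\<close>, so
  it factors through \<open>B\<close> as \<open>h0\<close>. The defect \<open>?f\<close> kills
  boundaries as well and factors through the differential, which gives the new \<open>k\<close>; the
  old \<open>k\<close> becomes the new \<open>l\<close>.\<close>

lemma fin_approx_down:
  assumes R: "ring R" "left_noetherian R" and T: "totally_acyclic (opp R) T" and ap: "fin_approx (opp R) T (n + 1)"
  shows "fin_approx (opp R) T n"
proof -
  let ?S = "opp R"
  have S: "ring ?S" by (rule ring_opp[OF R(1)])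
  have X: "is_cplx ?S T" and pX: "\<And>n. projective_module ?S (obj T n)" using T by (auto simp: totally_acyclic_def)
  obtain a b A g g' h h' k l where
     A: "A \<in> mod_hom ?S (FM ?S a) (FM ?S b)" and g: "g \<in> mod_hom ?S (obj T (n + 1)) (FM ?S b)"
     and g': "g' \<in> mod_hom ?S (obj T (n + 2)) (FM ?S a)" and h: "h \<in> mod_hom ?S (FM ?S b) (obj T (n + 1))"
     and h': "h' \<in> mod_hom ?S (FM ?S a) (obj T (n + 2))" and k: "k \<in> mod_hom ?S (obj T n) (obj T (n + 1))"
     and l: "l \<in> mod_hom ?S (obj T (n + 1)) (obj T (n + 2))"
     and gA: "\<And>t. t\<in>carrier (obj T (n + 2)) \<Longrightarrow> g (diff T (n + 2) t) = A (g' t)"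
     and hA: "\<And>y. y\<in>carrier (FM ?S a) \<Longrightarrow> h (A y) = diff T (n + 2) (h' y)"
     and hom: "\<And>t. t\<in>carrier (obj T (n + 1)) \<Longrightarrow>
        t = h (g t) \<oplus>\<^bsub>obj T (n + 1)\<^esub> k (diff T (n + 1) t) \<oplus>\<^bsub>obj T (n + 1)\<^esub> diff T (n + 2) (l t)"
    by (rule fin_approxE[OF ap, of "n + 2" n]) (simp, simp, rule that)
  note lX = cplx_module[OF X] and lF = left_module_free[OF S]
  have d2: "diff T (n + 2) \<in> mod_hom ?S (obj T (n + 2)) (obj T (n + 1))" by (rule cplx_diff2[OF X])
  have d1: "diff T (n + 1) \<in> mod_hom ?S (obj T (n + 1)) (obj T n)" using cplx_diff[OF X, of "n + 1"] by simp
  have dd: "diff T (n + 1) (diff T (n + 2) x) = \<zero>\<^bsub>obj T n\<^esub>" if "x \<in> carrier (obj T (n + 2))" for x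
    by (rule cplx_dd2[OF X that])
  obtain c B where B: "B \<in> mod_hom ?S (FM ?S b) (FM ?S c)"
    and BA: "\<And>x. x \<in> carrier (FM ?S a) \<Longrightarrow> B (A x) = \<zero>\<^bsub>FM ?S c\<^esub>"
    and fac: "\<And>f. f\<in>mod_hom ?S (FM ?S b) (regular_module ?S) \<Longrightarrow>
      (\<forall>x\<in>carrier (FM ?S a). f (A x) = \<zero>\<^bsub>R\<^esub>) \<Longrightarrow>
      (\<exists>g\<in>mod_hom ?S (FM ?S c) (regular_module ?S). \<forall>y\<in>carrier (FM ?S b). f y = g (B y))"
    using weak_cokernel[OF R A] by blast
  interpret d1: op_hom ?S "obj T (n + 1)" "obj T n" "diff T (n + 1)" by (intro op_homI left_module_op_group lX d1)
  have "B (g (diff T (n + 1 + 1) t)) = \<zero>\<^bsub>FM ?S c\<^esub>" if "t \<in> carrier (obj T (n + 1 + 1))" for t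
    using that gA[of t] BA[OF mod_hom_closed[OF g']] by (simp add: add.assoc del: free_mod_simps)
  then obtain g0 where g0: "g0 \<in> mod_hom ?S (obj T n) (FM ?S c)"
    "\<And>x. x \<in> carrier (obj T (n + 1)) \<Longrightarrow> B (g x) = g0 (diff T (n + 1) x)"
    using Hom_acyclicD[OF Hom_acyclic_FM[OF X totally_acyclic_regular[OF T]] mod_hom_comp[OF g B]] by auto
  have "diff T (n + 1) (h (A y)) = \<zero>\<^bsub>obj T n\<^esub>" if "y \<in> carrier (FM ?S a)" for y
    using hA[OF that] dd[OF mod_hom_closed[OF h' that]] by simp
  then obtain h0 where h0: "h0 \<in> mod_hom ?S (FM ?S c) (obj T n)"
    "\<And>y. y \<in> carrier (FM ?S b) \<Longrightarrow> diff T (n + 1) (h y) = h0 (B y)"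
  proof -
    have "\<exists>h0\<in>mod_hom ?S (FM ?S c) (obj T n). \<forall>y\<in>carrier (FM ?S b). diff T (n + 1) (h y) = h0 (B y)"
    proof (rule factor_projective[OF S pX B _ mod_hom_comp[OF h d1], of "A ` carrier (FM ?S a)"])
      fix f assume f: "f \<in> mod_hom ?S (FM ?S b) (regular_module ?S)"
        and "\<And>y. y \<in> A ` carrier (FM ?S a) \<Longrightarrow> f y = \<zero>\<^bsub>?S\<^esub>"
      then show "\<exists>g\<in>mod_hom ?S (FM ?S c) (regular_module ?S). \<forall>y\<in>carrier (FM ?S b). f y = g (B y)"
        by (intro fac) auto
    qed (use \<open>\<And>y. y \<in> carrier (FM ?S a) \<Longrightarrow> diff T (n + 1) (h (A y)) = \<zero>\<^bsub>obj T n\<^esub>\<close> in auto)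
    then show ?thesis using that by blast
  qed
  have hg: "(\<lambda>x. h0 (g0 x)) \<in> mod_hom ?S (obj T n) (obj T n)"
    and dk: "(\<lambda>x. diff T (n + 1) (k x)) \<in> mod_hom ?S (obj T n) (obj T n)"
    by (rule mod_hom_comp[OF g0(1) h0(1)] mod_hom_comp[OF k d1])+
  let ?f = "\<lambda>x. x \<ominus>\<^bsub>obj T n\<^esub> h0 (g0 x) \<ominus>\<^bsub>obj T n\<^esub> diff T (n + 1) (k x)"
  have f: "?f \<in> mod_hom ?S (obj T n) (obj T n)"
    by (intro mod_hom_diff left_module_op_group lX mod_hom_ident hg dk)
  have "?f (diff T (n + 1) z) = \<zero>\<^bsub>obj T n\<^esub>" if z: "z \<in> carrier (obj T (n + 1))" for z
  proof -
    let ?d = "diff T (n + 1)"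
    have cl: "h (g z) \<in> carrier (obj T (n + 1))" "k (?d z) \<in> carrier (obj T (n + 1))"
      "diff T (n + 2) (l z) \<in> carrier (obj T (n + 1))" "l z \<in> carrier (obj T (n + 2))"
      by (intro mod_hom_closed[OF h] mod_hom_closed[OF g] mod_hom_closed[OF k] mod_hom_closed[OF l]
          mod_hom_closed[OF d2] mod_hom_closed[OF d1] z)+
    have "?d z = ?d (h (g z)) \<oplus>\<^bsub>obj T n\<^esub> ?d (k (?d z)) \<oplus>\<^bsub>obj T n\<^esub> ?d (diff T (n + 2) (l z))"
      using arg_cong[OF hom[OF z], of ?d] cl by simp
    then have "?d z = ?d (h (g z)) \<oplus>\<^bsub>obj T n\<^esub> ?d (k (?d z))" using dd[OF cl(4)] cl by simp
    moreover have "h0 (g0 (?d z)) = ?d (h (g z))" using g0(2)[OF z] h0(2)[OF mod_hom_closed[OF g z]] by simp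
    ultimately have "?f (?d z) = (?d (h (g z)) \<oplus>\<^bsub>obj T n\<^esub> ?d (k (?d z))) \<ominus>\<^bsub>obj T n\<^esub> ?d (h (g z))
      \<ominus>\<^bsub>obj T n\<^esub> ?d (k (?d z))" by simp
    then show ?thesis using cl by (simp add: d1.N.ag)
  qed
  then obtain k0 where k0: "k0 \<in> mod_hom ?S (obj T (n - 1)) (obj T n)"
    "\<And>x. x \<in> carrier (obj T n) \<Longrightarrow> ?f x = k0 (diff T n x)"
    using Hom_acyclicD[OF totally_acyclic_term[OF T] f] by auto
  show ?thesis
  proof (rule fin_approxI[OF B g0(1) g h0(1) h k0(1) k])
    fix t assume t: "t \<in> carrier (obj T n)"
    have "h0 (g0 t) \<oplus>\<^bsub>obj T n\<^esub> ?f t \<oplus>\<^bsub>obj T n\<^esub> diff T (n + 1) (k t) = t"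
      using t mod_hom_closed[OF hg t] mod_hom_closed[OF dk t] by (simp add: d1.N.ag)
    then show "t = h0 (g0 t) \<oplus>\<^bsub>obj T n\<^esub> k0 (diff T n t) \<oplus>\<^bsub>obj T n\<^esub> diff T (n + 1) (k t)"
      using k0(2)[OF t] by simp
  qed (use g0 h0 in auto)
qed

text \<open>The approximation climbs on \<open>Q\<close>, where degree 0 is governed by
  \<open>M\<close>, passes to \<open>T\<close> where the two agree, and descends on
  \<open>T\<close>, where Hom into projective modules is exact.\<close>

lemma complete_resolution_fin_approx:
  assumes R: "noetherian R" and fg: "fin_gen (opp R) M (carrier M)"
    and cr: "complete_projective_resolution (opp R) T \<tau> Q \<pi> M"
  shows "fin_approx (opp R) T n"
proof -
  let ?S = "opp R"
  have R': "ring R" "left_noetherian R" "ring ?S" "left_noetherian ?S"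
    using R ring_opp by (auto simp: noetherian_def)
  have T: "totally_acyclic ?S T" and Q: "projective_resolution ?S Q \<pi> M" and \<tau>: "chain_map ?S T Q \<tau>"
    using cr by (auto simp: complete_projective_resolution_def)
  obtain m where m: "\<And>n. n \<ge> m \<Longrightarrow> \<tau> n \<in> mod_iso ?S (obj T n) (obj Q n)"
    using cr unfolding complete_projective_resolution_def by blast
  have cQ: "is_cplx ?S Q" "\<And>n. projective_module ?S (obj Q n)" "\<And>n. n > 0 \<Longrightarrow> acyclic_at Q n"
    using Q by (auto simp: projective_resolution_def)
  have cT: "is_cplx ?S T" using T by (simp add: totally_acyclic_def)
  have "fin_approx ?S Q n" if "0 \<le> n" for n
    using that
  proof (induction n rule: int_ge_induct)
    case base
    show ?case by (rule fin_approx_resolution_zero[OF R'(3,4) Q fg])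
  next
    case (step n)
    then show ?case by (intro fin_approx_up R' cQ) auto
  qed
  \<comment> \<open>The bound is \<open>m + 1\<close> because the transfer in degree
    \<open>n\<close> uses \<tau> in degree \<open>n - 1\<close> too; the bound 0 is where the climb
    on \<open>Q\<close> begins.\<close>
  then have hi: "fin_approx ?S T n" if "n \<ge> max (m + 1) 0" for n
    using that by (intro fin_approx_transfer[OF cT cQ(1) \<tau> m]) auto
  show ?thesis
  proof (cases "n \<ge> max (m + 1) 0")
    case False
    then have "n \<le> max (m + 1) 0" by linarith
    then show ?thesis
    proof (induction n rule: int_le_induct)
      case base
      show ?case by (rule hi) simp
    next
      case (step n)
      then show ?case using fin_approx_down[OF R'(1,2) T, of "n - 1"] by simp
    qed
  qed (rule hi)
qed

section \<open>Tensor products\<close>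

lemma free_product_simps [simp]:
  "c \<oplus>\<^bsub>free_product_module \<eta> X Y\<^esub> d = c + d" "\<zero>\<^bsub>free_product_module \<eta> X Y\<^esub> = 0"
  "a \<odot>\<^bsub>free_product_module \<eta> X Y\<^esub> c = frag_extend (\<lambda>(x, y). frag_of (\<eta> a \<odot>\<^bsub>X\<^esub> x, y)) c"
  "c \<in> carrier (free_product_module \<eta> X Y) \<longleftrightarrow> Poly_Mapping.keys c \<subseteq> carrier X \<times> carrier Y"
  by (simp_all add: free_product_module_def)

lemma keys_frag_extend_subset:
  assumes "Poly_Mapping.keys c \<subseteq> A" "\<And>x. x \<in> A \<Longrightarrow> Poly_Mapping.keys (f x) \<subseteq> B"
  shows "Poly_Mapping.keys (frag_extend f c) \<subseteq> B"
  using keys_frag_extend[of f c] assms by fastforce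

lemma keys_diff_subset: "\<lbrakk>Poly_Mapping.keys c \<subseteq> A; Poly_Mapping.keys d \<subseteq> A\<rbrakk> \<Longrightarrow> Poly_Mapping.keys (c - d) \<subseteq> A"
  and keys_add_subset: "\<lbrakk>Poly_Mapping.keys c \<subseteq> A; Poly_Mapping.keys d \<subseteq> A\<rbrakk> \<Longrightarrow> Poly_Mapping.keys (c + d) \<subseteq> A"
  using keys_diff[of c d] Poly_Mapping.keys_add[of c d] by auto

lemma frag_additive_eq:
  fixes f g :: "('a \<Rightarrow>\<^sub>0 int) \<Rightarrow> 'b \<Rightarrow>\<^sub>0 int"
  assumes "Poly_Mapping.keys c \<subseteq> A" "\<And>x. x \<in> A \<Longrightarrow> f (frag_of x) = g (frag_of x)"
    "\<And>c d. f (c - d) = f c - f d" "\<And>c d. g (c - d) = g c - g d"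
  shows "f c = g c"
  using assms(1)
proof (induction c rule: frag_induction)
  case zero
  show ?case using assms(3)[of 0 0] assms(4)[of 0 0] by simp
qed (simp_all add: assms)

definition tensor_gens :: "'r ring \<Rightarrow> ('r, 'x) module \<Rightarrow> ('r, 'y) module \<Rightarrow> ('x \<times> 'y \<Rightarrow>\<^sub>0 int) set" where
  "tensor_gens R X Y = {frag_of (x \<oplus>\<^bsub>X\<^esub> x', y) - frag_of (x, y) - frag_of (x', y) | x x' y.
         x \<in> carrier X \<and> x' \<in> carrier X \<and> y \<in> carrier Y} \<union>
      {frag_of (x, y \<oplus>\<^bsub>Y\<^esub> y') - frag_of (x, y) - frag_of (x, y') | x y y'.
         x \<in> carrier X \<and> y \<in> carrier Y \<and> y' \<in> carrier Y} \<union>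
      {frag_of (r \<odot>\<^bsub>X\<^esub> x, y) - frag_of (x, r \<odot>\<^bsub>Y\<^esub> y) | r x y.
         r \<in> carrier R \<and> x \<in> carrier X \<and> y \<in> carrier Y}"

lemma tensor_relations_generate:
  "tensor_relations R X Y = generate (free_Abelian_group (carrier X \<times> carrier Y)) (tensor_gens R X Y)"
  by (simp add: tensor_relations_def tensor_gens_def)

lemma tensor_gensE:
  assumes "d \<in> tensor_gens R X Y"
  obtains (left) x x' y where "x \<in> carrier X" "x' \<in> carrier X" "y \<in> carrier Y"
      "d = frag_of (x \<oplus>\<^bsub>X\<^esub> x', y) - frag_of (x, y) - frag_of (x', y)"
    | (right) x y y' where "x \<in> carrier X" "y \<in> carrier Y" "y' \<in> carrier Y"
      "d = frag_of (x, y \<oplus>\<^bsub>Y\<^esub> y') - frag_of (x, y) - frag_of (x, y')"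
    | (middle) r x y where "r \<in> carrier R" "x \<in> carrier X" "y \<in> carrier Y"
      "d = frag_of (r \<odot>\<^bsub>X\<^esub> x, y) - frag_of (x, r \<odot>\<^bsub>Y\<^esub> y)"
  using assms unfolding tensor_gens_def by blast

lemma tensor_gens_keys:
  assumes "left_module S X" "left_module R Y" "carrier S = carrier R" "d \<in> tensor_gens R X Y"
  shows "Poly_Mapping.keys d \<subseteq> carrier X \<times> carrier Y"
proof -
  interpret X: left_module S X by fact
  interpret Y: left_module R Y by fact
  show ?thesis using assms(4)
    by (cases rule: tensor_gensE; hypsubst)
      (intro keys_diff_subset; simp add: keys_frag_of assms(3) X.smult_closed Y.smult_closed)+
qed

locale k_algebra =
  fixes k :: "'k ring" and R :: "'r ring" and \<eta> :: "'k \<Rightarrow> 'r"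
  assumes alg: "ring_algebra k R \<eta>"
begin

lemma ring_R: "ring R" and eta_closed: "a \<in> carrier k \<Longrightarrow> \<eta> a \<in> carrier R"
  and eta_central: "\<lbrakk>a \<in> carrier k; r \<in> carrier R\<rbrakk> \<Longrightarrow> \<eta> a \<otimes>\<^bsub>R\<^esub> r = r \<otimes>\<^bsub>R\<^esub> \<eta> a"
  using alg by (auto simp: ring_algebra_def ring_hom_def)

abbreviation "S \<equiv> opp R"

text \<open>Centrality of the image of \<eta> is what lets \<open>k\<close> act on the first tensor
  factor by module endomorphisms.\<close>

lemma eta_hom:
  assumes X: "left_module S X" and a: "a \<in> carrier k"
  shows "(\<lambda>x. \<eta> a \<odot>\<^bsub>X\<^esub> x) \<in> mod_hom S X X"
proof -
  interpret X: left_module S X by fact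
  show ?thesis
  proof (rule mod_homI)
    fix r x assume r: "r \<in> carrier S" and x: "x \<in> carrier X"
    have "\<eta> a \<odot>\<^bsub>X\<^esub> (r \<odot>\<^bsub>X\<^esub> x) = (\<eta> a \<otimes>\<^bsub>S\<^esub> r) \<odot>\<^bsub>X\<^esub> x"
      using X.smult_assoc[of "\<eta> a" r x] eta_closed[OF a] r x by simp
    also have "\<dots> = (r \<otimes>\<^bsub>S\<^esub> \<eta> a) \<odot>\<^bsub>X\<^esub> x" using eta_central[OF a] r by simp
    also have "\<dots> = r \<odot>\<^bsub>X\<^esub> (\<eta> a \<odot>\<^bsub>X\<^esub> x)" using X.smult_assoc[of r "\<eta> a" x] eta_closed[OF a] r x by simp
    finally show "\<eta> a \<odot>\<^bsub>X\<^esub> (r \<odot>\<^bsub>X\<^esub> x) = r \<odot>\<^bsub>X\<^esub> (\<eta> a \<odot>\<^bsub>X\<^esub> x)" .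
  qed (use eta_closed[OF a] in \<open>simp_all add: X.smult_closed X.smult_r_distr\<close>)
qed

lemma free_product_op_group:
  assumes "left_module S X"
  shows "op_group k (free_product_module \<eta> X Y)"
proof -
  interpret X: left_module S X by fact
  let ?F = "free_product_module \<eta> X Y"
  have ab: "abelian_group ?F"
  proof (rule abelian_groupI)
    show "\<exists>d\<in>carrier ?F. d \<oplus>\<^bsub>?F\<^esub> c = \<zero>\<^bsub>?F\<^esub>" if "c \<in> carrier ?F" for c
      using that by (intro bexI[of _ "- c"]) auto
  qed (use Poly_Mapping.keys_add in \<open>fastforce simp: algebra_simps\<close>)+
  have "Poly_Mapping.keys (frag_extend (\<lambda>(x, y). frag_of (\<eta> a \<odot>\<^bsub>X\<^esub> x, y)) c) \<subseteq> carrier X \<times> carrier Y"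
    if "a \<in> carrier k" "Poly_Mapping.keys c \<subseteq> carrier X \<times> carrier Y" for a c
    using that eta_closed by (intro keys_frag_extend_subset) (auto simp: X.smult_closed keys_frag_of)
  then show ?thesis
    using ab by (intro op_group.intro op_group_axioms.intro) (simp_all add: frag_extend_add)
qed

lemma free_product_neg:
  assumes "left_module S X" "c \<in> carrier (free_product_module \<eta> X Y)"
  shows "\<ominus>\<^bsub>free_product_module \<eta> X Y\<^esub> c = - c"
proof -
  interpret F: op_group k "free_product_module \<eta> X Y" by (rule free_product_op_group) fact
  show ?thesis using assms by (intro F.minus_equality) auto
qed

lemma tensor_relations_map:
  assumes X: "left_module S X" and Y: "left_module R Y"
    and A: "op_group K A" and L: "submodule L K A"
    and cl: "\<And>c. Poly_Mapping.keys c \<subseteq> carrier X \<times> carrier Y \<Longrightarrow> \<Phi> c \<in> carrier A"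
    and add: "\<And>c d. \<lbrakk>Poly_Mapping.keys c \<subseteq> carrier X \<times> carrier Y; Poly_Mapping.keys d \<subseteq> carrier X \<times> carrier Y\<rbrakk>
      \<Longrightarrow> \<Phi> (c + d) = \<Phi> c \<oplus>\<^bsub>A\<^esub> \<Phi> d"
    and l: "\<And>x x' y. \<lbrakk>x \<in> carrier X; x' \<in> carrier X; y \<in> carrier Y\<rbrakk> \<Longrightarrow>
      \<Phi> (frag_of (x \<oplus>\<^bsub>X\<^esub> x', y) - frag_of (x, y) - frag_of (x', y)) \<in> L"
    and r: "\<And>x y y'. \<lbrakk>x \<in> carrier X; y \<in> carrier Y; y' \<in> carrier Y\<rbrakk> \<Longrightarrow>
      \<Phi> (frag_of (x, y \<oplus>\<^bsub>Y\<^esub> y') - frag_of (x, y) - frag_of (x, y')) \<in> L"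
    and m: "\<And>r x y. \<lbrakk>r \<in> carrier R; x \<in> carrier X; y \<in> carrier Y\<rbrakk> \<Longrightarrow>
      \<Phi> (frag_of (r \<odot>\<^bsub>X\<^esub> x, y) - frag_of (x, r \<odot>\<^bsub>Y\<^esub> y)) \<in> L"
    and c: "c \<in> tensor_relations R X Y"
  shows "Poly_Mapping.keys c \<subseteq> carrier X \<times> carrier Y" "\<Phi> c \<in> L"
proof -
  interpret X: left_module S X by fact
  interpret Y: left_module R Y by fact
  interpret A: op_group K A by fact
  note sL = A.submoduleE[OF L]
  let ?C = "carrier X \<times> carrier Y"
  have \<Phi>0: "\<Phi> 0 = \<zero>\<^bsub>A\<^esub>" using add[of 0 0] cl[of 0] by simp
  have \<Phi>m: "\<Phi> (- c) = \<ominus>\<^bsub>A\<^esub> \<Phi> c" if "Poly_Mapping.keys c \<subseteq> ?C" for c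
    using that add[of "- c" c] cl[of c] cl[of "- c"] \<Phi>0 A.minus_equality[of "\<Phi> (- c)" "\<Phi> c"] by simp
  have gen: "Poly_Mapping.keys c \<subseteq> ?C \<and> \<Phi> c \<in> L" if "c \<in> tensor_gens R X Y" for c
  proof
    show "Poly_Mapping.keys c \<subseteq> ?C" using tensor_gens_keys[OF X Y _ that] by simp
    show "\<Phi> c \<in> L" using that by (cases rule: tensor_gensE) (simp_all add: l r m)
  qed
  have "Poly_Mapping.keys c \<subseteq> ?C \<and> \<Phi> c \<in> L"
    using c unfolding tensor_relations_generate
  proof (induction c rule: generate.induct)
    case one
    then show ?case using \<Phi>0 sL(2) by simp
  next
    case (incl c)
    then show ?case using gen by blast
  next
    case (inv c)
    then have "Poly_Mapping.keys c \<subseteq> ?C \<and> \<Phi> c \<in> L" using gen by blast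
    then show ?case using \<Phi>m[of c] sL(4) by simp
  next
    case (eng c d)
    then show ?case using add[of c d] sL(3) keys_add_subset[of c ?C d] by simp
  qed
  then show "Poly_Mapping.keys c \<subseteq> ?C" "\<Phi> c \<in> L" by auto
qed

lemma relations_zero: "0 \<in> tensor_relations R X Y"
  using generate.one[of "free_Abelian_group (carrier X \<times> carrier Y)"] by (simp add: tensor_relations_def)

lemma relations_add: "\<lbrakk>c \<in> tensor_relations R X Y; d \<in> tensor_relations R X Y\<rbrakk> \<Longrightarrow> c + d \<in> tensor_relations R X Y"
  using generate.eng[of c "free_Abelian_group (carrier X \<times> carrier Y)"] by (simp add: tensor_relations_def)

lemma relations_gens:
  "\<lbrakk>x \<in> carrier X; x' \<in> carrier X; y \<in> carrier Y\<rbrakk> \<Longrightarrow>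
     frag_of (x \<oplus>\<^bsub>X\<^esub> x', y) - frag_of (x, y) - frag_of (x', y) \<in> tensor_relations R X Y"
  "\<lbrakk>x \<in> carrier X; y \<in> carrier Y; y' \<in> carrier Y\<rbrakk> \<Longrightarrow>
     frag_of (x, y \<oplus>\<^bsub>Y\<^esub> y') - frag_of (x, y) - frag_of (x, y') \<in> tensor_relations R X Y"
  "\<lbrakk>r \<in> carrier R; x \<in> carrier X; y \<in> carrier Y\<rbrakk> \<Longrightarrow>
     frag_of (r \<odot>\<^bsub>X\<^esub> x, y) - frag_of (x, r \<odot>\<^bsub>Y\<^esub> y) \<in> tensor_relations R X Y"
  unfolding tensor_relations_generate by (rule generate.incl; unfold tensor_gens_def; blast)+

lemma relations_keys:
  assumes "left_module S X" "left_module R Y" "c \<in> tensor_relations R X Y"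
  shows "Poly_Mapping.keys c \<subseteq> carrier X \<times> carrier Y"
proof -
  have "tensor_gens R X Y \<subseteq> carrier (free_Abelian_group (carrier X \<times> carrier Y))"
    using tensor_gens_keys[OF assms(1,2)] by auto
  then have "c \<in> carrier (free_Abelian_group (carrier X \<times> carrier Y))"
    using group.generate_incl[OF group_free_Abelian_group] assms(3) unfolding tensor_relations_generate by blast
  then show ?thesis by simp
qed

lemma relations_minus:
  assumes "left_module S X" "left_module R Y" "c \<in> tensor_relations R X Y"
  shows "- c \<in> tensor_relations R X Y"
proof -
  let ?F = "free_Abelian_group (carrier X \<times> carrier Y)"
  interpret X: left_module S X by fact
  interpret Y: left_module R Y by fact
  interpret F: group ?F by simp
  have "subgroup (tensor_relations R X Y) ?F"
    unfolding tensor_relations_generate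
    by (rule F.generate_is_subgroup) (use tensor_gens_keys[OF assms(1,2)] in auto)
  then have "inv\<^bsub>?F\<^esub> c \<in> tensor_relations R X Y" using assms(3) by (rule subgroup.m_inv_closed)
  then show ?thesis using relations_keys[OF assms] by simp
qed

lemma frag_map_relations:
  assumes X: "left_module S X" and Y: "left_module R Y" and X2: "left_module S X2" and Y2: "left_module R Y2"
    and f: "f \<in> mod_hom S X X2" and g: "g \<in> mod_hom R Y Y2" and c: "c \<in> tensor_relations R X Y"
  shows "frag_extend (\<lambda>(x, y). frag_of (f x, g y)) c \<in> tensor_relations R X2 Y2"
proof -
  let ?\<Phi> = "frag_extend (\<lambda>(x, y). frag_of (f x, g y))"
  interpret X: left_module S X by fact
  interpret Y: left_module R Y by fact
  note fs = mod_hom_closed[OF f] mod_hom_add[OF f] mod_hom_smult[OF f] mod_hom_closed[OF g] mod_hom_add[OF g] mod_hom_smult[OF g]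
  have gen: "?\<Phi> d \<in> tensor_relations R X2 Y2" if "d \<in> tensor_gens R X Y" for d
    using that by (cases rule: tensor_gensE) (simp_all add: frag_extend_diff fs relations_gens)
  show ?thesis
    using c unfolding tensor_relations_generate[of R X Y]
  proof (induction c rule: generate.induct)
    case one
    then show ?case by (simp add: relations_zero)
  next
    case (incl d)
    then show ?case by (rule gen)
  next
    case (inv d)
    then have "Poly_Mapping.keys d \<subseteq> carrier X \<times> carrier Y" using tensor_gens_keys[OF X Y] by simp
    then show ?case using relations_minus[OF X2 Y2 gen[OF inv]] by (simp add: frag_extend_minus)
  next
    case (eng d e)
    then show ?case by (simp add: frag_extend_add relations_add)
  qed
qed

text \<open>The relations are stable under \<open>k\<close> because a scalar acts through an
  endomorphism of \<open>X\<close>, and maps of the factors preserve relations.\<close>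

lemma tensor_quot:
  assumes X: "left_module S X" and Y: "left_module R Y"
  shows "quot k (free_product_module \<eta> X Y) (tensor_relations R X Y)"
proof -
  interpret F: op_group k "free_product_module \<eta> X Y" by (rule free_product_op_group) fact
  have "frag_extend (\<lambda>(x, y). frag_of (\<eta> a \<odot>\<^bsub>X\<^esub> x, y)) c \<in> tensor_relations R X Y"
    if "a \<in> carrier k" "c \<in> tensor_relations R X Y" for a c
    using frag_map_relations[OF X Y X Y eta_hom[OF X that(1)] mod_hom_ident that(2)] .
  moreover have "\<ominus>\<^bsub>free_product_module \<eta> X Y\<^esub> c \<in> tensor_relations R X Y" if "c \<in> tensor_relations R X Y" for c
    using that relations_minus[OF X Y that] relations_keys[OF X Y that] free_product_neg[OF X, of c Y] by simp
  ultimately show ?thesis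
    using relations_keys[OF X Y] relations_zero relations_add
    by (intro quot.intro quot_axioms.intro F.op_group_axioms F.submoduleI) (simp_all add: subset_iff)
qed

lemma tensor_op_group: "\<lbrakk>left_module S X; left_module R Y\<rbrakk> \<Longrightarrow> op_group k (tensor_module \<eta> R X Y)"
  unfolding tensor_module_def using quot.quot_op_group[OF tensor_quot] .

definition tens where
  "tens X Y x y = tensor_relations R X Y +>\<^bsub>free_product_module \<eta> X Y\<^esub> frag_of (x, y)"

context
  fixes X :: "('r, 'x) module" and Y :: "('r, 'y) module"
  assumes X: "left_module S X" and Y: "left_module R Y"
begin

interpretation X: left_module S X by (rule X)
interpretation Y: left_module R Y by (rule Y)
interpretation Q: quot k "free_product_module \<eta> X Y" "tensor_relations R X Y" by (rule tensor_quot[OF X Y])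
interpretation T: op_group k "tensor_module \<eta> R X Y" by (rule tensor_op_group[OF X Y])

lemma tens_closed: "\<lbrakk>x \<in> carrier X; y \<in> carrier Y\<rbrakk> \<Longrightarrow> tens X Y x y \<in> carrier (tensor_module \<eta> R X Y)"
  by (simp add: tens_def tensor_module_def keys_frag_of)

lemma free_product_diff: "\<lbrakk>Poly_Mapping.keys c \<subseteq> carrier X \<times> carrier Y; Poly_Mapping.keys d \<subseteq> carrier X \<times> carrier Y\<rbrakk> \<Longrightarrow>
    c \<ominus>\<^bsub>free_product_module \<eta> X Y\<^esub> d = c - d"
  using free_product_neg[OF X, of d Y] by (simp add: Q.minus_eq)

lemma tens_add_left:
  assumes "x \<in> carrier X" "x' \<in> carrier X" "y \<in> carrier Y"
  shows "tens X Y (x \<oplus>\<^bsub>X\<^esub> x') y = tens X Y x y \<oplus>\<^bsub>tensor_module \<eta> R X Y\<^esub> tens X Y x' y"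
proof -
  have k: "Poly_Mapping.keys (frag_of (x, y) + frag_of (x', y)) \<subseteq> carrier X \<times> carrier Y"
    using assms by (intro keys_add_subset) (auto simp: keys_frag_of)
  show ?thesis unfolding tens_def tensor_module_def
    using assms k relations_gens(1)[OF assms] Q.coset_eq_iff[OF Q.sub]
    by (subst Q.quot_add) (auto simp: keys_frag_of free_product_diff algebra_simps)
qed

lemma tens_add_right:
  assumes "x \<in> carrier X" "y \<in> carrier Y" "y' \<in> carrier Y"
  shows "tens X Y x (y \<oplus>\<^bsub>Y\<^esub> y') = tens X Y x y \<oplus>\<^bsub>tensor_module \<eta> R X Y\<^esub> tens X Y x y'"
proof -
  have k: "Poly_Mapping.keys (frag_of (x, y) + frag_of (x, y')) \<subseteq> carrier X \<times> carrier Y"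
    using assms by (intro keys_add_subset) (auto simp: keys_frag_of)
  show ?thesis unfolding tens_def tensor_module_def
    using assms k relations_gens(2)[OF assms] Q.coset_eq_iff[OF Q.sub]
    by (subst Q.quot_add) (auto simp: keys_frag_of free_product_diff algebra_simps)
qed

lemma tens_balanced:
  assumes "r \<in> carrier R" "x \<in> carrier X" "y \<in> carrier Y"
  shows "tens X Y (r \<odot>\<^bsub>X\<^esub> x) y = tens X Y x (r \<odot>\<^bsub>Y\<^esub> y)"
  unfolding tens_def tensor_module_def
  using assms relations_gens(3)[OF assms] Q.coset_eq_iff[OF Q.sub]
  by (auto simp: keys_frag_of free_product_diff X.smult_closed Y.smult_closed)

lemma tens_zero_left [simp]: "y \<in> carrier Y \<Longrightarrow> tens X Y \<zero>\<^bsub>X\<^esub> y = \<zero>\<^bsub>tensor_module \<eta> R X Y\<^esub>"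
  using tens_add_left[of "\<zero>\<^bsub>X\<^esub>" "\<zero>\<^bsub>X\<^esub>" y] tens_closed[of "\<zero>\<^bsub>X\<^esub>" y] by simp

lemma tens_zero_right [simp]: "x \<in> carrier X \<Longrightarrow> tens X Y x \<zero>\<^bsub>Y\<^esub> = \<zero>\<^bsub>tensor_module \<eta> R X Y\<^esub>"
  using tens_add_right[of x "\<zero>\<^bsub>Y\<^esub>" "\<zero>\<^bsub>Y\<^esub>"] tens_closed[of x "\<zero>\<^bsub>Y\<^esub>"] by simp

lemma tens_minus_left: "\<lbrakk>x \<in> carrier X; y \<in> carrier Y\<rbrakk> \<Longrightarrow>
    tens X Y (\<ominus>\<^bsub>X\<^esub> x) y = \<ominus>\<^bsub>tensor_module \<eta> R X Y\<^esub> tens X Y x y"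
  using tens_add_left[of "\<ominus>\<^bsub>X\<^esub> x" x y] tens_closed
  by (intro T.minus_equality[symmetric]) (auto simp: X.M.l_neg)

text \<open>There are no cases for zero and negatives: zero is the tensor of two zeros, and a minus
  sign is absorbed by the first factor.\<close>

lemma tensor_induct [consumes 1, case_names tens add]:
  assumes u: "u \<in> carrier (tensor_module \<eta> R X Y)"
    and t: "\<And>x y. \<lbrakk>x \<in> carrier X; y \<in> carrier Y\<rbrakk> \<Longrightarrow> P (tens X Y x y)"
    and a: "\<And>u v. \<lbrakk>u \<in> carrier (tensor_module \<eta> R X Y); v \<in> carrier (tensor_module \<eta> R X Y); P u; P v\<rbrakk> \<Longrightarrow>
      P (u \<oplus>\<^bsub>tensor_module \<eta> R X Y\<^esub> v)"
  shows "P u"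
proof -
  let ?F = "free_product_module \<eta> X Y" and ?L = "tensor_relations R X Y"
  let ?q = "\<lambda>c. ?L +>\<^bsub>?F\<^esub> c"
  obtain c where c: "Poly_Mapping.keys c \<subseteq> carrier X \<times> carrier Y" "u = ?q c"
    using u by (auto simp: tensor_module_def quot_carrier)
  \<comment> \<open>Induction on formal sums proceeds by differences, so the property is carried
    along for the class of \<open>c\<close> and for that of \<open>- c\<close>.\<close>
  have "(Poly_Mapping.keys c \<subseteq> carrier X \<times> carrier Y \<and> P (?q c)) \<and> P (?q (- c))"
    using c(1)
  proof (induction c rule: frag_induction)
    case zero
    have "?q 0 = ?L" using Q.coset_zero[OF Q.sub] by simp
    also have "?L = tens X Y \<zero>\<^bsub>X\<^esub> \<zero>\<^bsub>Y\<^esub>" by (simp add: tensor_module_def)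
    finally have "?q 0 = tens X Y \<zero>\<^bsub>X\<^esub> \<zero>\<^bsub>Y\<^esub>" .
    then show ?case using t[of "\<zero>\<^bsub>X\<^esub>" "\<zero>\<^bsub>Y\<^esub>"] by simp
  next
    case (one z)
    obtain x y where z: "z = (x, y)" "x \<in> carrier X" "y \<in> carrier Y" using one by auto
    have "?q (- frag_of z) = tens X Y (\<ominus>\<^bsub>X\<^esub> x) y"
    proof -
      have "?q (frag_of z) \<oplus>\<^bsub>tensor_module \<eta> R X Y\<^esub> ?q (- frag_of z) = \<zero>\<^bsub>tensor_module \<eta> R X Y\<^esub>"
        unfolding tensor_module_def using one Q.coset_zero[OF Q.sub]
        by (subst Q.quot_add) (auto simp: keys_frag_of)
      then have "?q (- frag_of z) = \<ominus>\<^bsub>tensor_module \<eta> R X Y\<^esub> ?q (frag_of z)"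
        using one Q.quot_closed[of "- frag_of z"] Q.quot_closed[of "frag_of z"]
        by (intro T.minus_equality[symmetric]) (auto simp: tensor_module_def keys_frag_of T.a_comm[unfolded tensor_module_def])
      then show ?thesis using z tens_minus_left by (simp add: tens_def)
    qed
    moreover have "?q (frag_of z) = tens X Y x y" using z by (simp add: tens_def)
    ultimately show ?case using t z by (simp add: keys_frag_of)
  next
    case (diff b c)
    have kb: "b \<in> carrier ?F" "- b \<in> carrier ?F" "c \<in> carrier ?F" "- c \<in> carrier ?F" using diff by auto
    have "?q (b - c) = ?q b \<oplus>\<^bsub>tensor_module \<eta> R X Y\<^esub> ?q (- c)"
      "?q (- (b - c)) = ?q (- b) \<oplus>\<^bsub>tensor_module \<eta> R X Y\<^esub> ?q c"
      unfolding tensor_module_def by (subst Q.quot_add; use kb in simp)+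
    moreover have "?q b \<in> carrier (tensor_module \<eta> R X Y)" "?q (- b) \<in> carrier (tensor_module \<eta> R X Y)"
      "?q c \<in> carrier (tensor_module \<eta> R X Y)" "?q (- c) \<in> carrier (tensor_module \<eta> R X Y)"
      unfolding tensor_module_def by (rule Q.quot_closed, fact)+
    ultimately show ?case using diff a keys_diff_subset[of b _ c] by simp
  qed
  then show ?thesis using c by simp
qed

lemma tensor_additive_eq:
  assumes "u \<in> carrier (tensor_module \<eta> R X Y)"
    "\<And>x y. \<lbrakk>x \<in> carrier X; y \<in> carrier Y\<rbrakk> \<Longrightarrow> \<Phi> (tens X Y x y) = \<Psi> (tens X Y x y)"
    "\<And>u v. \<lbrakk>u \<in> carrier (tensor_module \<eta> R X Y); v \<in> carrier (tensor_module \<eta> R X Y)\<rbrakk> \<Longrightarrow>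
      \<Phi> (u \<oplus>\<^bsub>tensor_module \<eta> R X Y\<^esub> v) = add A (\<Phi> u) (\<Phi> v)"
    "\<And>u v. \<lbrakk>u \<in> carrier (tensor_module \<eta> R X Y); v \<in> carrier (tensor_module \<eta> R X Y)\<rbrakk> \<Longrightarrow>
      \<Psi> (u \<oplus>\<^bsub>tensor_module \<eta> R X Y\<^esub> v) = add A (\<Psi> u) (\<Psi> v)"
  shows "\<Phi> u = \<Psi> u"
  using assms(1) by (induction rule: tensor_induct) (simp_all add: assms)

text \<open>The target may have any operators and the map is merely additive, since the lemma serves
  to define evaluations with values in an \<open>R\<close>-module, where \<open>k\<close> is not
  given as a set of operators. The map is induced from the free abelian group on pairs.\<close>

lemma tensor_universal:
  assumes A: "op_group K A"
    and cl: "\<And>x y. \<lbrakk>x \<in> carrier X; y \<in> carrier Y\<rbrakk> \<Longrightarrow> b x y \<in> carrier A"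
    and l: "\<And>x x' y. \<lbrakk>x \<in> carrier X; x' \<in> carrier X; y \<in> carrier Y\<rbrakk> \<Longrightarrow> b (x \<oplus>\<^bsub>X\<^esub> x') y = b x y \<oplus>\<^bsub>A\<^esub> b x' y"
    and r: "\<And>x y y'. \<lbrakk>x \<in> carrier X; y \<in> carrier Y; y' \<in> carrier Y\<rbrakk> \<Longrightarrow> b x (y \<oplus>\<^bsub>Y\<^esub> y') = b x y \<oplus>\<^bsub>A\<^esub> b x y'"
    and m: "\<And>r x y. \<lbrakk>r \<in> carrier R; x \<in> carrier X; y \<in> carrier Y\<rbrakk> \<Longrightarrow> b (r \<odot>\<^bsub>X\<^esub> x) y = b x (r \<odot>\<^bsub>Y\<^esub> y)"
  shows "\<exists>\<Phi>. (\<forall>u\<in>carrier (tensor_module \<eta> R X Y). \<Phi> u \<in> carrier A) \<and>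
    (\<forall>u\<in>carrier (tensor_module \<eta> R X Y). \<forall>v\<in>carrier (tensor_module \<eta> R X Y).
       \<Phi> (u \<oplus>\<^bsub>tensor_module \<eta> R X Y\<^esub> v) = \<Phi> u \<oplus>\<^bsub>A\<^esub> \<Phi> v) \<and>
    (\<forall>x\<in>carrier X. \<forall>y\<in>carrier Y. \<Phi> (tens X Y x y) = b x y)"
proof -
  interpret A: op_group K A by fact
  let ?F = "free_product_module \<eta> X Y" and ?C = "carrier X \<times> carrier Y" and ?L = "tensor_relations R X Y"
  let ?q = "\<lambda>c. ?L +>\<^bsub>?F\<^esub> c"
  obtain h where h: "h \<in> hom (free_Abelian_group ?C) (add_monoid A)" and
    hb: "\<And>z. z \<in> ?C \<Longrightarrow> h (frag_of z) = (\<lambda>(x, y). b x y) z"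
    by (rule comm_group.free_Abelian_group_universal[OF A.a_comm_group, of "\<lambda>(x, y). b x y" ?C]) (use cl in auto)
  have hc: "h c \<in> carrier A" if "Poly_Mapping.keys c \<subseteq> ?C" for c
    using h that by (auto simp: hom_def)
  have ha: "h (c + d) = h c \<oplus>\<^bsub>A\<^esub> h d" if "Poly_Mapping.keys c \<subseteq> ?C" "Poly_Mapping.keys d \<subseteq> ?C" for c d
    using h that by (auto simp: hom_def)
  have hd: "h (c - d) = h c \<ominus>\<^bsub>A\<^esub> h d" if "Poly_Mapping.keys c \<subseteq> ?C" "Poly_Mapping.keys d \<subseteq> ?C" for c d
  proof -
    have "h (c - d) \<oplus>\<^bsub>A\<^esub> h d = h c" using ha[of "c - d" d] keys_diff_subset[OF that] that by simp
    then have "h c \<ominus>\<^bsub>A\<^esub> h d = (h (c - d) \<oplus>\<^bsub>A\<^esub> h d) \<ominus>\<^bsub>A\<^esub> h d" by simp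
    then show ?thesis using hc[OF keys_diff_subset[OF that]] hc[OF that(2)] by (simp add: A.ag)
  qed
  have h0: "h c = \<zero>\<^bsub>A\<^esub>" if "c \<in> ?L" for c
  proof -
    have "h c \<in> {\<zero>\<^bsub>A\<^esub>}"
    proof (rule tensor_relations_map(2)[OF X Y A A.zero_submodule hc ha _ _ _ that])
      fix x x' y assume *: "x \<in> carrier X" "x' \<in> carrier X" "y \<in> carrier Y"
      show "h (frag_of (x \<oplus>\<^bsub>X\<^esub> x', y) - frag_of (x, y) - frag_of (x', y)) \<in> {\<zero>\<^bsub>A\<^esub>}"
        using * keys_diff_subset[of "frag_of (x \<oplus>\<^bsub>X\<^esub> x', y)" ?C "frag_of (x, y)"]
        by (simp add: hd keys_frag_of hb l cl A.ag)
    next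
      fix x y y' assume *: "x \<in> carrier X" "y \<in> carrier Y" "y' \<in> carrier Y"
      show "h (frag_of (x, y \<oplus>\<^bsub>Y\<^esub> y') - frag_of (x, y) - frag_of (x, y')) \<in> {\<zero>\<^bsub>A\<^esub>}"
        using * keys_diff_subset[of "frag_of (x, y \<oplus>\<^bsub>Y\<^esub> y')" ?C "frag_of (x, y)"]
        by (simp add: hd keys_frag_of hb r cl A.ag)
    next
      fix r x y assume *: "r \<in> carrier R" "x \<in> carrier X" "y \<in> carrier Y"
      show "h (frag_of (r \<odot>\<^bsub>X\<^esub> x, y) - frag_of (x, r \<odot>\<^bsub>Y\<^esub> y)) \<in> {\<zero>\<^bsub>A\<^esub>}"
        using * by (simp add: hd keys_frag_of hb m cl X.smult_closed Y.smult_closed A.ag)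
    qed auto
    then show ?thesis by simp
  qed
  \<comment> \<open>The value on a coset is read off from an arbitrary representative;
    \<open>h0\<close> shows that the choice does not matter.\<close>
  define \<Phi> where "\<Phi> C = h (SOME c. c \<in> C)" for C
  have \<Phi>: "\<Phi> (?q c) = h c" if c: "Poly_Mapping.keys c \<subseteq> ?C" for c
  proof -
    have "(SOME d. d \<in> ?q c) \<in> ?q c" using Q.coset_self[OF Q.sub, of c] c by (intro someI) auto
    then obtain d where d: "(SOME d. d \<in> ?q c) = d" "Poly_Mapping.keys d \<subseteq> ?C" "d - c \<in> ?L"
      using Q.coset_mem_iff[OF Q.sub, of c] c free_product_diff by auto
    have "h d \<ominus>\<^bsub>A\<^esub> h c = \<zero>\<^bsub>A\<^esub>" using h0[OF d(3)] hd[OF d(2) c] by simp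
    then show ?thesis using A.eq_iff_diff[of "h d" "h c"] hc d c by (simp add: \<Phi>_def)
  qed
  have rep: "\<exists>c. Poly_Mapping.keys c \<subseteq> ?C \<and> u = ?q c" if "u \<in> carrier (tensor_module \<eta> R X Y)" for u
  proof -
    from that obtain c where "c \<in> carrier ?F" "u = ?q c" unfolding tensor_module_def quot_carrier by (rule imageE)
    then show ?thesis by (intro exI[of _ c]) simp
  qed
  show ?thesis
  proof (intro exI[of _ \<Phi>] conjI ballI)
    fix u assume "u \<in> carrier (tensor_module \<eta> R X Y)"
    from rep[OF this] obtain c where c: "Poly_Mapping.keys c \<subseteq> ?C" "u = ?q c" by blast
    show "\<Phi> u \<in> carrier A" using c \<Phi> hc by simp
    fix v assume "v \<in> carrier (tensor_module \<eta> R X Y)"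
    from rep[OF this] obtain d where d: "Poly_Mapping.keys d \<subseteq> ?C" "v = ?q d" by blast
    have "u \<oplus>\<^bsub>tensor_module \<eta> R X Y\<^esub> v = ?q (c + d)"
      unfolding c d tensor_module_def using c d by (subst Q.quot_add) auto
    then show "\<Phi> (u \<oplus>\<^bsub>tensor_module \<eta> R X Y\<^esub> v) = \<Phi> u \<oplus>\<^bsub>A\<^esub> \<Phi> v"
      using c d \<Phi> ha \<Phi>[OF keys_add_subset[OF c(1) d(1)]] by simp
  next
    fix x y assume "x \<in> carrier X" "y \<in> carrier Y"
    then show "\<Phi> (tens X Y x y) = b x y" using \<Phi>[of "frag_of (x, y)"] hb[of "(x, y)"] by (simp add: tens_def keys_frag_of)
  qed
qed

end

lemma tensor_map:
  assumes X: "left_module S X" and Y: "left_module R Y" and X2: "left_module S X2" and Y2: "left_module R Y2"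
    and f: "f \<in> mod_hom S X X2" and g: "g \<in> mod_hom R Y Y2"
  shows tensor_map_hom: "tensor_map \<eta> R X2 Y2 f g \<in> mod_hom k (tensor_module \<eta> R X Y) (tensor_module \<eta> R X2 Y2)"
    and tensor_map_tens: "\<lbrakk>x \<in> carrier X; y \<in> carrier Y\<rbrakk> \<Longrightarrow>
      tensor_map \<eta> R X2 Y2 f g (tens X Y x y) = tens X2 Y2 (f x) (g y)"
proof -
  interpret X: left_module S X by fact
  let ?F = "free_product_module \<eta> X Y" and ?F2 = "free_product_module \<eta> X2 Y2"
  note q = tensor_quot[OF X Y] and q2 = tensor_quot[OF X2 Y2]
  let ?\<Phi> = "frag_extend (\<lambda>(x, y). frag_of (f x, g y))"
  have hom: "?\<Phi> \<in> mod_hom k ?F ?F2"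
  proof (rule mod_homI)
    fix c assume c: "c \<in> carrier ?F"
    have "Poly_Mapping.keys (?\<Phi> c) \<subseteq> carrier X2 \<times> carrier Y2"
      using c mod_hom_closed[OF f] mod_hom_closed[OF g]
      by (intro keys_frag_extend_subset[of c "carrier X \<times> carrier Y"]) (auto simp: keys_frag_of)
    then show "?\<Phi> c \<in> carrier ?F2" by simp
    fix a assume a: "a \<in> carrier k"
    show "?\<Phi> (a \<odot>\<^bsub>?F\<^esub> c) = a \<odot>\<^bsub>?F2\<^esub> ?\<Phi> c"
      using c eta_closed[OF a] mod_hom_smult[OF f]
      by (intro frag_additive_eq[of c "carrier X \<times> carrier Y" "\<lambda>c. ?\<Phi> (a \<odot>\<^bsub>?F\<^esub> c)" "\<lambda>c. a \<odot>\<^bsub>?F2\<^esub> ?\<Phi> c"])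
        (auto simp: frag_extend_diff)
  qed (simp add: frag_extend_add)
  have rel: "?\<Phi> c \<in> tensor_relations R X2 Y2" if "c \<in> tensor_relations R X Y" for c
    by (rule frag_map_relations[OF X Y X2 Y2 f g that])
  show "tensor_map \<eta> R X2 Y2 f g \<in> mod_hom k (tensor_module \<eta> R X Y) (tensor_module \<eta> R X2 Y2)"
    unfolding tensor_map_def tensor_module_def by (rule mod_hom_quot_map(1)[OF q q2 hom rel])
  show "tensor_map \<eta> R X2 Y2 f g (tens X Y x y) = tens X2 Y2 (f x) (g y)" if "x \<in> carrier X" "y \<in> carrier Y"
    using mod_hom_quot_map(2)[OF q q2 hom rel, of "frag_of (x, y)"] that
    by (simp add: tensor_map_def tens_def keys_frag_of)
qed

end

text \<open>Evaluations of tensors are additive between groups with different operators, so they are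
  not instances of \<open>op_hom\<close>; this lemma and the next replace it.\<close>

lemma additive_zero:
  assumes "op_group K A" "op_group L B" "\<And>x. x \<in> carrier A \<Longrightarrow> f x \<in> carrier B"
    "\<And>x y. \<lbrakk>x \<in> carrier A; y \<in> carrier A\<rbrakk> \<Longrightarrow> f (x \<oplus>\<^bsub>A\<^esub> y) = f x \<oplus>\<^bsub>B\<^esub> f y"
  shows "f \<zero>\<^bsub>A\<^esub> = \<zero>\<^bsub>B\<^esub>"
proof -
  interpret A: op_group K A by fact
  interpret B: op_group L B by fact
  show ?thesis using assms(3)[of "\<zero>\<^bsub>A\<^esub>"] assms(4)[of "\<zero>\<^bsub>A\<^esub>" "\<zero>\<^bsub>A\<^esub>"] by simp
qed

lemma additive_finsum:
  assumes "op_group K A" "op_group L B" "\<And>x. x \<in> carrier A \<Longrightarrow> f x \<in> carrier B"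
    "\<And>x y. \<lbrakk>x \<in> carrier A; y \<in> carrier A\<rbrakk> \<Longrightarrow> f (x \<oplus>\<^bsub>A\<^esub> y) = f x \<oplus>\<^bsub>B\<^esub> f y"
    and "finite I" "\<And>i. i \<in> I \<Longrightarrow> g i \<in> carrier A"
  shows "f (finsum A g I) = finsum B (\<lambda>i. f (g i)) I"
proof -
  interpret A: op_group K A by fact
  interpret B: op_group L B by fact
  show ?thesis using assms(5,6)
  proof (induction I rule: finite_induct)
    case empty
    then show ?case using additive_zero[OF assms(1-4)] by simp
  next
    case (insert i I)
    then show ?case using assms(3,4) by (simp add: A.finsum_insert B.finsum_insert Pi_def A.finsum_closed)
  qed
qed

context k_algebra
begin

lemma tensor_map_closed:
  assumes "left_module S X" "left_module R Y" "left_module S X2" "left_module R Y2"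
    "f \<in> mod_hom S X X2" "g \<in> mod_hom R Y Y2" "u \<in> carrier (tensor_module \<eta> R X Y)"
  shows "tensor_map \<eta> R X2 Y2 f g u \<in> carrier (tensor_module \<eta> R X2 Y2)"
  using mod_hom_closed[OF tensor_map_hom[OF assms(1-6)] assms(7)] .

lemma tensor_map_cong:
  assumes "left_module S X" "left_module R Y" "left_module S X2" "left_module R Y2"
    "f \<in> mod_hom S X X2" "g \<in> mod_hom R Y Y2" "f' \<in> mod_hom S X X2" "g' \<in> mod_hom R Y Y2"
    "\<And>x. x \<in> carrier X \<Longrightarrow> f x = f' x" "\<And>y. y \<in> carrier Y \<Longrightarrow> g y = g' y"
    "u \<in> carrier (tensor_module \<eta> R X Y)"
  shows "tensor_map \<eta> R X2 Y2 f g u = tensor_map \<eta> R X2 Y2 f' g' u"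
  using assms(11)
  by (rule tensor_additive_eq[OF assms(1,2), where A = "tensor_module \<eta> R X2 Y2"])
    (simp_all add: tensor_map_tens[OF assms(1-4)] assms(5-10)
      mod_hom_add[OF tensor_map_hom[OF assms(1-6)]] mod_hom_add[OF tensor_map_hom[OF assms(1-4,7,8)]])

lemma tensor_map_comp:
  assumes "left_module S X" "left_module R Y" "left_module S X2" "left_module R Y2"
    "left_module S X3" "left_module R Y3"
    "f \<in> mod_hom S X X2" "g \<in> mod_hom R Y Y2" "f' \<in> mod_hom S X2 X3" "g' \<in> mod_hom R Y2 Y3"
    "u \<in> carrier (tensor_module \<eta> R X Y)"
  shows "tensor_map \<eta> R X3 Y3 f' g' (tensor_map \<eta> R X2 Y2 f g u) =
    tensor_map \<eta> R X3 Y3 (\<lambda>x. f' (f x)) (\<lambda>y. g' (g y)) u"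
proof -
  note h1 = tensor_map_hom[OF assms(1-4,7,8)] and h2 = tensor_map_hom[OF assms(3-6,9,10)]
    and h3 = tensor_map_hom[OF assms(1,2,5,6) mod_hom_comp[OF assms(7,9)] mod_hom_comp[OF assms(8,10)]]
  show ?thesis
    using assms(11)
    by (rule tensor_additive_eq[OF assms(1,2), where A = "tensor_module \<eta> R X3 Y3"])
      (simp_all add: tensor_map_tens[OF assms(1-4,7,8)] tensor_map_tens[OF assms(3-6,9,10)]
        tensor_map_tens[OF assms(1,2,5,6) mod_hom_comp[OF assms(7,9)] mod_hom_comp[OF assms(8,10)]]
        mod_hom_closed[OF assms(7)] mod_hom_closed[OF assms(8)]
        mod_hom_add[OF h1] mod_hom_add[OF h2] mod_hom_add[OF h3] mod_hom_closed[OF h1])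
qed

lemma tensor_map_ident:
  assumes "left_module S X" "left_module R Y" "f \<in> mod_hom S X X" "g \<in> mod_hom R Y Y"
    "\<And>x. x \<in> carrier X \<Longrightarrow> f x = x" "\<And>y. y \<in> carrier Y \<Longrightarrow> g y = y"
    "u \<in> carrier (tensor_module \<eta> R X Y)"
  shows "tensor_map \<eta> R X Y f g u = u"
  using assms(7)
  by (rule tensor_additive_eq[OF assms(1,2), where A = "tensor_module \<eta> R X Y"])
    (simp_all add: tensor_map_tens[OF assms(1,2,1,2,3,4)] assms(5,6)
      mod_hom_add[OF tensor_map_hom[OF assms(1,2,1,2,3,4)]])

lemma tensor_map_add_left:
  assumes "left_module S X" "left_module R Y" "left_module S X2" "left_module R Y2"
    "f \<in> mod_hom S X X2" "f' \<in> mod_hom S X X2" "g \<in> mod_hom R Y Y2"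
    "u \<in> carrier (tensor_module \<eta> R X Y)"
  shows "tensor_map \<eta> R X2 Y2 (\<lambda>x. f x \<oplus>\<^bsub>X2\<^esub> f' x) g u =
    tensor_map \<eta> R X2 Y2 f g u \<oplus>\<^bsub>tensor_module \<eta> R X2 Y2\<^esub> tensor_map \<eta> R X2 Y2 f' g u"
proof -
  interpret T: op_group k "tensor_module \<eta> R X2 Y2" by (rule tensor_op_group[OF assms(3,4)])
  have s: "(\<lambda>x. f x \<oplus>\<^bsub>X2\<^esub> f' x) \<in> mod_hom S X X2"
    by (intro mod_hom_sum left_module_op_group assms)
  note h1 = tensor_map_hom[OF assms(1-4,5,7)] and h2 = tensor_map_hom[OF assms(1-4,6,7)]
    and h3 = tensor_map_hom[OF assms(1-4) s assms(7)]
  show ?thesis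
    using assms(8)
  proof (rule tensor_additive_eq[OF assms(1,2), where A = "tensor_module \<eta> R X2 Y2"])
    fix x y assume "x \<in> carrier X" "y \<in> carrier Y"
    then show "tensor_map \<eta> R X2 Y2 (\<lambda>x. f x \<oplus>\<^bsub>X2\<^esub> f' x) g (tens X Y x y) =
      tensor_map \<eta> R X2 Y2 f g (tens X Y x y) \<oplus>\<^bsub>tensor_module \<eta> R X2 Y2\<^esub> tensor_map \<eta> R X2 Y2 f' g (tens X Y x y)"
      using mod_hom_closed[OF assms(5)] mod_hom_closed[OF assms(6)] mod_hom_closed[OF assms(7)]
      by (simp add: tensor_map_tens[OF assms(1-4,5,7)] tensor_map_tens[OF assms(1-4,6,7)]
        tensor_map_tens[OF assms(1-4) s assms(7)] tens_add_left[OF assms(3,4)])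
  next
    fix u v assume "u \<in> carrier (tensor_module \<eta> R X Y)" "v \<in> carrier (tensor_module \<eta> R X Y)"
    then show "tensor_map \<eta> R X2 Y2 f g (u \<oplus>\<^bsub>tensor_module \<eta> R X Y\<^esub> v) \<oplus>\<^bsub>tensor_module \<eta> R X2 Y2\<^esub>
        tensor_map \<eta> R X2 Y2 f' g (u \<oplus>\<^bsub>tensor_module \<eta> R X Y\<^esub> v) =
      (tensor_map \<eta> R X2 Y2 f g u \<oplus>\<^bsub>tensor_module \<eta> R X2 Y2\<^esub> tensor_map \<eta> R X2 Y2 f' g u) \<oplus>\<^bsub>tensor_module \<eta> R X2 Y2\<^esub>
      (tensor_map \<eta> R X2 Y2 f g v \<oplus>\<^bsub>tensor_module \<eta> R X2 Y2\<^esub> tensor_map \<eta> R X2 Y2 f' g v)"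
      using mod_hom_closed[OF h1] mod_hom_closed[OF h2]
      by (simp add: mod_hom_add[OF h1] mod_hom_add[OF h2] T.a_ac)
  qed (simp add: mod_hom_add[OF h3])
qed

lemma tensor_map_zero:
  assumes "left_module S X" "left_module R Y" "left_module S X2" "left_module R Y2"
    "f \<in> mod_hom S X X2" "g \<in> mod_hom R Y Y2"
    "(\<forall>x\<in>carrier X. f x = \<zero>\<^bsub>X2\<^esub>) \<or> (\<forall>y\<in>carrier Y. g y = \<zero>\<^bsub>Y2\<^esub>)"
    "u \<in> carrier (tensor_module \<eta> R X Y)"
  shows "tensor_map \<eta> R X2 Y2 f g u = \<zero>\<^bsub>tensor_module \<eta> R X2 Y2\<^esub>"
proof -
  interpret T: op_group k "tensor_module \<eta> R X2 Y2" by (rule tensor_op_group[OF assms(3,4)])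
  show ?thesis
    using assms(8)
    by (rule tensor_additive_eq[OF assms(1,2), where A = "tensor_module \<eta> R X2 Y2"])
      (use assms(7) in \<open>auto simp: tensor_map_tens[OF assms(1-6)] tens_zero_left[OF assms(3,4)]
        tens_zero_right[OF assms(3,4)] mod_hom_closed[OF assms(5)] mod_hom_closed[OF assms(6)]
        mod_hom_add[OF tensor_map_hom[OF assms(1-6)]]\<close>)
qed

section \<open>Contractions of tensors, dual bases and flatness of projective modules\<close>

text \<open>Contraction of the first factor by a functional \<chi>, that is the map X \<otimes> Y
  \<rightarrow> R \<otimes> Y = Y. For \<chi> in a dual basis of \<open>X\<close> these are the
  coordinates of a tensor. The choice operator names the map that \<open>tensor_universal\<close>
  provides.\<close>

definition tensor_eval where
  "tensor_eval X Y \<chi> = (SOME \<Phi>. (\<forall>u\<in>carrier (tensor_module \<eta> R X Y). \<Phi> u \<in> carrier Y) \<and>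
    (\<forall>u\<in>carrier (tensor_module \<eta> R X Y). \<forall>v\<in>carrier (tensor_module \<eta> R X Y).
       \<Phi> (u \<oplus>\<^bsub>tensor_module \<eta> R X Y\<^esub> v) = \<Phi> u \<oplus>\<^bsub>Y\<^esub> \<Phi> v) \<and>
    (\<forall>x\<in>carrier X. \<forall>y\<in>carrier Y. \<Phi> (tens X Y x y) = \<chi> x \<odot>\<^bsub>Y\<^esub> y))"

lemma tensor_eval:
  assumes X: "left_module S X" and Y: "left_module R Y" and \<chi>: "\<chi> \<in> mod_hom S X (regular_module S)"
  shows tensor_eval_closed: "u \<in> carrier (tensor_module \<eta> R X Y) \<Longrightarrow> tensor_eval X Y \<chi> u \<in> carrier Y"
    and tensor_eval_add: "\<lbrakk>u \<in> carrier (tensor_module \<eta> R X Y); v \<in> carrier (tensor_module \<eta> R X Y)\<rbrakk> \<Longrightarrow>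
      tensor_eval X Y \<chi> (u \<oplus>\<^bsub>tensor_module \<eta> R X Y\<^esub> v) = tensor_eval X Y \<chi> u \<oplus>\<^bsub>Y\<^esub> tensor_eval X Y \<chi> v"
    and tensor_eval_tens: "\<lbrakk>x \<in> carrier X; y \<in> carrier Y\<rbrakk> \<Longrightarrow> tensor_eval X Y \<chi> (tens X Y x y) = \<chi> x \<odot>\<^bsub>Y\<^esub> y"
proof -
  interpret X: left_module S X by fact
  interpret Y: left_module R Y by fact
  note c = mod_hom_closed[OF \<chi>, simplified] mod_hom_add[OF \<chi>, simplified] mod_hom_smult[OF \<chi>, simplified]
  have "\<exists>\<Phi>. (\<forall>u\<in>carrier (tensor_module \<eta> R X Y). \<Phi> u \<in> carrier Y) \<and>
    (\<forall>u\<in>carrier (tensor_module \<eta> R X Y). \<forall>v\<in>carrier (tensor_module \<eta> R X Y).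
       \<Phi> (u \<oplus>\<^bsub>tensor_module \<eta> R X Y\<^esub> v) = \<Phi> u \<oplus>\<^bsub>Y\<^esub> \<Phi> v) \<and>
    (\<forall>x\<in>carrier X. \<forall>y\<in>carrier Y. \<Phi> (tens X Y x y) = \<chi> x \<odot>\<^bsub>Y\<^esub> y)"
    by (rule tensor_universal[OF X Y Y.M.op_group_axioms])
      (simp_all add: c Y.smult_closed Y.smult_l_distr Y.smult_r_distr Y.smult_assoc)
  from someI_ex[OF this, folded tensor_eval_def]
  show "u \<in> carrier (tensor_module \<eta> R X Y) \<Longrightarrow> tensor_eval X Y \<chi> u \<in> carrier Y"
    and "\<lbrakk>u \<in> carrier (tensor_module \<eta> R X Y); v \<in> carrier (tensor_module \<eta> R X Y)\<rbrakk> \<Longrightarrow>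
      tensor_eval X Y \<chi> (u \<oplus>\<^bsub>tensor_module \<eta> R X Y\<^esub> v) = tensor_eval X Y \<chi> u \<oplus>\<^bsub>Y\<^esub> tensor_eval X Y \<chi> v"
    and "\<lbrakk>x \<in> carrier X; y \<in> carrier Y\<rbrakk> \<Longrightarrow> tensor_eval X Y \<chi> (tens X Y x y) = \<chi> x \<odot>\<^bsub>Y\<^esub> y" by simp_all
qed

lemma tensor_eval_map:
  assumes X: "left_module S X" and Y: "left_module R Y" and X2: "left_module S X2" and Y2: "left_module R Y2"
    and f: "f \<in> mod_hom S X X2" and g: "g \<in> mod_hom R Y Y2" and \<chi>: "\<chi> \<in> mod_hom S X2 (regular_module S)"
    and u: "u \<in> carrier (tensor_module \<eta> R X Y)"
  shows "tensor_eval X2 Y2 \<chi> (tensor_map \<eta> R X2 Y2 f g u) = g (tensor_eval X Y (\<lambda>x. \<chi> (f x)) u)"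
proof -
  note \<chi>f = mod_hom_comp[OF f \<chi>]
  note t = tensor_map_hom[OF X Y X2 Y2 f g]
  note c = mod_hom_closed[OF \<chi>f, simplified]
  show ?thesis
    using u
    by (rule tensor_additive_eq[OF X Y, where A = Y2])
      (simp_all add: tensor_map_tens[OF X Y X2 Y2 f g] tensor_eval_tens[OF X2 Y2 \<chi>] tensor_eval_tens[OF X Y \<chi>f]
       mod_hom_closed[OF f] mod_hom_closed[OF g] mod_hom_smult[OF g] c mod_hom_add[OF t]
       tensor_eval_add[OF X2 Y2 \<chi>] mod_hom_closed[OF t] tensor_eval_add[OF X Y \<chi>f]
       tensor_eval_closed[OF X Y \<chi>f] mod_hom_add[OF g])
qed

lemma tensor_eval_zero:
  assumes X: "left_module S X" and Y: "left_module R Y" and \<chi>: "\<chi> \<in> mod_hom S X (regular_module S)"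
  shows "tensor_eval X Y \<chi> \<zero>\<^bsub>tensor_module \<eta> R X Y\<^esub> = \<zero>\<^bsub>Y\<^esub>"
  by (rule additive_zero[OF tensor_op_group[OF X Y] left_module_op_group[OF Y] tensor_eval_closed[OF X Y \<chi>]
     tensor_eval_add[OF X Y \<chi>]])

text \<open>The expansion of \<open>x\<close> is demanded for all finite \<open>F'\<close> beyond
  some \<open>F\<close>, so that the finite sets belonging to several elements can be
  united.\<close>

definition dual_basis where
  "dual_basis X I b s \<longleftrightarrow> (\<forall>m\<in>I. b m \<in> carrier X \<and> s m \<in> mod_hom S X (regular_module S)) \<and>
     (\<forall>x\<in>carrier X. \<exists>F. finite F \<and> F \<subseteq> I \<and>
       (\<forall>F'. finite F' \<longrightarrow> F \<subseteq> F' \<longrightarrow> F' \<subseteq> I \<longrightarrow> x = finsum X (\<lambda>m. s m x \<odot>\<^bsub>X\<^esub> b m) F'))"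

lemma dual_basis_projective:
  assumes "projective_module S X"
  shows "\<exists>s. dual_basis X (carrier X) (\<lambda>m. m) s"
proof -
  interpret X: left_module S X using assms by (simp add: projective_module_def)
  obtain s where s: "s \<in> mod_hom S X (free_mod S (carrier X))"
    "\<And>x. x \<in> carrier X \<Longrightarrow> lin_comb S X (\<lambda>m. m) (s x) = x"
    using projective_dual_basis[OF assms] by blast
  have "dual_basis X (carrier X) (\<lambda>m. m) (\<lambda>m x. s x m)"
    unfolding dual_basis_def
  proof (intro conjI ballI)
    show "(\<lambda>x. s x m) \<in> mod_hom S X (regular_module S)" for m
      by (rule mod_hom_comp[OF s(1) coordinate_hom])
    fix x assume x: "x \<in> carrier X"
    have sx: "s x \<in> carrier (free_mod S (carrier X))" using mod_hom_closed[OF s(1) x] .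
    show "\<exists>F. finite F \<and> F \<subseteq> carrier X \<and>
       (\<forall>F'. finite F' \<longrightarrow> F \<subseteq> F' \<longrightarrow> F' \<subseteq> carrier X \<longrightarrow> x = finsum X (\<lambda>m. s x m \<odot>\<^bsub>X\<^esub> m) F')"
    proof (intro exI[of _ "{m. s x m \<noteq> \<zero>\<^bsub>S\<^esub>}"] conjI allI impI)
      fix F' assume F': "finite F'" "{m. s x m \<noteq> \<zero>\<^bsub>S\<^esub>} \<subseteq> F'" "F' \<subseteq> carrier X"
      have "lin_comb S X (\<lambda>m. m) (s x) = finsum X (\<lambda>m. s x m \<odot>\<^bsub>X\<^esub> m) F'"
        using F' sx by (intro X.lin_comb_eq) (auto simp: free_mod_carrier)
      then show "x = finsum X (\<lambda>m. s x m \<odot>\<^bsub>X\<^esub> m) F'" using s(2)[OF x] by simp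
    qed (use sx in \<open>auto simp: free_mod_carrier\<close>)
  qed
  then show ?thesis by blast
qed

lemma ring_S: "ring S"
  by (rule ring_opp[OF ring_R])

lemma dual_basis_FM: "dual_basis (FM S b) {..<b} (basis_vec R) (\<lambda>i v. v i)"
proof -
  interpret F: left_module S "FM S b" by (rule left_module_free[OF ring_S])
  show ?thesis unfolding dual_basis_def
  proof (intro conjI ballI)
    show "(\<lambda>v. v i) \<in> mod_hom S (FM S b) (regular_module S)" for i by (rule coordinate_hom)
    show e: "basis_vec R i \<in> carrier (FM S b)" if "i \<in> {..<b}" for i
      using basis_vec_carrier[OF ring_S that] by simp
    fix v assume v: "v \<in> carrier (FM S b)"
    have "lin_comb S (FM S b) (basis_vec R) v = finsum (FM S b) (\<lambda>i. v i \<odot>\<^bsub>FM S b\<^esub> basis_vec R i) {..<b}"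
    proof (rule F.lin_comb_eq)
      show "{i. v i \<noteq> \<zero>\<^bsub>S\<^esub>} \<subseteq> {..<b}" "\<And>i. v i \<in> carrier S" using v by (auto simp: free_mod_carrier)
    qed (use e in auto)
    moreover have "lin_comb S (FM S b) (basis_vec R) v = v"
      by (rule free_hom_eq[OF F.left_module_axioms F.lin_comb_hom mod_hom_ident _ v])
        (use e F.lin_comb_basis[of "basis_vec R"] in auto)
    ultimately have "v = finsum (FM S b) (\<lambda>i. v i \<odot>\<^bsub>FM S b\<^esub> basis_vec R i) {..<b}" by simp
    then show "\<exists>F. finite F \<and> F \<subseteq> {..<b} \<and> (\<forall>F'. finite F' \<longrightarrow> F \<subseteq> F' \<longrightarrow> F' \<subseteq> {..<b} \<longrightarrow>
        v = finsum (FM S b) (\<lambda>i. v i \<odot>\<^bsub>FM S b\<^esub> basis_vec R i) F')"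
      by (intro exI[of _ "{..<b}"]) (metis finite_lessThan order_refl subset_antisym)
  qed
qed

text \<open>For an elementary tensor the expansion of \<open>x\<close> in the dual basis is moved
  across the tensor sign, from \<open>b m\<close> multiplied by \<open>s m x\<close> to
  \<open>y\<close> multiplied by \<open>s m x\<close>. Both sides are additive in \<open>u\<close>,
  and the finite sets of two tensors are united.\<close>

lemma tensor_decompose:
  assumes X: "left_module S X" and Y: "left_module R Y" and db: "dual_basis X I b s"
    and u: "u \<in> carrier (tensor_module \<eta> R X Y)"
  shows "\<exists>F. finite F \<and> F \<subseteq> I \<and> (\<forall>F'. finite F' \<longrightarrow> F \<subseteq> F' \<longrightarrow> F' \<subseteq> I \<longrightarrow>
    u = finsum (tensor_module \<eta> R X Y) (\<lambda>m. tens X Y (b m) (tensor_eval X Y (s m) u)) F')"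
proof -
  interpret X: left_module S X by fact
  interpret Y: left_module R Y by fact
  interpret T: op_group k "tensor_module \<eta> R X Y" by (rule tensor_op_group[OF X Y])
  have b: "b m \<in> carrier X" and s: "s m \<in> mod_hom S X (regular_module S)" if "m \<in> I" for m
    using db that by (auto simp: dual_basis_def)
  show ?thesis using u
  proof (induction rule: tensor_induct[OF X Y, consumes 1])
    case (1 x y)
    obtain F where F: "finite F" "F \<subseteq> I"
      "\<And>F'. \<lbrakk>finite F'; F \<subseteq> F'; F' \<subseteq> I\<rbrakk> \<Longrightarrow> x = finsum X (\<lambda>m. s m x \<odot>\<^bsub>X\<^esub> b m) F'"
      using db 1(1) unfolding dual_basis_def by meson
    show ?case
    proof (intro exI[of _ F] conjI allI impI F(1,2))
      fix F' assume F': "finite F'" "F \<subseteq> F'" "F' \<subseteq> I"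
      have sx: "s m x \<in> carrier R" if "m \<in> F'" for m
        using mod_hom_closed[OF s 1(1)] that F'(3) by auto
      have "tens X Y x y = tens X Y (finsum X (\<lambda>m. s m x \<odot>\<^bsub>X\<^esub> b m) F') y" using F(3)[OF F'] by simp
      also have "\<dots> = finsum (tensor_module \<eta> R X Y) (\<lambda>m. tens X Y (s m x \<odot>\<^bsub>X\<^esub> b m) y) F'"
        using 1(2) sx b F' 
        by (intro additive_finsum[OF X.M.op_group_axioms T.op_group_axioms, of "\<lambda>x. tens X Y x y"])
          (auto simp: tens_closed[OF X Y] tens_add_left[OF X Y] X.smult_closed)
      also have "\<dots> = finsum (tensor_module \<eta> R X Y) (\<lambda>m. tens X Y (b m) (tensor_eval X Y (s m) (tens X Y x y))) F'"
      proof (rule T.finsum_cong')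
        fix m assume m: "m \<in> F'"
        show "tens X Y (s m x \<odot>\<^bsub>X\<^esub> b m) y = tens X Y (b m) (tensor_eval X Y (s m) (tens X Y x y))"
          using m F'(3) 1 tensor_eval_tens[OF X Y s] tens_balanced[OF X Y sx b] by auto
      qed (use F' b s 1 in \<open>auto intro!: tens_closed[OF X Y] tensor_eval_closed[OF X Y]\<close>)
      finally show "tens X Y x y = finsum (tensor_module \<eta> R X Y)
        (\<lambda>m. tens X Y (b m) (tensor_eval X Y (s m) (tens X Y x y))) F'" .
    qed
  next
    case (2 u v)
    then obtain F G where F: "finite F" "F \<subseteq> I"
      "\<And>F'. \<lbrakk>finite F'; F \<subseteq> F'; F' \<subseteq> I\<rbrakk> \<Longrightarrow>
        u = finsum (tensor_module \<eta> R X Y) (\<lambda>m. tens X Y (b m) (tensor_eval X Y (s m) u)) F'"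
      and G: "finite G" "G \<subseteq> I"
      "\<And>F'. \<lbrakk>finite F'; G \<subseteq> F'; F' \<subseteq> I\<rbrakk> \<Longrightarrow>
        v = finsum (tensor_module \<eta> R X Y) (\<lambda>m. tens X Y (b m) (tensor_eval X Y (s m) v)) F'"
      by meson
    show ?case
    proof (intro exI[of _ "F \<union> G"] conjI allI impI)
      fix F' assume F': "finite F'" "F \<union> G \<subseteq> F'" "F' \<subseteq> I"
      have "u \<oplus>\<^bsub>tensor_module \<eta> R X Y\<^esub> v =
         finsum (tensor_module \<eta> R X Y) (\<lambda>m. tens X Y (b m) (tensor_eval X Y (s m) u)) F'
         \<oplus>\<^bsub>tensor_module \<eta> R X Y\<^esub>
         finsum (tensor_module \<eta> R X Y) (\<lambda>m. tens X Y (b m) (tensor_eval X Y (s m) v)) F'"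
        using F(3)[of F'] G(3)[of F'] F' by simp
      also have "\<dots> = finsum (tensor_module \<eta> R X Y) (\<lambda>m. tens X Y (b m) (tensor_eval X Y (s m) u)
        \<oplus>\<^bsub>tensor_module \<eta> R X Y\<^esub> tens X Y (b m) (tensor_eval X Y (s m) v)) F'"
        using F'(3) 2 b s by (intro T.finsum_addf[symmetric])
          (auto intro!: tens_closed[OF X Y] tensor_eval_closed[OF X Y])
      also have "\<dots> = finsum (tensor_module \<eta> R X Y)
        (\<lambda>m. tens X Y (b m) (tensor_eval X Y (s m) (u \<oplus>\<^bsub>tensor_module \<eta> R X Y\<^esub> v))) F'"
      proof (rule T.finsum_cong')
        fix m assume m: "m \<in> F'"
        then have mI: "m \<in> I" using F' by auto
        show "tens X Y (b m) (tensor_eval X Y (s m) u) \<oplus>\<^bsub>tensor_module \<eta> R X Y\<^esub> tens X Y (b m) (tensor_eval X Y (s m) v) =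
          tens X Y (b m) (tensor_eval X Y (s m) (u \<oplus>\<^bsub>tensor_module \<eta> R X Y\<^esub> v))"
          using tensor_eval_add[OF X Y s[OF mI], of u v] tens_add_right[OF X Y b[OF mI]]
            tensor_eval_closed[OF X Y s[OF mI]] 2(1,2) by simp
      qed (use F' 2 b s in \<open>auto intro!: tens_closed[OF X Y] tensor_eval_closed[OF X Y]\<close>)
      finally show "u \<oplus>\<^bsub>tensor_module \<eta> R X Y\<^esub> v = finsum (tensor_module \<eta> R X Y)
        (\<lambda>m. tens X Y (b m) (tensor_eval X Y (s m) (u \<oplus>\<^bsub>tensor_module \<eta> R X Y\<^esub> v))) F'" .
    qed (use F G in auto)
  qed
qed

lemma tensor_FM_decompose:
  assumes Y: "left_module R Y" and u: "u \<in> carrier (tensor_module \<eta> R (FM S b) Y)"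
  shows "u = finsum (tensor_module \<eta> R (FM S b) Y)
    (\<lambda>i. tens (FM S b) Y (basis_vec R i) (tensor_eval (FM S b) Y (\<lambda>v. v i) u)) {..<b}"
proof -
  obtain F where F: "finite F \<and> F \<subseteq> {..<b} \<and> (\<forall>F'. finite F' \<longrightarrow> F \<subseteq> F' \<longrightarrow> F' \<subseteq> {..<b} \<longrightarrow>
    u = finsum (tensor_module \<eta> R (FM S b) Y)
      (\<lambda>i. tens (FM S b) Y (basis_vec R i) (tensor_eval (FM S b) Y (\<lambda>v. v i) u)) F')"
    using tensor_decompose[OF left_module_free[OF ring_S] Y dual_basis_FM u] by (rule exE)
  then show ?thesis by (intro F[THEN conjunct2, THEN conjunct2, rule_format]) simp_all
qed

text \<open>Exactness is checked on the finitely many coefficients of \<open>u\<close> with respect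
  to a dual basis of \<open>X\<close>: contraction is natural, so \<open>g\<close> kills each of
  them, and each is lifted along \<open>f\<close> separately.\<close>

lemma tensor_flat:
  assumes X: "projective_module S X" and Y0: "left_module R Y0" and Y: "left_module R Y" and Y2: "left_module R Y2"
    and f: "f \<in> mod_hom R Y0 Y" and g: "g \<in> mod_hom R Y Y2"
    and ex: "\<And>y. \<lbrakk>y \<in> carrier Y; g y = \<zero>\<^bsub>Y2\<^esub>\<rbrakk> \<Longrightarrow> y \<in> f ` carrier Y0"
    and u: "u \<in> carrier (tensor_module \<eta> R X Y)"
    and gu: "tensor_map \<eta> R X Y2 id g u = \<zero>\<^bsub>tensor_module \<eta> R X Y2\<^esub>"
  shows "\<exists>w\<in>carrier (tensor_module \<eta> R X Y0). tensor_map \<eta> R X Y id f w = u"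
proof -
  have Xm: "left_module S X" using X by (simp add: projective_module_def)
  interpret T0: op_group k "tensor_module \<eta> R X Y0" by (rule tensor_op_group[OF Xm Y0])
  interpret T: op_group k "tensor_module \<eta> R X Y" by (rule tensor_op_group[OF Xm Y])
  obtain s where s: "dual_basis X (carrier X) (\<lambda>m. m) s" using dual_basis_projective[OF X] by blast
  obtain F where F: "finite F" "F \<subseteq> carrier X"
    "u = finsum (tensor_module \<eta> R X Y) (\<lambda>m. tens X Y m (tensor_eval X Y (s m) u)) F"
    using tensor_decompose[OF Xm Y s u] by (elim exE conjE) (rule that, assumption, assumption, simp)
  have sm: "s m \<in> mod_hom S X (regular_module S)" if "m \<in> F" for m
    using s F(2) that by (auto simp: dual_basis_def)
  have "\<exists>y\<in>carrier Y0. f y = tensor_eval X Y (s m) u" if m: "m \<in> F" for m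
  proof -
    have "g (tensor_eval X Y (s m) u) = \<zero>\<^bsub>Y2\<^esub>"
      using tensor_eval_map[OF Xm Y Xm Y2 mod_hom_id g sm[OF m] u] gu tensor_eval_zero[OF Xm Y2 sm[OF m]] by simp
    then show ?thesis using ex[OF tensor_eval_closed[OF Xm Y sm[OF m] u]] by (metis imageE)
  qed
  then obtain y where y: "\<And>m. m \<in> F \<Longrightarrow> y m \<in> carrier Y0" "\<And>m. m \<in> F \<Longrightarrow> f (y m) = tensor_eval X Y (s m) u" by metis
  interpret t: op_hom k "tensor_module \<eta> R X Y0" "tensor_module \<eta> R X Y" "tensor_map \<eta> R X Y id f"
    by (intro op_homI T0.op_group_axioms T.op_group_axioms tensor_map_hom Xm Y0 Y mod_hom_id f)
  let ?w = "finsum (tensor_module \<eta> R X Y0) (\<lambda>m. tens X Y0 m (y m)) F"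
  have c: "tens X Y0 m (y m) \<in> carrier (tensor_module \<eta> R X Y0)" if "m \<in> F" for m
    using tens_closed[OF Xm Y0] F(2) y(1) that by auto
  have "tensor_map \<eta> R X Y id f ?w = finsum (tensor_module \<eta> R X Y) (\<lambda>m. tensor_map \<eta> R X Y id f (tens X Y0 m (y m))) F"
    by (rule t.finsum[OF F(1) c])
  also have "\<dots> = finsum (tensor_module \<eta> R X Y) (\<lambda>m. tens X Y m (tensor_eval X Y (s m) u)) F"
  proof (rule T.finsum_cong')
    fix m assume m: "m \<in> F"
    then have mX: "m \<in> carrier X" using F(2) by auto
    show "tensor_map \<eta> R X Y id f (tens X Y0 m (y m)) = tens X Y m (tensor_eval X Y (s m) u)"
      using tensor_map_tens[OF Xm Y0 Xm Y mod_hom_id f mX y(1)[OF m]] y(2)[OF m] by simp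
  qed (use F(2) sm u in \<open>auto intro!: tens_closed[OF Xm Y] tensor_eval_closed[OF Xm Y]\<close>)
  also have "\<dots> = u" using F(3) by simp
  finally show ?thesis using c by (intro bexI[of _ ?w]) (auto intro: T0.finsum_closed)
qed

text \<open>Injectivity of \<open>g\<close> is exactness at \<open>Y\<close> of the zero
  endomorphism of \<open>Y\<close> followed by \<open>g\<close>, so this is a case of
  \<open>tensor_flat\<close>.\<close>

lemma tensor_flat_inj:
  assumes X: "projective_module S X" and Y: "left_module R Y" and Y2: "left_module R Y2"
    and g: "g \<in> mod_hom R Y Y2" and inj: "inj_on g (carrier Y)"
    and u: "u \<in> carrier (tensor_module \<eta> R X Y)"
    and gu: "tensor_map \<eta> R X Y2 id g u = \<zero>\<^bsub>tensor_module \<eta> R X Y2\<^esub>"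
  shows "u = \<zero>\<^bsub>tensor_module \<eta> R X Y\<^esub>"
proof -
  have Xm: "left_module S X" using X by (simp add: projective_module_def)
  interpret Y: left_module R Y by fact
  interpret g: op_hom R Y Y2 g by (intro op_homI left_module_op_group Y Y2 g)
  have z: "(\<lambda>y. \<zero>\<^bsub>Y\<^esub>) \<in> mod_hom R Y Y" by (rule mod_hom_zero_fun[OF Y.M.op_group_axioms])
  have "y \<in> (\<lambda>y. \<zero>\<^bsub>Y\<^esub>) ` carrier Y" if "y \<in> carrier Y" "g y = \<zero>\<^bsub>Y2\<^esub>" for y
    using inj_onD[OF inj, of y "\<zero>\<^bsub>Y\<^esub>"] that by auto
  from tensor_flat[OF X Y Y Y2 z g this u gu]
  show ?thesis using tensor_map_zero[OF Xm Y Xm Y mod_hom_id z] by auto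
qed

end

section \<open>Linear systems over injective modules\<close>

text \<open>A map from a left ideal extends to the ring and is then determined by the image of 1. To
  apply the definition, the ideal and the ring are copied into the type of the test modules as
  constant functions.\<close>

lemma injective_ideal:
  fixes J :: "('r, 'i) module"
  assumes J: "injective_module R J" and L: "submodule L R (regular_module R)"
    and f: "f \<in> mod_hom R ((regular_module R)\<lparr>carrier := L\<rparr>) J"
  shows "\<exists>w\<in>carrier J. \<forall>a\<in>L. f a = a \<odot>\<^bsub>J\<^esub> w"
proof -
  interpret J: left_module R J using J by (simp add: injective_module_def)
  interpret R: left_module R "regular_module R" by (rule left_module_regular) unfold_locales
  let ?RL = "(regular_module R)\<lparr>carrier := L\<rparr>" and ?c = "(\<lambda>r _. r) :: 'r \<Rightarrow> 'i \<Rightarrow> 'r"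
  have RL: "left_module R ?RL" by (rule R.restrict_left_module[OF L])
  have LR: "L \<subseteq> carrier R" using R.M.submoduleE(1)[OF L] by simp
  have inj: "inj_on ?c X" for X by (auto simp: inj_on_def fun_eq_iff)
  note t1 = transport[OF RL inj] and t2 = transport[OF R.left_module_axioms inj]
  let ?i = "inv_into (carrier ?RL) ?c"
  have i: "?i (?c a) = a" if "a \<in> L" for a using inv_into_f_f[OF inj, of a L] that by simp
  have "(\<lambda>x. x) \<in> mod_hom R ?RL (regular_module R)" using LR by (intro mod_homI) auto
  from mod_hom_comp[OF mod_hom_comp[OF t1(3) this] t2(2)]
  have j: "(\<lambda>x. ?c (?i x)) \<in> mod_hom R (transport ?c ?RL) (transport ?c (regular_module R))" .
  have "inj_on (\<lambda>x. ?c (?i x)) (carrier (transport ?c ?RL))"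
    using i by (auto simp: inj_on_def transport_def)
  from injective_moduleD[OF J t1(1) t2(1) j this mod_hom_comp[OF t1(3) f]]
  obtain h where h: "h \<in> mod_hom R (transport ?c (regular_module R)) J"
    "\<And>x. x \<in> carrier (transport ?c ?RL) \<Longrightarrow> h (?c (?i x)) = f (?i x)" by blast
  have hc: "(\<lambda>x. h (?c x)) \<in> mod_hom R (regular_module R) J" by (rule mod_hom_comp[OF t2(2) h(1)])
  have "f a = a \<odot>\<^bsub>J\<^esub> h (?c \<one>\<^bsub>R\<^esub>)" if a: "a \<in> L" for a
  proof -
    have "f a = h (?c a)" using h(2)[of "?c a"] i[OF a] a by (simp add: transport_def)
    also have "\<dots> = a \<odot>\<^bsub>J\<^esub> h (?c \<one>\<^bsub>R\<^esub>)" using mod_hom_smult[OF hc, of a "\<one>\<^bsub>R\<^esub>"] a LR by auto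
    finally show ?thesis .
  qed
  moreover have "h (?c \<one>\<^bsub>R\<^esub>) \<in> carrier J" using mod_hom_closed[OF hc] by simp
  ultimately show ?thesis by blast
qed

text \<open>\<open>V\<close> factors over the image of \<open>f\<close>, and the assertion extends
  it from that submodule to the whole free module. The induction on the rank treats one coordinate
  at a time, so that extension from left ideals suffices.\<close>

lemma injective_linear_system:
  assumes J: "injective_module R J" and X: "left_module R X"
  shows "\<lbrakk>f \<in> mod_hom R X (FM R a); V \<in> mod_hom R X J; \<And>x. \<lbrakk>x \<in> carrier X; f x = \<zero>\<^bsub>FM R a\<^esub>\<rbrakk> \<Longrightarrow> V x = \<zero>\<^bsub>J\<^esub>\<rbrakk>
    \<Longrightarrow> \<exists>w. (\<forall>j<a. w j \<in> carrier J) \<and> (\<forall>x\<in>carrier X. V x = lin_comb R J w (f x))"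
proof (induction a arbitrary: f V)
  case 0
  interpret J: left_module R J using J by (simp add: injective_module_def)
  have "f x = (\<lambda>_. \<zero>\<^bsub>R\<^esub>)" if "x \<in> carrier X" for x
    using mod_hom_closed[OF 0(1) that] by (intro ext) (auto simp: free_mod_carrier)
  then have "V x = \<zero>\<^bsub>J\<^esub>" "lin_comb R J (\<lambda>_. \<zero>\<^bsub>J\<^esub>) (f x) = \<zero>\<^bsub>J\<^esub>" if "x \<in> carrier X" for x
    using 0(3) that by (auto simp: lin_comb_def)
  then show ?case by (intro exI[of _ "\<lambda>_. \<zero>\<^bsub>J\<^esub>"]) auto
next
  case (Suc a)
  interpret J: left_module R J using J by (simp add: injective_module_def)
  interpret X: left_module R X by fact
  interpret Fa: left_module R "FM R a" by (rule left_module_free) unfold_locales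
  interpret Fa': left_module R "FM R (Suc a)" by (rule left_module_free) unfold_locales
  interpret R: left_module R "regular_module R" by (rule left_module_regular) unfold_locales
  interpret f: op_hom R X "FM R (Suc a)" f by (intro op_homI X.M.op_group_axioms Fa'.M.op_group_axioms Suc.prems)
  interpret V: op_hom R X J V by (intro op_homI X.M.op_group_axioms J.M.op_group_axioms Suc.prems)
  have co: "(\<lambda>x. f x i) \<in> mod_hom R X (regular_module R)" for i by (rule mod_hom_comp[OF Suc.prems(1) coordinate_hom])
  let ?f' = "\<lambda>x i. if i \<in> {..<a} then f x i else \<zero>\<^bsub>R\<^esub>"
  have f': "?f' \<in> mod_hom R X (FM R a)" by (rule tuple_hom[OF X]) (auto intro: co)
  interpret f': op_hom R X "FM R a" ?f' by (intro op_homI X.M.op_group_axioms Fa.M.op_group_axioms f')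
  define K where "K = {x \<in> carrier X. ?f' x = \<zero>\<^bsub>FM R a\<^esub>}"
  have K: "submodule K R X" unfolding K_def by (rule f'.kernel_submodule)
  note sK = X.M.submoduleE[OF K]
  interpret fa: op_hom R X "regular_module R" "\<lambda>x. f x a" by (intro op_homI X.M.op_group_axioms R.M.op_group_axioms co)
  \<comment> \<open>On \<open>K\<close> all coordinates but the last vanish, so \<open>V\<close>
    depends there on the last one alone and becomes a map \<open>f0\<close> on the left ideal
    \<open>L\<close>.\<close>
  define L where "L = (\<lambda>x. f x a) ` K"
  have L: "submodule L R (regular_module R)" unfolding L_def by (rule fa.image_submodule[OF K])
  have wd: "V x = V y" if "x \<in> K" "y \<in> K" "f x a = f y a" for x y
  proof -
    have xy: "x \<in> carrier X" "y \<in> carrier X" "x \<ominus>\<^bsub>X\<^esub> y \<in> K" using that sK(1,5) by auto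
    have "f (x \<ominus>\<^bsub>X\<^esub> y) i = \<zero>\<^bsub>R\<^esub>" for i
    proof -
      consider "i < a" | "i = a" | "i > a" by linarith
      then show ?thesis
      proof cases
        case 1
        then show ?thesis using xy(3) by (auto simp: K_def fun_eq_iff split: if_splits)
      next
        case 2
        have "f (x \<ominus>\<^bsub>X\<^esub> y) a = f x a \<ominus>\<^bsub>regular_module R\<^esub> f y a" using fa.diff[OF xy(1,2)] .
        also have "\<dots> = \<zero>\<^bsub>R\<^esub>" using that(3) R.M.eq_iff_diff[OF fa.closed[OF xy(2)] fa.closed[OF xy(2)]] by simp
        finally show ?thesis using 2 by simp
      next
        case 3
        then show ?thesis using f.closed[of "x \<ominus>\<^bsub>X\<^esub> y"] xy by (simp add: FM_carrier)
      qed
    qed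
    then have "f (x \<ominus>\<^bsub>X\<^esub> y) = \<zero>\<^bsub>FM R (Suc a)\<^esub>" by auto
    then have "V (x \<ominus>\<^bsub>X\<^esub> y) = \<zero>\<^bsub>J\<^esub>" using Suc.prems(3)[of "x \<ominus>\<^bsub>X\<^esub> y"] xy by simp
    then show ?thesis using xy J.M.eq_iff_diff[of "V x" "V y"] by simp
  qed
  define f0 where "f0 l = V (SOME x. x \<in> K \<and> f x a = l)" for l
  have f0: "f0 (f x a) = V x" if "x \<in> K" for x
    using someI[of "\<lambda>y. y \<in> K \<and> f y a = f x a" x] that wd unfolding f0_def by blast
  have "f0 \<in> mod_hom R ((regular_module R)\<lparr>carrier := L\<rparr>) J"
  proof (rule mod_homI)
    fix l assume "l \<in> carrier ((regular_module R)\<lparr>carrier := L\<rparr>)"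
    then obtain x where x: "x \<in> K" "l = f x a" by (auto simp: L_def)
    have xX: "x \<in> carrier X" using x sK(1) by auto
    show "f0 l \<in> carrier J" using f0[OF x(1)] x xX by simp
    show "f0 (r \<odot>\<^bsub>(regular_module R)\<lparr>carrier := L\<rparr>\<^esub> l) = r \<odot>\<^bsub>J\<^esub> f0 l" if r: "r \<in> carrier R" for r
      using f0[OF sK(6)[OF r x(1)]] f0[OF x(1)] x(2) r xX fa.smult[OF r xX] by simp
    fix l' assume "l' \<in> carrier ((regular_module R)\<lparr>carrier := L\<rparr>)"
    then obtain y where y: "y \<in> K" "l' = f y a" by (auto simp: L_def)
    have yX: "y \<in> carrier X" using y sK(1) by auto
    show "f0 (l \<oplus>\<^bsub>(regular_module R)\<lparr>carrier := L\<rparr>\<^esub> l') = f0 l \<oplus>\<^bsub>J\<^esub> f0 l'"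
      using f0[OF sK(3)[OF x(1) y(1)]] f0[OF x(1)] f0[OF y(1)] x(2) y(2) xX yX fa.add[OF xX yX] by simp
  qed
  from injective_ideal[OF J L this] obtain wa where wa: "wa \<in> carrier J" "\<And>l. l \<in> L \<Longrightarrow> f0 l = l \<odot>\<^bsub>J\<^esub> wa" by blast
  have VK: "V x = f x a \<odot>\<^bsub>J\<^esub> wa" if "x \<in> K" for x
    using f0[OF that] wa(2)[of "f x a"] that by (simp add: L_def)
  have fc: "f x i \<in> carrier R" if "x \<in> carrier X" for x i using mod_hom_closed[OF co that] by simp
  have m: "(\<lambda>x. f x a \<odot>\<^bsub>J\<^esub> wa) \<in> mod_hom R X J"
    using fc wa(1) fa.add fa.smult
    by (intro mod_homI) (simp_all add: J.smult_closed J.smult_l_distr J.smult_assoc)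
  \<comment> \<open>Subtracting the contribution of the last coordinate makes the remainder vanish
    on \<open>K\<close>, that is wherever the first \<open>a\<close> coordinates vanish.\<close>
  let ?V' = "\<lambda>x. V x \<ominus>\<^bsub>J\<^esub> f x a \<odot>\<^bsub>J\<^esub> wa"
  have V': "?V' \<in> mod_hom R X J"
    by (intro mod_hom_diff X.M.op_group_axioms J.M.op_group_axioms Suc.prems m)
  have "?V' x = \<zero>\<^bsub>J\<^esub>" if "x \<in> carrier X" "?f' x = \<zero>\<^bsub>FM R a\<^esub>" for x
    using VK[of x] that mod_hom_closed[OF m that(1)] by (simp add: K_def J.M.ag)
  from Suc.IH[OF f' V' this] obtain w where w: "\<And>j. j < a \<Longrightarrow> w j \<in> carrier J"
    "\<And>x. x \<in> carrier X \<Longrightarrow> ?V' x = lin_comb R J w (?f' x)" by blast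
  show ?case
  proof (intro exI[of _ "w(a := wa)"] conjI allI impI ballI)
    show "(w(a := wa)) j \<in> carrier J" if "j < Suc a" for j using that w(1) wa(1) by auto
    fix x assume x: "x \<in> carrier X"
    have cl: "f x j \<odot>\<^bsub>J\<^esub> w j \<in> carrier J" if "j < a" for j using that w(1) fc[OF x] J.smult_closed by simp
    have "lin_comb R J (w(a := wa)) (f x) = finsum J (\<lambda>j. f x j \<odot>\<^bsub>J\<^esub> (w(a := wa)) j) {..<Suc a}"
    proof (rule J.lin_comb_eq)
      show "{j. f x j \<noteq> \<zero>\<^bsub>R\<^esub>} \<subseteq> {..<Suc a}" using f.closed[OF x] by (auto simp: free_mod_carrier)
    qed (use fc[OF x] w(1) wa(1) in auto)
    also have "\<dots> = f x a \<odot>\<^bsub>J\<^esub> wa \<oplus>\<^bsub>J\<^esub> finsum J (\<lambda>j. f x j \<odot>\<^bsub>J\<^esub> (w(a := wa)) j) {..<a}"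
      unfolding lessThan_Suc using cl wa(1) fc[OF x]
      by (subst J.M.finsum_insert) (auto simp: J.smult_closed)
    also have "finsum J (\<lambda>j. f x j \<odot>\<^bsub>J\<^esub> (w(a := wa)) j) {..<a} = finsum J (\<lambda>j. ?f' x j \<odot>\<^bsub>J\<^esub> w j) {..<a}"
      using cl by (intro J.M.finsum_cong') auto
    also have "\<dots> = lin_comb R J w (?f' x)"
      using w(1) fc[OF x] by (intro J.lin_comb_eq[symmetric]) (auto split: if_splits)
    also have "\<dots> = ?V' x" using w(2)[OF x] by simp
    also have "f x a \<odot>\<^bsub>J\<^esub> wa \<oplus>\<^bsub>J\<^esub> ?V' x = V x"
      using mod_hom_closed[OF m x] V.closed[OF x] by (simp add: J.M.ag)
    finally show "V x = lin_comb R J (w(a := wa)) (f x)" by (rule sym)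
  qed
qed

lemma (in k_algebra) tensor_map_comp_left:
  assumes "left_module R J" "left_module S X1" "left_module S X2" "left_module S X3"
    "f \<in> mod_hom S X1 X2" "f' \<in> mod_hom S X2 X3" "v \<in> carrier (tensor_module \<eta> R X1 J)"
  shows "tensor_map \<eta> R X3 J f' id (tensor_map \<eta> R X2 J f id v) = tensor_map \<eta> R X3 J (\<lambda>x. f' (f x)) id v"
  using tensor_map_comp[OF assms(2,1,3,1,4,1,5) mod_hom_id assms(6) mod_hom_id assms(7)] by (simp add: id_def)

text \<open>The image \<open>?z\<close> of \<open>u\<close> under \<open>g\<close> is a column of
  \<open>b\<close> elements of \<open>J\<close>. By the homotopy, \<open>u\<close> differs from the
  image of \<open>?z\<close> under \<open>h\<close> by the boundary of its image under
  \<open>l\<close>; as \<open>h\<close> after \<open>A\<close> is the differential after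
  \<open>h'\<close>, a preimage \<open>?y\<close> of \<open>?z\<close> under \<open>A\<close> makes
  \<open>u\<close> a boundary. Finding \<open>?y\<close> is a linear system over \<open>J\<close>,
  solvable once every row that kills \<open>A\<close> kills the column.\<close>

lemma (in k_algebra) tensor_injective_exact:
  assumes J: "injective_module R J" and T: "totally_acyclic S T" and ap: "fin_approx S T n"
    and u: "u \<in> carrier (tensor_module \<eta> R (obj T n) J)"
    and du: "tensor_map \<eta> R (obj T (n - 1)) J (diff T n) id u = \<zero>\<^bsub>tensor_module \<eta> R (obj T (n - 1)) J\<^esub>"
  shows "\<exists>w\<in>carrier (tensor_module \<eta> R (obj T (n + 1)) J). tensor_map \<eta> R (obj T n) J (diff T (n + 1)) id w = u"
  using ap
proof (rule fin_approxE[OF _ refl refl])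
  fix a b A g g' h h' \<kappa> l
  let ?X = "obj T" and ?d0 = "diff T n" and ?d1 = "diff T (n + 1)"
  assume A: "A \<in> mod_hom S (FM S a) (FM S b)" and g: "g \<in> mod_hom S (?X n) (FM S b)"
     and g': "g' \<in> mod_hom S (?X (n + 1)) (FM S a)" and h: "h \<in> mod_hom S (FM S b) (?X n)"
     and h': "h' \<in> mod_hom S (FM S a) (?X (n + 1))" and \<kappa>: "\<kappa> \<in> mod_hom S (?X (n - 1)) (?X n)"
     and l: "l \<in> mod_hom S (?X n) (?X (n + 1))"
     and gA: "\<And>t. t\<in>carrier (?X (n + 1)) \<Longrightarrow> g (?d1 t) = A (g' t)"
     and hA: "\<And>y. y\<in>carrier (FM S a) \<Longrightarrow> h (A y) = ?d1 (h' y)"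
     and hom: "\<And>t. t\<in>carrier (?X n) \<Longrightarrow>
        t = h (g t) \<oplus>\<^bsub>?X n\<^esub> \<kappa> (?d0 t) \<oplus>\<^bsub>?X n\<^esub> ?d1 (l t)"
  have X: "is_cplx S T" using T by (simp add: totally_acyclic_def)
  note lX = cplx_module[OF X] and lF = left_module_free[OF ring_S] and i = mod_hom_id
  have Jm: "left_module R J" using J by (simp add: injective_module_def)
  interpret J: left_module R J by fact
  note d1 = cplx_diff_Suc[OF X, of n] and d0 = cplx_diff[OF X, of n]
  let ?M = "\<lambda>X. tensor_module \<eta> R X J" and ?t = "\<lambda>X f. tensor_map \<eta> R X J f id" and ?e = "\<lambda>X. tensor_eval X J"
  have og: "op_group k (?M (?X m))" "op_group k (?M (FM S c))" for m c by (intro tensor_op_group lX lF Jm)+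
  interpret Tn: op_group k "?M (?X n)" by (rule og)
  interpret Tb: op_group k "?M (FM S b)" by (rule og)
  interpret td1: op_hom k "?M (?X (n + 1))" "?M (?X n)" "?t (?X n) ?d1"
    by (intro op_homI og tensor_map_hom lX Jm d1 i)
  interpret tk: op_hom k "?M (?X (n - 1))" "?M (?X n)" "?t (?X n) \<kappa>"
    by (intro op_homI og tensor_map_hom lX Jm \<kappa> i)
  note cl = tensor_map_closed[OF _ Jm _ Jm _ i]
  have gu: "?t (FM S b) g u \<in> carrier (?M (FM S b))" by (rule cl[OF lX lF g u])
  have lu: "?t (?X (n + 1)) l u \<in> carrier (?M (?X (n + 1)))" by (rule cl[OF lX lX l u])
  note comp = tensor_map_comp_left[OF Jm]
  have hg: "(\<lambda>t. h (g t)) \<in> mod_hom S (?X n) (?X n)" and kd: "(\<lambda>t. \<kappa> (?d0 t)) \<in> mod_hom S (?X n) (?X n)"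
    and dl: "(\<lambda>t. ?d1 (l t)) \<in> mod_hom S (?X n) (?X n)"
    by (rule mod_hom_comp[OF g h] mod_hom_comp[OF d0 \<kappa>] mod_hom_comp[OF l d1])+
  have hgkd: "(\<lambda>t. h (g t) \<oplus>\<^bsub>?X n\<^esub> \<kappa> (?d0 t)) \<in> mod_hom S (?X n) (?X n)"
    by (intro mod_hom_sum left_module_op_group lX hg kd)
  have "u = ?t (?X n) (\<lambda>t. h (g t) \<oplus>\<^bsub>?X n\<^esub> \<kappa> (?d0 t) \<oplus>\<^bsub>?X n\<^esub> ?d1 (l t)) u"
    using hom by (intro tensor_map_ident[symmetric] lX Jm i u mod_hom_sum left_module_op_group hgkd dl) auto
  also have "\<dots> = ?t (?X n) (\<lambda>t. h (g t) \<oplus>\<^bsub>?X n\<^esub> \<kappa> (?d0 t)) u \<oplus>\<^bsub>?M (?X n)\<^esub> ?t (?X n) (\<lambda>t. ?d1 (l t)) u"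
    by (rule tensor_map_add_left[OF lX Jm lX Jm hgkd dl i u])
  also have "?t (?X n) (\<lambda>t. h (g t) \<oplus>\<^bsub>?X n\<^esub> \<kappa> (?d0 t)) u =
      ?t (?X n) (\<lambda>t. h (g t)) u \<oplus>\<^bsub>?M (?X n)\<^esub> ?t (?X n) (\<lambda>t. \<kappa> (?d0 t)) u"
    by (rule tensor_map_add_left[OF lX Jm lX Jm hg kd i u])
  also have "?t (?X n) (\<lambda>t. \<kappa> (?d0 t)) u = \<zero>\<^bsub>?M (?X n)\<^esub>"
    using comp[OF lX lX lX d0 \<kappa> u] du by simp
  also have "?t (?X n) (\<lambda>t. ?d1 (l t)) u = ?t (?X n) ?d1 (?t (?X (n + 1)) l u)"
    using comp[OF lX lX lX l d1 u] by simp
  also have "?t (?X n) (\<lambda>t. h (g t)) u = ?t (?X n) h (?t (FM S b) g u)"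
    using comp[OF lX lF lX g h u] by simp
  finally have dec: "u = ?t (?X n) h (?t (FM S b) g u) \<oplus>\<^bsub>?M (?X n)\<^esub> ?t (?X n) ?d1 (?t (?X (n + 1)) l u)"
    unfolding Tn.r_zero[OF cl[OF lF lX h gu]] .

  let ?z = "?t (FM S b) g u"
  define v where "v i = ?e (FM S b) (\<lambda>x. x i) ?z" for i
  have v: "v i \<in> carrier J" for i unfolding v_def by (rule tensor_eval_closed[OF lF Jm coordinate_hom gu])
  have eb: "basis_vec R i \<in> carrier (FM S b)" if "i < b" for i using basis_vec_carrier[OF ring_S, of i "{..<b}"] that by simp
  have ea: "basis_vec R i \<in> carrier (FM S a)" if "i < a" for i using basis_vec_carrier[OF ring_S, of i "{..<a}"] that by simp
  have z: "?z = finsum (?M (FM S b)) (\<lambda>i. tens (FM S b) J (basis_vec R i) (v i)) {..<b}"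
    unfolding v_def by (rule tensor_FM_decompose[OF Jm gu])
  interpret LR: left_module R "FM R b" by (rule left_module_free[OF ring_R])
  \<comment> \<open>Multiplication of rows by the matrix of \<open>A\<close>, a map of left modules.
    Its kernel consists of the relations with which the right-hand side must be compatible.\<close>
  let ?At = "\<lambda>\<phi> j. if j \<in> {..<a} then dotp R b \<phi> (A (basis_vec R j)) else \<zero>\<^bsub>R\<^esub>"
  have Ac: "A (basis_vec R j) i \<in> carrier R" if "j < a" for i j
    using mod_hom_closed[OF A ea[OF that]] by (simp add: FM_carrier)
  have At: "?At \<in> mod_hom R (FM R b) (FM R a)"
    by (rule tuple_hom[OF LR.left_module_axioms]) (use Ac in \<open>auto intro!: dotp_left_hom ring_R\<close>)
  have V: "lin_comb R J v \<in> mod_hom R (FM R b) J" using v by (intro J.lin_comb_hom)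
  \<comment> \<open>Compatibility. If the row \<phi> kills \<open>A\<close>, then \<phi> after
    \<open>g\<close> kills boundaries, so by total acyclicity it is \<psi> after the differential.
    The pairing of \<phi> with the column is thus the contraction by \<psi> of the boundary of
    \<open>u\<close>, which is zero.\<close>
  have "lin_comb R J v \<phi> = \<zero>\<^bsub>J\<^esub>" if \<phi>: "\<phi> \<in> carrier (FM R b)" and \<phi>A: "?At \<phi> = \<zero>\<^bsub>FM R a\<^esub>" for \<phi>
  proof -
    have \<phi>c: "\<phi> i \<in> carrier R" for i using \<phi> by (simp add: FM_carrier)
    have D: "dotp R b \<phi> \<in> mod_hom S (FM S b) (regular_module S)" by (intro dotp_right_hom ring_R \<phi>c)
    have regS: "left_module S (regular_module S)" by (rule left_module_regular[OF ring_S])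
    have A0: "dotp R b \<phi> (A y) = \<zero>\<^bsub>R\<^esub>" if "y \<in> carrier (FM S a)" for y
    proof -
      have "dotp R b \<phi> (A y) = (\<lambda>_. \<zero>\<^bsub>regular_module S\<^esub>) y"
      proof (rule free_hom_eq[OF regS mod_hom_comp[OF A D] mod_hom_zero_fun[OF left_module_op_group[OF regS]] _ that])
        fix j assume "j \<in> {..<a}"
        then show "dotp R b \<phi> (A (basis_vec S j)) = \<zero>\<^bsub>regular_module S\<^esub>"
          using fun_cong[OF \<phi>A, of j] by simp
      qed
      then show ?thesis by simp
    qed
    have "\<exists>\<psi>\<in>mod_hom S (?X (n - 1)) (regular_module S). \<forall>t\<in>carrier (?X n). dotp R b \<phi> (g t) = \<psi> (?d0 t)"
      using gA A0 mod_hom_closed[OF g']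
      by (intro Hom_acyclicD[OF totally_acyclic_regular[OF T] mod_hom_comp[OF g D]]) simp
    then obtain \<psi> where \<psi>: "\<psi> \<in> mod_hom S (?X (n - 1)) (regular_module S)"
      "\<And>t. t \<in> carrier (?X n) \<Longrightarrow> dotp R b \<phi> (g t) = \<psi> (?d0 t)" by blast
    note \<psi>d = mod_hom_comp[OF d0 \<psi>(1)]
    have cong: "?e (?X n) (\<lambda>t. dotp R b \<phi> (g t)) u = ?e (?X n) (\<lambda>t. \<psi> (?d0 t)) u"
      using u
      by (rule tensor_additive_eq[OF lX Jm, where A = J])
        (simp_all add: tensor_eval_tens[OF lX Jm mod_hom_comp[OF g D]] tensor_eval_tens[OF lX Jm \<psi>d] \<psi>(2)
          tensor_eval_add[OF lX Jm mod_hom_comp[OF g D]] tensor_eval_add[OF lX Jm \<psi>d])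
    have "lin_comb R J v \<phi> = finsum J (\<lambda>i. \<phi> i \<odot>\<^bsub>J\<^esub> v i) {..<b}"
      using \<phi> v \<phi>c by (intro J.lin_comb_eq) (auto simp: free_mod_carrier)
    also have "\<dots> = finsum J (\<lambda>i. ?e (FM S b) (dotp R b \<phi>) (tens (FM S b) J (basis_vec R i) (v i))) {..<b}"
    proof (rule J.M.finsum_cong')
      fix i assume "i \<in> {..<b}"
      then show "\<phi> i \<odot>\<^bsub>J\<^esub> v i = ?e (FM S b) (dotp R b \<phi>) (tens (FM S b) J (basis_vec R i) (v i))"
        using tensor_eval_tens[OF lF Jm D eb v] dotp_basis_right[OF ring_R, of i b \<phi>] \<phi>c by simp
    qed (use eb v in \<open>auto intro!: tensor_eval_closed[OF lF Jm D] tens_closed[OF lF Jm]\<close>)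
    also have "\<dots> = ?e (FM S b) (dotp R b \<phi>) ?z"
      unfolding z using eb v
      by (intro additive_finsum[symmetric, OF Tb.op_group_axioms J.M.op_group_axioms])
        (auto intro!: tens_closed[OF lF Jm] tensor_eval_closed[OF lF Jm D] tensor_eval_add[OF lF Jm D])
    also have "\<dots> = ?e (?X n) (\<lambda>t. dotp R b \<phi> (g t)) u"
      using tensor_eval_map[OF lX Jm lF Jm g i D u] by simp
    also have "\<dots> = ?e (?X (n - 1)) \<psi> (?t (?X (n - 1)) ?d0 u)"
      unfolding cong using tensor_eval_map[OF lX Jm lX Jm d0 i \<psi>(1) u] by simp
    also have "\<dots> = \<zero>\<^bsub>J\<^esub>" unfolding du by (rule tensor_eval_zero[OF lX Jm \<psi>(1)])
    finally show ?thesis .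
  qed
  from injective_linear_system[OF J LR.left_module_axioms At V this]
  obtain w where w: "\<And>j. j < a \<Longrightarrow> w j \<in> carrier J"
    "\<And>\<phi>. \<phi> \<in> carrier (FM R b) \<Longrightarrow> lin_comb R J v \<phi> = lin_comb R J w (?At \<phi>)" by blast
  \<comment> \<open>Evaluation on the basis rows turns the factorization into the single equations
    of the system.\<close>
  have vw: "v i = finsum J (\<lambda>j. A (basis_vec R j) i \<odot>\<^bsub>J\<^esub> w j) {..<a}" if i: "i < b" for i
  proof -
    have e: "basis_vec R i \<in> carrier (FM R b)" using eb[OF i] by simp
    have "v i = lin_comb R J w (?At (basis_vec R i))"
      using w(2)[OF e] J.lin_comb_basis[of v i] v by simp
    also have "\<dots> = finsum J (\<lambda>j. ?At (basis_vec R i) j \<odot>\<^bsub>J\<^esub> w j) {..<a}"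
      using mod_hom_closed[OF At e] w(1) by (intro J.lin_comb_eq) (auto simp: FM_carrier split: if_splits)
    also have "\<dots> = finsum J (\<lambda>j. A (basis_vec R j) i \<odot>\<^bsub>J\<^esub> w j) {..<a}"
      using w(1) Ac dotp_basis_left[OF ring_R i]
      by (intro J.M.finsum_cong') (auto intro!: J.smult_closed)
    finally show ?thesis .
  qed
  let ?y = "finsum (?M (FM S a)) (\<lambda>j. tens (FM S a) J (basis_vec R j) (w j)) {..<a}"
  interpret Ta: op_group k "?M (FM S a)" by (rule og)
  have tw: "tens (FM S a) J (basis_vec R j) (w j) \<in> carrier (?M (FM S a))" if "j < a" for j
    by (rule tens_closed[OF lF Jm ea[OF that] w(1)[OF that]])
  have y: "?y \<in> carrier (?M (FM S a))" using tw by (intro Ta.finsum_closed) auto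
  have Ay: "?t (FM S b) A ?y \<in> carrier (?M (FM S b))" by (rule cl[OF lF lF A y])
  have "?e (FM S b) (\<lambda>x. x i) (?t (FM S b) A ?y) = v i" if i: "i < b" for i
  proof -
    note Ai = mod_hom_comp[OF A coordinate_hom[of i S "{..<b}"]]
    have "?e (FM S b) (\<lambda>x. x i) (?t (FM S b) A ?y) = ?e (FM S a) (\<lambda>x. A x i) ?y"
      using tensor_eval_map[OF lF Jm lF Jm A mod_hom_id coordinate_hom[of i S "{..<b}"] y] by simp
    also have "\<dots> = finsum J (\<lambda>j. ?e (FM S a) (\<lambda>x. A x i) (tens (FM S a) J (basis_vec R j) (w j))) {..<a}"
      using tw by (intro additive_finsum[OF Ta.op_group_axioms J.M.op_group_axioms])
        (auto intro!: tensor_eval_closed[OF lF Jm Ai] tensor_eval_add[OF lF Jm Ai])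
    also have "\<dots> = finsum J (\<lambda>j. A (basis_vec R j) i \<odot>\<^bsub>J\<^esub> w j) {..<a}"
    proof (rule J.M.finsum_cong')
      fix j assume "j \<in> {..<a}"
      then show "?e (FM S a) (\<lambda>x. A x i) (tens (FM S a) J (basis_vec R j) (w j)) = A (basis_vec R j) i \<odot>\<^bsub>J\<^esub> w j"
        using tensor_eval_tens[OF lF Jm Ai ea w(1)] by simp
    qed (use Ac w(1) in \<open>auto intro!: J.smult_closed\<close>)
    finally show ?thesis using vw[OF i] by simp
  qed
  then have "?t (FM S b) A ?y = finsum (?M (FM S b)) (\<lambda>i. tens (FM S b) J (basis_vec R i) (v i)) {..<b}"
    using tensor_FM_decompose[OF Jm Ay] eb v
    by (subst tensor_FM_decompose[OF Jm Ay]) (intro Tb.finsum_cong', auto intro!: tens_closed[OF lF Jm])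
  then have Ayz: "?t (FM S b) A ?y = ?z" using z by simp
  have hA': "(\<lambda>y. h (A y)) \<in> mod_hom S (FM S a) (?X n)" by (rule mod_hom_comp[OF A h])
  have "?t (?X n) h ?z = ?t (?X n) (\<lambda>y. h (A y)) ?y" using comp[OF lF lF lX A h y] Ayz by simp
  also have "\<dots> = ?t (?X n) (\<lambda>y. ?d1 (h' y)) ?y"
    using hA by (intro tensor_map_cong[OF lF Jm lX Jm hA' i mod_hom_comp[OF h' d1] i _ _ y]) auto
  also have "\<dots> = ?t (?X n) ?d1 (?t (?X (n + 1)) h' ?y)" using comp[OF lF lX lX h' d1 y] by simp
  finally have hz: "?t (?X n) h ?z = ?t (?X n) ?d1 (?t (?X (n + 1)) h' ?y)" .
  have h'y: "?t (?X (n + 1)) h' ?y \<in> carrier (?M (?X (n + 1)))" by (rule cl[OF lF lX h' y])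
  have "?t (?X n) ?d1 (?t (?X (n + 1)) h' ?y \<oplus>\<^bsub>?M (?X (n + 1))\<^esub> ?t (?X (n + 1)) l u) = u"
    using td1.add[OF h'y lu] dec hz by simp
  then show ?thesis using td1.M.a_closed[OF h'y lu] by blast
qed

section \<open>Total complexes of double complexes\<close>

text \<open>The successor on the integers, kept opaque so that index arithmetic stays syntactic.\<close>

definition su :: "int \<Rightarrow> int" where "su n = n + 1"

lemma su_simps [simp]: "su i \<noteq> i" "i \<noteq> su i" "su i = su j \<longleftrightarrow> i = j" "i < su i" "\<not> su i \<le> i"
  by (simp_all add: su_def)

definition sg :: "('k, 'a) module \<Rightarrow> int \<Rightarrow> 'a \<Rightarrow> 'a" where
  "sg G j x = (if even j then x else \<ominus>\<^bsub>G\<^esub> x)"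

context op_group
begin

lemma sg_closed [simp]: "x \<in> carrier M \<Longrightarrow> sg M j x \<in> carrier M"
  and sg_zero [simp]: "sg M j \<zero> = \<zero>"
  and sg_add [simp]: "\<lbrakk>x \<in> carrier M; y \<in> carrier M\<rbrakk> \<Longrightarrow> sg M j (x \<oplus> y) = sg M j x \<oplus> sg M j y"
  and sg_neg [simp]: "x \<in> carrier M \<Longrightarrow> sg M j (\<ominus> x) = \<ominus> sg M j x"
  and sg_sg [simp]: "x \<in> carrier M \<Longrightarrow> sg M j (sg M j x) = x"
  and sg_su [simp]: "x \<in> carrier M \<Longrightarrow> sg M (su j) x = \<ominus> sg M j x"
  and sg_smult: "\<lbrakk>a \<in> carrier K; x \<in> carrier M\<rbrakk> \<Longrightarrow> sg M j (a \<odot> x) = a \<odot> sg M j x"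
  by (simp_all add: sg_def su_def minus_add a_comm op_minus)

lemma sg_eq_zero: "x \<in> carrier M \<Longrightarrow> sg M j x = \<zero> \<longleftrightarrow> x = \<zero>"
  by (metis sg_sg sg_zero)

end

lemma (in op_hom) sg [simp]: "x \<in> carrier M \<Longrightarrow> f (sg M j x) = sg N j (f x)"
  by (simp add: sg_def)

lemma prod_module_simps [simp]:
  "z \<in> carrier (prod_module A) \<longleftrightarrow> (\<forall>i. z i \<in> carrier (A i))"
  "z \<oplus>\<^bsub>prod_module A\<^esub> w = (\<lambda>i. z i \<oplus>\<^bsub>A i\<^esub> w i)" "\<zero>\<^bsub>prod_module A\<^esub> = (\<lambda>i. \<zero>\<^bsub>A i\<^esub>)"
  "a \<odot>\<^bsub>prod_module A\<^esub> z = (\<lambda>i. a \<odot>\<^bsub>A i\<^esub> z i)"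
  by (simp_all add: prod_module_def)

lemma prod_op_group:
  assumes "\<And>i. op_group K (A i)"
  shows "op_group K (prod_module A)"
proof -
  interpret G: op_group K "A i" for i by fact
  have ab: "abelian_group (prod_module A)"
  proof (rule abelian_groupI)
    show "\<exists>w\<in>carrier (prod_module A). w \<oplus>\<^bsub>prod_module A\<^esub> z = \<zero>\<^bsub>prod_module A\<^esub>"
      if "z \<in> carrier (prod_module A)" for z
      using that by (intro bexI[of _ "\<lambda>i. \<ominus>\<^bsub>A i\<^esub> z i"]) (auto simp: G.l_neg)
  qed (auto simp: G.a_ac)
  show ?thesis by (intro op_group.intro op_group_axioms.intro ab) (auto simp: G.op_add)
qed

lemma prod_neg:
  assumes "\<And>i. op_group K (A i)" "z \<in> carrier (prod_module A)"
  shows "\<ominus>\<^bsub>prod_module A\<^esub> z = (\<lambda>i. \<ominus>\<^bsub>A i\<^esub> z i)"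
proof -
  interpret G: op_group K "A i" for i by fact
  interpret P: op_group K "prod_module A" by (rule prod_op_group) fact
  show ?thesis using assms(2) by (intro P.minus_equality) (auto simp: G.l_neg)
qed

lemma prod_diff:
  assumes "\<And>i. op_group K (A i)" "z \<in> carrier (prod_module A)" "w \<in> carrier (prod_module A)"
  shows "z \<ominus>\<^bsub>prod_module A\<^esub> w = (\<lambda>i. z i \<ominus>\<^bsub>A i\<^esub> w i)"
  using prod_neg[of K A w] assms by (simp add: a_minus_def)

text \<open>\<open>A n i\<close> is the term of bidegree \<open>(i, n - i)\<close>; the maps are indexed by their targets.\<close>

locale bicx =
  fixes K :: "'k ring" and A :: "int \<Rightarrow> int \<Rightarrow> ('k, 'a) module"
    and h v :: "int \<Rightarrow> int \<Rightarrow> 'a \<Rightarrow> 'a"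
  assumes grp: "\<And>n i. op_group K (A n i)"
    and h_hom: "\<And>n i. h n i \<in> mod_hom K (A (su n) (su i)) (A n i)"
    and v_hom: "\<And>n i. v n i \<in> mod_hom K (A (su n) i) (A n i)"
    and hh: "\<And>n i x. x \<in> carrier (A (su (su n)) (su (su i))) \<Longrightarrow> h n i (h (su n) (su i) x) = \<zero>\<^bsub>A n i\<^esub>"
    and vv: "\<And>n i x. x \<in> carrier (A (su (su n)) i) \<Longrightarrow> v n i (v (su n) i x) = \<zero>\<^bsub>A n i\<^esub>"
    and hv: "\<And>n i x. x \<in> carrier (A (su (su n)) (su i)) \<Longrightarrow> h n i (v (su n) (su i) x) = v n i (h (su n) i x)"
    and triv: "\<And>n i x. \<lbrakk>i < n; x \<in> carrier (A n i)\<rbrakk> \<Longrightarrow> x = \<zero>\<^bsub>A n i\<^esub>"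
begin

sublocale G: op_group K "A n i" for n i by (rule grp)
sublocale h: op_hom K "A (su n) (su i)" "A n i" "h n i" for n i by (intro op_homI grp h_hom)
sublocale v: op_hom K "A (su n) i" "A n i" "v n i" for n i by (intro op_homI grp v_hom)

abbreviation "Tot n \<equiv> prod_module (A n)"

sublocale Tot: op_group K "Tot n" for n by (intro prod_op_group grp)

definition D :: "int \<Rightarrow> (int \<Rightarrow> 'a) \<Rightarrow> int \<Rightarrow> 'a" where
  "D n z j = h n j (z (su j)) \<oplus>\<^bsub>A n j\<^esub> sg (A n j) j (v n j (z j))"

lemma D_closed: "z \<in> carrier (Tot (su n)) \<Longrightarrow> D n z j \<in> carrier (A n j)"
  by (simp add: D_def)

lemma D_hom: "D n \<in> mod_hom K (Tot (su n)) (Tot n)"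
proof (rule mod_homI)
  fix z assume z: "z \<in> carrier (Tot (su n))"
  show "D n z \<in> carrier (Tot n)" using D_closed[OF z] by simp
  show "D n (z \<oplus>\<^bsub>Tot (su n)\<^esub> w) = D n z \<oplus>\<^bsub>Tot n\<^esub> D n w" if "w \<in> carrier (Tot (su n))" for w
    using z that by (auto simp: D_def fun_eq_iff G.a_ac)
  show "D n (a \<odot>\<^bsub>Tot (su n)\<^esub> z) = a \<odot>\<^bsub>Tot n\<^esub> D n z" if "a \<in> carrier K" for a
    using z that by (auto simp: D_def fun_eq_iff G.op_add G.sg_smult)
qed

sublocale D: op_hom K "Tot (su n)" "Tot n" "D n" for n
  by (intro op_homI Tot.op_group_axioms D_hom)

text \<open>\<open>h\<close> and \<open>v\<close> commute, and the sign in \<open>D\<close>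
  alternates with the first degree, so the two mixed terms cancel.\<close>

lemma DD:
  assumes z: "z \<in> carrier (Tot (su (su n)))"
  shows "D n (D (su n) z) j = \<zero>\<^bsub>A n j\<^esub>"
proof -
  have c: "z i \<in> carrier (A (su (su n)) i)" for i using z by simp
  have "D n (D (su n) z) j =
    h n j (h (su n) (su j) (z (su (su j))) \<oplus>\<^bsub>A (su n) (su j)\<^esub> sg (A (su n) (su j)) (su j) (v (su n) (su j) (z (su j))))
    \<oplus>\<^bsub>A n j\<^esub> sg (A n j) j (v n j (h (su n) j (z (su j)) \<oplus>\<^bsub>A (su n) j\<^esub> sg (A (su n) j) j (v (su n) j (z j))))"
    by (simp only: D_def)
  also have "\<dots> = \<zero>\<^bsub>A n j\<^esub>" using c by (simp add: hh vv hv G.ag)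
  finally show ?thesis .
qed

lemma D_single:
  assumes "x \<in> carrier (A (su n) i)"
  defines "z \<equiv> (\<lambda>j. if j = i then x else \<zero>\<^bsub>A (su n) j\<^esub>)"
  shows "z \<in> carrier (Tot (su n))" "D n z i = sg (A n i) i (v n i x)"
    "\<And>j. i = su j \<Longrightarrow> D n z j = h n j x" "\<And>j. \<lbrakk>j \<noteq> i; su j \<noteq> i\<rbrakk> \<Longrightarrow> D n z j = \<zero>\<^bsub>A n j\<^esub>"
  using assms by (auto simp: D_def z_def)

text \<open>The components of \<open>y\<close> are found by increasing first degree, beginning where
  the terms vanish; exactness of a column yields the next component. The recursion does not stop, so
  it delivers a family in the product and in general not a finite one.\<close>

lemma column_exact_total:
  assumes ex: "\<And>n i x. \<lbrakk>x \<in> carrier (A (su n) (su i)); h n i x = \<zero>\<^bsub>A n i\<^esub>\<rbrakk> \<Longrightarrow>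
      \<exists>y\<in>carrier (A (su (su n)) (su (su i))). h (su n) (su i) y = x"
    and z: "z \<in> carrier (Tot (su n))" and Dz: "\<And>j. D n z j = \<zero>\<^bsub>A n j\<^esub>"
  shows "\<exists>y\<in>carrier (Tot (su (su n))). D (su n) y = z"
proof -
  let ?A1 = "A (su n)" and ?A2 = "A (su (su n))"
  define ix where "ix l = n + int l" for l
  have ix: "ix (Suc l) = su (ix l)" for l by (simp add: ix_def su_def)
  have zc: "z i \<in> carrier (?A1 i)" for i using z by simp
  \<comment> \<open>For \<open>y\<close> in first degree \<open>su i\<close>, this is what the next
    component, in first degree \<open>su (su i)\<close>, has to hit under \<open>h\<close>. The
    invariant \<open>?P\<close> says that \<open>h\<close> kills it.\<close>
  define r where "r i y = z (su i) \<ominus>\<^bsub>?A1 (su i)\<^esub> sg (?A1 (su i)) (su i) (v (su n) (su i) y)" for i y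
  let ?P = "\<lambda>l y. y \<in> carrier (?A2 (su (ix l))) \<and> h n (ix l) (r (ix l) y) = \<zero>\<^bsub>A n (ix l)\<^esub>"
  let ?Q = "\<lambda>l y y'. h (su n) (su (ix l)) y' = r (ix l) y"
  have "\<exists>f. \<forall>l. ?P l (f l) \<and> ?Q l (f l) (f (Suc l))"
  proof (rule dependent_nat_choice)
    \<comment> \<open>The recursion begins in first degree \<open>su n\<close>, where
      \<open>?A2\<close> is zero and the component of \<open>y\<close> is therefore 0; the component
      \<open>z n\<close> is zero as well.\<close>
    have "z n = \<zero>\<^bsub>?A1 n\<^esub>" using triv[of n "su n" "z n"] zc by (simp add: su_def)
    then have "h n n (z (su n)) = \<zero>\<^bsub>A n n\<^esub>" using Dz[of n] zc by (simp add: D_def)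
    then show "\<exists>y. ?P 0 y" using zc
      by (intro exI[of _ "\<zero>\<^bsub>?A2 (su n)\<^esub>"]) (simp add: ix_def r_def G.ag)
  next
    fix y l assume P: "?P l y"
    let ?i = "ix l"
    have rc: "r ?i y \<in> carrier (?A1 (su ?i))" using P zc by (simp add: r_def)
    from ex[OF this] P obtain y' where y': "y' \<in> carrier (?A2 (su (su ?i)))" "h (su n) (su ?i) y' = r ?i y" by blast
    have "h n (su ?i) (r (su ?i) y') = h n (su ?i) (z (su (su ?i))) \<ominus>\<^bsub>A n (su ?i)\<^esub>
       sg (A n (su ?i)) (su (su ?i)) (v n (su ?i) (r ?i y))"
      using y' zc P by (simp add: r_def hv)
    also have "v n (su ?i) (r ?i y) = v n (su ?i) (z (su ?i))" using P zc by (simp add: r_def vv G.ag)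
    also have "h n (su ?i) (z (su (su ?i))) \<ominus>\<^bsub>A n (su ?i)\<^esub>
       sg (A n (su ?i)) (su (su ?i)) (v n (su ?i) (z (su ?i))) = D n z (su ?i)"
      using zc by (simp add: D_def G.ag)
    finally have "h n (su ?i) (r (su ?i) y') = \<zero>\<^bsub>A n (su ?i)\<^esub>" using Dz by simp
    then show "\<exists>y'. ?P (Suc l) y' \<and> ?Q l y y'" using y' by (auto simp: ix)
  qed
  then obtain f where f: "\<And>l. ?P l (f l)" "\<And>l. ?Q l (f l) (f (Suc l))" by blast
  define Y where "Y j = (if su n \<le> j then f (nat (j - su n)) else \<zero>\<^bsub>?A2 j\<^esub>)" for j
  have Yf: "Y (su (ix l)) = f l" for l by (simp add: Y_def ix_def su_def)
  have idx: "\<exists>l. j = su (ix l)" if "su n \<le> j" for j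
    using that by (intro exI[of _ "nat (j - su n)"]) (simp add: ix_def su_def)
  have Yc: "Y j \<in> carrier (?A2 j)" for j
  proof (cases "su n \<le> j")
    case True
    then show ?thesis using idx Yf f(1) by force
  qed (simp add: Y_def)
  have "D (su n) Y j = z j" for j
  proof (cases "su n \<le> j")
    case True
    then obtain l where l: "j = su (ix l)" using idx by blast
    have "D (su n) Y j = r (ix l) (f l) \<oplus>\<^bsub>?A1 j\<^esub> sg (?A1 j) j (v (su n) j (f l))"
      using Yf[of l] Yf[of "Suc l"] f(2)[of l] by (simp add: D_def l ix)
    also have "\<dots> = z j" using f(1)[of l] zc by (simp add: r_def l G.ag)
    finally show ?thesis .
  next
    case False
    then have "j < su n" by simp
    then show ?thesis using triv[of j "su n"] zc D_closed[of Y "su n"] Yc by (metis prod_module_simps(1))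
  qed
  then show ?thesis using Yc by (intro bexI[of _ Y]) auto
qed

end

section \<open>Augmented double complexes with exact rows and columns\<close>

text \<open>\<open>C\<close> augments the rows at second degree 0, that is at the terms
  \<open>A n n\<close>. Exactness of the augmented rows is split into \<open>e_inj\<close>,
  \<open>e_onto\<close> and \<open>row\<close>, according to the place in the row;
  \<open>column\<close> is exactness of the columns.\<close>

locale augmented_bicx = bicx K A h v
  for K :: "'k ring" and A :: "int \<Rightarrow> int \<Rightarrow> ('k, 'a) module" and h v +
  fixes C :: "int \<Rightarrow> ('k, 'c) module" and d :: "int \<Rightarrow> 'c \<Rightarrow> 'c" and e :: "int \<Rightarrow> 'c \<Rightarrow> 'a"
  assumes C_grp: "\<And>n. op_group K (C n)"
    and d_hom: "\<And>n. d n \<in> mod_hom K (C (su n)) (C n)"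
    and e_hom: "\<And>n. e n \<in> mod_hom K (C n) (A n n)"
    and e_d: "\<And>n c. c \<in> carrier (C (su n)) \<Longrightarrow> e n (d n c) = h n n (e (su n) c)"
    and v_e: "\<And>n c. c \<in> carrier (C (su n)) \<Longrightarrow> v n (su n) (e (su n) c) = \<zero>\<^bsub>A n (su n)\<^esub>"
    and e_inj: "\<And>n c. \<lbrakk>c \<in> carrier (C n); e n c = \<zero>\<^bsub>A n n\<^esub>\<rbrakk> \<Longrightarrow> c = \<zero>\<^bsub>C n\<^esub>"
    and e_onto: "\<And>n x. \<lbrakk>x \<in> carrier (A (su n) (su n)); v n (su n) x = \<zero>\<^bsub>A n (su n)\<^esub>\<rbrakk> \<Longrightarrow> \<exists>c\<in>carrier (C (su n)). e (su n) c = x"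
    and row: "\<And>n i x. \<lbrakk>su n < i; x \<in> carrier (A (su n) i); v n i x = \<zero>\<^bsub>A n i\<^esub>\<rbrakk> \<Longrightarrow>
      \<exists>y\<in>carrier (A (su (su n)) i). v (su n) i y = x"
    and column: "\<And>n i x. \<lbrakk>x \<in> carrier (A (su n) (su i)); h n i x = \<zero>\<^bsub>A n i\<^esub>\<rbrakk> \<Longrightarrow>
      \<exists>y\<in>carrier (A (su (su n)) (su (su i))). h (su n) (su i) y = x"
begin

sublocale C: op_group K "C n" for n by (rule C_grp)
sublocale d: op_hom K "C (su n)" "C n" "d n" for n by (intro op_homI C_grp d_hom)
sublocale e: op_hom K "C n" "A n n" "e n" for n by (intro op_homI C_grp grp e_hom)

definition edge :: "int \<Rightarrow> 'c \<Rightarrow> int \<Rightarrow> 'a" where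
  "edge n c = (\<lambda>j. if j = n then e n c else \<zero>\<^bsub>A n j\<^esub>)"

lemma edge_closed: "c \<in> carrier (C n) \<Longrightarrow> edge n c \<in> carrier (Tot n)"
  by (simp add: edge_def)

lemma edge_hom: "edge n \<in> mod_hom K (C n) (Tot n)"
  by (rule mod_homI) (auto simp: edge_def fun_eq_iff)

sublocale edge: op_hom K "C n" "Tot n" "edge n" for n
  by (intro op_homI C_grp Tot.op_group_axioms edge_hom)

text \<open>On the edge the \<open>v\<close>-part of the boundary dies by \<open>v_e\<close>, and
  the \<open>h\<close>-part stays on the edge by \<open>e_d\<close>.\<close>

lemma D_edge:
  assumes "c \<in> carrier (C (su n))"
  shows "D n (edge (su n) c) = edge n (d n c)"
proof
  fix j
  note s = D_single[OF e.closed[OF assms]]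
  consider "j = su n" | "j = n" | "j \<noteq> su n" "j \<noteq> n" by blast
  then show "D n (edge (su n) c) j = edge n (d n c) j"
  proof cases
    case 1
    then show ?thesis using s(2) v_e[OF assms] unfolding edge_def by (simp add: su_def)
  next
    case 2
    then show ?thesis using s(3)[of n] e_d[OF assms] unfolding edge_def by simp
  next
    case 3
    then show ?thesis using s(4)[of j] unfolding edge_def by (simp add: su_def)
  qed
qed

text \<open>A finite cochain that is closed off the edge is, up to a finite boundary, on the edge: peel off
  the top component by exactness of the rows.\<close>

lemma row_reduction:
  assumes "x \<in> carrier (Tot (su n))" "\<And>j. su n \<le> j \<Longrightarrow> D n x j = \<zero>\<^bsub>A n j\<^esub>"
    "\<And>j. N < j \<Longrightarrow> x j = \<zero>\<^bsub>A (su n) j\<^esub>"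
  shows "\<exists>y\<in>carrier (Tot (su (su n))). \<exists>c\<in>carrier (C (su n)). (\<exists>N. \<forall>j>N. y j = \<zero>\<^bsub>A (su (su n)) j\<^esub>) \<and>
    x = D (su n) y \<oplus>\<^bsub>Tot (su n)\<^esub> edge (su n) c"
proof -
  have main: "\<exists>y\<in>carrier (Tot (su (su n))). \<exists>c\<in>carrier (C (su n)). (\<exists>N. \<forall>j>N. y j = \<zero>\<^bsub>A (su (su n)) j\<^esub>) \<and>
      x = D (su n) y \<oplus>\<^bsub>Tot (su n)\<^esub> edge (su n) c"
    if "x \<in> carrier (Tot (su n))" "\<And>j. su n \<le> j \<Longrightarrow> D n x j = \<zero>\<^bsub>A n j\<^esub>"
      "\<And>j. su n + int l < j \<Longrightarrow> x j = \<zero>\<^bsub>A (su n) j\<^esub>" for l x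
    using that
  proof (induction l arbitrary: x)
    case (0 x)
    have xc: "x j \<in> carrier (A (su n) j)" for j using 0(1) by simp
    have "x (su (su n)) = \<zero>\<^bsub>A (su n) (su (su n))\<^esub>" using 0(3)[of "su (su n)"] by (simp add: su_def)
    then have "v n (su n) (x (su n)) = \<zero>\<^bsub>A n (su n)\<^esub>"
      using 0(2)[of "su n"] xc G.sg_eq_zero[of "v n (su n) (x (su n))"] by (simp add: D_def)
    then obtain c where c: "c \<in> carrier (C (su n))" "e (su n) c = x (su n)" using e_onto xc by blast
    have "x j = edge (su n) c j" for j
    proof -
      consider "j = su n" | "su n < j" | "j < su n" by linarith
      then show ?thesis
        using c 0(3)[of j] triv[of j "su n" "x j"] xc by cases (auto simp: edge_def)
    qed
    then have "x = D (su n) \<zero>\<^bsub>Tot (su (su n))\<^esub> \<oplus>\<^bsub>Tot (su n)\<^esub> edge (su n) c"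
      unfolding D.zero using edge_closed[OF c(1)] by (auto simp: fun_eq_iff)
    then show ?case using c(1) by (intro bexI[of _ "\<zero>\<^bsub>Tot (su (su n))\<^esub>"] bexI[of _ c]) auto
  next
    case (Suc l x)
    let ?N = "su n + int (Suc l)"
    have xc: "x j \<in> carrier (A (su n) j)" for j using Suc.prems(1) by simp
    have N: "su n < ?N" "?N < su ?N" by (simp_all add: su_def)
    \<comment> \<open>Above \<open>?N\<close> everything vanishes, so the boundary at
      \<open>?N\<close> is its \<open>v\<close>-part alone and exactness of the row provides
      \<open>y0\<close>. The sign in \<open>?y\<close> undoes the one in \<open>D\<close>.\<close>
    have "x (su ?N) = \<zero>\<^bsub>A (su n) (su ?N)\<^esub>" using Suc.prems(3) N(2) by blast
    then have "v n ?N (x ?N) = \<zero>\<^bsub>A n ?N\<^esub>"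
      using Suc.prems(2)[of ?N] N(1) xc G.sg_eq_zero[of "v n ?N (x ?N)"] by (simp add: D_def del: of_nat_Suc)
    then obtain y0 where y0: "y0 \<in> carrier (A (su (su n)) ?N)" "v (su n) ?N y0 = x ?N" using row[OF N(1)] xc by blast
    let ?y = "\<lambda>j. if j = ?N then sg (A (su (su n)) ?N) ?N y0 else \<zero>\<^bsub>A (su (su n)) j\<^esub>"
    note s = D_single[OF G.sg_closed[OF y0(1), of ?N]]
    define x' where "x' = x \<ominus>\<^bsub>Tot (su n)\<^esub> D (su n) ?y"
    have Dy: "D (su n) ?y \<in> carrier (Tot (su n))" by (rule D.closed[OF s(1)])
    have x'c: "x' \<in> carrier (Tot (su n))" unfolding x'_def using Suc.prems(1) Dy by (rule Tot.minus_closed)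
    have x'j: "x' j = x j \<ominus>\<^bsub>A (su n) j\<^esub> D (su n) ?y j" for j
      unfolding x'_def prod_diff[OF grp Suc.prems(1) Dy] ..
    have Dyc: "D (su n) ?y j \<in> carrier (A (su n) j)" for j using Dy by simp
    have "\<exists>y\<in>carrier (Tot (su (su n))). \<exists>c\<in>carrier (C (su n)). (\<exists>N. \<forall>j>N. y j = \<zero>\<^bsub>A (su (su n)) j\<^esub>) \<and>
      x' = D (su n) y \<oplus>\<^bsub>Tot (su n)\<^esub> edge (su n) c"
    proof (rule Suc.IH[OF x'c])
      fix j assume "su n \<le> j"
      have "D n x' = D n x \<ominus>\<^bsub>Tot n\<^esub> D n (D (su n) ?y)" unfolding x'_def using Suc.prems(1) Dy by (rule D.diff)
      then have "D n x' j = D n x j \<ominus>\<^bsub>A n j\<^esub> D n (D (su n) ?y) j"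
        using prod_diff[OF grp D.closed[OF Suc.prems(1)] D.closed[OF Dy]] by simp
      then show "D n x' j = \<zero>\<^bsub>A n j\<^esub>"
        using Suc.prems(2)[OF \<open>su n \<le> j\<close>] DD[OF s(1)] by (simp add: G.ag)
    next
      fix j assume j: "su n + int l < j"
      show "x' j = \<zero>\<^bsub>A (su n) j\<^esub>"
      proof (cases "j = ?N")
        case True
        have "D (su n) ?y ?N = x ?N" using s(2) y0 xc[of ?N] by (simp del: of_nat_Suc)
        then show ?thesis unfolding True x'j using xc by (simp add: G.ag del: of_nat_Suc)
      next
        case False
        then have "?N < j" "su j \<noteq> ?N" using j by (auto simp: su_def)
        then show ?thesis unfolding x'j using s(4)[of j] Suc.prems(3)[of j] False by (simp add: G.ag)
      qed
    qed
    then obtain y c N where y: "y \<in> carrier (Tot (su (su n)))" and c: "c \<in> carrier (C (su n))"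
      and N': "\<And>j. N < j \<Longrightarrow> y j = \<zero>\<^bsub>A (su (su n)) j\<^esub>" and eq: "x' = D (su n) y \<oplus>\<^bsub>Tot (su n)\<^esub> edge (su n) c" by blast
    have "x = x' \<oplus>\<^bsub>Tot (su n)\<^esub> D (su n) ?y"
      unfolding x'_def using Suc.prems(1) Dy by (simp add: Tot.ag del: prod_module_simps)
    also have "\<dots> = D (su n) (y \<oplus>\<^bsub>Tot (su (su n))\<^esub> ?y) \<oplus>\<^bsub>Tot (su n)\<^esub> edge (su n) c"
      unfolding eq D.add[OF y s(1)] using D.closed[OF y] Dy edge_closed[OF c]
      by (simp add: Tot.ag del: prod_module_simps)
    finally have "x = D (su n) (y \<oplus>\<^bsub>Tot (su (su n))\<^esub> ?y) \<oplus>\<^bsub>Tot (su n)\<^esub> edge (su n) c" .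
    moreover have "(y \<oplus>\<^bsub>Tot (su (su n))\<^esub> ?y) j = \<zero>\<^bsub>A (su (su n)) j\<^esub>" if "max N ?N < j" for j
      using N'[of j] that by simp
    ultimately show ?case using Tot.a_closed[OF y s(1)] c by blast
  qed
  show ?thesis
    by (rule main[OF assms(1,2), of "nat (N - su n)"]) (use assms(3) in \<open>auto split: if_splits\<close>)
qed

end

section \<open>Maps and homotopies in high first degrees\<close>

locale bicx_map = A: bicx K A h v + B: bicx K B h' v'
  for K :: "'k ring" and A :: "int \<Rightarrow> int \<Rightarrow> ('k, 'a) module" and h v
    and B :: "int \<Rightarrow> int \<Rightarrow> ('k, 'b) module" and h' v' +
  fixes f :: "int \<Rightarrow> int \<Rightarrow> 'a \<Rightarrow> 'b" and m :: int
  assumes f_hom: "\<And>n i. m \<le> i \<Longrightarrow> f n i \<in> mod_hom K (A n i) (B n i)"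
    and f_h: "\<And>n i x. \<lbrakk>m \<le> i; x \<in> carrier (A (su n) (su i))\<rbrakk> \<Longrightarrow> h' n i (f (su n) (su i) x) = f n i (h n i x)"
    and f_v: "\<And>n i x. \<lbrakk>m \<le> i; x \<in> carrier (A (su n) i)\<rbrakk> \<Longrightarrow> v' n i (f (su n) i x) = f n i (v n i x)"
begin

lemma f_op: "m \<le> i \<Longrightarrow> op_hom K (A n i) (B n i) (f n i)"
  by (intro op_homI A.grp B.grp f_hom)

text \<open>Extension by zero below \<open>N\<close> turns a map that exists in high first degrees
  only into one of total complexes. It commutes with the differential from \<open>N\<close> on, by
  \<open>cut_D\<close>; what happens below is invisible to germs.\<close>

definition cut :: "int \<Rightarrow> int \<Rightarrow> (int \<Rightarrow> 'a) \<Rightarrow> int \<Rightarrow> 'b" where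
  "cut N n z = (\<lambda>j. if N \<le> j then f n j (z j) else \<zero>\<^bsub>B n j\<^esub>)"

lemma cut_closed: "\<lbrakk>m \<le> N; z \<in> carrier (A.Tot n)\<rbrakk> \<Longrightarrow> cut N n z \<in> carrier (B.Tot n)"
  using mod_hom_closed[OF f_hom] by (auto simp: cut_def)

lemma cut_D:
  assumes "m \<le> N" "z \<in> carrier (A.Tot (su n))" "N \<le> j"
  shows "B.D n (cut N (su n) z) j = f n j (A.D n z j)"
proof -
  interpret f: op_hom K "A n j" "B n j" "f n j" using assms by (intro f_op) simp
  have z: "z i \<in> carrier (A (su n) i)" for i using assms(2) by simp
  have "N \<le> su j" using assms(3) by (simp add: su_def)
  then show ?thesis using assms f_h[of j "z (su j)" n] f_v[of j "z j" n] z
    by (simp add: B.D_def A.D_def cut_def)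
qed

end

text \<open>The shape that a homotopy of complexes takes after tensoring with \<open>I\<close>: it
  moves the first degree only and commutes with \<open>v\<close>.\<close>

locale bicx_homotopy = bicx K A h v
  for K :: "'k ring" and A :: "int \<Rightarrow> int \<Rightarrow> ('k, 'a) module" and h v +
  fixes \<phi> s :: "int \<Rightarrow> int \<Rightarrow> 'a \<Rightarrow> 'a" and m :: int
  assumes \<phi>_hom: "\<And>n i. m \<le> i \<Longrightarrow> \<phi> n i \<in> mod_hom K (A n i) (A n i)"
    and s_hom: "\<And>n i. m \<le> i \<Longrightarrow> s n i \<in> mod_hom K (A n i) (A (su n) (su i))"
    and s_v: "\<And>n i x. \<lbrakk>m \<le> i; x \<in> carrier (A (su n) i)\<rbrakk> \<Longrightarrow> v (su n) (su i) (s (su n) i x) = s n i (v n i x)"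
    and s_h: "\<And>n i x. \<lbrakk>m \<le> i; x \<in> carrier (A (su n) (su i))\<rbrakk> \<Longrightarrow>
      x = \<phi> (su n) (su i) x \<oplus>\<^bsub>A (su n) (su i)\<^esub> h (su n) (su i) (s (su n) (su i) x) \<oplus>\<^bsub>A (su n) (su i)\<^esub> s n i (h n i x)"
begin

definition shift :: "int \<Rightarrow> int \<Rightarrow> (int \<Rightarrow> 'a) \<Rightarrow> int \<Rightarrow> 'a" where
  "shift N n z = (\<lambda>j. if su N \<le> j then s n (j - 1) (z (j - 1)) else \<zero>\<^bsub>A (su n) j\<^esub>)"

lemma shift_su: "N \<le> i \<Longrightarrow> shift N n z (su i) = s n i (z i)"
  by (simp add: shift_def su_def)

lemma shift_closed:
  assumes "m \<le> N" "z \<in> carrier (Tot n)"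
  shows "shift N n z \<in> carrier (Tot (su n))"
proof -
  have "shift N n z j \<in> carrier (A (su n) j)" for j
  proof (cases "su N \<le> j")
    case True
    then have N: "N \<le> j - 1" and j: "su (j - 1) = j" by (simp_all add: su_def)
    have "s n (j - 1) (z (j - 1)) \<in> carrier (A (su n) (su (j - 1)))"
      using mod_hom_closed[OF s_hom] N assms by simp
    then show ?thesis using True j by (simp add: shift_def)
  qed (simp add: shift_def)
  then show ?thesis by simp
qed

text \<open>\<open>s\<close> raises the first degree by one, so the \<open>v\<close>-terms in the
  two summands carry opposite signs and cancel; the \<open>h\<close>-terms form the given homotopy.
  The bound is \<open>su N\<close> because \<open>shift\<close> reads the component one degree
  below.\<close>

lemma homotopy_D:
  assumes m: "m \<le> N" and z: "z \<in> carrier (Tot (su n))" and j: "su N \<le> j"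
  shows "z j = \<phi> (su n) j (z j) \<oplus>\<^bsub>A (su n) j\<^esub> (D (su n) (shift N (su n) z) j \<oplus>\<^bsub>A (su n) j\<^esub> shift N n (D n z) j)"
proof -
  define i where "i = j - 1"
  have i: "j = su i" "N \<le> i" "N \<le> su i" "m \<le> i" "m \<le> su i" using m j by (auto simp: i_def su_def)
  have c: "z l \<in> carrier (A (su n) l)" for l using z by simp
  interpret s: op_hom K "A n i" "A (su n) (su i)" "s n i" by (intro op_homI grp s_hom i)
  interpret s1: op_hom K "A (su n) (su i)" "A (su (su n)) (su (su i))" "s (su n) (su i)" by (intro op_homI grp s_hom i)
  interpret p: op_hom K "A (su n) (su i)" "A (su n) (su i)" "\<phi> (su n) (su i)" by (intro op_homI grp \<phi>_hom i)
  have "D (su n) (shift N (su n) z) (su i) = h (su n) (su i) (s (su n) (su i) (z (su i)))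
      \<oplus>\<^bsub>A (su n) (su i)\<^esub> sg (A (su n) (su i)) (su i) (s n i (v n i (z i)))"
    using i by (simp add: D_def shift_su s_v c)
  moreover have "shift N n (D n z) (su i) = s n i (h n i (z (su i))) \<oplus>\<^bsub>A (su n) (su i)\<^esub> sg (A (su n) (su i)) i (s n i (v n i (z i)))"
    using i c by (simp add: D_def shift_su)
  ultimately have "D (su n) (shift N (su n) z) (su i) \<oplus>\<^bsub>A (su n) (su i)\<^esub> shift N n (D n z) (su i) =
     h (su n) (su i) (s (su n) (su i) (z (su i))) \<oplus>\<^bsub>A (su n) (su i)\<^esub> s n i (h n i (z (su i)))"
    using c by (simp add: G.ag)
  moreover have "z (su i) = \<phi> (su n) (su i) (z (su i)) \<oplus>\<^bsub>A (su n) (su i)\<^esub>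
    (h (su n) (su i) (s (su n) (su i) (z (su i))) \<oplus>\<^bsub>A (su n) (su i)\<^esub> s n i (h n i (z (su i))))"
    using s_h[OF i(4), of "z (su i)" n] c by (simp add: G.a_assoc)
  ultimately show ?thesis unfolding i(1) by simp
qed

end

text \<open>\<open>A\<close> stands for \<open>T \<otimes> I\<close> augmented by \<open>T \<otimes> N\<close>, and \<open>B\<close> for \<open>P \<otimes> I\<close>; they are
  homotopy equivalent where the first degree is beyond \<open>m\<close>.\<close>

locale tate_bicx = A: augmented_bicx K A h v C d e + B: bicx K B h' v' +
  \<alpha>: bicx_map K A h v B h' v' \<alpha> m + \<beta>: bicx_map K B h' v' A h v \<beta> m +
  sA: bicx_homotopy K A h v "\<lambda>n i x. \<beta> n i (\<alpha> n i x)" s m +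
  sB: bicx_homotopy K B h' v' "\<lambda>n i x. \<alpha> n i (\<beta> n i x)" s' m
  for K :: "'k ring" and A :: "int \<Rightarrow> int \<Rightarrow> ('k, 'a) module" and h v
    and C :: "int \<Rightarrow> ('k, 'c) module" and d e
    and B :: "int \<Rightarrow> int \<Rightarrow> ('k, 'b) module" and h' v' and \<alpha> \<beta> s s' m
begin

text \<open>The graph of the connecting map: the germ of \<open>z\<close> is transferred by \<beta>
  and completed to some \<open>w\<close> in the product total complex, whose boundary lies on the
  edge. The completion is not unique, hence a relation.\<close>

definition rel :: "int \<Rightarrow> (int \<Rightarrow> 'b) \<Rightarrow> 'c \<Rightarrow> bool" where
  "rel n z t \<longleftrightarrow> (\<exists>w\<in>carrier (A.Tot (su n)). (\<exists>N\<ge>m. \<forall>j\<ge>N. w j = \<beta> (su n) j (z j)) \<and> A.D n w = A.edge n t)"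

lemma relE:
  assumes "rel n z t"
  obtains w N where "w \<in> carrier (A.Tot (su n))" "m \<le> N" "\<And>j. N \<le> j \<Longrightarrow> w j = \<beta> (su n) j (z j)"
    "A.D n w = A.edge n t"
  using assms unfolding rel_def by blast

lemma relI:
  assumes "w \<in> carrier (A.Tot (su n))" "m \<le> N" "\<And>j. N \<le> j \<Longrightarrow> w j = \<beta> (su n) j (z j)"
    "A.D n w = A.edge n t"
  shows "rel n z t"
  using assms unfolding rel_def by blast

lemma rel_add:
  assumes z: "z \<in> carrier (B.Tot (su n))" "y \<in> carrier (B.Tot (su n))" and t: "t \<in> carrier (C n)" "u \<in> carrier (C n)"
    and r: "rel n z t" "rel n y u"
  shows "rel n (z \<oplus>\<^bsub>B.Tot (su n)\<^esub> y) (t \<oplus>\<^bsub>C n\<^esub> u)"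
proof -
  obtain w N where w: "w \<in> carrier (A.Tot (su n))" "m \<le> N" "\<And>j. N \<le> j \<Longrightarrow> w j = \<beta> (su n) j (z j)"
    "A.D n w = A.edge n t" by (rule relE[OF r(1)]) (rule that; simp)
  obtain x L where x: "x \<in> carrier (A.Tot (su n))" "m \<le> L" "\<And>j. L \<le> j \<Longrightarrow> x j = \<beta> (su n) j (y j)"
    "A.D n x = A.edge n u" by (rule relE[OF r(2)]) (rule that; simp)
  show ?thesis
  proof (rule relI[OF A.Tot.a_closed[OF w(1) x(1)], of "max N L"])
    show "m \<le> max N L" using w(2) by simp
    show "A.D n (w \<oplus>\<^bsub>A.Tot (su n)\<^esub> x) = A.edge n (t \<oplus>\<^bsub>C n\<^esub> u)"
      using A.D.add[OF w(1) x(1)] A.edge.add[OF t] w(4) x(4) by simp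
    fix j assume j: "max N L \<le> j"
    interpret b: op_hom K "B (su n) j" "A (su n) j" "\<beta> (su n) j" using j w(2) by (intro \<beta>.f_op) simp
    show "(w \<oplus>\<^bsub>A.Tot (su n)\<^esub> x) j = \<beta> (su n) j ((z \<oplus>\<^bsub>B.Tot (su n)\<^esub> y) j)"
      using w(3) x(3) j z by simp
  qed
qed

lemma rel_neg:
  assumes z: "z \<in> carrier (B.Tot (su n))" and t: "t \<in> carrier (C n)" and r: "rel n z t"
  shows "rel n (\<ominus>\<^bsub>B.Tot (su n)\<^esub> z) (\<ominus>\<^bsub>C n\<^esub> t)"
proof -
  obtain w N where w: "w \<in> carrier (A.Tot (su n))" "m \<le> N" "\<And>j. N \<le> j \<Longrightarrow> w j = \<beta> (su n) j (z j)"
    "A.D n w = A.edge n t" by (rule relE[OF r]) (rule that; simp)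
  show ?thesis
  proof (rule relI[OF A.Tot.a_inv_closed[OF w(1)] w(2)])
    show "A.D n (\<ominus>\<^bsub>A.Tot (su n)\<^esub> w) = A.edge n (\<ominus>\<^bsub>C n\<^esub> t)"
      using A.D.minus[OF w(1)] A.edge.minus[OF t] w(4) by simp
    fix j assume j: "N \<le> j"
    interpret b: op_hom K "B (su n) j" "A (su n) j" "\<beta> (su n) j" using j w(2) by (intro \<beta>.f_op) simp
    show "(\<ominus>\<^bsub>A.Tot (su n)\<^esub> w) j = \<beta> (su n) j ((\<ominus>\<^bsub>B.Tot (su n)\<^esub> z) j)"
      using w(3)[OF j] z by (simp add: prod_neg[OF A.grp w(1)] prod_neg[OF B.grp z])
  qed
qed

lemma rel_smult:
  assumes a: "a \<in> carrier K" and z: "z \<in> carrier (B.Tot (su n))" and t: "t \<in> carrier (C n)" and r: "rel n z t"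
  shows "rel n (a \<odot>\<^bsub>B.Tot (su n)\<^esub> z) (a \<odot>\<^bsub>C n\<^esub> t)"
proof -
  obtain w N where w: "w \<in> carrier (A.Tot (su n))" "m \<le> N" "\<And>j. N \<le> j \<Longrightarrow> w j = \<beta> (su n) j (z j)"
    "A.D n w = A.edge n t" by (rule relE[OF r]) (rule that; simp)
  show ?thesis
  proof (rule relI[OF A.Tot.op_closed[OF a w(1)] w(2)])
    show "A.D n (a \<odot>\<^bsub>A.Tot (su n)\<^esub> w) = A.edge n (a \<odot>\<^bsub>C n\<^esub> t)"
      using A.D.smult[OF a w(1)] A.edge.smult[OF a t] w(4) by simp
    fix j assume j: "N \<le> j"
    interpret b: op_hom K "B (su n) j" "A (su n) j" "\<beta> (su n) j" using j w(2) by (intro \<beta>.f_op) simp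
    show "(a \<odot>\<^bsub>A.Tot (su n)\<^esub> w) j = \<beta> (su n) j ((a \<odot>\<^bsub>B.Tot (su n)\<^esub> z) j)"
      using w(3)[OF j] z a by simp
  qed
qed

text \<open>As \<open>z\<close> is a cycle in high degrees, the boundary of its truncated image
  \<open>w0\<close> is a finite cycle. \<open>row_reduction\<close> moves it to the edge at the cost
  of a finite \<open>y\<close>, and subtracting \<open>y\<close> from \<open>w0\<close> leaves the
  high degrees untouched.\<close>

lemma rel_total:
  assumes z: "z \<in> carrier (B.Tot (su (su p)))" and fin: "\<And>j. N \<le> j \<Longrightarrow> B.D (su p) z j = \<zero>\<^bsub>B (su p) j\<^esub>"
  shows "\<exists>t\<in>carrier (C (su p)). d p t = \<zero>\<^bsub>C p\<^esub> \<and> rel (su p) z t"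
proof -
  let ?n = "su p" and ?N = "max N m"
  define w0 where "w0 = \<beta>.cut ?N (su ?n) z"
  have w0: "w0 \<in> carrier (A.Tot (su ?n))" unfolding w0_def using z by (intro \<beta>.cut_closed) auto
  have Dw0: "A.D ?n w0 \<in> carrier (A.Tot ?n)" by (rule A.D.closed[OF w0])
  have z0: "A.D ?n w0 j = \<zero>\<^bsub>A ?n j\<^esub>" if "?N \<le> j" for j
  proof -
    interpret b: op_hom K "B ?n j" "A ?n j" "\<beta> ?n j" using that by (intro \<beta>.f_op) simp
    show ?thesis unfolding w0_def using \<beta>.cut_D[OF _ z that] fin[of j] that by simp
  qed
  obtain y c L where y: "y \<in> carrier (A.Tot (su ?n))" and c: "c \<in> carrier (C ?n)"
    and L: "\<And>j. L < j \<Longrightarrow> y j = \<zero>\<^bsub>A (su ?n) j\<^esub>" and eq: "A.D ?n w0 = A.D ?n y \<oplus>\<^bsub>A.Tot ?n\<^esub> A.edge ?n c"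
    using A.row_reduction[OF Dw0, of ?N] A.DD[OF w0] z0 by (metis less_imp_le)
  have e: "A.edge ?n c \<in> carrier (A.Tot ?n)" by (rule A.edge_closed[OF c])
  have Dy: "A.D ?n y \<in> carrier (A.Tot ?n)" by (rule A.D.closed[OF y])
  define w where "w = w0 \<ominus>\<^bsub>A.Tot (su ?n)\<^esub> y"
  have w: "w \<in> carrier (A.Tot (su ?n))" unfolding w_def by (rule A.Tot.minus_closed[OF w0 y])
  have "A.D ?n w = (A.D ?n y \<oplus>\<^bsub>A.Tot ?n\<^esub> A.edge ?n c) \<ominus>\<^bsub>A.Tot ?n\<^esub> A.D ?n y"
    unfolding w_def A.D.diff[OF w0 y] eq ..
  also have "\<dots> = A.edge ?n c" using e Dy by (simp add: A.Tot.ag del: prod_module_simps)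
  finally have Dw: "A.D ?n w = A.edge ?n c" .
  have "rel ?n z c"
  proof (rule relI[OF w _ _ Dw, of "max ?N (L + 1)"])
    fix j assume j: "max ?N (L + 1) \<le> j"
    interpret b: op_hom K "B (su ?n) j" "A (su ?n) j" "\<beta> (su ?n) j" using j by (intro \<beta>.f_op) simp
    have "w j = w0 j \<ominus>\<^bsub>A (su ?n) j\<^esub> y j" unfolding w_def prod_diff[OF A.grp w0 y] ..
    then show "w j = \<beta> (su ?n) j (z j)" using L[of j] j z by (simp add: w0_def \<beta>.cut_def A.G.ag)
  qed simp
  moreover have "d p c = \<zero>\<^bsub>C p\<^esub>"
  proof (rule A.e_inj[OF A.d.closed[OF c]])
    have "A.edge p (d p c) p = A.D p (A.D ?n w) p" unfolding Dw A.D_edge[OF c] ..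
    then show "e p (d p c) = \<zero>\<^bsub>A p p\<^esub>" using A.DD[OF w] by (simp add: A.edge_def)
  qed
  ultimately show ?thesis using c by blast
qed

text \<open>By exactness of the columns the edge of \<open>t\<close> is the boundary of some
  \<open>w\<close> in the product. This \<open>w\<close> need not come from \<open>B\<close> in high
  degrees; subtracting the boundary of its shift under the homotopy replaces it there by its image
  under \<beta> after \<alpha>, without changing its boundary.\<close>

lemma rel_onto:
  assumes t: "t \<in> carrier (C (su p))" and dt: "d p t = \<zero>\<^bsub>C p\<^esub>"
  shows "\<exists>z\<in>carrier (B.Tot (su (su p))). (\<exists>N. \<forall>j\<ge>N. B.D (su p) z j = \<zero>\<^bsub>B (su p) j\<^esub>) \<and> rel (su p) z t"
proof -
  \<comment> \<open>The bound \<open>su (su p)\<close> lies above the only component of the edge of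
    \<open>t\<close> that can be nonzero.\<close>
  let ?n = "su p" and ?N = "max m (su (su p))"
  have "A.D p (A.edge ?n t) j = \<zero>\<^bsub>A p j\<^esub>" for j
    unfolding A.D_edge[OF t] dt A.edge.zero by simp
  from A.column_exact_total[OF A.column A.edge_closed[OF t] this]
  obtain w where w: "w \<in> carrier (A.Tot (su ?n))" "A.D ?n w = A.edge ?n t" by blast
  have e0: "A.edge ?n t j = \<zero>\<^bsub>A ?n j\<^esub>" if "?N \<le> j" for j using that by (auto simp: A.edge_def)
  define z where "z = \<alpha>.cut ?N (su ?n) w"
  have z: "z \<in> carrier (B.Tot (su ?n))" unfolding z_def using w by (intro \<alpha>.cut_closed) auto
  have Dz: "B.D ?n z j = \<zero>\<^bsub>B ?n j\<^esub>" if "?N \<le> j" for j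
  proof -
    interpret a: op_hom K "A ?n j" "B ?n j" "\<alpha> ?n j" using that by (intro \<alpha>.f_op) simp
    show ?thesis unfolding z_def using \<alpha>.cut_D[OF _ w(1) that] e0[OF that] w(2) by simp
  qed
  define y where "y = sA.shift ?N (su ?n) w"
  have y: "y \<in> carrier (A.Tot (su (su ?n)))" unfolding y_def using w by (intro sA.shift_closed) auto
  have Dy: "A.D (su ?n) y \<in> carrier (A.Tot (su ?n))" by (rule A.D.closed[OF y])
  define w' where "w' = w \<ominus>\<^bsub>A.Tot (su ?n)\<^esub> A.D (su ?n) y"
  have w': "w' \<in> carrier (A.Tot (su ?n))" unfolding w'_def by (rule A.Tot.minus_closed[OF w(1) Dy])
  have "rel ?n z t"
  proof (rule relI[OF w', of "su ?N"])
    have "A.D ?n w' = A.D ?n w \<ominus>\<^bsub>A.Tot ?n\<^esub> A.D ?n (A.D (su ?n) y)" unfolding w'_def by (rule A.D.diff[OF w(1) Dy])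
    also have "A.D ?n (A.D (su ?n) y) = \<zero>\<^bsub>A.Tot ?n\<^esub>" using A.DD[OF y] by auto
    finally show "A.D ?n w' = A.edge ?n t"
      unfolding w(2) using A.edge_closed[OF t] by (simp add: A.Tot.ag del: prod_module_simps)
    fix j assume j: "su ?N \<le> j"
    then have jm: "m \<le> j" "?N \<le> j" by (auto simp: su_def)
    interpret a: op_hom K "A (su ?n) j" "B (su ?n) j" "\<alpha> (su ?n) j" using jm by (intro \<alpha>.f_op)
    interpret b: op_hom K "B (su ?n) j" "A (su ?n) j" "\<beta> (su ?n) j" using jm by (intro \<beta>.f_op)
    have c: "w j \<in> carrier (A (su ?n) j)" "A.D (su ?n) y j \<in> carrier (A (su ?n) j)" using w(1) Dy by simp_all
    have "sA.shift ?N ?n (A.D ?n w) j = \<zero>\<^bsub>A (su ?n) j\<^esub>"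
    proof -
      define i where "i = j - 1"
      have i: "j = su i" "?N \<le> i" "m \<le> i" using j by (auto simp: i_def su_def)
      interpret s: op_hom K "A ?n i" "A (su ?n) (su i)" "s ?n i" by (intro op_homI A.grp sA.s_hom i)
      show ?thesis unfolding w(2) i(1) using sA.shift_su[OF i(2)] e0[OF i(2)] by simp
    qed
    then have "w j = \<beta> (su ?n) j (\<alpha> (su ?n) j (w j)) \<oplus>\<^bsub>A (su ?n) j\<^esub> A.D (su ?n) y j"
      using sA.homotopy_D[OF _ w(1) j] c by (simp add: y_def)
    moreover have "w' j = w j \<ominus>\<^bsub>A (su ?n) j\<^esub> A.D (su ?n) y j" unfolding w'_def prod_diff[OF A.grp w(1) Dy] ..
    ultimately have "w' j = (\<beta> (su ?n) j (\<alpha> (su ?n) j (w j)) \<oplus>\<^bsub>A (su ?n) j\<^esub> A.D (su ?n) y j)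
      \<ominus>\<^bsub>A (su ?n) j\<^esub> A.D (su ?n) y j" by simp
    also have "\<dots> = \<beta> (su ?n) j (\<alpha> (su ?n) j (w j))" using c by (simp add: A.G.ag)
    finally show "w' j = \<beta> (su ?n) j (z j)" using jm by (simp add: z_def \<alpha>.cut_def)
  qed (simp add: su_def)
  then show ?thesis using z Dz by blast
qed

text \<open>If \<open>z\<close> bounds in high degrees, correcting \<open>w\<close> by the bounding
  family leaves a finite family with boundary the edge of \<open>t\<close>, and
  \<open>row_reduction\<close> exhibits \<open>t\<close> as a boundary. Conversely, if
  \<open>t\<close> bounds, correcting \<open>w\<close> on the edge gives a cycle of the product,
  hence a boundary by exact columns; \<alpha> and the homotopy on \<open>B\<close> bring this back
  to \<open>z\<close>.\<close>

lemma rel_boundary_iff: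
  assumes z: "z \<in> carrier (B.Tot (su n))" and fin: "\<And>j. N \<le> j \<Longrightarrow> B.D n z j = \<zero>\<^bsub>B n j\<^esub>"
    and t: "t \<in> carrier (C n)" and r: "rel n z t"
  shows "(\<exists>y\<in>carrier (B.Tot (su (su n))). \<exists>N. \<forall>j\<ge>N. z j = B.D (su n) y j) \<longleftrightarrow> (\<exists>u\<in>carrier (C (su n)). d n u = t)"
proof -
  obtain w N1 where w: "w \<in> carrier (A.Tot (su n))" and N1: "m \<le> N1" and wz: "\<And>j. N1 \<le> j \<Longrightarrow> w j = \<beta> (su n) j (z j)"
    and Dw: "A.D n w = A.edge n t" by (rule relE[OF r]) (rule that; simp)
  show ?thesis
  proof
    assume "\<exists>y\<in>carrier (B.Tot (su (su n))). \<exists>N. \<forall>j\<ge>N. z j = B.D (su n) y j"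
    then obtain y N2 where y: "y \<in> carrier (B.Tot (su (su n)))" and N2: "\<And>j. N2 \<le> j \<Longrightarrow> z j = B.D (su n) y j" by blast
    let ?N = "max N1 N2"
    define x where "x = \<beta>.cut ?N (su (su n)) y"
    have x: "x \<in> carrier (A.Tot (su (su n)))" unfolding x_def using y N1 by (intro \<beta>.cut_closed) auto
    have Dx: "A.D (su n) x \<in> carrier (A.Tot (su n))" by (rule A.D.closed[OF x])
    define f where "f = w \<ominus>\<^bsub>A.Tot (su n)\<^esub> A.D (su n) x"
    have f: "f \<in> carrier (A.Tot (su n))" unfolding f_def by (rule A.Tot.minus_closed[OF w Dx])
    have "A.D n f = A.D n w \<ominus>\<^bsub>A.Tot n\<^esub> A.D n (A.D (su n) x)" unfolding f_def by (rule A.D.diff[OF w Dx])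
    also have "A.D n (A.D (su n) x) = \<zero>\<^bsub>A.Tot n\<^esub>" using A.DD[OF x] by auto
    finally have Df: "A.D n f = A.edge n t"
      unfolding Dw using A.edge_closed[OF t] by (simp add: A.Tot.ag del: prod_module_simps)
    have f0: "f j = \<zero>\<^bsub>A (su n) j\<^esub>" if "?N \<le> j" for j
    proof -
      have "A.D (su n) x j = \<beta> (su n) j (B.D (su n) y j)"
        unfolding x_def using N1 by (intro \<beta>.cut_D y that) simp
      then have "A.D (su n) x j = w j" using that wz N2 by simp
      moreover have "w j \<in> carrier (A (su n) j)" using w by simp
      ultimately show ?thesis unfolding f_def prod_diff[OF A.grp w Dx] by (simp add: A.G.ag)
    qed
    have Df0: "A.D n f j = \<zero>\<^bsub>A n j\<^esub>" if "su n \<le> j" for j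
      unfolding Df using that by (auto simp: A.edge_def)
    obtain x' c where x': "x' \<in> carrier (A.Tot (su (su n)))" and c: "c \<in> carrier (C (su n))"
      and eq: "f = A.D (su n) x' \<oplus>\<^bsub>A.Tot (su n)\<^esub> A.edge (su n) c"
      using A.row_reduction[OF f Df0, of ?N] f0 by (metis less_imp_le)
    have "A.edge n t = A.D n (A.D (su n) x') \<oplus>\<^bsub>A.Tot n\<^esub> A.D n (A.edge (su n) c)"
      unfolding Df[symmetric] eq using A.D.closed[OF x'] A.edge_closed[OF c] by (rule A.D.add)
    also have "A.D n (A.D (su n) x') = \<zero>\<^bsub>A.Tot n\<^esub>" using A.DD[OF x'] by auto
    also have "A.D n (A.edge (su n) c) = A.edge n (d n c)" by (rule A.D_edge[OF c])
    finally have "A.edge n t = A.edge n (d n c)"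
      using A.edge_closed[OF A.d.closed[OF c]] by (simp add: A.Tot.ag del: prod_module_simps)
    then have "e n t = e n (d n c)" by (auto simp: A.edge_def fun_eq_iff split: if_splits)
    then have "e n (t \<ominus>\<^bsub>C n\<^esub> d n c) = \<zero>\<^bsub>A n n\<^esub>" using t c by (simp add: A.G.ag)
    then have "t \<ominus>\<^bsub>C n\<^esub> d n c = \<zero>\<^bsub>C n\<^esub>" using t c by (intro A.e_inj) auto
    then show "\<exists>u\<in>carrier (C (su n)). d n u = t" using t c A.C.eq_iff_diff[of t n "d n c"] by auto
  next
    assume "\<exists>u\<in>carrier (C (su n)). d n u = t"
    then obtain u where u: "u \<in> carrier (C (su n))" "d n u = t" by blast
    note eu = A.edge_closed[OF u(1)]
    define w1 where "w1 = w \<ominus>\<^bsub>A.Tot (su n)\<^esub> A.edge (su n) u"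
    have w1: "w1 \<in> carrier (A.Tot (su n))" unfolding w1_def by (rule A.Tot.minus_closed[OF w eu])
    have "A.D n w1 = A.edge n t \<ominus>\<^bsub>A.Tot n\<^esub> A.edge n t"
      unfolding w1_def A.D.diff[OF w eu] Dw A.D_edge[OF u(1)] u(2) ..
    also have "\<dots> = \<zero>\<^bsub>A.Tot n\<^esub>" using A.edge_closed[OF t] by (simp add: A.Tot.ag del: prod_module_simps)
    finally have "A.D n w1 j = \<zero>\<^bsub>A n j\<^esub>" for j by simp
    from A.column_exact_total[OF A.column w1 this]
    obtain x where x: "x \<in> carrier (A.Tot (su (su n)))" "A.D (su n) x = w1" by blast
    \<comment> \<open>Beyond this bound \<open>w\<close> is given by \<beta>, the boundary of
      \<open>z\<close> vanishes, and so does the edge, which sits in first degree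
      \<open>su n\<close>.\<close>
    let ?N = "max (max N1 N) (su (su n))"
    have mN: "m \<le> ?N" using N1 by simp
    define y where "y = \<alpha>.cut ?N (su (su n)) x"
    have y: "y \<in> carrier (B.Tot (su (su n)))" unfolding y_def by (rule \<alpha>.cut_closed[OF mN x(1)])
    define y' where "y' = sB.shift ?N (su n) z"
    have y': "y' \<in> carrier (B.Tot (su (su n)))" unfolding y'_def by (rule sB.shift_closed[OF mN z])
    have "z j = B.D (su n) (y \<oplus>\<^bsub>B.Tot (su (su n))\<^esub> y') j" if j: "su ?N \<le> j" for j
    proof -
      have jN: "?N \<le> j" and jm: "m \<le> j" and jn: "j \<noteq> su n" using j mN by (auto simp: su_def)
      have "w1 j = w j \<ominus>\<^bsub>A (su n) j\<^esub> A.edge (su n) u j" unfolding w1_def prod_diff[OF A.grp w eu] ..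
      moreover have "w j \<in> carrier (A (su n) j)" using w by simp
      ultimately have "w1 j = w j" using jn by (simp add: A.edge_def A.G.ag)
      then have "w1 j = \<beta> (su n) j (z j)" using wz[of j] jN by simp
      then have Dy: "B.D (su n) y j = \<alpha> (su n) j (\<beta> (su n) j (z j))"
        unfolding y_def \<alpha>.cut_D[OF mN x(1) jN] x(2) by simp
      have "sB.shift ?N n (B.D n z) j = \<zero>\<^bsub>B (su n) j\<^esub>"
      proof -
        define i where "i = j - 1"
        have i: "j = su i" "?N \<le> i" "m \<le> i" using j mN by (auto simp: i_def su_def)
        interpret s: op_hom K "B n i" "B (su n) (su i)" "s' n i" by (intro op_homI B.grp sB.s_hom i)
        show ?thesis unfolding i(1) using sB.shift_su[OF i(2)] fin[of i] i(2) by simp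
      qed
      moreover have "B.D (su n) y' j \<in> carrier (B (su n) j)" using B.D.closed[OF y'] by simp
      ultimately have "z j = B.D (su n) y j \<oplus>\<^bsub>B (su n) j\<^esub> B.D (su n) y' j"
        using sB.homotopy_D[OF mN z j] Dy by (simp add: y'_def)
      then show ?thesis unfolding B.D.add[OF y y'] by simp
    qed
    then show "\<exists>y\<in>carrier (B.Tot (su (su n))). \<exists>N. \<forall>j\<ge>N. z j = B.D (su n) y j"
      using B.Tot.a_closed[OF y y'] by blast
  qed
qed

end

section \<open>Comparison of projective resolutions\<close>

lemma int_Suc_su: "int (Suc n) = su (int n)"
  by (simp add: su_def)

lemma cplx_diff_su: "is_cplx S X \<Longrightarrow> diff X (su n) \<in> mod_hom S (obj X (su n)) (obj X n)"
  unfolding su_def by (rule cplx_diff_Suc)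

lemma cplx_dd_su: "\<lbrakk>is_cplx S X; x \<in> carrier (obj X (su (su n)))\<rbrakk> \<Longrightarrow>
    diff X (su n) (diff X (su (su n)) x) = \<zero>\<^bsub>obj X n\<^esub>"
  using cplx_dd[of S X x "su n"] by (simp add: su_def)

lemma acyclic_at_su:
  assumes "acyclic_at X (su n)" "x \<in> carrier (obj X (su n))" "diff X (su n) x = \<zero>\<^bsub>obj X n\<^esub>"
  shows "\<exists>y\<in>carrier (obj X (su (su n))). diff X (su (su n)) y = x"
proof -
  have eq: "su n + 1 = su (su n)" "su n - 1 = n" by (simp_all add: su_def)
  have "x \<in> diff X (su (su n)) ` carrier (obj X (su (su n)))"
    using assms unfolding acyclic_at_def cycles_def boundaries_def eq by blast
  then show ?thesis by blast
qed

lemma resolution_facts: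
  assumes "projective_resolution S P \<epsilon> M"
  shows "left_module S M" "is_cplx S P" "\<And>n. projective_module S (obj P n)"
    "\<epsilon> \<in> mod_hom S (obj P 0) M" "\<epsilon> ` carrier (obj P 0) = carrier M"
    "\<And>x. x \<in> carrier (obj P (su 0)) \<Longrightarrow> \<epsilon> (diff P (su 0) x) = \<zero>\<^bsub>M\<^esub>"
    "\<And>x. \<lbrakk>x \<in> carrier (obj P 0); \<epsilon> x = \<zero>\<^bsub>M\<^esub>\<rbrakk> \<Longrightarrow> x \<in> diff P (su 0) ` carrier (obj P (su 0))"
    "\<And>n x. \<lbrakk>x \<in> carrier (obj P (su (int n))); diff P (su (int n)) x = \<zero>\<^bsub>obj P (int n)\<^esub>\<rbrakk> \<Longrightarrow>
      x \<in> diff P (su (su (int n))) ` carrier (obj P (su (su (int n))))"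
proof -
  show "left_module S M" "is_cplx S P" "\<And>n. projective_module S (obj P n)"
    "\<epsilon> \<in> mod_hom S (obj P 0) M" "\<epsilon> ` carrier (obj P 0) = carrier M"
    using assms by (simp_all add: projective_resolution_def)
  have eq: "su 0 = 1" by (simp add: su_def)
  have ker: "{x \<in> carrier (obj P 0). \<epsilon> x = \<zero>\<^bsub>M\<^esub>} = diff P (su 0) ` carrier (obj P (su 0))"
    using assms by (simp add: projective_resolution_def boundaries_def eq)
  show "\<And>x. x \<in> carrier (obj P (su 0)) \<Longrightarrow> \<epsilon> (diff P (su 0) x) = \<zero>\<^bsub>M\<^esub>"
    "\<And>x. \<lbrakk>x \<in> carrier (obj P 0); \<epsilon> x = \<zero>\<^bsub>M\<^esub>\<rbrakk> \<Longrightarrow> x \<in> diff P (su 0) ` carrier (obj P (su 0))"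
    using ker by blast+
  fix n x assume x: "x \<in> carrier (obj P (su (int n)))" "diff P (su (int n)) x = \<zero>\<^bsub>obj P (int n)\<^esub>"
  have "acyclic_at P (su (int n))" using assms by (simp add: projective_resolution_def su_def)
  from acyclic_at_su[OF this x]
  show "x \<in> diff P (su (su (int n))) ` carrier (obj P (su (su (int n))))" by blast
qed

lemma comparison_exists:
  assumes P: "projective_resolution S P \<epsilon> M" and Q: "projective_resolution S Q \<pi> M"
  shows "\<exists>\<gamma>. (\<forall>n. \<gamma> n \<in> mod_hom S (obj P (int n)) (obj Q (int n)) \<and>
      (\<forall>x\<in>carrier (obj P (su (int n))). diff Q (su (int n)) (\<gamma> (Suc n) x) = \<gamma> n (diff P (su (int n)) x))) \<and>
    (\<forall>x\<in>carrier (obj P 0). \<pi> (\<gamma> 0 x) = \<epsilon> x)"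
proof -
  note p = resolution_facts[OF P] and q = resolution_facts[OF Q]
  let ?dP = "\<lambda>n. diff P (su (int n))" and ?dQ = "\<lambda>n. diff Q (su (int n))"
  \<comment> \<open>The invariant asks that \<open>f\<close> carry boundaries to boundaries, which
    is what the next lift needs. In this form degree 0, where exactness is measured by \<pi>, is
    treated like the others.\<close>
  let ?I = "\<lambda>n f. f \<in> mod_hom S (obj P (int n)) (obj Q (int n)) \<and>
    (\<forall>x\<in>carrier (obj P (su (int n))). f (?dP n x) \<in> ?dQ n ` carrier (obj Q (su (int n)))) \<and>
    (n = 0 \<longrightarrow> (\<forall>x\<in>carrier (obj P 0). \<pi> (f x) = \<epsilon> x))"
  let ?Q = "\<lambda>n f g. \<forall>x\<in>carrier (obj P (su (int n))). ?dQ n (g x) = f (?dP n x)"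
  have "\<exists>\<gamma>. \<forall>n. ?I n (\<gamma> n) \<and> ?Q n (\<gamma> n) (\<gamma> (Suc n))"
  proof (rule dependent_nat_choice)
    obtain f where f: "f \<in> mod_hom S (obj P 0) (obj Q 0)" "\<And>x. x \<in> carrier (obj P 0) \<Longrightarrow> \<pi> (f x) = \<epsilon> x"
      using projective_lift[OF p(3) cplx_module[OF q(2)] p(1) q(4) p(4)] p(5) q(5) by auto
    have "f (?dP 0 x) \<in> ?dQ 0 ` carrier (obj Q (su 0))" if x: "x \<in> carrier (obj P (su 0))" for x
    proof -
      have dx: "?dP 0 x \<in> carrier (obj P 0)" using mod_hom_closed[OF cplx_diff_su[OF p(2)] x] by simp
      show ?thesis using q(7)[OF mod_hom_closed[OF f(1) dx]] f(2)[OF dx] p(6)[OF x] by simp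
    qed
    then show "\<exists>f. ?I 0 f" using f by auto
  next
    fix f n assume I: "?I n f"
    have dP: "?dP n \<in> mod_hom S (obj P (su (int n))) (obj P (int n))" by (rule cplx_diff_su[OF p(2)])
    have dQ: "?dQ n \<in> mod_hom S (obj Q (su (int n))) (obj Q (int n))" by (rule cplx_diff_su[OF q(2)])
    interpret f: op_hom S "obj P (int n)" "obj Q (int n)" f
      using I by (intro op_homI left_module_op_group cplx_module p(2) q(2)) simp
    have "\<exists>g\<in>mod_hom S (obj P (su (int n))) (obj Q (su (int n))). ?Q n f g"
      using I by (intro projective_lift[OF p(3) cplx_module[OF q(2)] cplx_module[OF q(2)] dQ] mod_hom_comp[OF dP]) auto
    then obtain g where g: "g \<in> mod_hom S (obj P (su (int n))) (obj Q (su (int n)))"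
      "\<And>x. x \<in> carrier (obj P (su (int n))) \<Longrightarrow> ?dQ n (g x) = f (?dP n x)" by blast
    have "g (?dP (Suc n) x) \<in> ?dQ (Suc n) ` carrier (obj Q (su (su (int n))))"
      if x: "x \<in> carrier (obj P (su (su (int n))))" for x
    proof -
      have dx: "diff P (su (su (int n))) x \<in> carrier (obj P (su (int n)))"
        by (rule mod_hom_closed[OF cplx_diff_su[OF p(2)] x])
      show ?thesis
        using q(8)[OF mod_hom_closed[OF g(1) dx]] g(2)[OF dx] cplx_dd_su[OF p(2) x] by (simp add: int_Suc_su del: of_nat_Suc)
    qed
    then show "\<exists>g. ?I (Suc n) g \<and> ?Q n f g" using g by (auto simp: int_Suc_su simp del: of_nat_Suc)
  qed
  then show ?thesis by (metis of_nat_0)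
qed

lemma nullhomotopy_exists:
  assumes P: "projective_resolution S P \<epsilon> M"
    and u: "\<And>n. u n \<in> mod_hom S (obj P (int n)) (obj P (int n))"
    and du: "\<And>n x. x \<in> carrier (obj P (su (int n))) \<Longrightarrow> diff P (su (int n)) (u (Suc n) x) = u n (diff P (su (int n)) x)"
    and eu: "\<And>x. x \<in> carrier (obj P 0) \<Longrightarrow> \<epsilon> (u 0 x) = \<zero>\<^bsub>M\<^esub>"
  shows "\<exists>s. \<forall>n. s n \<in> mod_hom S (obj P (int n)) (obj P (su (int n))) \<and>
    (\<forall>x\<in>carrier (obj P (su (int n))).
      u (Suc n) x = diff P (su (su (int n))) (s (Suc n) x) \<oplus>\<^bsub>obj P (su (int n))\<^esub> s n (diff P (su (int n)) x))"
proof -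
  note p = resolution_facts[OF P]
  let ?d = "\<lambda>n. diff P (su (int n))"
  \<comment> \<open>The invariant says that \<open>u (Suc n)\<close> minus \<open>s\<close> after
    the differential takes values in cycles; these are boundaries, so the next component of the
    homotopy can be lifted.\<close>
  let ?I = "\<lambda>n s. s \<in> mod_hom S (obj P (int n)) (obj P (su (int n))) \<and>
    (\<forall>x\<in>carrier (obj P (su (int n))). ?d n (s (?d n x)) = ?d n (u (Suc n) x))"
  let ?Q = "\<lambda>n s t. \<forall>x\<in>carrier (obj P (su (int n))).
      u (Suc n) x = diff P (su (su (int n))) (t x) \<oplus>\<^bsub>obj P (su (int n))\<^esub> s (?d n x)"
  have d: "?d n \<in> mod_hom S (obj P (su (int n))) (obj P (int n))" for n by (rule cplx_diff_su[OF p(2)])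
  note lP = left_module_op_group[OF cplx_module[OF p(2)]]
  have "\<exists>s. \<forall>n. ?I n (s n) \<and> ?Q n (s n) (s (Suc n))"
  proof (rule dependent_nat_choice)
    have "u 0 ` carrier (obj P 0) \<subseteq> diff P (su 0) ` carrier (obj P (su 0))"
      using p(7) eu mod_hom_closed[OF u[of 0]] by auto
    then obtain s where s: "s \<in> mod_hom S (obj P 0) (obj P (su 0))" "\<And>x. x \<in> carrier (obj P 0) \<Longrightarrow> diff P (su 0) (s x) = u 0 x"
      using projective_lift[OF p(3) cplx_module[OF p(2)] cplx_module[OF p(2)] cplx_diff_su[OF p(2)], of "u 0" 0 0] u[of 0] by auto
    then show "\<exists>s. ?I 0 s" using du[of _ 0] mod_hom_closed[OF d[of 0]] by (intro exI[of _ s]) auto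
  next
    fix s n assume I: "?I n s"
    have uS: "u (Suc n) \<in> mod_hom S (obj P (su (int n))) (obj P (su (int n)))"
      using u[of "Suc n"] by (simp add: int_Suc_su del: of_nat_Suc)
    have sd: "(\<lambda>x. s (?d n x)) \<in> mod_hom S (obj P (su (int n))) (obj P (su (int n)))"
      using I by (intro mod_hom_comp[OF d]) simp
    interpret d: op_hom S "obj P (su (int n))" "obj P (int n)" "?d n" by (intro op_homI lP d)
    let ?f = "\<lambda>x. u (Suc n) x \<ominus>\<^bsub>obj P (su (int n))\<^esub> s (?d n x)"
    have f: "?f \<in> mod_hom S (obj P (su (int n))) (obj P (su (int n)))" by (intro mod_hom_diff lP uS sd)
    have "?f ` carrier (obj P (su (int n))) \<subseteq> diff P (su (su (int n))) ` carrier (obj P (su (su (int n))))"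
    proof (rule image_subsetI)
      fix x assume x: "x \<in> carrier (obj P (su (int n)))"
      have "?d n (?f x) = \<zero>\<^bsub>obj P (int n)\<^esub>"
        using I x mod_hom_closed[OF uS x] mod_hom_closed[OF sd x] by (simp add: d.N.ag)
      then show "?f x \<in> diff P (su (su (int n))) ` carrier (obj P (su (su (int n))))"
        using p(8) mod_hom_closed[OF f x] by blast
    qed
    then obtain t where t: "t \<in> mod_hom S (obj P (su (int n))) (obj P (su (su (int n))))"
      "\<And>x. x \<in> carrier (obj P (su (int n))) \<Longrightarrow> diff P (su (su (int n))) (t x) = ?f x"
      using projective_lift[OF p(3) cplx_module[OF p(2)] cplx_module[OF p(2)] cplx_diff_su[OF p(2)] f] by auto
    have "diff P (su (su (int n))) (t (diff P (su (su (int n))) x)) = diff P (su (su (int n))) (u (Suc (Suc n)) x)"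
      if x: "x \<in> carrier (obj P (su (su (int n))))" for x
    proof -
      have dx: "diff P (su (su (int n))) x \<in> carrier (obj P (su (int n)))" by (rule mod_hom_closed[OF cplx_diff_su[OF p(2)] x])
      interpret s: op_hom S "obj P (int n)" "obj P (su (int n))" s using I by (intro op_homI lP) simp
      show ?thesis
        using t(2)[OF dx] cplx_dd_su[OF p(2) x] du[of x "Suc n"] x mod_hom_closed[OF uS dx]
        by (simp add: int_Suc_su d.M.ag del: of_nat_Suc)
    qed
    moreover have "?Q n s t"
      using t(2) mod_hom_closed[OF uS] mod_hom_closed[OF sd] by (auto simp: d.M.ag)
    ultimately show "\<exists>t. ?I (Suc n) t \<and> ?Q n s t"
      using t(1) by (intro exI[of _ t]) (auto simp: int_Suc_su simp del: of_nat_Suc)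
  qed
  then show ?thesis by blast
qed

text \<open>One half of a homotopy equivalence, in degrees beyond \<open>m\<close> only.\<close>

definition high_half :: "'r ring \<Rightarrow> ('r, 'x) cplx \<Rightarrow> ('r, 'y) cplx \<Rightarrow> int \<Rightarrow>
    (int \<Rightarrow> 'x \<Rightarrow> 'y) \<Rightarrow> (int \<Rightarrow> 'y \<Rightarrow> 'x) \<Rightarrow> (int \<Rightarrow> 'x \<Rightarrow> 'x) \<Rightarrow> bool" where
  "high_half S X Y m \<alpha> \<beta> s \<longleftrightarrow> (\<forall>i\<ge>m.
     \<alpha> i \<in> mod_hom S (obj X i) (obj Y i) \<and> s i \<in> mod_hom S (obj X i) (obj X (su i)) \<and>
     (\<forall>x\<in>carrier (obj X (su i)). diff Y (su i) (\<alpha> (su i) x) = \<alpha> i (diff X (su i) x) \<and>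
        x = \<beta> (su i) (\<alpha> (su i) x) \<oplus>\<^bsub>obj X (su i)\<^esub> diff X (su (su i)) (s (su i) x) \<oplus>\<^bsub>obj X (su i)\<^esub> s i (diff X (su i) x)))"

lemma high_halfD:
  assumes "high_half S X Y m \<alpha> \<beta> s" "m \<le> i"
  shows "\<alpha> i \<in> mod_hom S (obj X i) (obj Y i)" "s i \<in> mod_hom S (obj X i) (obj X (su i))"
     "x \<in> carrier (obj X (su i)) \<Longrightarrow> diff Y (su i) (\<alpha> (su i) x) = \<alpha> i (diff X (su i) x)"
     "x \<in> carrier (obj X (su i)) \<Longrightarrow>
        x = \<beta> (su i) (\<alpha> (su i) x) \<oplus>\<^bsub>obj X (su i)\<^esub> diff X (su (su i)) (s (su i) x) \<oplus>\<^bsub>obj X (su i)\<^esub> s i (diff X (su i) x)"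
  using assms unfolding high_half_def by blast+

text \<open>The identity minus the round trip covers zero on \<open>M\<close>, so
  \<open>nullhomotopy_exists\<close> contracts it. Families over the naturals are read as families
  over the integers through \<open>nat\<close>, and the assertion concerns degrees from 0
  on.\<close>

lemma resolution_half:
  assumes P: "projective_resolution S P \<epsilon> M" and Q: "projective_resolution S Q \<pi> M"
    and \<gamma>: "\<And>n. \<gamma> n \<in> mod_hom S (obj P (int n)) (obj Q (int n))"
      "\<And>n x. x\<in>carrier (obj P (su (int n))) \<Longrightarrow> diff Q (su (int n)) (\<gamma> (Suc n) x) = \<gamma> n (diff P (su (int n)) x)"
      "\<And>x. x\<in>carrier (obj P 0) \<Longrightarrow> \<pi> (\<gamma> 0 x) = \<epsilon> x"
    and \<delta>: "\<And>n. \<delta> n \<in> mod_hom S (obj Q (int n)) (obj P (int n))"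
      "\<And>n x. x\<in>carrier (obj Q (su (int n))) \<Longrightarrow> diff P (su (int n)) (\<delta> (Suc n) x) = \<delta> n (diff Q (su (int n)) x)"
      "\<And>x. x\<in>carrier (obj Q 0) \<Longrightarrow> \<epsilon> (\<delta> 0 x) = \<pi> x"
  shows "\<exists>s. high_half S P Q 0 (\<lambda>i. \<gamma> (nat i)) (\<lambda>i. \<delta> (nat i)) s"
proof -
  note p = resolution_facts[OF P] and q = resolution_facts[OF Q]
  note lP = left_module_op_group[OF cplx_module[OF p(2)]]
  interpret P: op_group S "obj P n" for n by (rule lP)
  interpret d: op_hom S "obj P (su n)" "obj P n" "diff P (su n)" for n by (intro op_homI lP cplx_diff_su p(2))
  interpret M: op_group S M by (rule left_module_op_group[OF p(1)])
  interpret e: op_hom S "obj P 0" M \<epsilon> by (intro op_homI lP M.op_group_axioms p(4))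
  let ?u = "\<lambda>n x. x \<ominus>\<^bsub>obj P (int n)\<^esub> \<delta> n (\<gamma> n x)"
  note c = mod_hom_comp[OF \<gamma>(1) \<delta>(1)]
  have cl: "\<delta> n (\<gamma> n x) \<in> carrier (obj P (int n))" if "x \<in> carrier (obj P (int n))" for n x
    by (rule mod_hom_closed[OF c that])
  have clS: "\<delta> (Suc n) (\<gamma> (Suc n) x) \<in> carrier (obj P (su (int n)))" "\<gamma> (Suc n) x \<in> carrier (obj Q (su (int n)))"
    if "x \<in> carrier (obj P (su (int n)))" for n x
    using cl[of x "Suc n"] mod_hom_closed[OF \<gamma>(1)[of "Suc n"]] that by (simp_all add: int_Suc_su del: of_nat_Suc)
  have "\<exists>s. \<forall>n. s n \<in> mod_hom S (obj P (int n)) (obj P (su (int n))) \<and>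
    (\<forall>x\<in>carrier (obj P (su (int n))).
      ?u (Suc n) x = diff P (su (su (int n))) (s (Suc n) x) \<oplus>\<^bsub>obj P (su (int n))\<^esub> s n (diff P (su (int n)) x))"
  proof (rule nullhomotopy_exists[OF P])
    show "?u n \<in> mod_hom S (obj P (int n)) (obj P (int n))" for n by (intro mod_hom_diff lP mod_hom_ident c)
    show "diff P (su (int n)) (?u (Suc n) x) = ?u n (diff P (su (int n)) x)" if x: "x \<in> carrier (obj P (su (int n)))" for n x
      using x clS[OF x] \<delta>(2)[OF clS(2)[OF x]] \<gamma>(2)[OF x] by (simp add: int_Suc_su del: of_nat_Suc)
    show "\<epsilon> (?u 0 x) = \<zero>\<^bsub>M\<^esub>" if x: "x \<in> carrier (obj P 0)" for x
      using x cl[of x 0] \<delta>(3) \<gamma>(3) mod_hom_closed[OF \<gamma>(1)[of 0]] by (simp add: M.ag)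
  qed
  then obtain s where s: "\<And>n. s n \<in> mod_hom S (obj P (int n)) (obj P (su (int n)))"
    "\<And>n x. x\<in>carrier (obj P (su (int n))) \<Longrightarrow>
      ?u (Suc n) x = diff P (su (su (int n))) (s (Suc n) x) \<oplus>\<^bsub>obj P (su (int n))\<^esub> s n (diff P (su (int n)) x)" by blast
  have "high_half S P Q 0 (\<lambda>i. \<gamma> (nat i)) (\<lambda>i. \<delta> (nat i)) (\<lambda>i. s (nat i))"
    unfolding high_half_def
  proof (intro allI impI conjI ballI)
    fix i :: int assume "0 \<le> i"
    then obtain n where n: "i = int n" using nonneg_int_cases by blast
    then have nn: "nat i = n" "nat (su i) = Suc n" by (simp_all add: su_def)
    show "\<gamma> (nat i) \<in> mod_hom S (obj P i) (obj Q i)" "s (nat i) \<in> mod_hom S (obj P i) (obj P (su i))"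
      unfolding nn unfolding n by (rule \<gamma>(1) s(1))+
    fix x assume x: "x \<in> carrier (obj P (su i))"
    then have x': "x \<in> carrier (obj P (su (int n)))" by (simp add: n)
    show "diff Q (su i) (\<gamma> (nat (su i)) x) = \<gamma> (nat i) (diff P (su i) x)"
      unfolding nn unfolding n by (rule \<gamma>(2)[OF x'])
    have sc: "s (Suc n) x \<in> carrier (obj P (su (su (int n))))"
      using mod_hom_closed[OF s(1)[of "Suc n"]] x' by (simp add: int_Suc_su del: of_nat_Suc)
    have sd: "s n (diff P (su (int n)) x) \<in> carrier (obj P (su (int n)))"
      using mod_hom_closed[OF s(1)[of n]] x' by simp
    have "\<delta> (Suc n) (\<gamma> (Suc n) x) \<oplus>\<^bsub>obj P (su (int n))\<^esub> ?u (Suc n) x = x"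
      using x' clS[OF x'] by (simp add: int_Suc_su P.ag del: of_nat_Suc)
    then have "x = \<delta> (Suc n) (\<gamma> (Suc n) x) \<oplus>\<^bsub>obj P (su (int n))\<^esub>
      (diff P (su (su (int n))) (s (Suc n) x) \<oplus>\<^bsub>obj P (su (int n))\<^esub> s n (diff P (su (int n)) x))"
      using s(2)[OF x'] by simp
    then show "x = \<delta> (nat (su i)) (\<gamma> (nat (su i)) x) \<oplus>\<^bsub>obj P (su i)\<^esub> diff P (su (su i)) (s (nat (su i)) x) \<oplus>\<^bsub>obj P (su i)\<^esub>
       s (nat i) (diff P (su i) x)"
      unfolding nn unfolding n using sc sd clS[OF x'] by (simp add: P.a_assoc)
  qed
  then show ?thesis by blast
qed

text \<open>A complete resolution comes with its own projective resolution \<open>Q\<close>. It is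
  linked to \<open>P\<close> by comparison of resolutions and to \<open>T\<close> by \<tau>, whose
  inverse \<sigma> is available from degree \<open>m0\<close> on; conjugation by \<tau> carries the
  homotopy on \<open>Q\<close> over to \<open>T\<close>.\<close>

lemma complete_resolution_high_equiv:
  assumes cr: "complete_projective_resolution S T \<tau> Q \<pi> M" and P: "projective_resolution S P \<epsilon> M"
  shows "\<exists>m \<alpha> \<beta> s s'. high_half S T P m \<alpha> \<beta> s \<and> high_half S P T m \<beta> \<alpha> s'"
proof -
  have T: "totally_acyclic S T" and Q: "projective_resolution S Q \<pi> M" and \<tau>: "chain_map S T Q \<tau>"
    using cr by (auto simp: complete_projective_resolution_def)
  obtain m0 where m0: "\<And>n. n \<ge> m0 \<Longrightarrow> \<tau> n \<in> mod_iso S (obj T n) (obj Q n)"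
    using cr unfolding complete_projective_resolution_def by blast
  have cT: "is_cplx S T" using T by (simp add: totally_acyclic_def)
  note p = resolution_facts[OF P] and q = resolution_facts[OF Q]
  obtain \<gamma> where \<gamma>: "\<And>n. \<gamma> n \<in> mod_hom S (obj Q (int n)) (obj P (int n))"
      "\<And>n x. x\<in>carrier (obj Q (su (int n))) \<Longrightarrow> diff P (su (int n)) (\<gamma> (Suc n) x) = \<gamma> n (diff Q (su (int n)) x)"
      "\<And>x. x\<in>carrier (obj Q 0) \<Longrightarrow> \<epsilon> (\<gamma> 0 x) = \<pi> x"
    using comparison_exists[OF Q P] by blast
  obtain \<delta> where \<delta>: "\<And>n. \<delta> n \<in> mod_hom S (obj P (int n)) (obj Q (int n))"
      "\<And>n x. x\<in>carrier (obj P (su (int n))) \<Longrightarrow> diff Q (su (int n)) (\<delta> (Suc n) x) = \<delta> n (diff P (su (int n)) x)"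
      "\<And>x. x\<in>carrier (obj P 0) \<Longrightarrow> \<pi> (\<delta> 0 x) = \<epsilon> x"
    using comparison_exists[OF P Q] by blast
  obtain sQ where sQ: "high_half S Q P 0 (\<lambda>i. \<gamma> (nat i)) (\<lambda>i. \<delta> (nat i)) sQ"
    using resolution_half[OF Q P \<gamma> \<delta>] by blast
  obtain sP where sP: "high_half S P Q 0 (\<lambda>i. \<delta> (nat i)) (\<lambda>i. \<gamma> (nat i)) sP"
    using resolution_half[OF P Q \<delta> \<gamma>] by blast
  let ?m = "max m0 0" and ?g = "\<lambda>i. \<gamma> (nat i)" and ?d = "\<lambda>i. \<delta> (nat i)"
  note lT = left_module_op_group[OF cplx_module[OF cT]] and lQ = left_module_op_group[OF cplx_module[OF q(2)]]
  have t: "\<tau> i \<in> mod_hom S (obj T i) (obj Q i)" for i using \<tau> by (simp add: chain_map_def)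
  have td: "diff Q (su i) (\<tau> (su i) x) = \<tau> i (diff T (su i) x)" if "x \<in> carrier (obj T (su i))" for x i
    using \<tau> that unfolding chain_map_def su_def by (metis add_diff_cancel_right')
  have "\<forall>i. \<exists>\<sigma>. i \<ge> m0 \<longrightarrow> \<sigma> \<in> mod_hom S (obj Q i) (obj T i) \<and>
    (\<forall>x\<in>carrier (obj T i). \<sigma> (\<tau> i x) = x) \<and> (\<forall>y\<in>carrier (obj Q i). \<tau> i (\<sigma> y) = y)"
    using mod_iso_inverse[OF lT m0] by metis
  then obtain \<sigma> where \<sigma>: "\<And>i. i \<ge> m0 \<Longrightarrow> \<sigma> i \<in> mod_hom S (obj Q i) (obj T i)"
    "\<And>i x. \<lbrakk>i \<ge> m0; x \<in> carrier (obj T i)\<rbrakk> \<Longrightarrow> \<sigma> i (\<tau> i x) = x"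
    "\<And>i y. \<lbrakk>i \<ge> m0; y \<in> carrier (obj Q i)\<rbrakk> \<Longrightarrow> \<tau> i (\<sigma> i y) = y" by metis
  have \<sigma>d: "diff T (su i) (\<sigma> (su i) y) = \<sigma> i (diff Q (su i) y)" if i: "i \<ge> m0" and y: "y \<in> carrier (obj Q (su i))" for i y
  proof -
    have i': "su i \<ge> m0" using i by (simp add: su_def)
    note sy = mod_hom_closed[OF \<sigma>(1)[OF i'] y]
    show ?thesis
      using \<sigma>(2)[OF i mod_hom_closed[OF cplx_diff_su[OF cT] sy]] td[OF sy] \<sigma>(3)[OF i' y] by simp
  qed
  have A: "high_half S T P ?m (\<lambda>i x. ?g i (\<tau> i x)) (\<lambda>i x. \<sigma> i (?d i x)) (\<lambda>i x. \<sigma> (su i) (sQ i (\<tau> i x)))"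
    unfolding high_half_def
  proof (intro allI impI conjI ballI)
    fix i assume "?m \<le> i"
    then have i: "m0 \<le> i" "0 \<le> i" "m0 \<le> su i" "0 \<le> su i" "m0 \<le> su (su i)" by (auto simp: su_def)
    show "(\<lambda>x. ?g i (\<tau> i x)) \<in> mod_hom S (obj T i) (obj P i)"
      by (rule mod_hom_comp[OF t high_halfD(1)[OF sQ i(2)]])
    show "(\<lambda>x. \<sigma> (su i) (sQ i (\<tau> i x))) \<in> mod_hom S (obj T i) (obj T (su i))"
      by (rule mod_hom_comp[OF mod_hom_comp[OF t high_halfD(2)[OF sQ i(2)]] \<sigma>(1)[OF i(3)]])
    fix x assume x: "x \<in> carrier (obj T (su i))"
    have tx: "\<tau> (su i) x \<in> carrier (obj Q (su i))" by (rule mod_hom_closed[OF t x])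
    show "diff P (su i) (?g (su i) (\<tau> (su i) x)) = ?g i (\<tau> i (diff T (su i) x))"
      using high_halfD(3)[OF sQ i(2) tx] td[OF x] by simp
    interpret \<sigma>: op_hom S "obj Q (su i)" "obj T (su i)" "\<sigma> (su i)" by (intro op_homI lT lQ \<sigma> i)
    have gx: "?g (su i) (\<tau> (su i) x) \<in> carrier (obj P (su i))" by (rule mod_hom_closed[OF high_halfD(1)[OF sQ i(4)] tx])
    have c: "?d (su i) (?g (su i) (\<tau> (su i) x)) \<in> carrier (obj Q (su i))"
      "sQ (su i) (\<tau> (su i) x) \<in> carrier (obj Q (su (su i)))"
      "diff Q (su (su i)) (sQ (su i) (\<tau> (su i) x)) \<in> carrier (obj Q (su i))"
      "sQ i (diff Q (su i) (\<tau> (su i) x)) \<in> carrier (obj Q (su i))"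
      by (intro mod_hom_closed[OF high_halfD(1)[OF sP i(4)]] mod_hom_closed[OF high_halfD(2)[OF sQ i(4)]]
          mod_hom_closed[OF high_halfD(2)[OF sQ i(2)]] mod_hom_closed[OF cplx_diff_su[OF q(2)]] gx tx)+
    have "\<sigma> (su i) (\<tau> (su i) x) = \<sigma> (su i) (?d (su i) (?g (su i) (\<tau> (su i) x)) \<oplus>\<^bsub>obj Q (su i)\<^esub>
       diff Q (su (su i)) (sQ (su i) (\<tau> (su i) x)) \<oplus>\<^bsub>obj Q (su i)\<^esub> sQ i (diff Q (su i) (\<tau> (su i) x)))"
      using high_halfD(4)[OF sQ i(2) tx] by simp
    also have "\<dots> = \<sigma> (su i) (?d (su i) (?g (su i) (\<tau> (su i) x))) \<oplus>\<^bsub>obj T (su i)\<^esub>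
       \<sigma> (su i) (diff Q (su (su i)) (sQ (su i) (\<tau> (su i) x))) \<oplus>\<^bsub>obj T (su i)\<^esub> \<sigma> (su i) (sQ i (diff Q (su i) (\<tau> (su i) x)))"
      using c by simp
    finally show "x = \<sigma> (su i) (?d (su i) (?g (su i) (\<tau> (su i) x))) \<oplus>\<^bsub>obj T (su i)\<^esub>
       diff T (su (su i)) (\<sigma> (su (su i)) (sQ (su i) (\<tau> (su i) x))) \<oplus>\<^bsub>obj T (su i)\<^esub>
       \<sigma> (su i) (sQ i (\<tau> i (diff T (su i) x)))"
      unfolding \<sigma>(2)[OF i(3) x] \<sigma>d[OF i(3) c(2)] td[OF x] .
  qed
  have B: "high_half S P T ?m (\<lambda>i x. \<sigma> i (?d i x)) (\<lambda>i x. ?g i (\<tau> i x)) sP"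
    unfolding high_half_def
  proof (intro allI impI conjI ballI)
    fix i assume "?m \<le> i"
    then have i: "m0 \<le> i" "0 \<le> i" "m0 \<le> su i" "0 \<le> su i" by (auto simp: su_def)
    show "(\<lambda>x. \<sigma> i (?d i x)) \<in> mod_hom S (obj P i) (obj T i)"
      by (rule mod_hom_comp[OF high_halfD(1)[OF sP i(2)] \<sigma>(1)[OF i(1)]])
    show "sP i \<in> mod_hom S (obj P i) (obj P (su i))" by (rule high_halfD(2)[OF sP i(2)])
    fix x assume x: "x \<in> carrier (obj P (su i))"
    have dx: "?d (su i) x \<in> carrier (obj Q (su i))" by (rule mod_hom_closed[OF high_halfD(1)[OF sP i(4)] x])
    show "diff T (su i) (\<sigma> (su i) (?d (su i) x)) = \<sigma> i (?d i (diff P (su i) x))"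
      using \<sigma>d[OF i(1) dx] high_halfD(3)[OF sP i(2) x] by simp
    show "x = ?g (su i) (\<tau> (su i) (\<sigma> (su i) (?d (su i) x))) \<oplus>\<^bsub>obj P (su i)\<^esub>
       diff P (su (su i)) (sP (su i) x) \<oplus>\<^bsub>obj P (su i)\<^esub> sP i (diff P (su i) x)"
      using high_halfD(4)[OF sP i(2) x] \<sigma>(3)[OF i(3) dx] by simp
  qed
  show ?thesis using A B by blast
qed

section \<open>Stable total complexes\<close>

context bicx
begin

abbreviation "Fin n \<equiv> coprod_carrier (A n)"

text \<open>Components in first degree below \<open>n\<close> vanish by \<open>triv\<close>. So
  finite support means vanishing in high degrees, and classes modulo \<open>Fin n\<close> are germs
  at infinity.\<close>

lemma Fin_iff: "z \<in> Fin n \<longleftrightarrow> z \<in> carrier (Tot n) \<and> (\<exists>N. \<forall>j\<ge>N. z j = \<zero>\<^bsub>A n j\<^esub>)"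
proof -
  have "finite {i. z i \<noteq> \<zero>\<^bsub>A n i\<^esub>} \<longleftrightarrow> (\<exists>N. \<forall>j\<ge>N. z j = \<zero>\<^bsub>A n j\<^esub>)" if z: "z \<in> carrier (Tot n)"
  proof
    assume "finite {i. z i \<noteq> \<zero>\<^bsub>A n i\<^esub>}"
    then obtain N where "\<And>i. z i \<noteq> \<zero>\<^bsub>A n i\<^esub> \<Longrightarrow> i \<le> N"
      using bdd_above_finite[of "{i. z i \<noteq> \<zero>\<^bsub>A n i\<^esub>}"] by (auto simp: bdd_above_def)
    then have "\<forall>j\<ge>N + 1. z j = \<zero>\<^bsub>A n j\<^esub>" by force
    then show "\<exists>N. \<forall>j\<ge>N. z j = \<zero>\<^bsub>A n j\<^esub>" by blast
  next
    assume "\<exists>N. \<forall>j\<ge>N. z j = \<zero>\<^bsub>A n j\<^esub>"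
    then obtain N where N: "\<And>j. N \<le> j \<Longrightarrow> z j = \<zero>\<^bsub>A n j\<^esub>" by blast
    have "z i = \<zero>\<^bsub>A n i\<^esub>" if "i < n" for i using triv[OF that] z by simp
    with N have "{i. z i \<noteq> \<zero>\<^bsub>A n i\<^esub>} \<subseteq> {n..<N}" by (metis (mono_tags) atLeastLessThan_iff linorder_not_le mem_Collect_eq subsetI)
    then show "finite {i. z i \<noteq> \<zero>\<^bsub>A n i\<^esub>}" by (rule finite_subset) simp
  qed
  then show ?thesis by (auto simp: coprod_carrier_def simp del: prod_module_simps)
qed

lemma FinI: "\<lbrakk>z \<in> carrier (Tot n); \<And>j. N \<le> j \<Longrightarrow> z j = \<zero>\<^bsub>A n j\<^esub>\<rbrakk> \<Longrightarrow> z \<in> Fin n"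
  unfolding Fin_iff by blast

lemma FinE:
  assumes "z \<in> Fin n"
  obtains N where "z \<in> carrier (Tot n)" "\<forall>j\<ge>N. z j = \<zero>\<^bsub>A n j\<^esub>"
  using assms unfolding Fin_iff by blast

lemma Fin_submodule: "submodule (Fin n) K (Tot n)"
proof (rule Tot.submoduleI)
  show "Fin n \<subseteq> carrier (Tot n)" using FinE by blast
  show "\<zero>\<^bsub>Tot n\<^esub> \<in> Fin n" by (rule FinI) auto
next
  fix x y assume "x \<in> Fin n" "y \<in> Fin n"
  then obtain N L where x: "x \<in> carrier (Tot n)" "\<forall>j\<ge>N. x j = \<zero>\<^bsub>A n j\<^esub>"
    and y: "y \<in> carrier (Tot n)" "\<forall>j\<ge>L. y j = \<zero>\<^bsub>A n j\<^esub>" by (metis FinE)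
  show "x \<oplus>\<^bsub>Tot n\<^esub> y \<in> Fin n"
    by (rule FinI[OF Tot.a_closed[OF x(1) y(1)], of "max N L"]) (use x(2) y(2) in simp)
next
  fix x assume "x \<in> Fin n"
  then obtain N where x: "x \<in> carrier (Tot n)" "\<forall>j\<ge>N. x j = \<zero>\<^bsub>A n j\<^esub>" by (rule FinE)
  show "\<ominus>\<^bsub>Tot n\<^esub> x \<in> Fin n"
    by (rule FinI[OF Tot.a_inv_closed[OF x(1)], of N]) (use x(2) in \<open>simp add: prod_neg[OF grp x(1)]\<close>)
  show "a \<odot>\<^bsub>Tot n\<^esub> x \<in> Fin n" if "a \<in> carrier K" for a
    by (rule FinI[OF Tot.op_closed[OF that x(1)], of N]) (use x(2) that in simp)
qed

lemma quot_Fin: "quot K (Tot n) (Fin n)"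
  by (intro quot.intro quot_axioms.intro Tot.op_group_axioms Fin_submodule)

sublocale Q: quot K "Tot n" "Fin n" for n by (rule quot_Fin)

lemma D_Fin: "z \<in> Fin (su n) \<Longrightarrow> D n z \<in> Fin n"
proof -
  assume "z \<in> Fin (su n)"
  then obtain N where z: "z \<in> carrier (Tot (su n))" "\<forall>j\<ge>N. z j = \<zero>\<^bsub>A (su n) j\<^esub>" by (rule FinE)
  have "N \<le> su j" if "N \<le> j" for j using that by (simp add: su_def)
  then show ?thesis by (intro FinI[OF D.closed[OF z(1)], of N]) (use z(2) in \<open>simp add: D_def\<close>)
qed

abbreviation "St n \<equiv> quot_module (Tot n) (Fin n)"
abbreviation "cls n z \<equiv> Fin n +>\<^bsub>Tot n\<^esub> z"
abbreviation "sD n \<equiv> quot_map (Tot n) (Fin n) (D n)"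

lemma sD_cls: "z \<in> carrier (Tot (su n)) \<Longrightarrow> sD n (cls (su n) z) = cls n (D n z)"
  by (rule mod_hom_quot_map(2)[OF quot_Fin quot_Fin D_hom D_Fin])

lemma sD_op_hom: "op_hom K (St (su n)) (St n) (sD n)"
  by (intro op_homI Q.quot_op_group mod_hom_quot_map(1)[OF quot_Fin quot_Fin D_hom D_Fin])

lemma St_cases: "W \<in> carrier (St n) \<Longrightarrow> \<exists>z\<in>carrier (Tot n). W = cls n z"
  unfolding quot_carrier by blast

lemma cls_zero_iff: "z \<in> carrier (Tot n) \<Longrightarrow> cls n z = \<zero>\<^bsub>St n\<^esub> \<longleftrightarrow> z \<in> Fin n"
  using Tot.coset_eq_sub_iff[OF Fin_submodule] by simp

lemma cls_eq_iff:
  assumes z: "z \<in> carrier (Tot n)" and w: "w \<in> carrier (Tot n)"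
  shows "cls n z = cls n w \<longleftrightarrow> (\<exists>N. \<forall>j\<ge>N. z j = w j)"
proof -
  have "z j \<ominus>\<^bsub>A n j\<^esub> w j = \<zero>\<^bsub>A n j\<^esub> \<longleftrightarrow> z j = w j" for j
    using G.eq_iff_diff[of "z j" n j "w j"] z w by simp
  then show ?thesis
    using Tot.coset_eq_iff[OF Fin_submodule z w] Tot.minus_closed[OF z w]
    by (simp add: Fin_iff prod_diff[OF grp z w] del: prod_module_simps)
qed

end

context tate_bicx
begin

definition srel where
  "srel n W t \<longleftrightarrow> (\<exists>z\<in>carrier (B.Tot (su n)). W = B.cls (su n) z \<and> rel n z t)"

text \<open>The results on \<open>rel\<close> in terms of classes: a stable cycle is the class of a
  family with finite boundary, and a stable boundary is the class of a family that agrees with a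
  boundary in high degrees.\<close>

lemma stable_tate_quot_rel:
  "quot_rel K (B.St (su (su p))) (C (su p))
     {W \<in> carrier (B.St (su (su p))). B.sD (su p) W = \<zero>\<^bsub>B.St (su p)\<^esub>}
     (B.sD (su (su p)) ` carrier (B.St (su (su (su p)))))
     {t \<in> carrier (C (su p)). d p t = \<zero>\<^bsub>C p\<^esub>} (d (su p) ` carrier (C (su (su p)))) (srel (su p))"
proof -
  let ?n = "su p" let ?M = "B.St (su ?n)"
  interpret St: op_group K "B.St n" for n by (rule B.Q.quot_op_group)
  interpret sD: op_hom K "B.St (su n)" "B.St n" "B.sD n" for n by (rule B.sD_op_hom)
  have cyc: "\<exists>N. \<forall>j\<ge>N. B.D ?n z j = \<zero>\<^bsub>B ?n j\<^esub>" if "z \<in> carrier (B.Tot (su ?n))" "B.sD ?n (B.cls (su ?n) z) = \<zero>\<^bsub>B.St ?n\<^esub>" for z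
    using that B.cls_zero_iff[OF B.D.closed[OF that(1)]] by (auto simp: B.sD_cls B.Fin_iff simp del: prod_module_simps quot_zero)
  show ?thesis
  proof (intro quot_rel.intro quot_rel_axioms.intro St.op_group_axioms A.C.op_group_axioms)
    show "submodule {W \<in> carrier ?M. B.sD ?n W = \<zero>\<^bsub>B.St ?n\<^esub>} K ?M" by (rule sD.kernel_submodule)
    show "submodule (B.sD (su ?n) ` carrier (B.St (su (su ?n)))) K ?M"
      by (rule sD.image_submodule[OF St.carrier_submodule])
    show "submodule {t \<in> carrier (C ?n). d p t = \<zero>\<^bsub>C p\<^esub>} K (C ?n)" by (rule A.d.kernel_submodule)
    show "submodule (d ?n ` carrier (C (su ?n))) K (C ?n)" by (rule A.d.image_submodule[OF A.C.carrier_submodule])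
    show "B.sD (su ?n) ` carrier (B.St (su (su ?n))) \<subseteq> {W \<in> carrier ?M. B.sD ?n W = \<zero>\<^bsub>B.St ?n\<^esub>}"
    proof
      fix W assume "W \<in> B.sD (su ?n) ` carrier (B.St (su (su ?n)))"
      then obtain y where y: "y \<in> carrier (B.Tot (su (su ?n)))" "W = B.sD (su ?n) (B.cls (su (su ?n)) y)"
        using B.St_cases by blast
      have "B.D ?n (B.D (su ?n) y) \<in> B.Fin ?n"
        using B.DD[OF y(1)] by (intro B.FinI[OF B.D.closed[OF B.D.closed[OF y(1)]]]) auto
      then show "W \<in> {W \<in> carrier ?M. B.sD ?n W = \<zero>\<^bsub>B.St ?n\<^esub>}"
        using y B.D.closed[OF y(1)] B.D.closed[OF B.D.closed[OF y(1)]]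
        by (simp add: B.sD_cls B.cls_zero_iff del: prod_module_simps quot_zero)
    qed
    show "d ?n ` carrier (C (su ?n)) \<subseteq> {t \<in> carrier (C ?n). d p t = \<zero>\<^bsub>C p\<^esub>}"
    proof (rule image_subsetI)
      fix c assume c: "c \<in> carrier (C (su ?n))"
      have "e p (d p (d ?n c)) = \<zero>\<^bsub>A p p\<^esub>" using c by (simp add: A.e_d A.hh)
      then show "d ?n c \<in> {t \<in> carrier (C ?n). d p t = \<zero>\<^bsub>C p\<^esub>}" using c A.e_inj by auto
    qed
  next
    fix W t V u
    assume W: "W \<in> {W \<in> carrier ?M. B.sD ?n W = \<zero>\<^bsub>B.St ?n\<^esub>}" and V: "V \<in> {W \<in> carrier ?M. B.sD ?n W = \<zero>\<^bsub>B.St ?n\<^esub>}"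
      and t: "t \<in> {t \<in> carrier (C ?n). d p t = \<zero>\<^bsub>C p\<^esub>}" and u: "u \<in> {t \<in> carrier (C ?n). d p t = \<zero>\<^bsub>C p\<^esub>}"
      and r: "srel ?n W t" "srel ?n V u"
    obtain z y where z: "z \<in> carrier (B.Tot (su ?n))" "W = B.cls (su ?n) z" "rel ?n z t"
      and y: "y \<in> carrier (B.Tot (su ?n))" "V = B.cls (su ?n) y" "rel ?n y u" using r unfolding srel_def by blast
    show "srel ?n (W \<oplus>\<^bsub>?M\<^esub> V) (t \<oplus>\<^bsub>C ?n\<^esub> u)"
      unfolding srel_def z(2) y(2) B.Q.quot_add[OF z(1) y(1)]
      using rel_add[OF z(1) y(1) _ _ z(3) y(3)] t u B.Tot.a_closed[OF z(1) y(1)] by blast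
  next
    fix W t
    assume W: "W \<in> {W \<in> carrier ?M. B.sD ?n W = \<zero>\<^bsub>B.St ?n\<^esub>}" 
      and t: "t \<in> {t \<in> carrier (C ?n). d p t = \<zero>\<^bsub>C p\<^esub>}" 
      and r: "srel ?n W t"
    obtain z where z: "z \<in> carrier (B.Tot (su ?n))" "W = B.cls (su ?n) z" "rel ?n z t" using r unfolding srel_def by blast
    note nz = B.Tot.a_inv_closed[OF z(1)]
    have "B.cls (su ?n) (\<ominus>\<^bsub>B.Tot (su ?n)\<^esub> z) \<oplus>\<^bsub>?M\<^esub> W = \<zero>\<^bsub>?M\<^esub>"
      unfolding z(2) B.Q.quot_add[OF nz z(1)] B.Tot.l_neg[OF z(1)] using B.Tot.coset_zero[OF B.Fin_submodule] by simp
    then have "\<ominus>\<^bsub>?M\<^esub> W = B.cls (su ?n) (\<ominus>\<^bsub>B.Tot (su ?n)\<^esub> z)"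
      using W B.Q.quot_closed[OF nz] by (intro St.minus_equality) simp_all
    then show "srel ?n (\<ominus>\<^bsub>?M\<^esub> W) (\<ominus>\<^bsub>C ?n\<^esub> t)"
      unfolding srel_def using rel_neg[OF z(1) _ z(3)] t nz by blast
    show "srel ?n (a \<odot>\<^bsub>?M\<^esub> W) (a \<odot>\<^bsub>C ?n\<^esub> t)" if a: "a \<in> carrier K" for a
      unfolding srel_def z(2) B.Q.quot_smult[OF a z(1)]
      using rel_smult[OF a z(1) _ z(3)] t B.Tot.op_closed[OF a z(1)] by blast
    obtain N where N: "\<And>j. N \<le> j \<Longrightarrow> B.D ?n z j = \<zero>\<^bsub>B ?n j\<^esub>" using cyc z W by blast
    have "W \<in> B.sD (su ?n) ` carrier (B.St (su (su ?n))) \<longleftrightarrow>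
      (\<exists>y\<in>carrier (B.Tot (su (su ?n))). \<exists>N. \<forall>j\<ge>N. z j = B.D (su ?n) y j)"
    proof
      assume "W \<in> B.sD (su ?n) ` carrier (B.St (su (su ?n)))"
      then obtain y where y: "y \<in> carrier (B.Tot (su (su ?n)))" "W = B.sD (su ?n) (B.cls (su (su ?n)) y)"
        using B.St_cases by blast
      then show "\<exists>y\<in>carrier (B.Tot (su (su ?n))). \<exists>N. \<forall>j\<ge>N. z j = B.D (su ?n) y j"
        using B.cls_eq_iff[OF z(1) B.D.closed[OF y(1)]] z(2) B.sD_cls[OF y(1)] by blast
    next
      assume "\<exists>y\<in>carrier (B.Tot (su (su ?n))). \<exists>N. \<forall>j\<ge>N. z j = B.D (su ?n) y j"
      then obtain y where y: "y \<in> carrier (B.Tot (su (su ?n)))" "\<exists>N. \<forall>j\<ge>N. z j = B.D (su ?n) y j" by blast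
      then have "W = B.sD (su ?n) (B.cls (su (su ?n)) y)"
        using B.cls_eq_iff[OF z(1) B.D.closed[OF y(1)]] z(2) B.sD_cls[OF y(1)] by blast
      then show "W \<in> B.sD (su ?n) ` carrier (B.St (su (su ?n)))" using B.Q.quot_closed[OF y(1)] by blast
    qed
    also have "\<dots> \<longleftrightarrow> (\<exists>u\<in>carrier (C (su ?n)). d ?n u = t)"
      using rel_boundary_iff[OF z(1) N _ z(3)] t by blast
    finally show "W \<in> B.sD (su ?n) ` carrier (B.St (su (su ?n))) \<longleftrightarrow> t \<in> d ?n ` carrier (C (su ?n))" by auto
  next
    fix W assume W: "W \<in> {W \<in> carrier ?M. B.sD ?n W = \<zero>\<^bsub>B.St ?n\<^esub>}"
    then obtain z where z: "z \<in> carrier (B.Tot (su ?n))" "W = B.cls (su ?n) z" using B.St_cases by blast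
    obtain N where N: "\<And>j. N \<le> j \<Longrightarrow> B.D ?n z j = \<zero>\<^bsub>B ?n j\<^esub>" using cyc z W by blast
    show "\<exists>t\<in>{t \<in> carrier (C ?n). d p t = \<zero>\<^bsub>C p\<^esub>}. srel ?n W t"
      using rel_total[OF z(1) N] z unfolding srel_def by blast
  next
    fix t assume "t \<in> {t \<in> carrier (C ?n). d p t = \<zero>\<^bsub>C p\<^esub>}"
    then obtain z where z: "z \<in> carrier (B.Tot (su ?n))" "\<exists>N. \<forall>j\<ge>N. B.D ?n z j = \<zero>\<^bsub>B ?n j\<^esub>" "rel ?n z t"
      using rel_onto by blast
    have "B.D ?n z \<in> B.Fin ?n" using z(2) B.D.closed[OF z(1)] unfolding B.Fin_iff by blast
    then have "B.sD ?n (B.cls (su ?n) z) = \<zero>\<^bsub>B.St ?n\<^esub>"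
      using B.cls_zero_iff[OF B.D.closed[OF z(1)]] B.sD_cls[OF z(1)] by simp
    then show "\<exists>W\<in>{W \<in> carrier ?M. B.sD ?n W = \<zero>\<^bsub>B.St ?n\<^esub>}. srel ?n W t"
      using z B.Q.quot_closed[OF z(1)] unfolding srel_def by blast
  qed
qed

end

section \<open>Tensor products of complexes as double complexes\<close>

lemma su_diff [simp]: "su n - su i = n - i" "su (n - su i) = n - i" and su_diff_left: "su n - i = su (n - i)"
  by (simp_all add: su_def)

context k_algebra
begin

abbreviation col :: "('r, 'x) cplx \<Rightarrow> ('r, 'i) cplx \<Rightarrow> int \<Rightarrow> int \<Rightarrow> ('x, 'i) tensor \<Rightarrow> ('x, 'i) tensor" where
  "col X I n i \<equiv> tensor_map \<eta> R (obj X i) (obj I (n - i)) (diff X (su i)) id"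

abbreviation row :: "('r, 'x) cplx \<Rightarrow> ('r, 'i) cplx \<Rightarrow> int \<Rightarrow> int \<Rightarrow> ('x, 'i) tensor \<Rightarrow> ('x, 'i) tensor" where
  "row X I n i \<equiv> tensor_map \<eta> R (obj X i) (obj I (n - i)) id (diff I (su (n - i)))"

lemma tensor_map_commute:
  assumes "left_module S X" "left_module R Y" "left_module S X2" "left_module R Y2"
    "f \<in> mod_hom S X X2" "g \<in> mod_hom R Y Y2" "u \<in> carrier (tensor_module \<eta> R X Y)"
  shows "tensor_map \<eta> R X2 Y2 f id (tensor_map \<eta> R X Y2 id g u) = tensor_map \<eta> R X2 Y2 id g (tensor_map \<eta> R X2 Y f id u)"
  using tensor_map_comp[OF assms(1,2,1,4,3,4) mod_hom_id assms(6,5) mod_hom_id assms(7)]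
    tensor_map_comp[OF assms(1,2,3,2,3,4,5) mod_hom_id mod_hom_id assms(6,7)]
  by (simp only: id_apply)

lemma tensor_map_comp_right:
  assumes "left_module S X" "left_module R Y" "left_module R Y2" "left_module R Y3"
    "g \<in> mod_hom R Y Y2" "g' \<in> mod_hom R Y2 Y3" "u \<in> carrier (tensor_module \<eta> R X Y)"
  shows "tensor_map \<eta> R X Y3 id g' (tensor_map \<eta> R X Y2 id g u) = tensor_map \<eta> R X Y3 id (\<lambda>y. g' (g y)) u"
  using tensor_map_comp[OF assms(1,2,1,3,1,4) mod_hom_id assms(5) mod_hom_id assms(6,7)]
  by (simp add: id_def)

lemma tensor_term_su: "tensor_term \<eta> R X I (su n) (su i) = tensor_module \<eta> R (obj X (su i)) (obj I (n - i))"
  "tensor_term \<eta> R X I (su n) i = tensor_module \<eta> R (obj X i) (obj I (su (n - i)))"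
  "tensor_term \<eta> R X I n n = tensor_module \<eta> R (obj X n) (obj I 0)"
  by (simp_all add: tensor_term_def su_diff_left)

lemma tensor_bicx:
  assumes X: "is_cplx S X" and I: "is_cplx R I" and I0: "\<And>n. n > 0 \<Longrightarrow> carrier (obj I n) = {\<zero>\<^bsub>obj I n\<^esub>}"
  shows "bicx k (tensor_term \<eta> R X I) (col X I) (row X I)"
proof -
  note lX = cplx_module[OF X] and lI = cplx_module[OF I] and i = mod_hom_id
  note dX = cplx_diff_su[OF X] and dI = cplx_diff_su[OF I]
  show ?thesis
  proof (rule bicx.intro)
    show "op_group k (tensor_term \<eta> R X I n i)" for n i unfolding tensor_term_def by (rule tensor_op_group[OF lX lI])
    show "col X I n i \<in> mod_hom k (tensor_term \<eta> R X I (su n) (su i)) (tensor_term \<eta> R X I n i)" for n i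
      unfolding tensor_term_su(1) unfolding tensor_term_def by (rule tensor_map_hom[OF lX lI lX lI dX i])
    show "row X I n i \<in> mod_hom k (tensor_term \<eta> R X I (su n) i) (tensor_term \<eta> R X I n i)" for n i
      unfolding tensor_term_su(2) unfolding tensor_term_def by (rule tensor_map_hom[OF lX lI lX lI i dI])
  next
    fix n i x assume x: "x \<in> carrier (tensor_term \<eta> R X I (su (su n)) (su (su i)))"
    then have x': "x \<in> carrier (tensor_module \<eta> R (obj X (su (su i))) (obj I (n - i)))" by (simp add: tensor_term_su(1))
    have "col X I n i (col X I (su n) (su i) x) =
      tensor_map \<eta> R (obj X i) (obj I (n - i)) (\<lambda>x. diff X (su i) (diff X (su (su i)) x)) id x"
      using tensor_map_comp_left[OF lI lX lX lX dX dX x'] by simp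
    also have "\<dots> = \<zero>\<^bsub>tensor_term \<eta> R X I n i\<^esub>"
      unfolding tensor_term_def using cplx_dd_su[OF X]
      by (intro tensor_map_zero[OF lX lI lX lI mod_hom_comp[OF dX dX] i _ x']) auto
    finally show "col X I n i (col X I (su n) (su i) x) = \<zero>\<^bsub>tensor_term \<eta> R X I n i\<^esub>" .
  next
    fix n i x assume x: "x \<in> carrier (tensor_term \<eta> R X I (su (su n)) i)"
    then have x': "x \<in> carrier (tensor_module \<eta> R (obj X i) (obj I (su (su (n - i)))))"
      by (simp add: tensor_term_su(2) su_diff_left)
    have "row X I n i (row X I (su n) i x) =
      tensor_map \<eta> R (obj X i) (obj I (n - i)) id (\<lambda>x. diff I (su (n - i)) (diff I (su (su (n - i))) x)) x"
      using tensor_map_comp_right[OF lX lI lI lI dI dI x'] by (simp add: su_diff_left)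
    also have "\<dots> = \<zero>\<^bsub>tensor_term \<eta> R X I n i\<^esub>"
      unfolding tensor_term_def using cplx_dd_su[OF I]
      by (intro tensor_map_zero[OF lX lI lX lI i mod_hom_comp[OF dI dI] _ x']) auto
    finally show "row X I n i (row X I (su n) i x) = \<zero>\<^bsub>tensor_term \<eta> R X I n i\<^esub>" .
  next
    fix n i x assume x: "x \<in> carrier (tensor_term \<eta> R X I (su (su n)) (su i))"
    then have x': "x \<in> carrier (tensor_module \<eta> R (obj X (su i)) (obj I (su (n - i))))"
      by (simp add: tensor_term_su(1) su_diff_left)
    show "col X I n i (row X I (su n) (su i) x) = row X I n i (col X I (su n) i x)"
      using tensor_map_commute[OF lX lI lX lI dX dI x'] by (simp add: su_diff_left)
  next
    fix n i :: int and x assume "i < n" "x \<in> carrier (tensor_term \<eta> R X I n i)"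
    then have x: "x \<in> carrier (tensor_module \<eta> R (obj X i) (obj I (n - i)))" and ni: "n - i > 0"
      by (simp_all add: tensor_term_def)
    interpret T: op_group k "tensor_module \<eta> R (obj X i) (obj I (n - i))" by (rule tensor_op_group[OF lX lI])
    from x have "x = \<zero>\<^bsub>tensor_module \<eta> R (obj X i) (obj I (n - i))\<^esub>"
    proof (induction rule: tensor_induct[OF lX lI, consumes 1])
      case (1 x y)
      then have "y = \<zero>\<^bsub>obj I (n - i)\<^esub>" using I0[OF ni] by simp
      then show ?case using tens_zero_right[OF lX lI] 1(1) by simp
    qed simp
    then show "x = \<zero>\<^bsub>tensor_term \<eta> R X I n i\<^esub>" by (simp add: tensor_term_def)
  qed
qed

lemma unbounded_diff:
  assumes "is_cplx S X" "is_cplx R I" "\<And>n. n > 0 \<Longrightarrow> carrier (obj I n) = {\<zero>\<^bsub>obj I n\<^esub>}"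
  shows "diff (unbounded_tensor \<eta> R X I) (su n) = bicx.D (tensor_term \<eta> R X I) (col X I) (row X I) n"
proof -
  interpret bicx k "tensor_term \<eta> R X I" "col X I" "row X I" by (rule tensor_bicx[OF assms])
  have eq: "su n - 1 = n" "j + 1 = su j" "su (n - 1 - j) = n - j" for j by (simp_all add: su_def)
  show ?thesis unfolding unbounded_tensor_def D_def
    by (simp add: fun_eq_iff sg_def Let_def eq su_diff_left tensor_term_def)
qed

lemma tensor_bicx_map:
  assumes X: "is_cplx S X" and Y: "is_cplx S Y" and I: "is_cplx R I"
    and I0: "\<And>n. n > 0 \<Longrightarrow> carrier (obj I n) = {\<zero>\<^bsub>obj I n\<^esub>}" and f: "high_half S X Y m f g s"
  shows "bicx_map k (tensor_term \<eta> R X I) (col X I) (row X I) (tensor_term \<eta> R Y I) (col Y I) (row Y I)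
    (\<lambda>n i. tensor_map \<eta> R (obj Y i) (obj I (n - i)) (f i) id) m"
proof -
  note lX = cplx_module[OF X] and lY = cplx_module[OF Y] and lI = cplx_module[OF I] and i = mod_hom_id
  note dX = cplx_diff_su[OF X] and dY = cplx_diff_su[OF Y] and dI = cplx_diff_su[OF I]
  show ?thesis
  proof (intro bicx_map.intro bicx_map_axioms.intro tensor_bicx X Y I I0)
    fix n j assume j: "m \<le> j"
    then have j': "m \<le> su j" by (simp add: su_def)
    note fj = high_halfD(1)[OF f j] and fj' = high_halfD(1)[OF f j']
    show "tensor_map \<eta> R (obj Y j) (obj I (n - j)) (f j) id \<in> mod_hom k (tensor_term \<eta> R X I n j) (tensor_term \<eta> R Y I n j)"
      unfolding tensor_term_def by (rule tensor_map_hom[OF lX lI lY lI fj i])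
    {
      fix x assume "x \<in> carrier (tensor_term \<eta> R X I (su n) (su j))"
      then have x: "x \<in> carrier (tensor_module \<eta> R (obj X (su j)) (obj I (n - j)))" by (simp add: tensor_term_su(1))
      have "tensor_map \<eta> R (obj Y j) (obj I (n - j)) (\<lambda>x. diff Y (su j) (f (su j) x)) id x =
        tensor_map \<eta> R (obj Y j) (obj I (n - j)) (\<lambda>x. f j (diff X (su j) x)) id x"
        using high_halfD(3)[OF f j]
        by (intro tensor_map_cong[OF lX lI lY lI mod_hom_comp[OF fj' dY] i mod_hom_comp[OF dX fj] i _ _ x]) auto
      then show "col Y I n j (tensor_map \<eta> R (obj Y (su j)) (obj I (su n - su j)) (f (su j)) id x) =
        tensor_map \<eta> R (obj Y j) (obj I (n - j)) (f j) id (col X I n j x)"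
        using tensor_map_comp_left[OF lI lX lY lY fj' dY x] tensor_map_comp_left[OF lI lX lX lY dX fj x] by simp
    next
      fix x assume "x \<in> carrier (tensor_term \<eta> R X I (su n) j)"
      then have x: "x \<in> carrier (tensor_module \<eta> R (obj X j) (obj I (su (n - j))))" by (simp add: tensor_term_su(2))
      show "row Y I n j (tensor_map \<eta> R (obj Y j) (obj I (su n - j)) (f j) id x) =
        tensor_map \<eta> R (obj Y j) (obj I (n - j)) (f j) id (row X I n j x)"
        using tensor_map_commute[OF lX lI lY lI fj dI x] by (simp add: su_diff_left)
    }
  qed
qed

lemma tensor_bicx_homotopy:
  assumes X: "is_cplx S X" and Y: "is_cplx S Y" and I: "is_cplx R I"
    and I0: "\<And>n. n > 0 \<Longrightarrow> carrier (obj I n) = {\<zero>\<^bsub>obj I n\<^esub>}" and f: "high_half S X Y m f g s" and g: "high_half S Y X m g f s'"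
  shows "bicx_homotopy k (tensor_term \<eta> R X I) (col X I) (row X I)
    (\<lambda>n i x. tensor_map \<eta> R (obj X i) (obj I (n - i)) (g i) id (tensor_map \<eta> R (obj Y i) (obj I (n - i)) (f i) id x))
    (\<lambda>n i. tensor_map \<eta> R (obj X (su i)) (obj I (n - i)) (s i) id) m"
proof -
  note lX = cplx_module[OF X] and lY = cplx_module[OF Y] and lI = cplx_module[OF I] and i = mod_hom_id
  note dX = cplx_diff_su[OF X] and dY = cplx_diff_su[OF Y] and dI = cplx_diff_su[OF I]
  show ?thesis
  proof (intro bicx_homotopy.intro bicx_homotopy_axioms.intro tensor_bicx X I I0)
    fix n j assume j: "m \<le> j"
    then have j': "m \<le> su j" by (simp add: su_def)
    note fj = high_halfD(1)[OF f j] and fj' = high_halfD(1)[OF f j'] and gj = high_halfD(1)[OF g j] and gj' = high_halfD(1)[OF g j']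
      and sj = high_halfD(2)[OF f j] and sj' = high_halfD(2)[OF f j']
    show "(\<lambda>x. tensor_map \<eta> R (obj X j) (obj I (n - j)) (g j) id (tensor_map \<eta> R (obj Y j) (obj I (n - j)) (f j) id x))
        \<in> mod_hom k (tensor_term \<eta> R X I n j) (tensor_term \<eta> R X I n j)"
      unfolding tensor_term_def
      by (rule mod_hom_comp[OF tensor_map_hom[OF lX lI lY lI fj i] tensor_map_hom[OF lY lI lX lI gj i]])
    show "tensor_map \<eta> R (obj X (su j)) (obj I (n - j)) (s j) id
        \<in> mod_hom k (tensor_term \<eta> R X I n j) (tensor_term \<eta> R X I (su n) (su j))"
      unfolding tensor_term_su(1) unfolding tensor_term_def by (rule tensor_map_hom[OF lX lI lX lI sj i])
    {
      fix x assume "x \<in> carrier (tensor_term \<eta> R X I (su n) j)"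
      then have x: "x \<in> carrier (tensor_module \<eta> R (obj X j) (obj I (su (n - j))))" by (simp add: tensor_term_su(2))
      show "row X I (su n) (su j) (tensor_map \<eta> R (obj X (su j)) (obj I (su n - j)) (s j) id x) =
        tensor_map \<eta> R (obj X (su j)) (obj I (n - j)) (s j) id (row X I n j x)"
        using tensor_map_commute[OF lX lI lX lI sj dI x] by (simp add: su_diff_left)
    next
      fix x assume "x \<in> carrier (tensor_term \<eta> R X I (su n) (su j))"
      then have x: "x \<in> carrier (tensor_module \<eta> R (obj X (su j)) (obj I (n - j)))" by (simp add: tensor_term_su(1))
      let ?X = "obj X (su j)" let ?t = "\<lambda>f. tensor_map \<eta> R ?X (obj I (n - j)) f id"
      have c: "(\<lambda>x. g (su j) (f (su j) x)) \<in> mod_hom S ?X ?X" "(\<lambda>x. diff X (su (su j)) (s (su j) x)) \<in> mod_hom S ?X ?X"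
        "(\<lambda>x. s j (diff X (su j) x)) \<in> mod_hom S ?X ?X"
        by (rule mod_hom_comp[OF fj' gj'] mod_hom_comp[OF sj' dX] mod_hom_comp[OF dX sj])+
      have c12: "(\<lambda>x. g (su j) (f (su j) x) \<oplus>\<^bsub>?X\<^esub> diff X (su (su j)) (s (su j) x)) \<in> mod_hom S ?X ?X"
        by (intro mod_hom_sum left_module_op_group lX c)
      have "x = ?t (\<lambda>x. g (su j) (f (su j) x) \<oplus>\<^bsub>?X\<^esub> diff X (su (su j)) (s (su j) x) \<oplus>\<^bsub>?X\<^esub> s j (diff X (su j) x)) x"
        using high_halfD(4)[OF f j]
        by (intro tensor_map_ident[symmetric] lX lI i x mod_hom_sum left_module_op_group c12 c) auto
      also have "\<dots> = ?t (\<lambda>x. g (su j) (f (su j) x)) x \<oplus>\<^bsub>tensor_module \<eta> R ?X (obj I (n - j))\<^esub>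
        ?t (\<lambda>x. diff X (su (su j)) (s (su j) x)) x \<oplus>\<^bsub>tensor_module \<eta> R ?X (obj I (n - j))\<^esub> ?t (\<lambda>x. s j (diff X (su j) x)) x"
        unfolding tensor_map_add_left[OF lX lI lX lI c12 c(3) i x] tensor_map_add_left[OF lX lI lX lI c(1,2) i x] ..
      finally show "x = tensor_map \<eta> R ?X (obj I (su n - su j)) (g (su j)) id
           (tensor_map \<eta> R (obj Y (su j)) (obj I (su n - su j)) (f (su j)) id x)
         \<oplus>\<^bsub>tensor_term \<eta> R X I (su n) (su j)\<^esub>
         col X I (su n) (su j) (tensor_map \<eta> R (obj X (su (su j))) (obj I (su n - su j)) (s (su j)) id x)
         \<oplus>\<^bsub>tensor_term \<eta> R X I (su n) (su j)\<^esub>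
         tensor_map \<eta> R ?X (obj I (n - j)) (s j) id (col X I n j x)"
        using tensor_map_comp_left[OF lI lX lY lX fj' gj' x] tensor_map_comp_left[OF lI lX lX lX sj' dX x]
          tensor_map_comp_left[OF lI lX lX lX dX sj x]
        by (simp add: tensor_term_su(1))
    }
  qed
qed

text \<open>The rows have a fixed projective term of \<open>T\<close> as first factor, so their
  exactness is \<open>tensor_flat\<close> applied to the resolution. A column has a fixed injective
  module as second factor and is covered by \<open>tensor_injective_exact\<close>.\<close>

lemma tensor_augmented_bicx:
  assumes T: "totally_acyclic S T" and ap: "\<And>n. fin_approx S T n" and res: "injective_resolution R N \<iota> I"
  shows "augmented_bicx k (tensor_term \<eta> R T I) (col T I) (row T I)
    (\<lambda>n. tensor_module \<eta> R (obj T n) N) (\<lambda>n. tensor_map \<eta> R (obj T n) N (diff T (su n)) id)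
    (\<lambda>n. tensor_map \<eta> R (obj T n) (obj I 0) id \<iota>)"
proof -
  have X: "is_cplx S T" and pT: "\<And>n. projective_module S (obj T n)" using T by (auto simp: totally_acyclic_def)
  have N: "left_module R N" and I: "is_cplx R I" and inj: "\<And>n. injective_module R (obj I n)"
    and I0: "\<And>n. n > 0 \<Longrightarrow> carrier (obj I n) = {\<zero>\<^bsub>obj I n\<^esub>}" and ac: "\<And>n. n < 0 \<Longrightarrow> acyclic_at I n"
    and \<iota>: "\<iota> \<in> mod_hom R N (obj I 0)" "inj_on \<iota> (carrier N)" "\<iota> ` carrier N = cycles I 0"
    using res by (auto simp: injective_resolution_def)
  note lX = cplx_module[OF X] and lI = cplx_module[OF I] and i = mod_hom_id
  note dX = cplx_diff_su[OF X] and dI = cplx_diff_su[OF I]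
  interpret bicx k "tensor_term \<eta> R T I" "col T I" "row T I" by (rule tensor_bicx[OF X I I0])
  have z0: "su (n - su n) = 0" for n by (simp add: su_def)
  have cyc: "\<iota> ` carrier N = {y \<in> carrier (obj I 0). diff I 0 y = \<zero>\<^bsub>obj I (- 1)\<^esub>}"
    using \<iota>(3) by (simp add: cycles_def)
  have nn: "n - su n = - 1" "su (- 1) = 0" for n by (simp_all add: su_def)
  show ?thesis
  proof (intro augmented_bicx.intro augmented_bicx_axioms.intro bicx_axioms)
    show "op_group k (tensor_module \<eta> R (obj T n) N)" for n by (rule tensor_op_group[OF lX N])
    show "tensor_map \<eta> R (obj T n) N (diff T (su n)) id \<in> mod_hom k (tensor_module \<eta> R (obj T (su n)) N) (tensor_module \<eta> R (obj T n) N)"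
      for n by (rule tensor_map_hom[OF lX N lX N dX i])
    show "tensor_map \<eta> R (obj T n) (obj I 0) id \<iota> \<in> mod_hom k (tensor_module \<eta> R (obj T n) N) (tensor_term \<eta> R T I n n)" for n
      unfolding tensor_term_su(3) by (rule tensor_map_hom[OF lX N lX lI i \<iota>(1)])
  next
    fix n c assume c: "c \<in> carrier (tensor_module \<eta> R (obj T (su n)) N)"
    show "tensor_map \<eta> R (obj T n) (obj I 0) id \<iota> (tensor_map \<eta> R (obj T n) N (diff T (su n)) id c) =
      col T I n n (tensor_map \<eta> R (obj T (su n)) (obj I 0) id \<iota> c)"
      using tensor_map_commute[OF lX N lX lI dX \<iota>(1) c] by simp
    have d0: "diff I 0 \<in> mod_hom R (obj I 0) (obj I (- 1))" using cplx_diff[OF I, of 0] by simp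
    have "tensor_map \<eta> R (obj T (su n)) (obj I (- 1)) id (\<lambda>x. diff I 0 (\<iota> x)) c =
      \<zero>\<^bsub>tensor_module \<eta> R (obj T (su n)) (obj I (- 1))\<^esub>"
      using cyc by (intro tensor_map_zero[OF lX N lX lI i mod_hom_comp[OF \<iota>(1) d0] _ c]) auto
    then show "row T I n (su n) (tensor_map \<eta> R (obj T (su n)) (obj I 0) id \<iota> c) = \<zero>\<^bsub>tensor_term \<eta> R T I n (su n)\<^esub>"
      using tensor_map_comp_right[OF lX N lI lI \<iota>(1) d0 c] by (simp add: z0 nn tensor_term_def)
  next
    fix n c assume c: "c \<in> carrier (tensor_module \<eta> R (obj T n) N)"
      and z: "tensor_map \<eta> R (obj T n) (obj I 0) id \<iota> c = \<zero>\<^bsub>tensor_term \<eta> R T I n n\<^esub>"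
    show "c = \<zero>\<^bsub>tensor_module \<eta> R (obj T n) N\<^esub>"
      using tensor_flat_inj[OF pT N lI \<iota>(1,2) c] z by (simp add: tensor_term_su(3))
  next
    fix n x assume x: "x \<in> carrier (tensor_term \<eta> R T I (su n) (su n))" and z: "row T I n (su n) x = \<zero>\<^bsub>tensor_term \<eta> R T I n (su n)\<^esub>"
    have d0: "diff I 0 \<in> mod_hom R (obj I 0) (obj I (- 1))" using cplx_diff[OF I, of 0] by simp
    show "\<exists>c\<in>carrier (tensor_module \<eta> R (obj T (su n)) N). tensor_map \<eta> R (obj T (su n)) (obj I 0) id \<iota> c = x"
      using x z cyc by (intro tensor_flat[OF pT N lI lI \<iota>(1) d0]) (auto simp: tensor_term_def z0 nn)
  next
    fix n j x assume j: "su n < j" and x: "x \<in> carrier (tensor_term \<eta> R T I (su n) j)" and z: "row T I n j x = \<zero>\<^bsub>tensor_term \<eta> R T I n j\<^esub>"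
    \<comment> \<open>The condition \<open>su n < j\<close> puts the second degree
      \<open>su (n - j)\<close> strictly below 0, where the resolution is exact without its
      augmentation.\<close>
    have ac': "acyclic_at I (su (n - j))" using j by (intro ac) (simp add: su_def)
    have "\<exists>y\<in>carrier (tensor_module \<eta> R (obj T j) (obj I (su (su (n - j))))). tensor_map \<eta> R (obj T j) (obj I (su (n - j))) id (diff I (su (su (n - j)))) y = x"
      using x z acyclic_at_su[OF ac'] by (intro tensor_flat[OF pT lI lI lI dI dI]) (auto simp: tensor_term_def su_diff_left)
    then show "\<exists>y\<in>carrier (tensor_term \<eta> R T I (su (su n)) j). row T I (su n) j y = x"
      by (simp add: tensor_term_def su_diff_left)
  next
    fix n j x assume x: "x \<in> carrier (tensor_term \<eta> R T I (su n) (su j))" and z: "col T I n j x = \<zero>\<^bsub>tensor_term \<eta> R T I n j\<^esub>"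
    have s: "su j - 1 = j" "su j + 1 = su (su j)" by (simp_all add: su_def)
    show "\<exists>y\<in>carrier (tensor_term \<eta> R T I (su (su n)) (su (su j))). col T I (su n) (su j) y = x"
      using tensor_injective_exact[OF inj T ap[of "su j"], of x "n - j"] x z unfolding s by (simp add: tensor_term_def)
  qed
qed

end

context k_algebra
begin

section \<open>The comparison for one injective resolution\<close>

lemma tensor_tate_bicx:
  assumes T: "totally_acyclic S T" and ap: "\<And>n. fin_approx S T n" and P: "is_cplx S P"
    and \<alpha>: "high_half S T P m \<alpha> \<beta> s" and \<beta>: "high_half S P T m \<beta> \<alpha> s'" and res: "injective_resolution R N \<iota> I"
  shows "tate_bicx k (tensor_term \<eta> R T I) (col T I) (row T I)
    (\<lambda>n. tensor_module \<eta> R (obj T n) N) (\<lambda>n. tensor_map \<eta> R (obj T n) N (diff T (su n)) id)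
    (\<lambda>n. tensor_map \<eta> R (obj T n) (obj I 0) id \<iota>)
    (tensor_term \<eta> R P I) (col P I) (row P I)
    (\<lambda>n i. tensor_map \<eta> R (obj P i) (obj I (n - i)) (\<alpha> i) id)
    (\<lambda>n i. tensor_map \<eta> R (obj T i) (obj I (n - i)) (\<beta> i) id)
    (\<lambda>n i. tensor_map \<eta> R (obj T (su i)) (obj I (n - i)) (s i) id)
    (\<lambda>n i. tensor_map \<eta> R (obj P (su i)) (obj I (n - i)) (s' i) id) m"
proof -
  have X: "is_cplx S T" using T by (simp add: totally_acyclic_def)
  have I: "is_cplx R I" and I0: "\<And>n. n > 0 \<Longrightarrow> carrier (obj I n) = {\<zero>\<^bsub>obj I n\<^esub>}"
    using res by (auto simp: injective_resolution_def)
  show ?thesis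
    by (intro tate_bicx.intro tensor_augmented_bicx[OF T ap res] tensor_bicx[OF P I I0]
        tensor_bicx_map[OF X P I I0 \<alpha>] tensor_bicx_map[OF P X I I0 \<beta>]
        tensor_bicx_homotopy[OF X P I I0 \<alpha> \<beta>] tensor_bicx_homotopy[OF P X I I0 \<beta> \<alpha>])
qed

text \<open>The relation between a class \<open>W\<close> in the stable tensor product of \<open>P\<close> and \<open>I\<close> and \<open>t \<in> T\<^sub>n \<otimes> N\<close>:
  some \<open>w\<close> agrees with the image of \<open>W\<close> in all high first degrees and has boundary \<open>t\<close>.\<close>

definition tate_rel where
  "tate_rel T P m \<beta> \<iota> I n W t \<longleftrightarrow>
    (\<exists>z\<in>carrier (prod_module (tensor_term \<eta> R P I (su n))).
      W = coprod_carrier (tensor_term \<eta> R P I (su n)) +>\<^bsub>prod_module (tensor_term \<eta> R P I (su n))\<^esub> z \<and>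
      (\<exists>w\<in>carrier (prod_module (tensor_term \<eta> R T I (su n))).
        (\<exists>N\<ge>m. \<forall>j\<ge>N. w j = tensor_map \<eta> R (obj T j) (obj I (su n - j)) (\<beta> j) id (z j)) \<and>
        bicx.D (tensor_term \<eta> R T I) (col T I) (row T I) n w =
          (\<lambda>j. if j = n then tensor_map \<eta> R (obj T n) (obj I 0) id \<iota> t else \<zero>\<^bsub>tensor_term \<eta> R T I n j\<^esub>)))"

text \<open>\<open>tate_rel\<close> is \<open>srel\<close> with the parameters of the double
  complexes written out. It mentions \<beta> but neither \<alpha> nor the homotopies, which only
  enter the proof that it induces an isomorphism.\<close>

lemma tate_rel_quot_rel:
  assumes T: "totally_acyclic S T" and ap: "\<And>n. fin_approx S T n" and P: "is_cplx S P"
    and \<alpha>: "high_half S T P m \<alpha> \<beta> s" and \<beta>: "high_half S P T m \<beta> \<alpha> s'" and res: "injective_resolution R N \<iota> I"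
  shows "quot_rel k (obj (stable_tensor \<eta> R P I) (su (su p))) (obj (tensor_with_module \<eta> R T N) (su p))
    (cycles (stable_tensor \<eta> R P I) (su (su p))) (boundaries (stable_tensor \<eta> R P I) (su (su p)))
    (cycles (tensor_with_module \<eta> R T N) (su p)) (boundaries (tensor_with_module \<eta> R T N) (su p))
    (tate_rel T P m \<beta> \<iota> I (su p))"
proof -
  interpret tb: tate_bicx k "tensor_term \<eta> R T I" "col T I" "row T I"
    "\<lambda>n. tensor_module \<eta> R (obj T n) N" "\<lambda>n. tensor_map \<eta> R (obj T n) N (diff T (su n)) id"
    "\<lambda>n. tensor_map \<eta> R (obj T n) (obj I 0) id \<iota>"
    "tensor_term \<eta> R P I" "col P I" "row P I"
    "\<lambda>n i. tensor_map \<eta> R (obj P i) (obj I (n - i)) (\<alpha> i) id"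
    "\<lambda>n i. tensor_map \<eta> R (obj T i) (obj I (n - i)) (\<beta> i) id"
    "\<lambda>n i. tensor_map \<eta> R (obj T (su i)) (obj I (n - i)) (s i) id"
    "\<lambda>n i. tensor_map \<eta> R (obj P (su i)) (obj I (n - i)) (s' i) id" m
    by (rule tensor_tate_bicx[OF assms])
  have I: "is_cplx R I" and I0: "\<And>n. n > 0 \<Longrightarrow> carrier (obj I n) = {\<zero>\<^bsub>obj I n\<^esub>}"
    using res by (auto simp: injective_resolution_def)
  have eq: "su n + 1 = su (su n)" "su n - 1 = n" for n by (simp_all add: su_def)
  have o: "obj (stable_tensor \<eta> R P I) n = tb.B.St n" for n by (simp add: stable_tensor_def unbounded_tensor_def)
  have dd: "diff (stable_tensor \<eta> R P I) (su n) = tb.B.sD n" for n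
    using unbounded_diff[OF P I I0, of n] by (simp add: stable_tensor_def eq) (simp add: unbounded_tensor_def)
  have o': "obj (tensor_with_module \<eta> R T N) n = tensor_module \<eta> R (obj T n) N"
    and d': "diff (tensor_with_module \<eta> R T N) (su n) = tensor_map \<eta> R (obj T n) N (diff T (su n)) id" for n
    by (simp_all add: tensor_with_module_def eq)
  have r: "tb.srel n = tate_rel T P m \<beta> \<iota> I n" for n
    by (intro ext) (simp only: tb.srel_def tb.rel_def tb.A.edge_def tate_rel_def)
  show ?thesis
    unfolding cycles_def boundaries_def eq o dd o' d' r[symmetric] by (rule tb.stable_tate_quot_rel)
qed

section \<open>Naturality with respect to maps of injective resolutions\<close>

lemma chain_map_hom: "chain_map R I I2 g \<Longrightarrow> g n \<in> mod_hom R (obj I n) (obj I2 n)"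
  by (simp add: chain_map_def)

lemma chain_map_su: "\<lbrakk>chain_map R I I2 g; x \<in> carrier (obj I (su n))\<rbrakk> \<Longrightarrow>
    diff I2 (su n) (g (su n) x) = g n (diff I (su n) x)"
  unfolding chain_map_def su_def by (metis add_diff_cancel_right')

definition total_map where
  "total_map X I2 g n z = (\<lambda>j. tensor_map \<eta> R (obj X j) (obj I2 (n - j)) id (g (n - j)) (z j))"

context
  fixes X :: "('r, 'x) cplx" and I :: "('r, 'i) cplx" and I2 :: "('r, 'i2) cplx" and g
  assumes X: "is_cplx S X" and I: "is_cplx R I" and I2: "is_cplx R I2"
    and I0: "\<And>n. n > 0 \<Longrightarrow> carrier (obj I n) = {\<zero>\<^bsub>obj I n\<^esub>}"
    and I20: "\<And>n. n > 0 \<Longrightarrow> carrier (obj I2 n) = {\<zero>\<^bsub>obj I2 n\<^esub>}"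
    and g: "chain_map R I I2 g"
begin

interpretation A: bicx k "tensor_term \<eta> R X I" "col X I" "row X I" by (rule tensor_bicx[OF X I I0])
interpretation B: bicx k "tensor_term \<eta> R X I2" "col X I2" "row X I2" by (rule tensor_bicx[OF X I2 I20])

lemma total_component: "tensor_map \<eta> R (obj X j) (obj I2 (n - j)) id (g (n - j)) \<in> mod_hom k (tensor_term \<eta> R X I n j) (tensor_term \<eta> R X I2 n j)"
  unfolding tensor_term_def by (intro tensor_map_hom cplx_module X I I2 mod_hom_id chain_map_hom g)

lemma total_map_hom: "total_map X I2 g n \<in> mod_hom k (A.Tot n) (B.Tot n)"
proof -
  note c = mod_hom_closed[OF total_component] mod_hom_add[OF total_component] mod_hom_smult[OF total_component]
  show ?thesis by (rule mod_homI) (simp_all add: total_map_def c fun_eq_iff)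
qed

lemma total_map_D:
  assumes z: "z \<in> carrier (A.Tot (su n))"
  shows "B.D n (total_map X I2 g (su n) z) = total_map X I2 g n (A.D n z)"
proof
  fix j
  note lX = cplx_module[OF X] and lI = cplx_module[OF I] and lI2 = cplx_module[OF I2]
  note dX = cplx_diff_su[OF X] and dI = cplx_diff_su[OF I] and dI2 = cplx_diff_su[OF I2] and gh = chain_map_hom[OF g]
  have z1: "z (su j) \<in> carrier (tensor_module \<eta> R (obj X (su j)) (obj I (n - j)))"
    using z by (simp add: tensor_term_su(1)[symmetric])
  have z0: "z j \<in> carrier (tensor_module \<eta> R (obj X j) (obj I (su (n - j))))"
    using z by (simp add: tensor_term_su(2)[symmetric])
  interpret f: op_hom k "tensor_term \<eta> R X I n j" "tensor_term \<eta> R X I2 n j"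
    "tensor_map \<eta> R (obj X j) (obj I2 (n - j)) id (g (n - j))"
    by (intro op_homI A.grp B.grp total_component)
  have zz: "z j \<in> carrier (tensor_term \<eta> R X I (su n) j)" "z (su j) \<in> carrier (tensor_term \<eta> R X I (su n) (su j))"
    using z by simp_all
  have c1: "col X I2 n j (tensor_map \<eta> R (obj X (su j)) (obj I2 (n - j)) id (g (n - j)) (z (su j))) =
    tensor_map \<eta> R (obj X j) (obj I2 (n - j)) id (g (n - j)) (col X I n j (z (su j)))"
    by (rule tensor_map_commute[OF lX lI lX lI2 dX gh z1])
  have "row X I2 n j (tensor_map \<eta> R (obj X j) (obj I2 (su (n - j))) id (g (su (n - j))) (z j)) =
    tensor_map \<eta> R (obj X j) (obj I2 (n - j)) id (\<lambda>y. diff I2 (su (n - j)) (g (su (n - j)) y)) (z j)"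
    by (rule tensor_map_comp_right[OF lX lI lI2 lI2 gh dI2 z0])
  also have "\<dots> = tensor_map \<eta> R (obj X j) (obj I2 (n - j)) id (\<lambda>y. g (n - j) (diff I (su (n - j)) y)) (z j)"
    by (rule tensor_map_cong[OF lX lI lX lI2 mod_hom_id mod_hom_comp[OF gh dI2] mod_hom_id mod_hom_comp[OF dI gh] _ _ z0])
      (simp_all add: chain_map_su[OF g])
  also have "\<dots> = tensor_map \<eta> R (obj X j) (obj I2 (n - j)) id (g (n - j)) (row X I n j (z j))"
    by (rule tensor_map_comp_right[OF lX lI lI lI2 dI gh z0, symmetric])
  finally show "B.D n (total_map X I2 g (su n) z) j = total_map X I2 g n (A.D n z) j"
    using zz c1 by (simp add: A.D_def B.D_def total_map_def su_diff_left)
qed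

lemma total_map_Fin: "z \<in> A.Fin n \<Longrightarrow> total_map X I2 g n z \<in> B.Fin n"
proof -
  assume "z \<in> A.Fin n"
  then obtain N where z: "z \<in> carrier (A.Tot n)" "\<forall>j\<ge>N. z j = \<zero>\<^bsub>tensor_term \<eta> R X I n j\<^esub>" by (rule A.FinE)
  interpret f: op_hom k "tensor_term \<eta> R X I n j" "tensor_term \<eta> R X I2 n j"
    "tensor_map \<eta> R (obj X j) (obj I2 (n - j)) id (g (n - j))" for j
    by (intro op_homI A.grp B.grp total_component)
  show ?thesis
    by (rule B.FinI[OF mod_hom_closed[OF total_map_hom z(1)], of N]) (use z(2) in \<open>simp add: total_map_def\<close>)
qed

lemma stable_tensor_map_eq: "stable_tensor_map \<eta> R X I2 g n = quot_map (B.Tot n) (B.Fin n) (total_map X I2 g n)"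
  by (simp add: stable_tensor_map_def unbounded_tensor_def total_map_def[abs_def])

lemma stable_map_hom: "stable_tensor_map \<eta> R X I2 g n \<in> mod_hom k (A.St n) (B.St n)"
  and stable_map_cls: "z \<in> carrier (A.Tot n) \<Longrightarrow> stable_tensor_map \<eta> R X I2 g n (A.cls n z) = B.cls n (total_map X I2 g n z)"
  unfolding stable_tensor_map_eq
  by (rule mod_hom_quot_map[OF A.quot_Fin B.quot_Fin total_map_hom total_map_Fin]; assumption)+

lemma stable_map_sD:
  assumes W: "W \<in> carrier (A.St (su n))"
  shows "B.sD n (stable_tensor_map \<eta> R X I2 g (su n) W) = stable_tensor_map \<eta> R X I2 g n (A.sD n W)"
proof -
  obtain z where z: "z \<in> carrier (A.Tot (su n))" "W = A.cls (su n) z" using A.St_cases[OF W] by blast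
  show ?thesis
    using z total_map_D[OF z(1)] mod_hom_closed[OF total_map_hom z(1)] A.D.closed[OF z(1)]
    by (simp add: stable_map_cls A.sD_cls B.sD_cls del: prod_module_simps)
qed

end

text \<open>The lift \<open>g\<close> carries witnesses to witnesses. On the second factor it
  commutes with \<beta>, which acts on the first, and with the boundary of the total complex; on the
  edge the equation between \<open>g 0\<close> after \<iota> and \<open>\<iota>2\<close> after
  \<open>f\<close> replaces \<open>t\<close> by its image under \<open>f\<close>.\<close>

lemma tate_rel_natural:
  assumes T: "is_cplx S T" and P: "is_cplx S P" and res: "injective_resolution R N \<iota> I" and res2: "injective_resolution R N2 \<iota>2 I2"
    and l: "lifts_to R N \<iota> I N2 \<iota>2 I2 f g" and \<beta>: "\<And>i. m \<le> i \<Longrightarrow> \<beta> i \<in> mod_hom S (obj P i) (obj T i)"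
    and t: "t \<in> carrier (tensor_module \<eta> R (obj T n) N)" and r: "tate_rel T P m \<beta> \<iota> I n W t"
  shows "tate_rel T P m \<beta> \<iota>2 I2 n (stable_tensor_map \<eta> R P I2 g (su n) W) (tensor_map \<eta> R (obj T n) N2 id f t)"
proof -
  have N: "left_module R N" and I: "is_cplx R I" and I0: "\<And>n. n > 0 \<Longrightarrow> carrier (obj I n) = {\<zero>\<^bsub>obj I n\<^esub>}"
    and \<iota>: "\<iota> \<in> mod_hom R N (obj I 0)"
    using res by (auto simp: injective_resolution_def)
  have N2: "left_module R N2" and I2: "is_cplx R I2" and I20: "\<And>n. n > 0 \<Longrightarrow> carrier (obj I2 n) = {\<zero>\<^bsub>obj I2 n\<^esub>}"
    and \<iota>2: "\<iota>2 \<in> mod_hom R N2 (obj I2 0)"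
    using res2 by (auto simp: injective_resolution_def)
  have f: "f \<in> mod_hom R N N2" and g: "chain_map R I I2 g" and fg: "\<And>x. x \<in> carrier N \<Longrightarrow> g 0 (\<iota> x) = \<iota>2 (f x)"
    using l by (auto simp: lifts_to_def)
  note lT = cplx_module[OF T] and lP = cplx_module[OF P] and lI = cplx_module[OF I] and lI2 = cplx_module[OF I2]
  note ctx = I I2 I0 I20 g and gh = chain_map_hom[OF g]
  interpret A: bicx k "tensor_term \<eta> R T I" "col T I" "row T I" by (rule tensor_bicx[OF T I I0])
  interpret A2: bicx k "tensor_term \<eta> R T I2" "col T I2" "row T I2" by (rule tensor_bicx[OF T I2 I20])
  interpret B: bicx k "tensor_term \<eta> R P I" "col P I" "row P I" by (rule tensor_bicx[OF P I I0])
  obtain z w L where z: "z \<in> carrier (B.Tot (su n))" "W = B.cls (su n) z"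
    and w: "w \<in> carrier (A.Tot (su n))" and L: "m \<le> L"
      "\<And>j. L \<le> j \<Longrightarrow> w j = tensor_map \<eta> R (obj T j) (obj I (su n - j)) (\<beta> j) id (z j)"
    and Dw: "A.D n w = (\<lambda>j. if j = n then tensor_map \<eta> R (obj T n) (obj I 0) id \<iota> t else \<zero>\<^bsub>tensor_term \<eta> R T I n j\<^esub>)"
    using r unfolding tate_rel_def by blast
  let ?z = "total_map P I2 g (su n) z" and ?w = "total_map T I2 g (su n) w"
  have zc: "?z \<in> carrier (prod_module (tensor_term \<eta> R P I2 (su n)))"
    by (rule mod_hom_closed[OF total_map_hom[OF P ctx] z(1)])
  have wc: "?w \<in> carrier (A2.Tot (su n))" by (rule mod_hom_closed[OF total_map_hom[OF T ctx] w])
  have "?w j = tensor_map \<eta> R (obj T j) (obj I2 (su n - j)) (\<beta> j) id (?z j)" if j: "L \<le> j" for j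
  proof -
    have "z j \<in> carrier (tensor_module \<eta> R (obj P j) (obj I (su n - j)))" using z(1) by (simp add: tensor_term_def)
    from tensor_map_commute[OF lP lI lT lI2 \<beta> gh this] show ?thesis
      using L(2)[OF j] L(1) j by (simp add: total_map_def)
  qed
  moreover have "A2.D n ?w = (\<lambda>j. if j = n then tensor_map \<eta> R (obj T n) (obj I2 0) id \<iota>2 (tensor_map \<eta> R (obj T n) N2 id f t)
      else \<zero>\<^bsub>tensor_term \<eta> R T I2 n j\<^esub>)"
  proof -
    have e: "tensor_map \<eta> R (obj T n) (obj I2 0) id (g 0) (tensor_map \<eta> R (obj T n) (obj I 0) id \<iota> t) =
      tensor_map \<eta> R (obj T n) (obj I2 0) id \<iota>2 (tensor_map \<eta> R (obj T n) N2 id f t)"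
      unfolding tensor_map_comp_right[OF lT N lI lI2 \<iota> gh t] tensor_map_comp_right[OF lT N N2 lI2 f \<iota>2 t]
      by (rule tensor_map_cong[OF lT N lT lI2 mod_hom_id mod_hom_comp[OF \<iota> gh] mod_hom_id mod_hom_comp[OF f \<iota>2] _ _ t])
        (simp_all add: fg)
    have z0: "tensor_map \<eta> R (obj T j) (obj I2 (n - j)) id (g (n - j)) \<zero>\<^bsub>tensor_term \<eta> R T I n j\<^esub> = \<zero>\<^bsub>tensor_term \<eta> R T I2 n j\<^esub>" for j
      by (rule op_hom.zero[OF op_homI[OF A.grp A2.grp total_component[OF T ctx]]])
    have "A2.D n ?w = total_map T I2 g n (A.D n w)" by (rule total_map_D[OF T ctx w])
    then show ?thesis unfolding Dw using e z0 by (simp add: total_map_def fun_eq_iff)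
  qed
  moreover have "stable_tensor_map \<eta> R P I2 g (su n) W =
    coprod_carrier (tensor_term \<eta> R P I2 (su n)) +>\<^bsub>prod_module (tensor_term \<eta> R P I2 (su n))\<^esub> ?z"
    unfolding z(2) by (rule stable_map_cls[OF P ctx z(1)])
  ultimately show ?thesis
    unfolding tate_rel_def using L(1) zc wc by blast
qed

end

section \<open>Assembly of the natural isomorphism\<close>

theorem theorem6p4:
  fixes k :: "'k ring" and R :: "'r ring" and \<eta> :: "'k \<Rightarrow> 'r"
    and M :: "('r, 'm) module"
    and P :: "('r, 'p) cplx" and \<epsilon> :: "'p \<Rightarrow> 'm"
    and T :: "('r, 't) cplx" and \<tau> :: "int \<Rightarrow> 't \<Rightarrow> 'q"
    and Q :: "('r, 'q) cplx" and \<pi> :: "'q \<Rightarrow> 'm"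
  assumes "ring_algebra k R \<eta>"
    and "noetherian R"
    and "left_module (opp R) M"
    and "fin_gen (opp R) M (carrier M)"
    and "complete_projective_resolution (opp R) T \<tau> Q \<pi> M"
    and "projective_resolution (opp R) P \<epsilon> M"
  shows "\<forall>i. \<exists>\<phi> :: ('r, 'n) module \<Rightarrow> ('n \<Rightarrow> 'i) \<Rightarrow> ('r, 'i) cplx \<Rightarrow>
                 (int \<Rightarrow> ('p, 'i) tensor) set set \<Rightarrow> ('t, 'n) tensor set.
           natural_iso_stable_Tate k \<eta> R P T i \<phi>"
proof
  fix i :: int
  interpret k_algebra k R \<eta> by (rule k_algebra.intro) fact
  \<comment> \<open>With \<open>i = su p\<close>, the degrees on both sides of \<open>i\<close>
    become \<open>p\<close> and \<open>su (su p)\<close>, the form in which the relation was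
    studied.\<close>
  define p where "p = i - 1"
  have ip: "i = su p" "i + 1 = su (su p)" by (simp_all add: p_def su_def)
  have T: "totally_acyclic S T" using assms(5) by (simp add: complete_projective_resolution_def)
  have cT: "is_cplx S T" using T by (simp add: totally_acyclic_def)
  have cP: "is_cplx S P" using assms(6) by (simp add: projective_resolution_def)
  note ap = complete_resolution_fin_approx[OF assms(2,4,5)]
  \<comment> \<open>Chosen from \<open>T\<close> and \<open>P\<close> alone, before any module or
    injective resolution: all maps \<open>\<phi> N \<iota> I\<close> are built from the same
    \<beta>, which makes their related pairs comparable.\<close>
  obtain m \<alpha> \<beta> s s' where \<alpha>: "high_half S T P m \<alpha> \<beta> s" and \<beta>: "high_half S P T m \<beta> \<alpha> s'"
    using complete_resolution_high_equiv[OF assms(5,6)] by blast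
  let ?n = "su p"
  let ?C = "\<lambda>N. tensor_with_module \<eta> R T N" and ?St = "\<lambda>I. stable_tensor \<eta> R P I"
  define \<phi> :: "('r, 'n) module \<Rightarrow> ('n \<Rightarrow> 'i) \<Rightarrow> ('r, 'i) cplx \<Rightarrow>
     (int \<Rightarrow> ('p, 'i) tensor) set set \<Rightarrow> ('t, 'n) tensor set" where
    "\<phi> N \<iota> I = rel_map (obj (?C N) ?n) (boundaries (?C N) ?n) (cycles (?C N) ?n) (tate_rel T P m \<beta> \<iota> I ?n)" for N \<iota> I
  have qr: "quot_rel k (obj (?St I) (su ?n)) (obj (?C N) ?n) (cycles (?St I) (su ?n)) (boundaries (?St I) (su ?n))
    (cycles (?C N) ?n) (boundaries (?C N) ?n) (tate_rel T P m \<beta> \<iota> I ?n)" 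
    if "injective_resolution R N \<iota> I" for N :: "('r, 'n) module" and \<iota> and I :: "('r, 'i) cplx"
    by (rule tate_rel_quot_rel[OF T ap cP \<alpha> \<beta> that])
  have "natural_iso_stable_Tate k \<eta> R P T i \<phi>"
    unfolding natural_iso_stable_Tate_def
  proof (intro conjI allI impI ballI)
    fix N :: "('r, 'n) module" and \<iota> and I :: "('r, 'i) cplx" assume "injective_resolution R N \<iota> I"
    from quot_rel.rel_map_iso[OF qr[OF this]]
    show "\<phi> N \<iota> I \<in> mod_iso k (stable_Tor \<eta> R P I i) (Tate_Tor \<eta> R T N i)"
      unfolding \<phi>_def stable_Tor_def Tate_Tor_def homology_def ip(2) unfolding ip(1) .
  next
    fix N :: "('r, 'n) module" and \<iota> and I :: "('r, 'i) cplx" and N2 :: "('r, 'n) module" and \<iota>2 and I2 :: "('r, 'i) cplx" and f g c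
    assume a: "injective_resolution R N \<iota> I \<and> injective_resolution R N2 \<iota>2 I2 \<and> lifts_to R N \<iota> I N2 \<iota>2 I2 f g"
      and c: "c \<in> carrier (stable_Tor \<eta> R P I i)"
    then have res: "injective_resolution R N \<iota> I" and res2: "injective_resolution R N2 \<iota>2 I2"
      and l: "lifts_to R N \<iota> I N2 \<iota>2 I2 f g" by auto
    have N: "left_module R N" and I: "is_cplx R I" and I0: "\<And>n. n > 0 \<Longrightarrow> carrier (obj I n) = {\<zero>\<^bsub>obj I n\<^esub>}"
      using res by (auto simp: injective_resolution_def)
    have N2: "left_module R N2" and I2: "is_cplx R I2" and I20: "\<And>n. n > 0 \<Longrightarrow> carrier (obj I2 n) = {\<zero>\<^bsub>obj I2 n\<^esub>}"
      using res2 by (auto simp: injective_resolution_def)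
    have f: "f \<in> mod_hom R N N2" and g: "chain_map R I I2 g" using l by (auto simp: lifts_to_def)
    note ctx = I I2 I0 I20 g
    interpret q: quot_rel k "obj (?St I) (su ?n)" "obj (?C N) ?n" "cycles (?St I) (su ?n)" "boundaries (?St I) (su ?n)"
      "cycles (?C N) ?n" "boundaries (?C N) ?n" "tate_rel T P m \<beta> \<iota> I ?n" by (rule qr[OF res])
    interpret q2: quot_rel k "obj (?St I2) (su ?n)" "obj (?C N2) ?n" "cycles (?St I2) (su ?n)" "boundaries (?St I2) (su ?n)"
      "cycles (?C N2) ?n" "boundaries (?C N2) ?n" "tate_rel T P m \<beta> \<iota>2 I2 ?n" by (rule qr[OF res2])
    interpret B: bicx k "tensor_term \<eta> R P I" "col P I" "row P I" by (rule tensor_bicx[OF cP I I0])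
    interpret B2: bicx k "tensor_term \<eta> R P I2" "col P I2" "row P I2" by (rule tensor_bicx[OF cP I2 I20])
    have eq: "su n + 1 = su (su n)" "su n - 1 = n" for n by (simp_all add: su_def)
    have o: "obj (?St I) n = B.St n" "obj (?St I2) n = B2.St n" for n by (simp_all add: stable_tensor_def unbounded_tensor_def)
    have dS: "diff (?St I) (su n) = B.sD n" "diff (?St I2) (su n) = B2.sD n" for n
      using unbounded_diff[OF cP I I0, of n] unbounded_diff[OF cP I2 I20, of n]
      by (simp_all add: stable_tensor_def eq) (simp_all add: unbounded_tensor_def)
    let ?G = "stable_tensor_map \<eta> R P I2 g" and ?F = "tensor_map \<eta> R (obj T ?n) N2 id f"
    have G: "?G n \<in> mod_hom k (B.St n) (B2.St n)" for n by (rule stable_map_hom[OF cP ctx])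
    have GD: "B2.sD n (?G (su n) V) = ?G n (B.sD n V)" if "V \<in> carrier (B.St (su n))" for n V
      by (rule stable_map_sD[OF cP ctx that])
    note lT = cplx_module[OF cT] and i = mod_hom_id
    obtain W where W: "W \<in> cycles (?St I) (su ?n)" "c = boundaries (?St I) (su ?n) +>\<^bsub>obj (?St I) (su ?n)\<^esub> W"
      using c unfolding stable_Tor_def homology_def ip(2) by (auto simp: quot_carrier)
    \<comment> \<open>Any related \<open>W\<close> and \<open>t\<close> compute \<phi> on
      \<open>c\<close>. Their images under \<open>?G\<close> and \<open>?F\<close> are related
      again, and this one pair evaluates both sides of the naturality square.\<close>
    obtain t where t: "t \<in> cycles (?C N) ?n" "tate_rel T P m \<beta> \<iota> I ?n W t" using q.\<rho>_total[OF W(1)] by blast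
    have Wc: "W \<in> carrier (B.St (su ?n))" and WD: "B.sD ?n W = \<zero>\<^bsub>B.St ?n\<^esub>"
      using W(1) unfolding cycles_def eq o dS by auto
    have tc: "t \<in> carrier (tensor_module \<eta> R (obj T ?n) N)" and td: "tensor_map \<eta> R (obj T p) N (diff T ?n) id t = \<zero>\<^bsub>tensor_module \<eta> R (obj T p) N\<^esub>"
      using t(1) by (auto simp: cycles_def tensor_with_module_def eq)
    note FT = tensor_map_hom[OF lT N lT N2 i f]
    have comm: "tensor_map \<eta> R (obj T n) N2 (diff T (su n)) id (tensor_map \<eta> R (obj T (su n)) N2 id f x) =
       tensor_map \<eta> R (obj T n) N2 id f (tensor_map \<eta> R (obj T n) N (diff T (su n)) id x)"
      if "x \<in> carrier (tensor_module \<eta> R (obj T (su n)) N)" for n x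
      by (rule tensor_map_commute[OF lT N lT N2 cplx_diff_su[OF cT] f that])
    have z: "F0 \<zero>\<^bsub>tensor_module \<eta> R (obj T n) N\<^esub> = \<zero>\<^bsub>tensor_module \<eta> R (obj T n) N2\<^esub>"
      if "F0 = tensor_map \<eta> R (obj T n) N2 id f" for n F0
      unfolding that by (rule op_hom.zero[OF op_homI[OF tensor_op_group[OF lT N] tensor_op_group[OF lT N2] FT]])
    have Gz: "?G n \<zero>\<^bsub>B.St n\<^esub> = \<zero>\<^bsub>B2.St n\<^esub>" for n
      by (rule op_hom.zero[OF op_homI[OF B.Q.quot_op_group B2.Q.quot_op_group G]])
    have GW: "?G (su ?n) W \<in> cycles (?St I2) (su ?n)"
      unfolding cycles_def eq o dS using mod_hom_closed[OF G Wc] GD[OF Wc] WD Gz by simp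
    have Ft: "?F t \<in> cycles (?C N2) ?n"
      using mod_hom_closed[OF FT tc] comm[of t p] tc td z[OF refl, of p] by (simp add: cycles_def tensor_with_module_def eq)
    have r2: "tate_rel T P m \<beta> \<iota>2 I2 ?n (?G (su ?n) W) (?F t)"
      by (rule tate_rel_natural[OF cT cP res res2 l high_halfD(1)[OF \<beta>] tc t(2)])
    have "stable_Tor_map \<eta> R P I2 g i c = boundaries (?St I2) (su ?n) +>\<^bsub>obj (?St I2) (su ?n)\<^esub> ?G (su ?n) W"
      unfolding stable_Tor_map_def homology_map_def ip(2) W(2)
    proof (rule quot_map_coset[OF q.M.op_group_axioms q.B q2.M.op_group_axioms q2.B])
      show "W \<in> carrier (obj (?St I) (su ?n))" using Wc unfolding o .
      fix x assume "x \<in> boundaries (?St I) (su ?n)"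
      then obtain y where y: "y \<in> carrier (B.St (su (su ?n)))" "x = B.sD (su ?n) y"
        unfolding boundaries_def eq o dS by blast
      have "?G (su ?n) x \<in> B2.sD (su ?n) ` carrier (B2.St (su (su ?n)))"
        unfolding y(2) GD[OF y(1), symmetric] by (rule imageI[OF mod_hom_closed[OF G y(1)]])
      then show "?G (su ?n) x \<in> boundaries (?St I2) (su ?n)"
        unfolding boundaries_def eq o dS .
    qed (use mod_hom_closed[OF G] mod_hom_add[OF G] in \<open>simp_all only: o\<close>)
    then have "\<phi> N2 \<iota>2 I2 (stable_Tor_map \<eta> R P I2 g i c) = boundaries (?C N2) ?n +>\<^bsub>obj (?C N2) ?n\<^esub> ?F t"
      unfolding \<phi>_def using q2.rel_map_coset[OF GW Ft r2] by simp
    moreover have "\<phi> N \<iota> I c = boundaries (?C N) ?n +>\<^bsub>obj (?C N) ?n\<^esub> t"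
      unfolding \<phi>_def W(2) by (rule q.rel_map_coset[OF W(1) t])
    moreover have "Tate_Tor_map \<eta> R T N2 f i (boundaries (?C N) ?n +>\<^bsub>obj (?C N) ?n\<^esub> t) = boundaries (?C N2) ?n +>\<^bsub>obj (?C N2) ?n\<^esub> ?F t"
      unfolding Tate_Tor_map_def homology_map_def ip(1)
    proof (rule quot_map_coset[OF q.N.op_group_axioms q.B' q2.N.op_group_axioms q2.B'])
      fix x assume "x \<in> boundaries (?C N) ?n"
      then obtain y where y: "y \<in> carrier (tensor_module \<eta> R (obj T (su ?n)) N)" "x = tensor_map \<eta> R (obj T ?n) N (diff T (su ?n)) id y"
        by (auto simp: boundaries_def tensor_with_module_def eq)
      show "?F x \<in> boundaries (?C N2) ?n"
        using comm[OF y(1)] y mod_hom_closed[OF FT y(1)] by (auto simp: boundaries_def tensor_with_module_def eq image_iff)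
    qed (use mod_hom_closed[OF FT] mod_hom_add[OF FT] tc in \<open>simp_all add: tensor_with_module_def\<close>)
    ultimately show "\<phi> N2 \<iota>2 I2 (stable_Tor_map \<eta> R P I2 g i c) = Tate_Tor_map \<eta> R T N2 f i (\<phi> N \<iota> I c)" by simp
  qed
  then show "\<exists>\<phi> :: ('r, 'n) module \<Rightarrow> ('n \<Rightarrow> 'i) \<Rightarrow> ('r, 'i) cplx \<Rightarrow>
                 (int \<Rightarrow> ('p, 'i) tensor) set set \<Rightarrow> ('t, 'n) tensor set.
           natural_iso_stable_Tate k \<eta> R P T i \<phi>" by blast
qed

end
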